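(* Let $F$ be an arbitrary quasinorm on $D(e)=\mathrm{span}(X,Y)\cong\mathbb{R}^2$, and let $\varphi_4^2+\varphi_5^2\ne0$. Then any extremal (with $M=1$) on the Cartan group starting at the unit is given by $$x(t)=\int_0^t\frac{r'(\theta)\sin\theta+r(\theta)\cos\theta}{r^2(\theta)}d\tau,\qquad y(t)=\int_0^t\frac{r(\theta)\sin\theta-r'(\theta)\cos\theta}{r^2(\theta)}d\tau\qquad(\theta=\theta(\tau)),$$ with arbitrary measurable integrands of the indicated form (where $r'(\theta(\tau))$ denotes a value between the one-sided derivatives of $r$ at $\theta(\tau)$, the same in both integrals) and a continuously differentiable function $\theta=\theta(t)$ satisfying $$r^2(\theta(t))\dot\theta(t)=\varphi_3+\varphi_4x(t)+\varphi_5y(t),$$ $$\dot\theta^2=\frac{\varphi_3^2+2\varphi_4(r(\theta)\sin\theta-\varphi_2)-2\varphi_5(r(\theta)\cos\theta-\varphi_1)}{r^4(\theta)}.\qquad( * )$$ Moreover, if $\varphi_5\neq0$, then $$z(t)=\frac1{\varphi_5}\left(\varphi_2+\left(\varphi_3+\tfrac12\varphi_4x(t)+\tfrac12\varphi_5y(t)\right)x(t)-r(\theta(t))\sin\theta(t)\right),$$ $$v(t)=\frac13\int_0^t(x\dot z-z\dot x)d\tau-\frac16x(t)z(t),$$ $$w(t)=\frac1{3\varphi_5}\left(t-\varphi_1x(t)-\varphi_2y(t)-2\varphi_3z(t)-3\varphi_4v(t)-\tfrac{\varphi_4}2x(t)z(t)-\tfrac{\varphi_5}2y(t)z(t)\right).$$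 If $\varphi_5=0$ and $\varphi_4\ne0$, then $$z(t)=\frac1{\varphi_4}\left(\varphi_1-\left(\varphi_3+\tfrac12\varphi_4x(t)\right)y(t)-r(\theta(t))\cos\theta(t)\right),$$ $$v(t)=\frac1{3\varphi_4}\left(t-\varphi_1x(t)-\varphi_2y(t)-2\varphi_3z(t)-\tfrac{\varphi_4}2x(t)z(t)\right),\qquad w(t)=\frac13\int_0^t(y\dot z-z\dot y)d\tau-\frac16y(t)z(t).$$ Set $\theta_0=\theta(0)$, so that $r(\theta_0)\cos\theta_0=\varphi_1$, $r(\theta_0)\sin\theta_0=\varphi_2$, and $$\mathcal E_0=\max_{h\in U^*}(\varphi_5h_1-\varphi_4h_2),\qquad \mathcal E_{-1}=\min_{h\in U^*}(\varphi_5h_1-\varphi_4h_2),\qquad \mathcal E=\tfrac12\varphi_3^2+\varphi_1\varphi_5-\varphi_2\varphi_4.$$ The following cases are possible. 1. Let $\varphi_3\ne0$ and $\mathcal E>\mathcal E_0$. Then $\theta(t)$, $t\in\mathbb{R}$, is inverse to the function $$t(\theta)=\int_{\theta_0}^{\theta}\frac{r^2(\xi)d\xi}{\varphi_3\sqrt{1+(2\varphi_4/\varphi_3^2)(r(\xi)\sin\xi-\varphi_2)-(2\varphi_5/\varphi_3^2)(r(\xi)\cos\xi-\varphi_1)}}.\qquad( ** )$$ 2. Let $\varphi_3=0$ and $\mathcal E=\mathcal E_{-1}$. Then $\theta(t)\equiv\theta_0$ and the extremal is a metric straight line of the form (A1), (A2) or (A3). 3. Let $\mathcal E_{-1}<\mathcal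 E<\mathcal E_0$. Then for some numbers $t_1<t_2$ and for all $t\in\mathbb{R}$, $k\in\mathbb{Z}$, $$\theta(t+2k(t_2-t_1))=\theta(t),\quad\dot\theta(t_i+t)=-\dot\theta(t_i-t),\quad\theta(t_i+t)=\theta(t_i-t),\quad i=1,2.$$ 3.1. If $\varphi_3\ne0$, then here $t_i=t(\theta_i)$, $i=1,2$, computed by $( ** )$, where $\theta_1\neq\theta_2$ are the values nearest to $\theta_0$ (one on each side) at which the right-hand side of $( * )$ vanishes, and $\varphi_3(\theta_2-\theta_1)>0$. 3.2. If $\varphi_3=0$, then here $\theta_2\ne\theta_1=\theta_0$, $t_1=0$, $t_2=t(\theta_2)$, where $$t(\theta)=\pm\int_{\theta_0}^{\theta}\frac{r^2(\xi)d\xi}{\sqrt{2\varphi_4(r(\xi)\sin\xi-\varphi_2)-2\varphi_5(r(\xi)\cos\xi-\varphi_1)}}\qquad( *{*}* )$$ with sign $+$ if $\theta_2>\theta_0$ and $-$ if $\theta_2<\theta_0$. Here $\theta_2\neq\theta_0$ is a number such that $\varphi_4(h_2(\theta)-h_2(\theta_0))\ge\varphi_5(h_1(\theta)-h_1(\theta_0))$ for all $\theta$ in the closed interval with endpoints $\theta_0$ and $\theta_2$, with equality only for $\theta=\theta_0$ and $\theta=\theta_2$. 4. Let $\varphi_3\ne0$ and $\mathcal E=\mathcal E_0$. Then there exist values $\theta_1<\theta_0<\theta_2$ nearest to $\theta_0$ such that the right-hand side of $( * )$ vanishes at $\theta=\theta_i$, $i=1,2$. If the improper integrals $( ** )$ diverge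 for $\theta=\theta_1$ and $\theta=\theta_2$, then $\theta(t)\in(\theta_1,\theta_2)$, $t\in\mathbb{R}$, is the inverse function to $t(\theta)$ defined by $( ** )$. If the improper integral $( ** )$ is finite for $\theta=\theta_i$, $i\in\{1,2\}$, then the function $\theta(t)$ is not unique and can take constant values, equal to $\theta_1+2\pi k$ for some $k\in\mathbb{Z}$ (and with an arbitrary alternation of intervals of increase and decrease) if the integral is finite for both $i=1,2$ and $\theta_2=\theta_1+2\pi$, and equal to $\theta_i$ in the other cases, on some non-degenerate closed intervals of arbitrary length, on which the formulas (B1) are valid if $\varphi_5\ne0$ and the formulas (B2) are valid if $\varphi_5=0$. 5. Let $\varphi_3=0$ and $\mathcal E=\mathcal E_0$. Then there exists the largest segment $[\theta_1,\theta_2]$, $\theta_1\le\theta_2$, such that $\theta_0\in[\theta_1,\theta_2]$ and $\varphi_5(h_1(\theta)-\varphi_1)=\varphi_4(h_2(\theta)-\varphi_2)$ for all $\theta\in[\theta_1,\theta_2]$. If $\theta_0=\theta_2$ (respectively, $\theta_0=\theta_1$), let $t(\theta)$ denote the improper integral $( *{*}* )$ without the sign $\pm$ for $\theta\in[\theta_0,\theta_1+2\pi]$ (respectively, $\theta\in[\theta_2-2\pi,\theta_0]$). Then $\theta(t)\equiv\theta_0$ and the extremal is a metric straight line of the form (A1), (A2) or (A3) in the following cases: 5.1. $\theta_1=\theta_0=\theta_2$ and $t(\theta)=\infty$ both for $\theta\nearrow\theta_0$ and for $\theta\searrow\theta_0$; 5.2. $\theta_1<\theta_0<\theta_2$; 5.3.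 $\theta_0=\theta_1<\theta_2$ and $t(\theta)=\infty$ for $\theta\nearrow\theta_0$; 5.4. $\theta_0=\theta_2>\theta_1$ and $t(\theta)=\infty$ for $\theta\searrow\theta_0$. In all other cases the function $\theta(t)$ is not unique and can take constant values on some closed intervals of arbitrary length, on which the formulas (B1) with $\varphi_3=0$ are valid if $\varphi_5\ne0$, and the formulas (B2) with $\varphi_3=0$ are valid if $\varphi_5=0$. These constant values may be equal to: 1) $\theta_0$ and $\theta_1+2\pi$ if $\theta_1<\theta_0=\theta_2$, $t(\theta)$ is finite for $\theta\searrow\theta_0$, and $t(\theta_1+2\pi)$ is finite; 2) $\theta_0$ and $\theta_2-2\pi$ if $\theta_0=\theta_1<\theta_2$, $t(\theta)$ is finite for $\theta\nearrow\theta_0$, and $t(\theta_2-2\pi)$ is finite; 3) $\theta_0+2\pi k$ for some $k\in\mathbb{Z}$ (with an arbitrary alternation of intervals of increase and decrease) if $\theta_0=\theta_1=\theta_2$ and $t(\theta)$ is finite for $\theta\nearrow\theta_0$ and for $\theta\searrow\theta_0$; 4) $\theta_0$ in all other cases.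
   Context: The Cartan algebra is the 5-dimensional real Lie algebra with basis $X,Y,Z,V,W$ and $[X,Y]=Z$, $[X,Z]=V$, $[Y,Z]=W$, all other brackets of basis elements zero. The Cartan group $G$ is the connected simply connected Lie group with this Lie algebra, identified with $\mathbb{R}^5$ via $(x,y,z,v,w)\leftrightarrow\exp(xX+yY+zZ+vV+wW)$ (the unit is $0$). A quasinorm $F:\mathbb{R}^2\to[0,\infty)$ satisfies $F(u)=0$ iff $u=0$, $F(\lambda u)=\lambda F(u)$ for $\lambda\ge0$, $F(u+u')\le F(u)+F(u')$ (symmetry is not required); $u_1X+u_2Y$ is identified with $(u_1,u_2)$, and $U=\{u: F(u)\le1\}$. Trajectories are the absolutely continuous solutions of $\dot g=u_1X(g)+u_2Y(g)$ with measurable controls $u(t)=(u_1(t),u_2(t))\in U$; in coordinates $$\dot x=u_1,\quad \dot y=u_2,\quad \dot z=\tfrac12(xu_2-yu_1),$$ $$\dot v=-\tfrac12\left(z+\tfrac16xy\right)u_1+\tfrac1{12}x^2u_2,\quad \dot w=-\tfrac1{12}y^2u_1-\tfrac12\left(z-\tfrac16xy\right)u_2 .$$ The left-invariant sub-Finsler quasimetric $d(p,q)$ is the least time needed to go from $p$ to $q$ along such trajectories. A curve $g(t)$, $t\in\mathbb{R}$, is a metric straight line if $d(g(t_1),g(t_2))=t_2-t_1$ for all $t_1\le t_2$. For a covector $\psi=(\psi_1,\dots,\psi_5)$ at $(x,y,z,v,w)$ (components relative to $\partial_x,\partial_y,\partial_z,\partial_v,\partial_w$) put $$h_1=\psi(X)=\psi_1-\tfrac12\psi_3y-\tfrac1{12}\psi_4xy-\tfrac1{12}\psi_5y^2-\tfrac12\psi_4z,$$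 $$h_2=\psi(Y)=\psi_2+\tfrac12\psi_3x+\tfrac1{12}\psi_4x^2+\tfrac1{12}\psi_5xy-\tfrac12\psi_5z,$$ and $\mathcal H=h_1u_1+h_2u_2$. An extremal with $M=1$ is a trajectory $g(t)=(x,y,z,v,w)(t)$, $t\in\mathbb{R}$, with control $u(t)$, for which there is an absolutely continuous nowhere vanishing $\psi(t)$ with $\dot\psi=-\partial\mathcal H/\partial(x,y,z,v,w)$ a.e. and, for a.e. $t$, $h_1(t)u_1(t)+h_2(t)u_2(t)=\max_{u\in U}(h_1(t)u_1+h_2(t)u_2)=1$. Put $\varphi_i=\psi_i(0)$, $i=1,\dots,5$. $F_U(h)=\max_{u\in U}h\cdot u$ is the support function of $U$ and $U^*=\{h: F_U(h)\le1\}$ the polar figure; $(h_1(t),h_2(t))$ lies on the curve $F_U=1$, whose polar equation is $r=r(\theta)$, $\theta\in\mathbb{R}$; we write $h_1(\theta)=r(\theta)\cos\theta$, $h_2(\theta)=r(\theta)\sin\theta$, and $\theta(t)$ is the continuous function with $h_i(t)=h_i(\theta(t))$, $i=1,2$. "Arbitrary measurable integrands" means that any measurable choice of the values $r'(\theta(\tau))$ between the one-sided derivatives is allowed, provided $\theta$ satisfies the stated relations. "Not unique" means not uniquely determined by $\varphi_1,\dots,\varphi_5$. "$t(\theta)=\infty$ (finite) for $\theta\nearrow\theta_0$", respectively "$\theta\searrow\theta_0$", means that the improper integral $( *{*}* )$ diverges (converges) at the point $\theta_0$ when taken over a left, respectively right, neighbourhood of $\theta_0$. Lines, with $s=\pm1$: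 (A1) $x\equiv0$, $y=\frac{st}{F(0,s)}$, $z=v=w\equiv0$; (A2) $x=\frac{st}{F(s,0)}$, $y=z=v=w\equiv0$; (A3) $x=\frac{s\varphi_5t}{F(s\varphi_5,-s\varphi_4)}$, $y=-\frac{\varphi_4x}{\varphi_5}$, $z=v=w\equiv0$, $\varphi_4\varphi_5\ne0$. Formulas on an interval of constancy of $\theta$, where $t_0$ is the point of the interval closest to zero and $x_0=x(t_0)$, $y_0=y(t_0)$, $z_0=z(t_0)$, $v_0=v(t_0)$, $w_0=w(t_0)$: (B1) $x=x_0+\frac{\varphi_5}{\mathcal E}(t-t_0)$, $y=-\frac{\varphi_4}{\mathcal E}(t-t_0)-\frac1{\varphi_5}(\varphi_3+\varphi_4x_0)$, $z=z_0+\frac{\varphi_3}{2\mathcal E}(t-t_0)$, $v=v_0-\frac{\varphi_3\varphi_5}{12\mathcal E^2}(t-t_0)^2+\frac1{12\mathcal E}(\varphi_3x_0-6\varphi_5z_0)(t-t_0)$, $w=w_0+\frac{\varphi_3\varphi_4}{12\mathcal E^2}(t-t_0)^2+\frac1{12\varphi_5\mathcal E}(6\varphi_4\varphi_5z_0-\varphi_3\varphi_4x_0-\varphi_3^2)(t-t_0)$; (B2) $x\equiv-\frac{\varphi_3}{\varphi_4}$, $y=y_0-\frac{\varphi_4}{\mathcal E}(t-t_0)$, $z=z_0+\frac{\varphi_3}{2\mathcal E}(t-t_0)$, $v=v_0-\frac{\varphi_3^2}{12\varphi_4\mathcal E}(t-t_0)$, $w=w_0+\frac{\varphi_3\varphi_4}{12\mathcal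 E^2}(t-t_0)^2+\frac1{12\mathcal E}(\varphi_3y_0+6\varphi_4z_0)(t-t_0)$. *)

theory Defs
  imports "HOL-Analysis.Analysis"
begin

section \<open>Quasinorms on the plane and polar duality\<close>

definition quasinorm :: "(real \<times> real \<Rightarrow> real) \<Rightarrow> bool" where
  "quasinorm F \<longleftrightarrow>
     (\<forall>u. 0 \<le> F u) \<and> (\<forall>u. F u = 0 \<longleftrightarrow> u = 0) \<and>
     (\<forall>c u. 0 \<le> c \<longrightarrow> F (c *\<^sub>R u) = c * F u) \<and>
     (\<forall>u u'. F (u + u') \<le> F u + F u')"

definition unit_ball :: "(real \<times> real \<Rightarrow> real) \<Rightarrow> (real \<times> real) set" where
  "unit_ball F = {u. F u \<le> 1}"

text \<open>For the unit ball of a quasinorm, which is compact, the suprema and infima below are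
  attained.\<close>

definition support_function :: "(real \<times> real) set \<Rightarrow> real \<times> real \<Rightarrow> real" where
  "support_function U h = (SUP u\<in>U. h \<bullet> u)"

definition polar_figure :: "(real \<times> real) set \<Rightarrow> (real \<times> real) set" where
  "polar_figure U = {h. support_function U h \<le> 1}"

text \<open>The polar equation of the boundary curve of the polar figure.\<close>

definition polar_radius :: "(real \<times> real \<Rightarrow> real) \<Rightarrow> real \<Rightarrow> real" where
  "polar_radius F \<theta> =
     (THE \<rho>. \<rho> > 0 \<and> support_function (unit_ball F) (\<rho> * cos \<theta>, \<rho> * sin \<theta>) = 1)"

definition between_one_sided_derivs :: "(real \<Rightarrow> real) \<Rightarrow> real \<Rightarrow> real \<Rightarrow> bool" where
  "between_one_sided_derivs f x d \<longleftrightarrow>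
     (\<exists>dl dr. (f has_real_derivative dl) (at_left x) \<and>
              (f has_real_derivative dr) (at_right x) \<and> d \<in> closed_segment dl dr)"

section \<open>The Cartan group\<close>

text \<open>Points \<open>(x, y, z, v, w)\<close> of the group in coordinates of the first kind; covectors are
  written in the dual coordinates, so that the pairing is the inner product.\<close>

type_synonym pt = "real \<times> real \<times> real \<times> real \<times> real"

fun X_field :: "pt \<Rightarrow> pt" where
  "X_field (x, y, z, v, w) = (1, 0, - y / 2, - (z + x * y / 6) / 2, - y\<^sup>2 / 12)"

fun Y_field :: "pt \<Rightarrow> pt" where
  "Y_field (x, y, z, v, w) = (0, 1, x / 2, x\<^sup>2 / 12, - (z - x * y / 6) / 2)"

text \<open>Absolute continuity on intervals, with finite families of non-overlapping closed
  subintervals given as divisions; on a set \<open>S\<close> it is required on all compact subintervals.\<close>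

definition absolutely_continuous_on :: "real set \<Rightarrow> (real \<Rightarrow> 'a::real_normed_vector) \<Rightarrow> bool" where
  "absolutely_continuous_on S f \<longleftrightarrow>
     (\<forall>a b. {a..b} \<subseteq> S \<longrightarrow>
       (\<forall>\<epsilon>>0. \<exists>\<delta>>0. \<forall>\<D> T. \<D> division_of T \<and> T \<subseteq> {a..b} \<and> (\<Sum>K\<in>\<D>. Sup K - Inf K) < \<delta> \<longrightarrow>
         (\<Sum>K\<in>\<D>. norm (f (Sup K) - f (Inf K))) < \<epsilon>))"

definition trajectory ::
    "(real \<times> real \<Rightarrow> real) \<Rightarrow> real set \<Rightarrow> (real \<Rightarrow> pt) \<Rightarrow> (real \<Rightarrow> real \<times> real) \<Rightarrow> bool" where
  "trajectory F S g u \<longleftrightarrow>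
     u \<in> borel_measurable (lebesgue_on S) \<and> (\<forall>t\<in>S. u t \<in> unit_ball F) \<and>
     absolutely_continuous_on S g \<and>
     (AE t in lebesgue. t \<in> S \<longrightarrow>
        (g has_vector_derivative
           (fst (u t) *\<^sub>R X_field (g t) + snd (u t) *\<^sub>R Y_field (g t))) (at t within S))"

definition sub_Finsler_dist :: "(real \<times> real \<Rightarrow> real) \<Rightarrow> pt \<Rightarrow> pt \<Rightarrow> real" where
  "sub_Finsler_dist F p q =
     Inf {T. 0 \<le> T \<and> (\<exists>g u. trajectory F {0..T} g u \<and> g 0 = p \<and> g T = q)}"

definition metric_straight_line :: "(real \<times> real \<Rightarrow> real) \<Rightarrow> (real \<Rightarrow> pt) \<Rightarrow> bool" where
  "metric_straight_line F g \<longleftrightarrow>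
     (\<forall>t1 t2. t1 \<le> t2 \<longrightarrow> sub_Finsler_dist F (g t1) (g t2) = t2 - t1)"

section \<open>Extremals\<close>

definition mom_X :: "pt \<Rightarrow> pt \<Rightarrow> real" where
  "mom_X \<psi> q = \<psi> \<bullet> X_field q"

definition mom_Y :: "pt \<Rightarrow> pt \<Rightarrow> real" where
  "mom_Y \<psi> q = \<psi> \<bullet> Y_field q"

lemma mom_X_explicit:
  "mom_X (p1, p2, p3, p4, p5) (x, y, z, v, w) =
     p1 - p3 * y / 2 - p4 * x * y / 12 - p5 * y\<^sup>2 / 12 - p4 * z / 2"
  by (simp add: mom_X_def field_simps)

lemma mom_Y_explicit:
  "mom_Y (p1, p2, p3, p4, p5) (x, y, z, v, w) =
     p2 + p3 * x / 2 + p4 * x\<^sup>2 / 12 + p5 * x * y / 12 - p5 * z / 2"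
  by (simp add: mom_Y_def field_simps)

definition hamiltonian :: "pt \<Rightarrow> pt \<Rightarrow> real \<times> real \<Rightarrow> real" where
  "hamiltonian \<psi> q u = mom_X \<psi> q * fst u + mom_Y \<psi> q * snd u"

text \<open>The extremals with \<open>M = 1\<close> that start at the unit.\<close>

definition extremal ::
    "(real \<times> real \<Rightarrow> real) \<Rightarrow> (real \<Rightarrow> pt) \<Rightarrow> (real \<Rightarrow> real \<times> real) \<Rightarrow> (real \<Rightarrow> pt) \<Rightarrow> bool" where
  "extremal F g u \<psi> \<longleftrightarrow>
     trajectory F UNIV g u \<and> g 0 = 0 \<and>
     absolutely_continuous_on UNIV \<psi> \<and> (\<forall>t. \<psi> t \<noteq> 0) \<and>
     (AE t in lebesgue. \<exists>D. GDERIV (\<lambda>q. hamiltonian (\<psi> t) q (u t)) (g t) :> D \<and>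
                            (\<psi> has_vector_derivative - D) (at t)) \<and>
     (AE t in lebesgue.
        hamiltonian (\<psi> t) (g t) (u t)
          = support_function (unit_ball F) (mom_X (\<psi> t) (g t), mom_Y (\<psi> t) (g t)) \<and>
        support_function (unit_ball F) (mom_X (\<psi> t) (g t), mom_Y (\<psi> t) (g t)) = 1)"

definition angle_function ::
    "(real \<times> real \<Rightarrow> real) \<Rightarrow> (real \<Rightarrow> pt) \<Rightarrow> (real \<Rightarrow> pt) \<Rightarrow> (real \<Rightarrow> real) \<Rightarrow> bool" where
  "angle_function F g \<psi> \<theta> \<longleftrightarrow>
     continuous_on UNIV \<theta> \<and>
     (\<forall>t. mom_X (\<psi> t) (g t) = polar_radius F (\<theta> t) * cos (\<theta> t) \<and>
          mom_Y (\<psi> t) (g t) = polar_radius F (\<theta> t) * sin (\<theta> t))"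

definition extremal_with :: "(real \<times> real \<Rightarrow> real) \<Rightarrow> pt \<Rightarrow> (real \<Rightarrow> pt) \<Rightarrow> (real \<Rightarrow> real) \<Rightarrow> bool" where
  "extremal_with F \<phi> g \<theta> \<longleftrightarrow>
     (\<exists>u \<psi>. extremal F g u \<psi> \<and> \<psi> 0 = \<phi> \<and> angle_function F g \<psi> \<theta>)"

section \<open>Explicit formulas\<close>

fun energy :: "pt \<Rightarrow> real" where
  "energy (\<phi>1, \<phi>2, \<phi>3, \<phi>4, \<phi>5) = \<phi>3\<^sup>2 / 2 + \<phi>1 * \<phi>5 - \<phi>2 * \<phi>4"

text \<open>The right-hand side of the equation for the square of the derivative of the angle.\<close>

fun angle_rhs :: "(real \<times> real \<Rightarrow> real) \<Rightarrow> pt \<Rightarrow> real \<Rightarrow> real" where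
  "angle_rhs F (\<phi>1, \<phi>2, \<phi>3, \<phi>4, \<phi>5) \<xi> =
     (\<phi>3\<^sup>2 + 2 * \<phi>4 * (polar_radius F \<xi> * sin \<xi> - \<phi>2)
          - 2 * \<phi>5 * (polar_radius F \<xi> * cos \<xi> - \<phi>1)) / polar_radius F \<xi> ^ 4"

text \<open>The integrals against \<open>lebesgue\<close> (not \<open>lborel\<close>) allow Lebesgue measurable choices of the
  values \<open>\<rho> \<tau>\<close> between the one-sided derivatives of the polar radius. The derivatives
  of \<open>x, y, z\<close> under the integral sign exist almost everywhere.\<close>

fun extremal_formulas ::
    "(real \<times> real \<Rightarrow> real) \<Rightarrow> pt \<Rightarrow> (real \<Rightarrow> pt) \<Rightarrow> (real \<Rightarrow> real) \<Rightarrow> bool" where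
  "extremal_formulas F (\<phi>1, \<phi>2, \<phi>3, \<phi>4, \<phi>5) g \<theta> \<longleftrightarrow>
     (\<exists>x y z v w \<rho> :: real \<Rightarrow> real. let r = polar_radius F in
        (\<forall>t. g t = (x t, y t, z t, v t, w t)) \<and>
        r (\<theta> 0) * cos (\<theta> 0) = \<phi>1 \<and> r (\<theta> 0) * sin (\<theta> 0) = \<phi>2 \<and>
        \<rho> \<in> borel_measurable lebesgue \<and>
        (\<forall>\<tau>. between_one_sided_derivs r (\<theta> \<tau>) (\<rho> \<tau>)) \<and>
        (\<forall>t. x t = (LINT \<tau>=ereal 0..ereal t|lebesgue.
                 ((\<rho> \<tau> * sin (\<theta> \<tau>) + r (\<theta> \<tau>) * cos (\<theta> \<tau>)) / (r (\<theta> \<tau>))\<^sup>2))) \<and>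
        (\<forall>t. y t = (LINT \<tau>=ereal 0..ereal t|lebesgue.
                 ((r (\<theta> \<tau>) * sin (\<theta> \<tau>) - \<rho> \<tau> * cos (\<theta> \<tau>)) / (r (\<theta> \<tau>))\<^sup>2))) \<and>
        \<theta> C1_differentiable_on UNIV \<and>
        (\<forall>t. (r (\<theta> t))\<^sup>2 * deriv \<theta> t = \<phi>3 + \<phi>4 * x t + \<phi>5 * y t) \<and>
        (\<forall>t. (deriv \<theta> t)\<^sup>2 = angle_rhs F (\<phi>1, \<phi>2, \<phi>3, \<phi>4, \<phi>5) (\<theta> t)) \<and>
        (\<phi>5 \<noteq> 0 \<longrightarrow>
          (\<forall>t. z t = 1 / \<phi>5 * (\<phi>2 + (\<phi>3 + \<phi>4 * x t / 2 + \<phi>5 * y t / 2) * x t - r (\<theta> t) * sin (\<theta> t)) \<and>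
               v t = 1 / 3 * (LINT \<tau>=ereal 0..ereal t|lebesgue. (x \<tau> * deriv z \<tau> - z \<tau> * deriv x \<tau>))
                       - x t * z t / 6 \<and>
               w t = 1 / (3 * \<phi>5) * (t - \<phi>1 * x t - \<phi>2 * y t - 2 * \<phi>3 * z t - 3 * \<phi>4 * v t
                       - \<phi>4 / 2 * x t * z t - \<phi>5 / 2 * y t * z t))) \<and>
        (\<phi>5 = 0 \<and> \<phi>4 \<noteq> 0 \<longrightarrow>
          (\<forall>t. z t = 1 / \<phi>4 * (\<phi>1 - (\<phi>3 + \<phi>4 * x t / 2) * y t - r (\<theta> t) * cos (\<theta> t)) \<and>
               v t = 1 / (3 * \<phi>4) * (t - \<phi>1 * x t - \<phi>2 * y t - 2 * \<phi>3 * z t - \<phi>4 / 2 * x t * z t) \<and>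
               w t = 1 / 3 * (LINT \<tau>=ereal 0..ereal t|lebesgue. (y \<tau> * deriv z \<tau> - z \<tau> * deriv y \<tau>))
                       - y t * z t / 6)))"

text \<open>The straight lines; \<open>s\<close> is a sign.\<close>

definition line_A1 :: "(real \<times> real \<Rightarrow> real) \<Rightarrow> real \<Rightarrow> (real \<Rightarrow> pt) \<Rightarrow> bool" where
  "line_A1 F s g \<longleftrightarrow> (\<forall>t. g t = (0, s * t / F (0, s), 0, 0, 0))"

definition line_A2 :: "(real \<times> real \<Rightarrow> real) \<Rightarrow> real \<Rightarrow> (real \<Rightarrow> pt) \<Rightarrow> bool" where
  "line_A2 F s g \<longleftrightarrow> (\<forall>t. g t = (s * t / F (s, 0), 0, 0, 0, 0))"

fun line_A3 :: "(real \<times> real \<Rightarrow> real) \<Rightarrow> pt \<Rightarrow> real \<Rightarrow> (real \<Rightarrow> pt) \<Rightarrow> bool" where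
  "line_A3 F (\<phi>1, \<phi>2, \<phi>3, \<phi>4, \<phi>5) s g \<longleftrightarrow>
     \<phi>4 * \<phi>5 \<noteq> 0 \<and>
     (\<forall>t. let x = s * \<phi>5 * t / F (s * \<phi>5, - s * \<phi>4) in g t = (x, - \<phi>4 * x / \<phi>5, 0, 0, 0))"

definition metric_line_A :: "(real \<times> real \<Rightarrow> real) \<Rightarrow> pt \<Rightarrow> (real \<Rightarrow> pt) \<Rightarrow> bool" where
  "metric_line_A F \<phi> g \<longleftrightarrow>
     metric_straight_line F g \<and>
     (\<exists>s\<in>{1, -1}. line_A1 F s g \<or> line_A2 F s g \<or> line_A3 F \<phi> s g)"

text \<open>The point reached at time \<open>t0 + \<tau>\<close> from \<open>g t0 = (x0, y0, z0, v0, w0)\<close> while the angle is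
  constant.\<close>

fun point_B1 :: "pt \<Rightarrow> pt \<Rightarrow> real \<Rightarrow> pt" where
  "point_B1 (\<phi>1, \<phi>2, \<phi>3, \<phi>4, \<phi>5) (x0, y0, z0, v0, w0) \<tau> =
     (let E = energy (\<phi>1, \<phi>2, \<phi>3, \<phi>4, \<phi>5) in
      (x0 + \<phi>5 / E * \<tau>,
       - \<phi>4 / E * \<tau> - 1 / \<phi>5 * (\<phi>3 + \<phi>4 * x0),
       z0 + \<phi>3 / (2 * E) * \<tau>,
       v0 - \<phi>3 * \<phi>5 / (12 * E\<^sup>2) * \<tau>\<^sup>2 + 1 / (12 * E) * (\<phi>3 * x0 - 6 * \<phi>5 * z0) * \<tau>,
       w0 + \<phi>3 * \<phi>4 / (12 * E\<^sup>2) * \<tau>\<^sup>2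
          + 1 / (12 * \<phi>5 * E) * (6 * \<phi>4 * \<phi>5 * z0 - \<phi>3 * \<phi>4 * x0 - \<phi>3\<^sup>2) * \<tau>))"

fun point_B2 :: "pt \<Rightarrow> pt \<Rightarrow> real \<Rightarrow> pt" where
  "point_B2 (\<phi>1, \<phi>2, \<phi>3, \<phi>4, \<phi>5) (x0, y0, z0, v0, w0) \<tau> =
     (let E = energy (\<phi>1, \<phi>2, \<phi>3, \<phi>4, \<phi>5) in
      (- \<phi>3 / \<phi>4,
       y0 - \<phi>4 / E * \<tau>,
       z0 + \<phi>3 / (2 * E) * \<tau>,
       v0 - \<phi>3\<^sup>2 / (12 * \<phi>4 * E) * \<tau>,
       w0 + \<phi>3 * \<phi>4 / (12 * E\<^sup>2) * \<tau>\<^sup>2 + 1 / (12 * E) * (\<phi>3 * y0 + 6 * \<phi>4 * z0) * \<tau>))"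

fun formulas_B_on :: "pt \<Rightarrow> (real \<Rightarrow> pt) \<Rightarrow> real \<Rightarrow> real \<Rightarrow> bool" where
  "formulas_B_on (\<phi>1, \<phi>2, \<phi>3, \<phi>4, \<phi>5) g a b \<longleftrightarrow>
     (let \<phi> = (\<phi>1, \<phi>2, \<phi>3, \<phi>4, \<phi>5); t0 = closest_point {a..b} 0 in
      \<forall>t\<in>{a..b}. (\<phi>5 \<noteq> 0 \<longrightarrow> g t = point_B1 \<phi> (g t0) (t - t0)) \<and>
                 (\<phi>5 = 0 \<longrightarrow> g t = point_B2 \<phi> (g t0) (t - t0)))"

section \<open>Time as a function of the angle\<close>

fun time_integrand :: "(real \<times> real \<Rightarrow> real) \<Rightarrow> pt \<Rightarrow> real \<Rightarrow> real" where
  "time_integrand F (\<phi>1, \<phi>2, \<phi>3, \<phi>4, \<phi>5) \<xi> =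
     (polar_radius F \<xi>)\<^sup>2 /
       (\<phi>3 * sqrt (1 + (2 * \<phi>4 / \<phi>3\<^sup>2) * (polar_radius F \<xi> * sin \<xi> - \<phi>2)
                     - (2 * \<phi>5 / \<phi>3\<^sup>2) * (polar_radius F \<xi> * cos \<xi> - \<phi>1)))"

fun time_integrand0 :: "(real \<times> real \<Rightarrow> real) \<Rightarrow> pt \<Rightarrow> real \<Rightarrow> real" where
  "time_integrand0 F (\<phi>1, \<phi>2, \<phi>3, \<phi>4, \<phi>5) \<xi> =
     (polar_radius F \<xi>)\<^sup>2 /
       sqrt (2 * \<phi>4 * (polar_radius F \<xi> * sin \<xi> - \<phi>2) - 2 * \<phi>5 * (polar_radius F \<xi> * cos \<xi> - \<phi>1))"

text \<open>On the intervals where these integrands are integrated they have constant sign and are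
  continuous in the interior, so the improper integral converges iff the Lebesgue integral over the
  open interval is finite. Singularities occur only at end points. Note that \<open>LINT\<close> is oriented,
  whereas integrability does not depend on the order of the end points.\<close>

abbreviation integral_finite :: "(real \<Rightarrow> real) \<Rightarrow> real \<Rightarrow> real \<Rightarrow> bool" where
  "integral_finite f a b \<equiv> interval_lebesgue_integrable lborel (ereal a) (ereal b) f"

abbreviation integral_from_to :: "(real \<Rightarrow> real) \<Rightarrow> real \<Rightarrow> real \<Rightarrow> real" where
  "integral_from_to f a b \<equiv> interval_lebesgue_integral lborel (ereal a) (ereal b) f"

definition finite_from_left :: "(real \<Rightarrow> real) \<Rightarrow> real \<Rightarrow> bool" where
  "finite_from_left f b \<longleftrightarrow> (\<exists>a<b. integral_finite f a b)"

definition finite_from_right :: "(real \<Rightarrow> real) \<Rightarrow> real \<Rightarrow> bool" where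
  "finite_from_right f a \<longleftrightarrow> (\<exists>b>a. integral_finite f a b)"

definition nearest_zeros :: "(real \<Rightarrow> real) \<Rightarrow> real \<Rightarrow> real \<Rightarrow> real \<Rightarrow> bool" where
  "nearest_zeros f c a b \<longleftrightarrow>
     a < c \<and> c < b \<and> f a = 0 \<and> f b = 0 \<and> (\<forall>\<xi>\<in>{a<..<b}. f \<xi> \<noteq> 0)"

definition largest_segment :: "(real \<Rightarrow> bool) \<Rightarrow> real \<Rightarrow> real \<Rightarrow> real \<Rightarrow> bool" where
  "largest_segment P c a b \<longleftrightarrow>
     a \<le> b \<and> c \<in> {a..b} \<and> (\<forall>\<xi>\<in>{a..b}. P \<xi>) \<and>
     (\<forall>a' b'. c \<in> {a'..b'} \<and> (\<forall>\<xi>\<in>{a'..b'}. P \<xi>) \<longrightarrow> {a'..b'} \<subseteq> {a..b})"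

section \<open>Non-uniqueness and intervals of constancy\<close>

definition angle_not_unique :: "(real \<times> real \<Rightarrow> real) \<Rightarrow> pt \<Rightarrow> real \<Rightarrow> bool" where
  "angle_not_unique F \<phi> \<theta>0 \<longleftrightarrow>
     (\<exists>g g' \<theta> \<theta>'. extremal_with F \<phi> g \<theta> \<and> extremal_with F \<phi> g' \<theta>' \<and>
        \<theta> 0 = \<theta>0 \<and> \<theta>' 0 = \<theta>0 \<and> \<theta> \<noteq> \<theta>')"

definition maximal_constancy :: "(real \<Rightarrow> real) \<Rightarrow> real \<Rightarrow> real \<Rightarrow> real \<Rightarrow> bool" where
  "maximal_constancy \<theta> c a b \<longleftrightarrow>
     (\<forall>t\<in>{a..b}. \<theta> t = c) \<and>
     (\<forall>a' b'. a' \<le> a \<and> b \<le> b' \<and> (\<forall>t\<in>{a'..b'}. \<theta> t = c) \<longrightarrow> a' = a \<and> b' = b)"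

text \<open>\<open>C\<close> is exactly the set of values which the angles (with initial value \<open>\<theta>0\<close>) of the extremals
  with initial covector \<open>\<phi>\<close> take on non-degenerate intervals of constancy. Each of
  these values is taken on maximal intervals of constancy of every length, and the
  explicit formulas hold on every interval of constancy.\<close>

definition constant_values :: "(real \<times> real \<Rightarrow> real) \<Rightarrow> pt \<Rightarrow> real \<Rightarrow> real set \<Rightarrow> bool" where
  "constant_values F \<phi> \<theta>0 C \<longleftrightarrow>
     (\<forall>g \<theta> a b c. extremal_with F \<phi> g \<theta> \<and> \<theta> 0 = \<theta>0 \<and> a < b \<and> (\<forall>t\<in>{a..b}. \<theta> t = c) \<longrightarrow>
        c \<in> C \<and> formulas_B_on \<phi> g a b) \<and>
     (\<forall>c\<in>C. \<forall>L>0. \<exists>g \<theta> a. extremal_with F \<phi> g \<theta> \<and> \<theta> 0 = \<theta>0 \<and> maximal_constancy \<theta> c a (a + L))"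

text \<open>For every integer \<open>n\<close> the function \<open>\<theta>\<close> is constant, equal to a number \<open>c + 2 * pi * k n\<close>, on the
  possibly degenerate interval \<open>{a n..a n + L n}\<close>, and between two consecutive intervals it
  increases or decreases by \<open>2 * pi\<close>, as prescribed by \<open>up n\<close>.\<close>

definition alternates ::
    "(real \<Rightarrow> real) \<Rightarrow> real \<Rightarrow> (int \<Rightarrow> bool) \<Rightarrow> (int \<Rightarrow> real) \<Rightarrow> (int \<Rightarrow> real) \<Rightarrow> bool" where
  "alternates \<theta> c up L a \<longleftrightarrow>
     (\<exists>k :: int \<Rightarrow> int. \<forall>n.
        (\<forall>t\<in>{a n..a n + L n}. \<theta> t = c + 2 * pi * of_int (k n)) \<and>
        a n + L n < a (n + 1) \<and>
        (if up n
         then k (n + 1) = k n + 1 \<and> strict_mono_on {a n + L n..a (n + 1)} \<theta>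
         else k (n + 1) = k n - 1 \<and> strict_antimono_on {a n + L n..a (n + 1)} \<theta>))"

end

theory Submission
 imports Defs
begin

text \<open>Along an extremal the angle solves \<open>th'\<^sup>2 = R th\<close> with \<open>R = 2 (E - L) / r ^ 4\<close>, where
 \<open>L\<close> is the linear function \<open>ph5 h1 - ph4 h2\<close> on the polar curve. Conversely, every \<open>C\<^sup>1\<close>
 solution with the right initial data comes from an extremal if \<open>E\<close> is the maximum of \<open>L\<close>: where
 \<open>R = 0\<close> the control is \<open>(ph5, - ph4) / E\<close>, and elsewhere any choice of the support point will do.
 By trigonometric convexity of the support function, \<open>E l - l L\<close> has at most one arc of negativity
 per period, bounded by simple zeros, or one arc of zeros when \<open>E\<close> is the maximum. In the first
 case the angle cannot rest and is reflected at the zeros; in the second it may rest at a zero exactly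
 when the time integral converges there, and solutions are glued from flights and rests.\<close>

section \<open>Absolutely continuous functions and indefinite integrals\<close>

text \<open>The equation comes from a conservation law. With \<open>h3 = ph3 + ph4 x + ph5 y\<close>
  the momenta satisfy \<open>H1' = - h3 b\<close> and \<open>H2' = h3 a\<close> for the control
  \<open>(a, b)\<close>, so \<open>ph5 H1 - ph4 H2 + h3^2 / 2\<close> keeps the value
  \<open>E\<close>; in polar coordinates \<open>h3 = r^2 th'\<close>. The control has dropped out,
  and the angle can be studied alone. Two obstacles shape the proof. Only the square of
  \<open>th'\<close> is prescribed and \<open>R\<close> may vanish, so no uniqueness theorem applies
  at its zeros; statements about solutions are drawn from the travel time, the integral of
  \<open>1 / sqrt R\<close>, whose convergence at a zero decides whether the zero can be reached.
  For the converse, differentiating \<open>h3^2 = 2 (E - L)\<close> gives the wanted equation for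
  \<open>h3'\<close> only up to the factor \<open>h3\<close>, and rests, where
  \<open>h3 = 0\<close>, may have positive measure. On a rest the control must be orthogonal to
  \<open>(ph4, ph5)\<close> and pair to 1 with the momentum, which leaves only
  \<open>(ph5, - ph4) / E\<close>; for \<open>E > 0\<close> it is admissible exactly when
  \<open>L <= E\<close>.\<close>

lemma absolutely_continuous_has_integral:
 fixes f :: "real \<Rightarrow> real"
 assumes ac: "absolutely_continuous_on S f" and sub: "{a..b} \<subseteq> S" and ab: "a <= b"
  and ae: "AE t in lebesgue. t \<in> {a..b} --> (f has_real_derivative k t) (at t within {a..b})"
 shows "(k has_integral f b - f a) {a..b}"
proof -
 define N where "N = {t\<in>{a..b}. ~ (f has_real_derivative k t) (at t within {a..b})}"
 have negN: "negligible N"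
 proof -
  have "{t. ~ (t \<in> {a..b} --> (f has_real_derivative k t) (at t within {a..b}))} = N"
   by (auto simp: N_def)
  then show ?thesis
   using ae by (simp add: completion.AE_iff_null_sets negligible_iff_null_sets)
 qed
 \<comment> \<open>On the negligible set \<open>N\<close> the values of \<open>k\<close> carry no
   information. With the value 0 there, the terms of a Riemann sum with tags in \<open>N\<close>
   reduce to increments of \<open>f\<close>.\<close>
 define k0 where "k0 t = (if t \<in> N then 0 else k t)" for t
 have "(k0 has_integral f b - f a) {a..b}"
  unfolding has_integral_real
 proof (intro allI impI)
  fix e :: real assume e: "0 < e"
  define et where "et = e / (2 * (b - a + 1))"
  have et: "et > 0" using e ab by (simp add: et_def)
  have etb: "et * (b - a) < e / 2" using e ab by (simp add: et_def field_simps)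
  have e2: "e / 2 > 0" using e by simp
  obtain de where de: "de > 0" "!!\<D> T. [|\<D> division_of T; T \<subseteq> {a..b}; (\<Sum>K\<in>\<D>. Sup K - Inf K) < de|]
    ==> (\<Sum>K\<in>\<D>. norm (f (Sup K) - f (Inf K))) < e / 2"
   using ac[unfolded absolutely_continuous_on_def, rule_format, OF sub e2] by blast
  have "N \<in> sets lebesgue" using negN negligible_imp_sets by blast
  then obtain G where G: "open G" "N \<subseteq> G" "G - N \<in> lmeasurable" "emeasure lebesgue (G - N) < ennreal de"
   using sets_lebesgue_outer_open[of N de] de(1) by blast
  have Gm: "G \<in> lmeasurable"
  proof -
   have "G = (G - N) \<union> N" using G by auto
   then show ?thesis using G(3) negligible_imp_measurable[OF negN] by (metis fmeasurable.Un)
  qed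
  have mG: "measure lebesgue G < de"
  proof -
   have "measure lebesgue G <= measure lebesgue (G - N) + measure lebesgue N"
    using measure_Un_le[of "G - N" lebesgue N] G(2,3) \<open>N \<in> sets lebesgue\<close>
    by (simp add: fmeasurableD Un_absorb2)
   also have "\<dots> < de"
    using G(3,4) negligible_imp_measure0[OF negN] de(1) emeasure_eq_measure2[OF G(3)]
    by (simp add: ennreal_less_iff)
   finally show ?thesis .
  qed
  \<comment> \<open>The gauge treats two kinds of tags. Around points of \<open>N\<close> it stays
    inside the open set \<open>G\<close> of measure below \<open>de\<close>, so that absolute
    continuity controls the increments of \<open>f\<close>; elsewhere it is a radius at which the
    derivative approximates \<open>f\<close> with relative error \<open>et\<close>.\<close>
  have "\<exists>d>0. (t \<in> N --> ball t d \<subseteq> G) & (t \<in> {a..b} - N -->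
    (\<forall>y\<in>{a..b}. norm (y - t) < d --> norm (f y - f t - k t * (y - t)) <= et * norm (y - t)))" for t
  proof (cases "t \<in> N")
   case True
   then show ?thesis using G by (meson DiffD2 open_contains_ball subsetD)
  next
   case tN: False
   show ?thesis
   proof (cases "t \<in> {a..b}")
    case True
    then have "(f has_real_derivative k t) (at t within {a..b})"
     using tN by (auto simp: N_def)
    then show ?thesis
     using et tN unfolding has_field_derivative_def has_derivative_within_alt by (auto simp: mult.commute)
   next
    case False
    then show ?thesis using tN by (intro exI[of _ 1]) auto
   qed
  qed
  then obtain d where d0: "!!t. d t > 0" and dN: "!!t. t \<in> N ==> ball t (d t) \<subseteq> G"
   and d: "!!t y. [|t \<in> {a..b} - N; y \<in> {a..b}; norm (y - t) < d t|] ==>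
    norm (f y - f t - k t * (y - t)) <= et * norm (y - t)"
   by metis
  show "\<exists>ga. gauge ga & (\<forall>\<D>. \<D> tagged_division_of {a..b} & ga fine \<D> -->
    norm ((\<Sum>(x, K)\<in>\<D>. measure lborel K *\<^sub>R k0 x) - (f b - f a)) < e)"
  proof (intro exI[of _ "%x. ball x (d x)"] conjI allI impI)
   show "gauge (%x. ball x (d x))" using d0 gauge_ball_dependent by blast
   fix \<D> assume "\<D> tagged_division_of {a..b} & (%x. ball x (d x)) fine \<D>"
   then have D: "\<D> tagged_division_of {a..b}" and fine: "(%x. ball x (d x)) fine \<D>" by auto
   have fin: "finite \<D>" using D by blast
   have int: "\<exists>u v. K = {u..v} & u <= v & x \<in> {u..v} & a <= u & v <= b & {u..v} \<subseteq> ball x (d x)"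
    if xK: "(x, K) \<in> \<D>" for x K
   proof -
    obtain u v where K: "K = cbox u v" using D xK by blast
    have "x \<in> K" "K \<subseteq> {a..b}" using D xK by blast+
    moreover have "K \<subseteq> ball x (d x)" using fine xK by blast
    ultimately show ?thesis using K by auto
   qed
   let ?g = "%(x::real, K). f (Sup K) - f (Inf K)"
   have fba: "f b - f a = (\<Sum>(x, K)\<in>\<D>. f (Sup K) - f (Inf K))"
    and ba: "b - a = (\<Sum>(x, K)\<in>\<D>. Sup K - Inf K)"
    using additive_tagged_division_1[OF ab D, of f] additive_tagged_division_1[OF ab D, of "%x. x"] by auto
   define DN where "DN = {p\<in>\<D>. fst p \<in> N}"
   have DNsub: "DN \<subseteq> \<D>" by (auto simp: DN_def)
   have DNpart: "DN tagged_partial_division_of {a..b}"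
    using D DNsub by (meson tagged_division_of_def tagged_partial_division_subset)
   have DNdiv: "DN tagged_division_of (\<Union>(snd ` DN))"
    by (rule tagged_partial_division_of_Union_self[OF DNpart])
   have div: "snd ` DN division_of (\<Union>(snd ` DN))"
    using DNdiv by (rule division_of_tagged_division)
   \<comment> \<open>Absolute continuity speaks of a set of intervals, the Riemann sum of tagged
     ones. Intervals lost when the tags are forgotten are degenerate and contribute nothing because
     \<open>h u u = 0\<close>. The guard for the empty set is there because \<open>Sup {}\<close>
     has no useful value.\<close>
   have over: "(\<Sum>(x, K)\<in>DN. h (Sup K) (Inf K)) = (\<Sum>K\<in>snd ` DN. h (Sup K) (Inf K))"
    if h: "!!u. h u u = 0" for h :: "real \<Rightarrow> real \<Rightarrow> real"
   proof -
    have ne: "K ~= {}" if "K \<in> snd ` DN" for K using int that DNsub by fastforce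
    have "(\<Sum>(x, K)\<in>DN. if K = {} then 0 else h (Sup K) (Inf K))
      = (\<Sum>K\<in>snd ` DN. if K = {} then 0 else h (Sup K) (Inf K))"
    proof (rule sum.over_tagged_division_lemma[OF DNdiv])
     fix u v :: real assume "box u v = {}"
     then have "v <= u" by simp
     then show "(if cbox u v = {} then 0 else h (Sup (cbox u v)) (Inf (cbox u v))) = 0"
      using h by (cases "u = v") auto
    qed
    moreover have "(\<Sum>K\<in>snd ` DN. if K = {} then 0 else h (Sup K) (Inf K)) = (\<Sum>K\<in>snd ` DN. h (Sup K) (Inf K))"
     using ne by (intro sum.cong) auto
    moreover have "(\<Sum>(x, K)\<in>DN. if K = {} then 0 else h (Sup K) (Inf K)) = (\<Sum>(x, K)\<in>DN. h (Sup K) (Inf K))"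
     using ne by (intro sum.cong) force+
    ultimately show ?thesis by simp
   qed
   have mU: "measure lebesgue (\<Union>(snd ` DN)) = (\<Sum>K\<in>snd ` DN. measure lebesgue K)"
    using content_division[OF div] by auto
   have "\<Union>(snd ` DN) \<subseteq> G"
   proof
    fix y assume "y \<in> \<Union>(snd ` DN)"
    then obtain x K where xK: "(x, K) \<in> DN" "y \<in> K" by auto
    then show "y \<in> G" using int[of x K] dN[of x] by (auto simp: DN_def)
   qed
   then have "measure lebesgue (\<Union>(snd ` DN)) <= measure lebesgue G"
    using Gm div by (intro measure_mono_fmeasurable) (auto intro: lmeasurable_division fmeasurableD)
   moreover have "(\<Sum>K\<in>snd ` DN. Sup K - Inf K) = (\<Sum>K\<in>snd ` DN. measure lebesgue K)"
   proof (rule sum.cong[OF refl])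
    fix K assume "K \<in> snd ` DN"
    then obtain x where "(x, K) \<in> \<D>" using DNsub by auto
    from int[OF this] show "Sup K - Inf K = measure lebesgue K" by auto
   qed
   ultimately have "(\<Sum>K\<in>snd ` DN. Sup K - Inf K) < de" using mU mG by simp
   moreover have "\<Union>(snd ` DN) \<subseteq> {a..b}" using int DNsub by fastforce
   ultimately have "(\<Sum>K\<in>snd ` DN. norm (f (Sup K) - f (Inf K))) < e / 2"
    using de(2)[OF div] by blast
   then have smN: "(\<Sum>(x, K)\<in>DN. norm (f (Sup K) - f (Inf K))) < e / 2"
    using over[of "%u v. norm (f u - f v)"] by simp
   have smG: "norm (measure lborel K *\<^sub>R k0 x - (f (Sup K) - f (Inf K))) <= et * (Sup K - Inf K)"
    if xK: "(x, K) \<in> \<D> - DN" for x K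
   proof -
    obtain u v where K: "K = {u..v}" "u <= v" "x \<in> {u..v}" "a <= u" "v <= b" "{u..v} \<subseteq> ball x (d x)"
     using int[of x K] xK by auto
    have x: "x \<in> {a..b} - N" using xK K by (auto simp: DN_def)
    have "u \<in> ball x (d x)" "v \<in> ball x (d x)" using K(2,6) by (meson atLeastAtMost_iff order_refl subsetD)+
    then have "u \<in> {a..b}" "norm (u - x) < d x" "v \<in> {a..b}" "norm (v - x) < d x"
     using K(2,4,5) by (auto simp: dist_real_def abs_minus_commute)
    then have "norm (f u - f x - k x * (u - x)) <= et * norm (u - x)"
     "norm (f v - f x - k x * (v - x)) <= et * norm (v - x)" using d[OF x] by auto
    then have "\<bar>f v - f u - k x * (v - u)\<bar> <= et * ((v - x) + (x - u))"
     using K(2,3) unfolding real_norm_def distrib_left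
     by (auto simp: algebra_simps abs_le_iff)
    then show ?thesis using K x by (simp add: k0_def abs_minus_commute mult.commute)
   qed
   have "norm ((\<Sum>(x, K)\<in>\<D>. measure lborel K *\<^sub>R k0 x) - (f b - f a))
     = norm (\<Sum>(x, K)\<in>\<D>. measure lborel K *\<^sub>R k0 x - (f (Sup K) - f (Inf K)))"
    unfolding fba by (simp add: sum_subtractf split_def)
   also have "\<dots> <= (\<Sum>(x, K)\<in>\<D>. norm (measure lborel K *\<^sub>R k0 x - (f (Sup K) - f (Inf K))))"
    by (rule order_trans[OF norm_sum]) (simp add: split_def)
   also have "\<dots> = (\<Sum>(x, K)\<in>\<D> - DN. norm (measure lborel K *\<^sub>R k0 x - (f (Sup K) - f (Inf K))))
     + (\<Sum>(x, K)\<in>DN. norm (measure lborel K *\<^sub>R k0 x - (f (Sup K) - f (Inf K))))"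
    using DNsub fin by (simp add: sum.subset_diff)
   also have "(\<Sum>(x, K)\<in>DN. norm (measure lborel K *\<^sub>R k0 x - (f (Sup K) - f (Inf K))))
     = (\<Sum>(x, K)\<in>DN. norm (f (Sup K) - f (Inf K)))"
    by (intro sum.cong) (auto simp: DN_def k0_def abs_minus_commute)
   also have "(\<Sum>(x, K)\<in>\<D> - DN. norm (measure lborel K *\<^sub>R k0 x - (f (Sup K) - f (Inf K))))
     <= (\<Sum>(x, K)\<in>\<D> - DN. et * (Sup K - Inf K))"
    using smG by (intro sum_mono) auto
   also have "\<dots> <= (\<Sum>(x, K)\<in>\<D>. et * (Sup K - Inf K))"
    using int et fin by (intro sum_mono2) fastforce+
   also have "\<dots> = et * (b - a)" unfolding ba by (simp add: sum_distrib_left split_def)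
   finally show "norm ((\<Sum>(x, K)\<in>\<D>. measure lborel K *\<^sub>R k0 x) - (f b - f a)) < e"
    using etb smN by linarith
  qed
 qed
 then show ?thesis
  by (rule has_integral_spike[OF negN, rotated]) (auto simp: k0_def)
qed

text \<open>Near a point where the difference quotients do not tend to \<open>f\<close> there are
  arbitrarily short intervals with a large error. Vitali's theorem extracts disjoint ones that cover
  almost all such points, and Henstock's lemma bounds the sum of their errors, hence their total
  length. Countably many thresholds \<open>1 / (n + 1)\<close> exhaust the exceptional
  points.\<close>

lemma lebesgue_differentiation:
 fixes f :: "real \<Rightarrow> real"
 assumes f: "f integrable_on {a..b}"
 shows "AE t in lebesgue. t \<in> {a<..<b} --> ((%t. integral {a..t} f) has_real_derivative f t) (at t)"
proof -
 define F where "F t = integral {a..t} f" for t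
 have diff: "integral {min x y..max x y} f - \<bar>y - x\<bar> * f x = sgn (y - x) * (F y - F x - f x * (y - x))"
  if "x \<in> {a..b}" "y \<in> {a..b}" for x y
 proof -
  have *: "integral {u..v} f = F v - F u" if "u <= v" "u \<in> {a..b}" "v \<in> {a..b}" for u v
   using Henstock_Kurzweil_Integration.integral_combine[of a u v f] that
    integrable_subinterval_real[OF f, of a v] by (auto simp: F_def)
  show ?thesis
   using *[of x y] *[of y x] that by (cases "x <= y") (auto simp: sgn_if algebra_simps)
 qed
 define bad where "bad n x y \<longleftrightarrow> y ~= x & \<bar>y - x\<bar> < (real n + 1) * \<bar>F y - F x - f x * (y - x)\<bar>" for n :: nat and x y
 define E where "E n = {x\<in>{a<..<b}. \<forall>de>0. \<exists>y\<in>{a..b}. \<bar>y - x\<bar> < de & bad n x y}" for n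
 have neg: "negligible (E n)" for n
  unfolding negligible_outer_le
 proof (intro allI impI)
  fix e :: real assume e: "0 < e"
  define ep where "ep = e / (real n + 1)"
  have "ep > 0" using e by (simp add: ep_def)
  then obtain ga where ga: "gauge ga"
   and hen: "!!p. [|p tagged_partial_division_of (cbox a b); ga fine p|] ==>
      sum (%(x,k). norm (measure lborel k *\<^sub>R f x - integral k f)) p < ep"
   using Henstock_lemma[of f a b ep] f by auto
  define I where "I = {(x, y). x \<in> E n & y \<in> {a..b} & bad n x y & {min x y..max x y} \<subseteq> ga x}"
  \<comment> \<open>The interval between \<open>x\<close> and \<open>y\<close>, tagged at its end
    \<open>x\<close>, is written as a ball about the midpoint because the covering theorem is about
    balls.\<close>
  define c where "c = (%(x, y). (x + y) / 2 :: real)"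
  define rh where "rh = (%(x, y). \<bar>y - x\<bar> / 2 :: real)"
  have cb: "cball (c i) (rh i) = {min (fst i) (snd i)..max (fst i) (snd i)}" for i
   by (cases i) (auto simp: c_def rh_def cball_eq_atLeastAtMost min_def max_def field_simps)
  obtain C where C: "countable C" "C \<subseteq> I"
   "pairwise (%i j. disjnt (cball (c i) (rh i)) (cball (c j) (rh j))) C"
   "negligible (E n - (\<Union>i\<in>C. cball (c i) (rh i)))"
  proof (rule Vitali_covering_theorem_cballs[of I rh "E n" c])
   show "0 < rh i" if "i \<in> I" for i using that by (auto simp: I_def rh_def bad_def)
   fix x d :: real assume x: "x \<in> E n" and d: "0 < d"
   obtain r where r: "r > 0" "ball x r \<subseteq> ga x"
    using ga by (meson gauge_def open_contains_ball)
   obtain y where y: "y \<in> {a..b}" "\<bar>y - x\<bar> < min r d" "bad n x y"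
    using x r d by (auto simp: E_def dest!: spec[of _ "min r d"])
   have "{min x y..max x y} \<subseteq> ball x r"
    using y by (auto simp: dist_real_def)
   then have "(x, y) \<in> I" using x y r by (auto simp: I_def)
   moreover have "x \<in> cball (c (x, y)) (rh (x, y))" unfolding cb by simp
   moreover have "rh (x, y) < d" using y d by (simp add: rh_def)
   ultimately show "\<exists>i. i \<in> I & x \<in> cball (c i) (rh i) & rh i < d" by blast
  qed
  have bound: "measure lebesgue (\<Union>i\<in>C'. cball (c i) (rh i)) <= e" if C': "C' \<subseteq> C" "finite C'" for C'
  proof -
   let ?g = "%i. (fst i, cball (c i) (rh i))"
   have CI: "i \<in> I" if "i \<in> C'" for i using that C' C by auto
   have inj: "inj_on ?g C'"
   proof (rule inj_onI)
    fix i j assume ij: "i \<in> C'" "j \<in> C'" "?g i = ?g j"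
    have "fst i \<in> cball (c i) (rh i)" unfolding cb by simp
    then show "i = j"
     using ij C(3) C'(1) unfolding pairwise_def disjnt_def by (metis disjoint_iff prod.inject subsetD)
   qed
   have ptag: "?g ` C' tagged_partial_division_of cbox a b"
   unfolding tagged_partial_division_of_def
   proof (intro conjI allI impI)
    show "finite (?g ` C')" using C' by simp
    fix x K assume "(x, K) \<in> ?g ` C'"
    then obtain i where i: "i \<in> C'" "x = fst i" "K = cball (c i) (rh i)" by auto
    then show "x \<in> K" unfolding cb by simp
    show "K \<subseteq> cbox a b" using CI[OF i(1)] i unfolding cb by (auto simp: I_def E_def)
    show "\<exists>u v. K = cbox u v" unfolding i cb by (metis box_real(2))
   next
    fix x1 K1 x2 K2 assume "(x1, K1) \<in> ?g ` C' & (x2, K2) \<in> ?g ` C' & (x1, K1) ~= (x2, K2)"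
    then obtain i j where "i \<in> C'" "K1 = cball (c i) (rh i)" "j \<in> C'" "K2 = cball (c j) (rh j)" "i ~= j"
     by auto
    then have "disjnt K1 K2" using C(3) C'(1) unfolding pairwise_def by blast
    then show "interior K1 \<inter> interior K2 = {}"
     using interior_subset unfolding disjnt_def by blast
   qed
   have "ga fine (?g ` C')"
   proof (rule fineI)
    fix x K assume "(x, K) \<in> ?g ` C'"
    then obtain i where i: "i \<in> C'" "x = fst i" "K = cball (c i) (rh i)" by auto
    then show "K \<subseteq> ga x" using CI[OF i(1)] unfolding i cb by (auto simp: I_def)
   qed
   from hen[OF ptag this]
   have "(\<Sum>i\<in>C'. norm (measure lborel (cball (c i) (rh i)) *\<^sub>R f (fst i) - integral (cball (c i) (rh i)) f)) < ep"
    by (subst (asm) sum.reindex[OF inj]) simp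
   \<comment> \<open>A bad interval is shorter than \<open>n + 1\<close> times its Henstock error.
     This explains the choice \<open>ep = e / (n + 1)\<close>: a total error below \<open>ep\<close>
     gives a total length below \<open>e\<close>.\<close>
   then have "(real n + 1) * (\<Sum>i\<in>C'. norm (measure lborel (cball (c i) (rh i)) *\<^sub>R f (fst i) - integral (cball (c i) (rh i)) f)) < e"
    by (simp add: ep_def field_simps)
   moreover have "measure lebesgue (cball (c i) (rh i)) <= (real n + 1) * norm (measure lborel (cball (c i) (rh i)) *\<^sub>R f (fst i) - integral (cball (c i) (rh i)) f)"
    if "i \<in> C'" for i
   proof -
    obtain x y where i: "i = (x, y)" by fastforce
    have I: "x \<in> {a..b}" "y \<in> {a..b}" "bad n x y" using CI[OF that] by (auto simp: i I_def E_def)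
    have m: "measure lborel (cball (c i) (rh i)) = \<bar>y - x\<bar>" unfolding cb by (auto simp: i)
    have ab: "\<bar>sgn (y - x) * z\<bar> = \<bar>z\<bar>" for z using I by (auto simp: bad_def abs_mult abs_sgn_eq)
    have "norm (measure lborel (cball (c i) (rh i)) *\<^sub>R f (fst i) - integral (cball (c i) (rh i)) f)
      = \<bar>F y - F x - f x * (y - x)\<bar>"
     unfolding m unfolding cb unfolding i fst_conv snd_conv real_norm_def real_scaleR_def
     using diff[OF I(1,2)] ab[of "F y - F x - f x * (y - x)"] by linarith
    then show ?thesis using I(3) m by (simp add: bad_def)
   qed
   then have "(\<Sum>i\<in>C'. measure lebesgue (cball (c i) (rh i)))
     <= (real n + 1) * (\<Sum>i\<in>C'. norm (measure lborel (cball (c i) (rh i)) *\<^sub>R f (fst i) - integral (cball (c i) (rh i)) f))"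
    unfolding sum_distrib_left by (rule sum_mono)
   moreover have "measure lebesgue (\<Union>i\<in>C'. cball (c i) (rh i)) <= (\<Sum>i\<in>C'. measure lebesgue (cball (c i) (rh i)))"
    using C' by (intro measure_UNION_le) auto
   ultimately show ?thesis by linarith
  qed
  have lm: "(\<Union>i\<in>C. cball (c i) (rh i)) \<in> lmeasurable"
   and me: "measure lebesgue (\<Union>i\<in>C. cball (c i) (rh i)) <= e"
   using fmeasurable_UN_bound[OF C(1), of "%i. cball (c i) (rh i)" lebesgue e]
    measure_UN_bound[OF C(1), of "%i. cball (c i) (rh i)" lebesgue e] bound by auto
  let ?N = "E n - (\<Union>i\<in>C. cball (c i) (rh i))"
  show "\<exists>T. E n \<subseteq> T & T \<in> lmeasurable & measure lebesgue T <= e"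
  proof (intro exI conjI)
   show "E n \<subseteq> (\<Union>i\<in>C. cball (c i) (rh i)) \<union> ?N" by blast
   show "(\<Union>i\<in>C. cball (c i) (rh i)) \<union> ?N \<in> lmeasurable"
    using lm negligible_imp_measurable[OF C(4)] by (rule fmeasurable.Un)
   show "measure lebesgue ((\<Union>i\<in>C. cball (c i) (rh i)) \<union> ?N) <= e"
    using measure_Un_le[of "\<Union>i\<in>C. cball (c i) (rh i)" lebesgue ?N] lm me
     negligible_imp_sets[OF C(4)] negligible_imp_measure0[OF C(4)] by (simp add: fmeasurableD)
  qed
 qed
 have "negligible (\<Union>n. E n)" using neg by (intro negligible_countable_Union) auto
 then have "AE t in lebesgue. t \<notin> (\<Union>n. E n)"
  unfolding negligible_iff_null_sets by (rule AE_not_in)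
 then show ?thesis
 proof (eventually_elim, intro impI)
  fix x assume x: "x \<notin> (\<Union>n. E n)" "x \<in> {a<..<b}"
  show "((%t. integral {a..t} f) has_real_derivative f x) (at x)"
   unfolding has_field_derivative_def has_derivative_within_alt F_def[symmetric]
  proof (intro conjI allI impI)
   show "bounded_linear ((*) (f x))" by (rule bounded_linear_mult_right)
   fix e :: real assume e: "0 < e"
   obtain n where n: "1 / e < real n + 1" using reals_Archimedean2[of "1 / e - 1"] by (metis diff_less_eq)
   obtain de where de: "de > 0" "!!y. [|y \<in> {a..b}; \<bar>y - x\<bar> < de|] ==> ~ bad n x y"
   proof -
    have "\<exists>de>0. \<forall>y\<in>{a..b}. \<bar>y - x\<bar> < de --> ~ bad n x y"
     using x by (auto simp: E_def)
    then show ?thesis using that by blast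
   qed
   have "\<bar>F y - F x - f x * (y - x)\<bar> <= e * \<bar>y - x\<bar>" if y: "\<bar>y - x\<bar> < min de (min (x - a) (b - x))" for y
   proof (cases "y = x")
    case False
    have "y \<in> {a..b}" using y by (auto simp: abs_less_iff)
    then have "~ bad n x y" using de(2)[of y] y by auto
    then have *: "(real n + 1) * \<bar>F y - F x - f x * (y - x)\<bar> <= \<bar>y - x\<bar>" using False by (simp add: bad_def)
    have "\<bar>F y - F x - f x * (y - x)\<bar> = e * (1 / e * \<bar>F y - F x - f x * (y - x)\<bar>)" using e by simp
    also have "\<dots> <= e * ((real n + 1) * \<bar>F y - F x - f x * (y - x)\<bar>)"
     using e n by (intro mult_left_mono mult_right_mono) auto
    also have "\<dots> <= e * \<bar>y - x\<bar>" using * e by (intro mult_left_mono) auto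
    finally show ?thesis .
   qed simp
   then show "\<exists>d>0. \<forall>y\<in>UNIV. norm (y - x) < d --> norm (F y - F x - f x * (y - x)) <= e * norm (y - x)"
    using de(1) x(2) by (intro exI[of _ "min de (min (x - a) (b - x))"]) auto
  qed
 qed
qed

text \<open>Controls are bounded, so all coordinates and covector components turn out to belong to
  this class. It implies absolute continuity and is closed under products and under outer Lipschitz
  functions such as \<open>r\<close>, \<open>sin\<close> and \<open>cos\<close>.\<close>

definition loc_lipschitz :: "(real \<Rightarrow> real) \<Rightarrow> bool" where
 "loc_lipschitz f \<longleftrightarrow> (\<forall>a b. \<exists>C. \<forall>s\<in>{a..b}. \<forall>t\<in>{a..b}. \<bar>f t - f s\<bar> <= C * \<bar>t - s\<bar>)"

lemma loc_lipschitzE: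
 assumes "loc_lipschitz f"
 obtains C where "C > 0" "!!s t. [|s \<in> {a..b}; t \<in> {a..b}|] ==> \<bar>f t - f s\<bar> <= C * \<bar>t - s\<bar>"
proof -
 obtain C where C: "!!s t. [|s \<in> {a..b}; t \<in> {a..b}|] ==> \<bar>f t - f s\<bar> <= C * \<bar>t - s\<bar>"
  using assms unfolding loc_lipschitz_def by meson
 have "\<bar>f t - f s\<bar> <= (\<bar>C\<bar> + 1) * \<bar>t - s\<bar>" if "s \<in> {a..b}" "t \<in> {a..b}" for s t
  by (rule order_trans[OF C[OF that]]) (intro mult_right_mono, auto)
 then show ?thesis using that[of "\<bar>C\<bar> + 1"] by auto
qed

lemma loc_lipschitz_continuous:
 assumes "loc_lipschitz f"
 shows "continuous_on UNIV f"
proof (intro continuous_at_imp_continuous_on ballI)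
 fix t :: real
 obtain C where C: "C > 0" "!!s t'. [|s \<in> {t - 1..t + 1}; t' \<in> {t - 1..t + 1}|] ==> \<bar>f t' - f s\<bar> <= C * \<bar>t' - s\<bar>"
  using loc_lipschitzE[OF assms] by blast
 then have "C-lipschitz_on {t - 1..t + 1} f"
  by (auto simp: lipschitz_on_def dist_real_def abs_minus_commute)
 then have "continuous_on {t - 1..t + 1} f" by (rule lipschitz_on_continuous_on)
 then show "isCont f t"
  by (rule continuous_on_interior) auto
qed

lemma continuous_loc_bounded:
 assumes "continuous_on UNIV (f :: real \<Rightarrow> real)"
 obtains B where "B > 0" "!!t. t \<in> {a..b} ==> \<bar>f t\<bar> <= B"
proof -
 have "compact (f ` {a..b})"
  using assms continuous_on_subset by (intro compact_continuous_image) auto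
 then obtain B where "B > 0" "\<forall>x\<in>f ` {a..b}. norm x <= B"
  using compact_imp_bounded bounded_pos by metis
 then show ?thesis using that by auto
qed

lemma loc_lipschitz_const [intro, simp]: "loc_lipschitz (%t. c)"
 unfolding loc_lipschitz_def by (auto intro!: exI[of _ 0])

lemma loc_lipschitz_id [intro, simp]: "loc_lipschitz (%t. t)"
 unfolding loc_lipschitz_def by (auto intro!: exI[of _ 1])

lemma loc_lipschitz_add [intro]:
 assumes "loc_lipschitz f" "loc_lipschitz g"
 shows "loc_lipschitz (%t. f t + g t)"
 unfolding loc_lipschitz_def
proof (intro allI)
 fix a b
 obtain C where C: "!!s t. [|s \<in> {a..b}; t \<in> {a..b}|] ==> \<bar>f t - f s\<bar> <= C * \<bar>t - s\<bar>"
  using loc_lipschitzE[OF assms(1)] by metis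
 obtain D where D: "!!s t. [|s \<in> {a..b}; t \<in> {a..b}|] ==> \<bar>g t - g s\<bar> <= D * \<bar>t - s\<bar>"
  using loc_lipschitzE[OF assms(2)] by metis
 have "\<bar>f t + g t - (f s + g s)\<bar> <= (C + D) * \<bar>t - s\<bar>" if "s \<in> {a..b}" "t \<in> {a..b}" for s t
  unfolding distrib_right using C[OF that] D[OF that] by linarith
 then show "\<exists>C. \<forall>s\<in>{a..b}. \<forall>t\<in>{a..b}. \<bar>f t + g t - (f s + g s)\<bar> <= C * \<bar>t - s\<bar>" by blast
qed

lemma loc_lipschitz_mult [intro]:
 assumes "loc_lipschitz f" "loc_lipschitz g"
 shows "loc_lipschitz (%t. f t * g t)"
 unfolding loc_lipschitz_def
proof (intro allI)
 fix a b
 obtain C where C: "!!s t. [|s \<in> {a..b}; t \<in> {a..b}|] ==> \<bar>f t - f s\<bar> <= C * \<bar>t - s\<bar>"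
  using loc_lipschitzE[OF assms(1)] by metis
 obtain D where D: "!!s t. [|s \<in> {a..b}; t \<in> {a..b}|] ==> \<bar>g t - g s\<bar> <= D * \<bar>t - s\<bar>"
  using loc_lipschitzE[OF assms(2)] by metis
 obtain A where A: "A > 0" "!!t. t \<in> {a..b} ==> \<bar>f t\<bar> <= A"
  using continuous_loc_bounded[OF loc_lipschitz_continuous[OF assms(1)]] by metis
 obtain B where B: "B > 0" "!!t. t \<in> {a..b} ==> \<bar>g t\<bar> <= B"
  using continuous_loc_bounded[OF loc_lipschitz_continuous[OF assms(2)]] by metis
 have "\<bar>f t * g t - f s * g s\<bar> <= (A * D + B * C) * \<bar>t - s\<bar>" if st: "s \<in> {a..b}" "t \<in> {a..b}" for s t
 proof -
  have "f t * g t - f s * g s = f t * (g t - g s) + g s * (f t - f s)" by (simp add: algebra_simps)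
  also have "\<bar>\<dots>\<bar> <= \<bar>f t\<bar> * \<bar>g t - g s\<bar> + \<bar>g s\<bar> * \<bar>f t - f s\<bar>"
   by (metis abs_mult abs_triangle_ineq)
  also have "\<dots> <= A * (D * \<bar>t - s\<bar>) + B * (C * \<bar>t - s\<bar>)"
   using A B C[OF st] D[OF st] st by (intro add_mono mult_mono) auto
  finally show ?thesis by (simp add: algebra_simps)
 qed
 then show "\<exists>C. \<forall>s\<in>{a..b}. \<forall>t\<in>{a..b}. \<bar>f t * g t - f s * g s\<bar> <= C * \<bar>t - s\<bar>" by blast
qed

lemma loc_lipschitz_minus [intro]: "loc_lipschitz f ==> loc_lipschitz (%t. - f t)"
 using loc_lipschitz_mult[OF loc_lipschitz_const[of "-1"]] by simp

lemma loc_lipschitz_diff [intro]: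
 "loc_lipschitz f ==> loc_lipschitz g ==> loc_lipschitz (%t. f t - g t)"
 using loc_lipschitz_add[OF _ loc_lipschitz_minus] by simp

lemma loc_lipschitz_divide [intro]: "loc_lipschitz f ==> loc_lipschitz (%t. f t / c)"
 using loc_lipschitz_mult[OF _ loc_lipschitz_const[of "1 / c"]] by simp

lemma loc_lipschitz_power [intro]: "loc_lipschitz f ==> loc_lipschitz (%t. f t ^ n)"
 by (induction n) auto

lemma division_length_finite:
 assumes "\<D> division_of (T :: real set)" "K \<in> \<D>"
 shows "Inf K <= Sup K" "Inf K \<in> K" "Sup K \<in> K"
proof -
 obtain u v where K: "K = cbox u v" using assms by blast
 moreover have "K ~= {}" using assms by blast
 ultimately show "Inf K <= Sup K" "Inf K \<in> K" "Sup K \<in> K" by auto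
qed

lemma Lipschitz_imp_absolutely_continuous_on:
 fixes f :: "real \<Rightarrow> 'a::real_normed_vector"
 assumes "!!a b. \<exists>C. \<forall>s\<in>{a..b}. \<forall>t\<in>{a..b}. norm (f t - f s) <= C * \<bar>t - s\<bar>"
 shows "absolutely_continuous_on S f"
 unfolding absolutely_continuous_on_def
proof (intro allI impI)
 fix a b ep :: real assume "ep > 0"
 obtain C where C: "!!s t. [|s \<in> {a..b}; t \<in> {a..b}|] ==> norm (f t - f s) <= C * \<bar>t - s\<bar>"
  using assms by meson
 have C1: "norm (f t - f s) <= (\<bar>C\<bar> + 1) * \<bar>t - s\<bar>" if "s \<in> {a..b}" "t \<in> {a..b}" for s t
  by (rule order_trans[OF C[OF that]]) (intro mult_right_mono, auto)
 show "\<exists>de>0. \<forall>\<D> T. \<D> division_of T & T \<subseteq> {a..b} & (\<Sum>K\<in>\<D>. Sup K - Inf K) < de -->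
    (\<Sum>K\<in>\<D>. norm (f (Sup K) - f (Inf K))) < ep"
 proof (intro exI[of _ "ep / (\<bar>C\<bar> + 1)"] conjI allI impI)
  show "ep / (\<bar>C\<bar> + 1) > 0" using \<open>ep > 0\<close> by simp
  fix \<D> T assume "\<D> division_of T & T \<subseteq> {a..b} & (\<Sum>K\<in>\<D>. Sup K - Inf K) < ep / (\<bar>C\<bar> + 1)"
  then have D: "\<D> division_of T" "T \<subseteq> {a..b}" and s: "(\<bar>C\<bar> + 1) * (\<Sum>K\<in>\<D>. Sup K - Inf K) < ep"
   by (auto simp: field_simps)
  have "(\<Sum>K\<in>\<D>. norm (f (Sup K) - f (Inf K))) <= (\<Sum>K\<in>\<D>. (\<bar>C\<bar> + 1) * (Sup K - Inf K))"
  proof (rule sum_mono)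
   fix K assume K: "K \<in> \<D>"
   then have "K \<subseteq> {a..b}" using D by blast
   then have "Inf K \<in> {a..b}" "Sup K \<in> {a..b}" using division_length_finite[OF D(1) K] by blast+
   then show "norm (f (Sup K) - f (Inf K)) <= (\<bar>C\<bar> + 1) * (Sup K - Inf K)"
    using C1[of "Inf K" "Sup K"] division_length_finite(1)[OF D(1) K] by auto
  qed
  also have "\<dots> < ep" using s by (simp add: sum_distrib_left)
  finally show "(\<Sum>K\<in>\<D>. norm (f (Sup K) - f (Inf K))) < ep" .
 qed
qed

lemma loc_lipschitz_absolutely_continuous:
 "loc_lipschitz f ==> absolutely_continuous_on S f"
 by (rule Lipschitz_imp_absolutely_continuous_on) (simp add: loc_lipschitz_def)

lemma absolutely_continuous_on_norm_le:
 fixes f :: "real \<Rightarrow> 'a::real_normed_vector" and g :: "real \<Rightarrow> 'b::real_normed_vector"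
 assumes "absolutely_continuous_on S f" "!!s t. norm (g t - g s) <= norm (f t - f s)"
 shows "absolutely_continuous_on S g"
 unfolding absolutely_continuous_on_def
proof (intro allI impI)
 fix a b ep :: real assume "{a..b} \<subseteq> S" "ep > 0"
 then obtain de where de: "de > 0" "!!\<D> T. [|\<D> division_of T; T \<subseteq> {a..b}; (\<Sum>K\<in>\<D>. Sup K - Inf K) < de|] ==>
    (\<Sum>K\<in>\<D>. norm (f (Sup K) - f (Inf K))) < ep"
  using assms(1) unfolding absolutely_continuous_on_def by meson
 show "\<exists>de>0. \<forall>\<D> T. \<D> division_of T & T \<subseteq> {a..b} & (\<Sum>K\<in>\<D>. Sup K - Inf K) < de -->
    (\<Sum>K\<in>\<D>. norm (g (Sup K) - g (Inf K))) < ep"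
  by (intro exI[of _ de] conjI de allI impI order_le_less_trans[OF sum_mono de(2)] assms(2)) auto
qed

lemma absolutely_continuous_on_imp_continuous_on:
 fixes f :: "real \<Rightarrow> 'a::real_normed_vector"
 assumes ac: "absolutely_continuous_on {a..b} f"
 shows "continuous_on {a..b} f"
 unfolding continuous_on_iff
proof (intro ballI allI impI)
 fix t e :: real assume t: "t \<in> {a..b}" and "0 < e"
 then obtain de where de: "de > 0" "!!\<D> T. [|\<D> division_of T; T \<subseteq> {a..b}; (\<Sum>K\<in>\<D>. Sup K - Inf K) < de|] ==>
    (\<Sum>K\<in>\<D>. norm (f (Sup K) - f (Inf K))) < e"
  using ac unfolding absolutely_continuous_on_def by (meson order_refl)
 have "dist (f s) (f t) < e" if s: "s \<in> {a..b}" "dist s t < de" for s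
  using de(2)[OF division_of_self[of "min s t" "max s t"]] s t
  by (cases "s <= t") (auto simp: dist_norm norm_minus_commute)
 then show "\<exists>d>0. \<forall>x'\<in>{a..b}. dist x' t < d --> dist (f x') (f t) < e"
  using de(1) by blast
qed

text \<open>Increments are integrals of an essentially bounded function. This upgrades the mere
  absolute continuity in the definition of trajectories and extremals.\<close>

lemma absolutely_continuous_loc_lipschitz:
 fixes f :: "real \<Rightarrow> real"
 assumes ac: "absolutely_continuous_on UNIV f"
  and ae: "AE t in lebesgue. (f has_real_derivative k t) (at t)"
  and bd: "!!a b. \<exists>B. AE t in lebesgue. t \<in> {a..b} --> \<bar>k t\<bar> <= B"
 shows "loc_lipschitz f"
 unfolding loc_lipschitz_def
proof (intro allI)
 fix a b :: real
 obtain B where B: "AE t in lebesgue. t \<in> {a..b} --> \<bar>k t\<bar> <= B" using bd by blast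
 have *: "\<bar>f t - f s\<bar> <= \<bar>B\<bar> * (t - s)" if st: "s \<in> {a..b}" "t \<in> {a..b}" "s <= t" for s t
 proof -
  have "(k has_integral f t - f s) {s..t}"
   using ae by (intro absolutely_continuous_has_integral[OF ac _ st(3)])
    (auto intro: has_field_derivative_at_within)
  define N where "N = {t. ~ (t \<in> {a..b} --> \<bar>k t\<bar> <= B)}"
  have N: "negligible N"
   using B unfolding N_def negligible_iff_null_sets by (simp add: completion.AE_iff_null_sets)
  have "((%t. if t \<in> N then 0 else k t) has_integral f t - f s) {s..t}"
   by (rule has_integral_spike[OF N _ \<open>(k has_integral f t - f s) {s..t}\<close>]) auto
  then have "norm (f t - f s) <= \<bar>B\<bar> * measure lborel (cbox s t)"
   unfolding box_real[symmetric] using st by (intro has_integral_bound) (auto simp: N_def)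
  then show ?thesis using st by simp
 qed
 have "\<bar>f t - f s\<bar> <= \<bar>B\<bar> * \<bar>t - s\<bar>" if "s \<in> {a..b}" "t \<in> {a..b}" for s t
  using *[of s t] *[of t s] that by (cases "s <= t") auto
 then show "\<exists>C. \<forall>s\<in>{a..b}. \<forall>t\<in>{a..b}. \<bar>f t - f s\<bar> <= C * \<bar>t - s\<bar>" by blast
qed

lemma loc_lipschitz_has_integral:
 assumes "loc_lipschitz f" "AE t in lebesgue. (f has_real_derivative k t) (at t)" "a <= b"
 shows "(k has_integral f b - f a) {a..b}"
 using assms(2,3)
 by (intro absolutely_continuous_has_integral[OF loc_lipschitz_absolutely_continuous[OF assms(1)], of _ _ UNIV])
  (auto intro: has_field_derivative_at_within)

text \<open>This replaces explicit integration: a closed form along an extremal is verified by its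
  value at time 0 and its derivative almost everywhere.\<close>

lemma loc_lipschitz_eqI:
 assumes "loc_lipschitz f" "loc_lipschitz g" and f0: "f 0 = g 0"
  and f: "AE t in lebesgue. (f has_real_derivative k t) (at t)"
  and g: "AE t in lebesgue. (g has_real_derivative k t) (at t)"
 shows "f t = g t"
proof (cases "0 <= t")
 case True
 then show ?thesis
  using has_integral_unique[OF loc_lipschitz_has_integral[OF assms(1) f True]
   loc_lipschitz_has_integral[OF assms(2) g True]] f0 by simp
next
 case False
 then have "t <= 0" by simp
 then show ?thesis
  using has_integral_unique[OF loc_lipschitz_has_integral[OF assms(1) f \<open>t <= 0\<close>]
   loc_lipschitz_has_integral[OF assms(2) g \<open>t <= 0\<close>]] f0 by simp
qed

text \<open>\<open>deriv\<close> need not exist everywhere, so no measurability of the integrand is assumed.\<close>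

lemma loc_lipschitz_interval_integral:
 assumes f: "loc_lipschitz f" and k: "AE t in lebesgue. (f has_real_derivative k t) (at t)"
 shows "(LINT ta=ereal 0..ereal t|lebesgue. k ta) = f t - f 0"
proof -
 have *: "(LINT ta:{a<..<b}|lebesgue. k ta) = f b - f a" if ab: "a <= b" for a b
 proof -
  have hi: "(k has_integral f b - f a) {a..b}" by (rule loc_lipschitz_has_integral[OF f k ab])
  obtain C where C: "C > 0" "!!s t. [|s \<in> {a..b}; t \<in> {a..b}|] ==> \<bar>f t - f s\<bar> <= C * \<bar>t - s\<bar>"
   using loc_lipschitzE[OF f] by metis
  \<comment> \<open>The Lipschitz constant bounds the difference quotients, hence \<open>k\<close>
    almost everywhere; boundedness turns gauge integrability into Lebesgue integrability.\<close>
  have bd: "AE t in lebesgue. t \<in> {a<..<b} --> \<bar>k t\<bar> <= C"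
   using k
  proof (eventually_elim, intro impI)
   fix t assume d: "(f has_real_derivative k t) (at t)" and t: "t \<in> {a<..<b}"
   have "((%h. \<bar>(f (t + h) - f t) / h\<bar>) \<longlongrightarrow> \<bar>k t\<bar>) (at 0)"
    using d unfolding DERIV_def by (intro tendsto_intros)
   then show "\<bar>k t\<bar> <= C"
   proof (rule tendsto_upperbound)
    have "\<bar>(f (t + h) - f t) / h\<bar> <= C" if "\<bar>h\<bar> < min (t - a) (b - t)" "h ~= 0" for h
    proof -
     have "\<bar>f (t + h) - f t\<bar> <= C * \<bar>h\<bar>" using C(2)[of t "t + h"] t that by (auto simp: abs_less_iff)
     then show ?thesis using that by (simp add: abs_divide field_simps)
    qed
    then show "\<forall>\<^sub>F h in at 0. \<bar>(f (t + h) - f t) / h\<bar> <= C"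
     unfolding eventually_at using t by (intro exI[of _ "min (t - a) (b - t)"]) auto
   qed simp
  qed
  define N where "N = {t. ~ (t \<in> {a<..<b} --> \<bar>k t\<bar> <= C)}"
  have N: "negligible N"
   using bd unfolding N_def negligible_iff_null_sets by (simp add: completion.AE_iff_null_sets)
  define k0 where "k0 t = (if t \<in> N then 0 else k t)" for t
  have hik: "(k has_integral f b - f a) {a<..<b}"
   using hi has_integral_Icc_iff_Ioo by blast
  have hi0: "(k0 has_integral f b - f a) {a<..<b}"
   by (rule has_integral_spike[OF N _ hik]) (simp add: k0_def)
  have "k0 absolutely_integrable_on {a<..<b}"
  proof (rule measurable_bounded_by_integrable_imp_absolutely_integrable)
   show "k0 \<in> borel_measurable (lebesgue_on {a<..<b})"
    using hi0 integrable_imp_measurable by blast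
   show "(%x. C) integrable_on {a<..<b}"
    by (rule integrable_on_const) simp
   show "norm (k0 x) <= C" if "x \<in> {a<..<b}" for x
    using that C(1) by (auto simp: k0_def N_def)
  qed simp
  moreover have "AE t in lebesgue. indicator {a<..<b} t *\<^sub>R k t = indicator {a<..<b} t *\<^sub>R k0 t"
   using bd by eventually_elim (auto simp: k0_def N_def indicator_def)
  moreover have "(%t. indicator {a<..<b} t *\<^sub>R k t) \<in> borel_measurable lebesgue"
   using integrable_imp_measurable[of k "{a<..<b}"] hik
   by (auto simp: borel_measurable_restrict_space_iff)
  ultimately have "(LINT ta:{a<..<b}|lebesgue. k ta) = (LINT ta:{a<..<b}|lebesgue. k0 ta)"
   unfolding set_lebesgue_integral_def set_integrable_def
   by (intro integral_cong_AE) auto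
  also have "\<dots> = f b - f a"
   using set_lebesgue_integral_eq_integral(2)[OF \<open>k0 absolutely_integrable_on {a<..<b}\<close>] hi0
   by (simp add: integral_unique)
  finally show ?thesis .
 qed
 show ?thesis
  using *[of 0 t] *[of t 0] by (auto simp: interval_lebesgue_integral_def)
qed

lemma indefinite_integral_loc_bounded:
 fixes f :: "real \<Rightarrow> real"
 assumes f: "f \<in> borel_measurable lebesgue" and B: "!!a b. \<exists>B. \<forall>t\<in>{a..b}. \<bar>f t\<bar> <= B"
 defines "F \<equiv> %t. (LINT ta=ereal 0..ereal t|lebesgue. f ta)"
 shows "loc_lipschitz F" "F 0 = 0" "AE t in lebesgue. (F has_real_derivative f t) (at t)"
  "!!s t. s <= t ==> (f has_integral F t - F s) {s..t}"
proof -
 have ai: "f absolutely_integrable_on {a..b}" for a b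
 proof -
  obtain B where "\<forall>t\<in>{a..b}. \<bar>f t\<bar> <= B" using assms(2) by blast
  then show ?thesis
   using f by (intro measurable_bounded_by_integrable_imp_absolutely_integrable[where g = "%x. B"])
    (auto intro: measurable_restrict_space1 integrable_on_const)
 qed
 have ion: "f integrable_on {a..b}" for a b
  using ai[of a b] set_lebesgue_integral_eq_integral(1) by blast
 have aio: "f absolutely_integrable_on {a<..<b}" for a b
  by (rule set_integrable_subset[OF ai[of a b]]) auto
 have *: "(LINT ta:{a<..<b}|lebesgue. f ta) = integral {a..b} f" for a b
  using set_lebesgue_integral_eq_integral(2)[OF aio]
  by (simp add: integral_open_interval_real)
 have F: "F t = (if 0 <= t then integral {0..t} f else - integral {t..0} f)" for t
  by (auto simp: F_def interval_lebesgue_integral_def *)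
 show F0: "F 0 = 0" by (simp add: F)
 \<comment> \<open>A common lower end \<open>c\<close> removes the distinction between positive and
   negative times.\<close>
 have Fd: "F t = integral {c..t} f - integral {c..0} f" if "c <= t" "c <= 0" for c t
  using Henstock_Kurzweil_Integration.integral_combine[of c 0 t f]
   Henstock_Kurzweil_Integration.integral_combine[of c t 0 f] ion that by (auto simp: F)
 show hi: "(f has_integral F t - F s) {s..t}" if "s <= t" for s t
 proof -
  have "F t - F s = integral {s..t} f"
   using Fd[of "min s 0" t] Fd[of "min s 0" s]
    Henstock_Kurzweil_Integration.integral_combine[of "min s 0" s t f] ion that by auto
  then show ?thesis using ion by (metis integrable_integral)
 qed
 show "loc_lipschitz F"
  unfolding loc_lipschitz_def
 proof (intro allI)
  fix a b
  obtain B where B: "\<forall>t\<in>{a..b}. \<bar>f t\<bar> <= B" using assms(2) by blast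
  have lip: "\<bar>F t - F s\<bar> <= \<bar>B\<bar> * (t - s)" if "s \<in> {a..b}" "t \<in> {a..b}" "s <= t" for s t
  proof -
   have "\<bar>f x\<bar> <= \<bar>B\<bar>" if "x \<in> {s..t}" for x
    by (rule order_trans[OF B[rule_format] abs_ge_self]) (use that \<open>s \<in> {a..b}\<close> \<open>t \<in> {a..b}\<close> in auto)
   then have "norm (F t - F s) <= \<bar>B\<bar> * measure lborel (cbox s t)"
    by (intro has_integral_bound[OF _ hi[OF that(3), folded box_real]]) auto
   then show ?thesis using that by simp
  qed
  have "\<bar>F t - F s\<bar> <= \<bar>B\<bar> * \<bar>t - s\<bar>" if "s \<in> {a..b}" "t \<in> {a..b}" for s t
   using lip[of s t] lip[of t s] that by (cases "s <= t") auto
  then show "\<exists>C. \<forall>s\<in>{a..b}. \<forall>t\<in>{a..b}. \<bar>F t - F s\<bar> <= C * \<bar>t - s\<bar>" by blast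
 qed
 have "AE t in lebesgue. \<forall>n. t \<in> {- real n<..<real n} --> ((%t. integral {- real n..t} f) has_real_derivative f t) (at t)"
  unfolding AE_all_countable using lebesgue_differentiation[OF ion] by blast
 then show "AE t in lebesgue. (F has_real_derivative f t) (at t)"
 proof eventually_elim
  fix t assume H: "\<forall>n. t \<in> {- real n<..<real n} --> ((%t. integral {- real n..t} f) has_real_derivative f t) (at t)"
  obtain n where n: "\<bar>t\<bar> < real n" using reals_Archimedean2 by blast
  then have "((%t. integral {- real n..t} f - integral {- real n..0} f) has_real_derivative f t) (at t)"
   using H[rule_format, of n] by (auto simp: abs_less_iff intro!: derivative_eq_intros)
  moreover have "\<forall>\<^sub>F s in nhds t. s \<in> {- real n<..<real n}"
   using n by (intro eventually_nhds_in_open) (auto simp: abs_less_iff)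
  then have "\<forall>\<^sub>F s in nhds t. F s = integral {- real n..s} f - integral {- real n..0} f"
   by eventually_elim (auto intro!: Fd)
  ultimately show "(F has_real_derivative f t) (at t)"
   by (subst DERIV_cong_ev[OF refl _ refl])
 qed
qed

lemma loc_lipschitz_compose:
 assumes f: "!!a b. \<bar>f a - f b\<bar> <= M * \<bar>a - b\<bar>" and g: "loc_lipschitz g"
 shows "loc_lipschitz (%t. f (g t))"
 unfolding loc_lipschitz_def
proof (intro allI)
 fix a b
 obtain C where C: "!!s t. [|s \<in> {a..b}; t \<in> {a..b}|] ==> \<bar>g t - g s\<bar> <= C * \<bar>t - s\<bar>"
  using loc_lipschitzE[OF g] by metis
 have M: "M \<ge> 0" using f[of 1 0] by simp
 have "\<bar>f (g t) - f (g s)\<bar> <= M * C * \<bar>t - s\<bar>" if "s \<in> {a..b}" "t \<in> {a..b}" for s t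
  using order_trans[OF f mult_left_mono[OF C[OF that] M]] by (simp add: mult.assoc)
 then show "\<exists>C. \<forall>s\<in>{a..b}. \<forall>t\<in>{a..b}. \<bar>f (g t) - f (g s)\<bar> <= C * \<bar>t - s\<bar>" by blast
qed

lemma abs_sin_diff_le: "\<bar>sin a - sin b\<bar> <= 1 * \<bar>a - b\<bar>" and abs_cos_diff_le: "\<bar>cos a - cos b\<bar> <= 1 * \<bar>a - b\<bar>"
 for a b :: real
proof -
 have *: "\<bar>sin ((a - b) / 2)\<bar> <= \<bar>a - b\<bar> / 2" for a b :: real
  using abs_sin_x_le_abs_x[of "(a - b) / 2"] by simp
 have "\<bar>sin a - sin b\<bar> = 2 * (\<bar>sin ((a - b) / 2)\<bar> * \<bar>cos ((a + b) / 2)\<bar>)"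
  by (simp add: sin_diff_sin abs_mult)
 also have "\<dots> <= 2 * (\<bar>a - b\<bar> / 2 * 1)" using * by (intro mult_left_mono mult_mono) auto
 finally show "\<bar>sin a - sin b\<bar> <= 1 * \<bar>a - b\<bar>" by simp
 have "\<bar>cos a - cos b\<bar> = 2 * (\<bar>sin ((a + b) / 2)\<bar> * \<bar>sin ((b - a) / 2)\<bar>)"
  by (simp add: cos_diff_cos abs_mult)
 also have "\<dots> <= 2 * (1 * (\<bar>b - a\<bar> / 2))" using *[of b a] by (intro mult_left_mono mult_mono) auto
 finally show "\<bar>cos a - cos b\<bar> <= 1 * \<bar>a - b\<bar>" by (simp add: abs_minus_commute)
qed

lemma C1_imp_loc_lipschitz:
 fixes f :: "real \<Rightarrow> real"
 assumes f: "!!t. (f has_real_derivative D t) (at t)" and D: "continuous_on UNIV D"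
 shows "loc_lipschitz f"
 unfolding loc_lipschitz_def
proof (intro allI)
 fix a b
 obtain B where B: "B > 0" "!!t. t \<in> {a..b} ==> \<bar>D t\<bar> <= B"
  using continuous_loc_bounded[OF D] by metis
 have "norm (f t - f s) <= B * norm (t - s)" if "s \<in> {a..b}" "t \<in> {a..b}" for s t
  using that B(2) by (intro field_differentiable_bound[of "{a..b}" f D])
   (auto intro: has_field_derivative_at_within f)
 then have "\<bar>f t - f s\<bar> <= B * \<bar>t - s\<bar>" if "s \<in> {a..b}" "t \<in> {a..b}" for s t
  using that unfolding real_norm_def by blast
 then show "\<exists>C. \<forall>s\<in>{a..b}. \<forall>t\<in>{a..b}. \<bar>f t - f s\<bar> <= C * \<bar>t - s\<bar>" by blast
qed

text \<open>Each point of \<open>S\<close> is the only one in some interval with rational end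
  points, and there are countably many such intervals.\<close>

lemma countable_if_isolated:
 fixes S :: "real set"
 assumes "!!t. t \<in> S ==> \<exists>e>0. \<forall>s\<in>S. \<bar>s - t\<bar> < e --> s = t"
 shows "countable S"
proof -
 define G where "G p = {t\<in>S. of_rat (fst p) < t & t < of_rat (snd p) &
   (\<forall>s\<in>S. of_rat (fst p) < s & s < of_rat (snd p) --> s = t)}" for p :: "rat \<times> rat"
 have "S \<subseteq> (\<Union>p. G p)"
 proof
  fix t assume t: "t \<in> S"
  then obtain e where e: "e > 0" "\<forall>s\<in>S. \<bar>s - t\<bar> < e --> s = t" using assms by blast
  obtain a where a: "t - e < of_rat a" "of_rat a < t" using of_rat_dense[of "t - e" t] e by auto
  obtain b where b: "t < of_rat b" "of_rat b < t + e" using of_rat_dense[of t "t + e"] e by auto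
  have "t \<in> G (a, b)" using t a b e(2) by (auto simp: G_def)
  then show "t \<in> (\<Union>p. G p)" by blast
 qed
 moreover have "countable (G p)" for p
 proof (cases "G p = {}")
  case False
  then obtain t where "t \<in> G p" by blast
  then have "G p \<subseteq> {t}" by (auto simp: G_def)
  then show ?thesis using countable_subset by blast
 qed simp
 ultimately show ?thesis by (meson countable_UN countable_subset uncountable_def countableI_type)
qed

lemma AE_continuous_eq:
 fixes f g :: "real \<Rightarrow> real"
 assumes "continuous_on UNIV f" "continuous_on UNIV g" "AE t in lebesgue. f t = g t"
 shows "f t = g t"
proof (rule ccontr)
 assume "f t ~= g t"
 then have ne: "{t. f t ~= g t} ~= {}" by blast
 have "open {t. f t ~= g t}" using assms(1,2) by (rule open_Collect_neq)
 moreover have "negligible {t. f t ~= g t}"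
  using assms(3) by (simp add: completion.AE_iff_null_sets negligible_iff_null_sets)
 ultimately show False using open_not_negligible ne by blast
qed

section \<open>Polar duality in the plane\<close>

locale plane_quasinorm =
 fixes F :: "real \<times> real \<Rightarrow> real"
 assumes quasinorm: "quasinorm F"
begin

lemma F_nonneg: "0 <= F u" and F_eq_0: "F u = 0 \<longleftrightarrow> u = 0"
 and F_scale: "0 <= c ==> F (c *\<^sub>R u) = c * F u" and F_add: "F (u + u') <= F u + F u'"
 using quasinorm unfolding quasinorm_def by blast+

lemma convex_F: "convex_on UNIV F"
proof (rule convex_onI)
 fix t :: real and x y assume "0 < t" "t < 1"
 then show "F ((1 - t) *\<^sub>R x + t *\<^sub>R y) <= (1 - t) * F x + t * F y"
  using F_add[of "(1 - t) *\<^sub>R x" "t *\<^sub>R y"] by (simp add: F_scale)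
qed simp

lemma continuous_F: "continuous_on UNIV F"
 by (rule convex_on_continuous[OF open_UNIV convex_F])

lemma F_lower_bound:
 obtains m where "m > 0" "!!u. m * norm u <= F u"
proof -
 have "compact (sphere (0 :: real \<times> real) 1)" by simp
 moreover have "sphere (0 :: real \<times> real) 1 ~= {}" by simp
 ultimately obtain a where a: "a \<in> sphere 0 1" "!!u. u \<in> sphere 0 1 ==> F a <= F u"
  using continuous_attains_inf[of "sphere (0 :: real \<times> real) 1" F]
   continuous_on_subset[OF continuous_F subset_UNIV] by blast
 have "F a > 0" using a(1) F_nonneg[of a] F_eq_0[of a] by (cases "F a = 0") auto
 moreover have "F a * norm u <= F u" for u
 proof (cases "u = 0")
  case False
  then have "F a <= F ((1 / norm u) *\<^sub>R u)" by (intro a(2)) simp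
  also have "\<dots> = F u / norm u" by (simp add: F_scale)
  finally show ?thesis using False by (simp add: field_simps)
 qed (simp add: F_nonneg)
 ultimately show ?thesis by (rule that)
qed

lemma F_upper_bound:
 obtains M where "M > 0" "!!u. F u <= M * norm u"
proof
 let ?M = "F (1, 0) + F (-1, 0) + F (0, 1) + F (0, -1) + 1"
 show "?M > 0" using F_nonneg by (smt (verit))
 fix u :: "real \<times> real"
 obtain a b where u: "u = (a, b)" by fastforce
 have sc: "F (c, 0) <= \<bar>c\<bar> * (F (1, 0) + F (-1, 0))" "F (0, c) <= \<bar>c\<bar> * (F (0, 1) + F (0, -1))" for c
  using F_scale[of "\<bar>c\<bar>" "(1, 0)"] F_scale[of "\<bar>c\<bar>" "(-1, 0)"] F_scale[of "\<bar>c\<bar>" "(0, 1)"]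
   F_scale[of "\<bar>c\<bar>" "(0, -1)"] F_nonneg[of "(1, 0)"] F_nonneg[of "(-1, 0)"] F_nonneg[of "(0, 1)"]
   F_nonneg[of "(0, -1)"] by (auto simp: abs_if algebra_simps mult_nonneg_nonneg mult_nonpos_nonneg split: if_splits)
 have n: "\<bar>a\<bar> <= norm u" "\<bar>b\<bar> <= norm u"
  using norm_fst_le[of a b] norm_snd_le[of b a] by (auto simp: u)
 have "F u <= F (a, 0) + F (0, b)" using F_add[of "(a, 0)" "(0, b)"] by (simp add: u)
 also have "\<dots> <= norm u * (F (1, 0) + F (-1, 0)) + norm u * (F (0, 1) + F (0, -1))"
  using F_nonneg n by (intro add_mono order_trans[OF sc(1)] order_trans[OF sc(2)] mult_right_mono add_nonneg_nonneg)
 also have "\<dots> <= ?M * norm u" by (simp add: algebra_simps)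
 finally show "F u <= ?M * norm u" .
qed

abbreviation "U \<equiv> unit_ball F"
definition "N h = support_function U h"

lemma U_iff: "u \<in> U \<longleftrightarrow> F u <= 1"
 by (simp add: unit_ball_def)

lemma U_bounded: obtains B where "B > 0" "!!u. u \<in> U ==> norm u <= B"
proof -
 obtain m where m: "m > 0" "!!u. m * norm u <= F u" using F_lower_bound by blast
 have "norm u <= 1 / m" if "u \<in> U" for u
  using m(2)[of u] m(1) that by (simp add: U_iff field_simps)
 then show ?thesis using that[of "1 / m"] m(1) by simp
qed

lemma zero_in_U: "0 \<in> U"
 using F_eq_0[of 0] by (auto simp: U_iff simp del: zero_prod_def)

lemma closed_U: "closed U"
 unfolding unit_ball_def using closed_Collect_le[OF continuous_F continuous_on_const] by simp

lemma convex_U: "convex U"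
proof (rule convexI)
 fix x y :: "real \<times> real" and a b :: real
 assume H: "x \<in> U" "y \<in> U" "0 <= a" "0 <= b" "a + b = 1"
 have "F (a *\<^sub>R x + b *\<^sub>R y) <= a * F x + b * F y"
  using F_add[of "a *\<^sub>R x" "b *\<^sub>R y"] H by (simp add: F_scale)
 also have "\<dots> <= a * 1 + b * 1" using H by (intro add_mono mult_left_mono) (auto simp: U_iff)
 finally show "a *\<^sub>R x + b *\<^sub>R y \<in> U" using H by (simp add: U_iff)
qed

lemma N_bdd: "bdd_above ((%u. h \<bullet> u) ` U)"
proof -
 obtain B where B: "B > 0" "!!u. u \<in> U ==> norm u <= B" using U_bounded by blast
 have "h \<bullet> u <= norm h * B" if "u \<in> U" for u
  using norm_cauchy_schwarz[of h u] mult_left_mono[OF B(2)[OF that], of "norm h"] by simp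
 then show ?thesis unfolding bdd_above_def by blast
qed

lemma N_ge: "u \<in> U ==> h \<bullet> u <= N h"
 unfolding N_def support_function_def by (intro cSUP_upper N_bdd)

lemma N_le: "(!!u. u \<in> U ==> h \<bullet> u <= c) ==> N h <= c"
 unfolding N_def support_function_def using zero_in_U by (intro cSUP_least) auto

lemma N_add: "N (h + h') <= N h + N h'"
 by (rule N_le) (auto simp: inner_add_left intro: add_mono N_ge)

lemma N_zero: "N 0 = 0"
 using N_le[of 0 0] N_ge[OF zero_in_U, of 0] by simp

lemma N_scale:
 assumes "0 <= c"
 shows "N (c *\<^sub>R h) = c * N h"
proof (cases "c = 0")
 case False
 with assms have c: "c > 0" by simp
 have le: "N (a *\<^sub>R h') <= a * N h'" if "a > 0" for a h'
  using that by (intro N_le) (simp add: N_ge)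
 have "c * N h = c * N ((1 / c) *\<^sub>R (c *\<^sub>R h))" using c by simp
 also have "\<dots> <= c * (1 / c * N (c *\<^sub>R h))" using c by (intro mult_left_mono le) auto
 finally show ?thesis using le[OF c, of h] c by simp
qed (simp add: N_zero)

lemma N_scale_pair: "0 <= c ==> N (c * a, c * b) = c * N (a, b)"
 using N_scale[of c "(a, b)"] by simp

lemma N_lower_bound:
 obtains m where "m > 0" "!!h. m * norm h <= N h"
proof -
 obtain M where M: "M > 0" "!!u. F u <= M * norm u" using F_upper_bound by blast
 have "1 / M * norm h <= N h" for h :: "real \<times> real"
 proof (cases "h = 0")
  case False
  let ?u = "(1 / (M * norm h)) *\<^sub>R h"
  have "F ?u <= M * norm ?u" by (rule M)
  also have "\<dots> = 1" using M False by simp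
  finally have "h \<bullet> ?u <= N h" by (intro N_ge) (simp add: U_iff)
  then show ?thesis using M(1) False by (simp add: dot_square_norm power2_eq_square)
 qed (use N_zero in \<open>simp add: zero_prod_def\<close>)
 then show ?thesis using that[of "1 / M"] M(1) by simp
qed

lemma N_pos: "h ~= 0 ==> N h > 0"
 using N_lower_bound by (metis less_le_trans mult_pos_pos zero_less_norm_iff)

lemma N_upper_bound:
 obtains B where "B > 0" "!!h. N h <= B * norm h"
proof -
 obtain B where B: "B > 0" "!!u. u \<in> U ==> norm u <= B" using U_bounded by blast
 have "h \<bullet> u <= B * norm h" if "u \<in> U" for h u
  using norm_cauchy_schwarz[of h u] mult_left_mono[OF B(2)[OF that], of "norm h"] by (simp add: mult.commute)
 then show ?thesis using that[of B] B(1) N_le by blast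
qed

lemma convex_N: "convex_on UNIV N"
proof (rule convex_onI)
 fix t :: real and x y assume "0 < t" "t < 1"
 then show "N ((1 - t) *\<^sub>R x + t *\<^sub>R y) <= (1 - t) * N x + t * N y"
  using N_add[of "(1 - t) *\<^sub>R x" "t *\<^sub>R y"] by (simp add: N_scale)
qed simp

lemma continuous_N: "continuous_on UNIV N"
 by (rule convex_on_continuous[OF open_UNIV convex_N])

text \<open>A point outside the closed convex set \<open>U\<close> would be separated from it by a
  line, and the negated normal of this line would violate the hypothesis.\<close>

lemma bipolar:
 assumes "!!h. h \<bullet> u <= N h"
 shows "u \<in> U"
proof (rule ccontr)
 assume "u \<notin> U"
 then obtain a b where ab: "a \<bullet> u < b" "!!x. x \<in> U ==> b < a \<bullet> x"
  using separating_hyperplane_closed_point[OF convex_U closed_U] by metis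
 have "N (- a) <= - b" using ab(2) by (intro N_le) (simp add: less_imp_le)
 moreover have "(- a) \<bullet> u <= N (- a)" by (rule assms)
 ultimately show False using ab(1) by simp
qed

text \<open>The support function on the unit circle. Subadditivity of \<open>N\<close> becomes an
  inequality that is linear in \<open>l\<close>, while it would be fractional in
  \<open>r = 1 / l\<close>; convexity arguments therefore go through \<open>l\<close>.\<close>

definition l :: "real \<Rightarrow> real" where "l xi = N (cos xi, sin xi)"

abbreviation "r \<equiv> polar_radius F"

lemma l_pos: "l xi > 0"
proof -
 have "(cos xi, sin xi) ~= 0"
  using sin_zero_norm_cos_one[of xi] by (auto simp: zero_prod_def)
 then show ?thesis unfolding l_def by (rule N_pos)
qed

lemma l_periodic: "l (xi + 2 * pi * of_int k) = l xi"
 by (simp add: l_def sin_add cos_add)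

lemma continuous_l: "continuous_on S l"
 unfolding l_def by (intro continuous_on_compose2[OF continuous_N] continuous_intros) auto

lemma N_polar: "0 <= rh ==> N (rh * cos xi, rh * sin xi) = rh * l xi"
 using N_scale[of rh "(cos xi, sin xi)"] by (simp add: l_def)

lemma r_eq: "r xi = 1 / l xi"
 unfolding polar_radius_def
proof (rule the_equality)
 show "1 / l xi > 0 & support_function U (1 / l xi * cos xi, 1 / l xi * sin xi) = 1"
  using l_pos[of xi] N_polar[of "1 / l xi" xi] by (simp add: N_def)
 fix rh assume "rh > 0 & support_function U (rh * cos xi, rh * sin xi) = 1"
 then show "rh = 1 / l xi" using N_polar[of rh xi] l_pos[of xi] by (simp add: N_def field_simps)
qed

lemma r_pos: "r xi > 0" using l_pos[of xi] by (simp add: r_eq)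

lemma r_periodic: "r (xi + 2 * pi * of_int k) = r xi" by (simp add: r_eq l_periodic)

lemma continuous_r: "continuous_on S r"
 unfolding r_eq using l_pos by (intro continuous_intros continuous_l) (metis less_irrefl)

lemma N_r: "N (r xi * cos xi, r xi * sin xi) = 1"
 using N_polar[of "r xi" xi] r_pos[of xi] l_pos[of xi] by (simp add: r_eq)

text \<open>Multiplied by \<open>sin (q - p)\<close>, the unit vector at angle \<open>xi\<close> is
  the combination of those at \<open>p\<close> and \<open>q\<close> with the nonnegative
  coefficients \<open>sin (q - xi)\<close> and \<open>sin (xi - p)\<close>; homogeneity and
  subadditivity of \<open>N\<close> do the rest.\<close>

lemma l_le:
 assumes "p <= xi" "xi <= q" "q <= p + pi"
 shows "sin (q - p) * l xi <= sin (q - xi) * l p + sin (xi - p) * l q"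
proof -
 have s: "0 <= sin (q - p)" "0 <= sin (q - xi)" "0 <= sin (xi - p)"
  using assms by (auto intro!: sin_ge_zero)
 have 1: "sin (q - p) * cos xi = sin (q - xi) * cos p + sin (xi - p) * cos q"
  and 2: "sin (q - p) * sin xi = sin (q - xi) * sin p + sin (xi - p) * sin q"
  by (simp_all add: sin_diff algebra_simps)
 have "sin (q - p) * l xi = N (sin (q - p) *\<^sub>R (cos xi, sin xi))" by (simp add: l_def N_scale_pair s)
 also have "sin (q - p) *\<^sub>R (cos xi, sin xi) = sin (q - xi) *\<^sub>R (cos p, sin p) + sin (xi - p) *\<^sub>R (cos q, sin q)"
  using 1 2 by simp
 also have "N \<dots> <= N (sin (q - xi) *\<^sub>R (cos p, sin p)) + N (sin (xi - p) *\<^sub>R (cos q, sin q))" by (rule N_add)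
 finally show ?thesis by (simp add: l_def N_scale_pair s)
qed

lemma polar_coordinates:
 fixes h :: "real \<times> real"
 obtains rh xi :: real where "rh \<ge> 0" "h = (rh * cos xi, rh * sin xi)"
proof (cases "h = 0")
 case False
 obtain a b where h: "h = (a, b)" by fastforce
 define n where "n = sqrt (a\<^sup>2 + b\<^sup>2)"
 have n: "n > 0" using False by (auto simp: n_def h zero_prod_def sum_power2_gt_zero_iff)
 have "n\<^sup>2 = a\<^sup>2 + b\<^sup>2" by (simp add: n_def)
 moreover have "n\<^sup>2 ~= 0" using n by simp
 ultimately have "(a\<^sup>2 + b\<^sup>2) / n\<^sup>2 = 1" by (metis divide_self)
 then have "(a / n)\<^sup>2 + (b / n)\<^sup>2 = 1" by (simp add: power_divide add_divide_distrib)
 then obtain xi where "a / n = cos xi" "b / n = sin xi" by (meson sincos_total_2pi)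
 then show ?thesis using n by (intro that[of n xi]) (auto simp: h field_simps)
qed (use that[of 0 0] in \<open>simp add: zero_prod_def\<close>)

lemma shift_2pi:
 obtains k :: int where "a <= xi + 2 * pi * of_int k" "xi + 2 * pi * of_int k < a + 2 * pi"
proof
 let ?k = "- \<lfloor>(xi - a) / (2 * pi)\<rfloor>"
 have *: "of_int \<lfloor>(xi - a) / (2 * pi)\<rfloor> * (2 * pi) <= xi - a"
  by (metis (no_types) floor_divide_lower mult_pos_pos pi_gt_zero zero_less_numeral)
 then show "a <= xi + 2 * pi * of_int ?k" by (simp add: mult.commute)
 have "xi - a < (of_int \<lfloor>(xi - a) / (2 * pi)\<rfloor> + 1) * (2 * pi)"
  by (metis (no_types) floor_divide_upper mult_pos_pos pi_gt_zero zero_less_numeral)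
 then show "xi + 2 * pi * of_int ?k < a + 2 * pi" by (simp add: algebra_simps)
qed

lemma in_U_iff_l: "(a, b) \<in> U \<longleftrightarrow> (\<forall>xi. a * cos xi + b * sin xi <= l xi)"
proof
 assume "(a, b) \<in> U"
 then show "\<forall>xi. a * cos xi + b * sin xi <= l xi"
  using N_ge[of "(a, b)" "(cos _, sin _)"] by (auto simp: l_def mult.commute)
next
 assume *: "\<forall>xi. a * cos xi + b * sin xi <= l xi"
 show "(a, b) \<in> U"
 proof (rule bipolar)
  fix h :: "real \<times> real"
  obtain rh xi where h: "rh \<ge> 0" "h = (rh * cos xi, rh * sin xi)" using polar_coordinates[of h] by blast
  have "h \<bullet> (a, b) = rh * (a * cos xi + b * sin xi)" by (simp add: h algebra_simps)
  also have "\<dots> <= rh * l xi" using * h by (intro mult_left_mono) auto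
  finally show "h \<bullet> (a, b) <= N h" using h N_polar by simp
 qed
qed

subsection \<open>One-sided derivatives of the polar radius\<close>

definition slope :: "real \<Rightarrow> real \<Rightarrow> real" where
 "slope th xi = (l xi - l th * cos (xi - th)) / sin (xi - th)"

lemma slope_right_mono:
 assumes "th < xi" "xi <= et" "et < th + pi"
 shows "slope th xi <= slope th et"
proof -
 have s: "sin (et - th) > 0" "sin (xi - th) > 0" using assms by (auto intro!: sin_gt_zero)
 have "sin (et - th) * l xi <= sin (et - xi) * l th + sin (xi - th) * l et"
  using assms by (intro l_le) auto
 moreover have "sin (et - xi) = sin (et - th) * cos (xi - th) - cos (et - th) * sin (xi - th)"
  using sin_diff[of "et - th" "xi - th"] by simp
 ultimately show ?thesis using s by (simp add: slope_def divide_simps) (simp add: algebra_simps)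
qed


lemma slope_left_right:
 assumes "th - pi < xi" "xi < th" "th < et" "et <= xi + pi"
 shows "slope th xi <= slope th et"
proof -
 have s: "sin (et - th) > 0" "sin (th - xi) > 0" using assms by (auto intro!: sin_gt_zero)
 have "sin (et - xi) * l th <= sin (et - th) * l xi + sin (th - xi) * l et"
  using assms by (intro l_le) auto
 moreover have "sin (et - xi) = sin (et - th) * cos (th - xi) + cos (et - th) * sin (th - xi)"
  using sin_add[of "et - th" "th - xi"] by simp
 moreover have "sin (xi - th) = - sin (th - xi)" "cos (xi - th) = cos (th - xi)"
  by (metis minus_diff_eq sin_minus, metis minus_diff_eq cos_minus)
 ultimately show ?thesis using s by (simp add: slope_def divide_simps) (simp add: algebra_simps)
qed

text \<open>The slope is \<open>(f s - f 0) / s\<close> with \<open>s = tan (xi - th)\<close> for the convex function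
 \<open>f s = N (e + s *\<^sub>R e')\<close>, where \<open>e\<close> and \<open>e'\<close> are the unit vectors with the angles \<open>th\<close> and \<open>th + pi / 2\<close>.\<close>

lemma l_right_derivative:
 "\<exists>d. (l has_real_derivative d) (at_right th) & (\<forall>xi. th < xi & xi < th + pi --> d <= slope th xi)
  & (\<forall>p. (\<forall>xi. th < xi & xi < th + pi --> p <= slope th xi) --> p <= d)"
proof -
 let ?S = "slope th ` {th<..<th + pi}"
 have ne: "?S ~= {}" using pi_gt_zero by (simp add: not_le)
 have bdd: "bdd_below ?S"
 proof (rule bdd_belowI[of _ "slope th (th - pi / 2)"])
  fix y assume "y \<in> ?S"
  then obtain xi where xi: "th < xi" "xi < th + pi" "y = slope th xi" by auto
  \<comment> \<open>Comparison across \<open>th\<close> needs two angles at most \<open>pi\<close>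
    apart. Truncating \<open>xi\<close> at \<open>th + pi / 2\<close> ensures this, and monotonicity
    on the right leads back to \<open>xi\<close>.\<close>
  have "slope th (th - pi / 2) <= slope th (min xi (th + pi / 2))"
  proof (rule slope_left_right)
   show "th - pi < th - pi / 2" "th - pi / 2 < th" using pi_gt_zero by linarith+
   show "th < min xi (th + pi / 2)" unfolding min_less_iff_conj using xi pi_gt_zero by linarith
   show "min xi (th + pi / 2) <= th - pi / 2 + pi" using min.cobounded2[of xi "th + pi / 2"] by linarith
  qed
  also have "\<dots> <= slope th xi" using xi by (intro slope_right_mono) auto
  finally show "slope th (th - pi / 2) <= y" by (simp add: xi)
 qed
 define d where "d = Inf ?S"
 have le: "d <= slope th xi" if "th < xi" "xi < th + pi" for xi
  unfolding d_def using that bdd by (intro cInf_lower) auto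
 have gr: "p <= d" if "!!xi. th < xi & xi < th + pi --> p <= slope th xi" for p
  unfolding d_def using that ne by (intro cInf_greatest) auto
 have lim: "(slope th \<longlongrightarrow> d) (at_right th)"
 proof (rule order_tendstoI)
  fix a assume "a < d"
  then show "\<forall>\<^sub>F xi in at_right th. a < slope th xi"
   unfolding eventually_at_right_field by (intro exI[of _ "th + pi"]) (auto intro: less_le_trans le)
 next
  fix a assume "d < a"
  then obtain et where et: "th < et" "et < th + pi" "slope th et < a"
   using cInf_lessD[OF ne, of a] unfolding d_def by fastforce
  then show "\<forall>\<^sub>F xi in at_right th. slope th xi < a"
   unfolding eventually_at_right_field
   by (intro exI[of _ et]) (auto intro!: le_less_trans[OF slope_right_mono[of th _ et]])
 qed
 have s: "((%xi. sin (xi - th) / (xi - th)) \<longlongrightarrow> 1) (at th)"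
 proof -
  have "((%xi. sin (xi - th)) has_real_derivative 1) (at th)" by (auto intro!: derivative_eq_intros)
  then show ?thesis unfolding has_field_derivative_iff by simp
 qed
 have c: "((%xi. (cos (xi - th) - 1) / (xi - th)) \<longlongrightarrow> 0) (at th)"
 proof -
  have "((%xi. cos (xi - th)) has_real_derivative 0) (at th)" by (auto intro!: derivative_eq_intros)
  then show ?thesis unfolding has_field_derivative_iff by simp
 qed
 \<comment> \<open>With \<open>s = xi - th\<close>, the difference quotient of \<open>l\<close> is
   the slope times \<open>sin s / s\<close> plus \<open>l th\<close> times
   \<open>(cos s - 1) / s\<close>.\<close>
 have "((%xi. slope th xi * (sin (xi - th) / (xi - th)) + l th * ((cos (xi - th) - 1) / (xi - th))) \<longlongrightarrow> d * 1 + l th * 0) (at_right th)"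
  by (intro tendsto_intros lim tendsto_mono[OF at_le[OF subset_UNIV] s] tendsto_mono[OF at_le[OF subset_UNIV] c])
 moreover have "\<forall>\<^sub>F xi in at_right th. slope th xi * (sin (xi - th) / (xi - th)) + l th * ((cos (xi - th) - 1) / (xi - th)) = (l xi - l th) / (xi - th)"
  unfolding eventually_at_right_field
 proof (intro exI[of _ "th + pi"] conjI allI impI)
  fix xi assume "th < xi" "xi < th + pi"
  then have "sin (xi - th) > 0" by (auto intro!: sin_gt_zero)
  then show "slope th xi * (sin (xi - th) / (xi - th)) + l th * ((cos (xi - th) - 1) / (xi - th)) = (l xi - l th) / (xi - th)"
   using \<open>th < xi\<close> by (simp add: slope_def divide_simps) (simp add: algebra_simps)
 qed simp
 ultimately have "((%xi. (l xi - l th) / (xi - th)) \<longlongrightarrow> d) (at_right th)"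
  by (simp add: tendsto_cong)
 then have "(l has_real_derivative d) (at_right th)" by (simp add: has_field_derivative_iff)
 with le gr show ?thesis by blast
qed

end

text \<open>Reflection in the first axis reverses angles, so the left derivative of \<open>l\<close>
  is obtained from the right derivative for the reflected quasinorm.\<close>

lemma plane_quasinorm_reflect:
 assumes "plane_quasinorm F"
 shows "plane_quasinorm (%(a, b). F (a, - b))"
  and "plane_quasinorm.l (%(a, b). F (a, - b)) xi = plane_quasinorm.l F (- xi)"
proof -
 interpret plane_quasinorm F by fact
 let ?F = "%(a, b). F (a, - b)"
 show pq: "plane_quasinorm ?F"
 proof
  have "?F (c *\<^sub>R u) = c * ?F u" if "0 <= c" for c u
   using F_scale[OF that, of "(fst u, - snd u)"] by (simp add: split_def)
  moreover have "?F (u + u') <= ?F u + ?F u'" for u u'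
   using F_add[of "(fst u, - snd u)" "(fst u', - snd u')"] by (simp add: split_def)
  ultimately show "quasinorm ?F"
   using F_nonneg F_eq_0 unfolding quasinorm_def by (auto simp: zero_prod_def split_def prod_eq_iff)
 qed
 interpret R: plane_quasinorm ?F by (rule pq)
 have le: "R.N (a, b) <= N (a, - b)" for a b
 proof (rule R.N_le)
  fix u assume "u \<in> R.U"
  then have "(fst u, - snd u) \<in> U" by (simp add: unit_ball_def split_def)
  then show "(a, b) \<bullet> u <= N (a, - b)" using N_ge[of "(fst u, - snd u)" "(a, - b)"] by (simp add: inner_prod_def)
 qed
 moreover have "N (a, - b) <= R.N (a, b)" for a b
 proof (rule N_le)
  fix u assume "u \<in> U"
  then have "(fst u, - snd u) \<in> R.U" by (simp add: unit_ball_def split_def)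
  then show "(a, - b) \<bullet> u <= R.N (a, b)" using R.N_ge[of "(fst u, - snd u)" "(a, b)"] by (simp add: inner_prod_def)
 qed
 ultimately show "R.l xi = l (- xi)" by (simp add: R.l_def l_def antisym)
qed

context plane_quasinorm
begin

lemma l_left_derivative:
 "\<exists>d. (l has_real_derivative d) (at_left th) & (\<forall>xi. th - pi < xi & xi < th --> slope th xi <= d)
  & (\<forall>p. (\<forall>xi. th - pi < xi & xi < th --> slope th xi <= p) --> d <= p)"
proof -
 interpret R: plane_quasinorm "%(a, b). F (a, - b)"
  by (rule plane_quasinorm_reflect) unfold_locales
 have Rl: "R.l = (%xi. l (- xi))"
  using plane_quasinorm_reflect(2)[of F] plane_quasinorm_axioms by blast
 have sl: "R.slope (- th) xi = - slope th (- xi)" for xi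
  using sin_minus[of "- xi - th"] cos_minus[of "- xi - th"] by (simp add: R.slope_def slope_def Rl add.commute)
 obtain d where d: "(R.l has_real_derivative d) (at_right (- th))"
  "!!xi. - th < xi ==> xi < - th + pi ==> d <= R.slope (- th) xi"
  "!!p. (!!xi. - th < xi ==> xi < - th + pi ==> p <= R.slope (- th) xi) ==> p <= d"
  using R.l_right_derivative[of "- th"] by blast
 have im: "uminus ` {..<th} = {- th<..}" by (auto simp: image_iff intro: bexI[of _ "- _"])
 have "((R.l \<circ> uminus) has_real_derivative d * - 1) (at_left th)"
  by (rule DERIV_image_chain) (use d(1) in \<open>auto simp: im intro!: derivative_eq_intros\<close>)
 then have "(l has_real_derivative - d) (at_left th)" by (simp add: o_def Rl)
 moreover have "slope th xi <= - d" if "th - pi < xi" "xi < th" for xi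
  using d(2)[of "- xi"] that by (simp add: sl)
 moreover have "- d <= p" if "\<forall>xi. th - pi < xi & xi < th --> slope th xi <= p" for p
  using d(3)[of "- p"] that by (auto simp: sl)
 ultimately show ?thesis by blast
qed

text \<open>The point \<open>u\<close> of the supporting line of \<open>U\<close> with normal angle \<open>th\<close> which corresponds to the
 value \<open>rh\<close> of \<open>r' th\<close>.\<close>

definition supp1 :: "real \<Rightarrow> real \<Rightarrow> real" where
 "supp1 th rh = (rh * sin th + r th * cos th) / (r th)\<^sup>2"

definition supp2 :: "real \<Rightarrow> real \<Rightarrow> real" where
 "supp2 th rh = (r th * sin th - rh * cos th) / (r th)\<^sup>2"

lemma supp_dot: "r th * cos th * supp1 th rh + r th * sin th * supp2 th rh = 1"
proof -
 have "r th * cos th * supp1 th rh + r th * sin th * supp2 th rh = (r th)\<^sup>2 * ((cos th)\<^sup>2 + (sin th)\<^sup>2) / (r th)\<^sup>2"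
  unfolding supp1_def supp2_def by (simp add: divide_simps del: sin_cos_squared_add sin_cos_squared_add2)
   (simp add: algebra_simps power2_eq_square del: sin_cos_squared_add3)
 then show ?thesis using r_pos[of th] by simp
qed

text \<open>The controls that pair to 1 with a fixed momentum form a line. The component of the
  control orthogonal to the momentum, scaled by \<open>(r th)^2\<close>, is the parameter of this
  line, so every maximizing control is recovered from one number.\<close>

lemma supp_eq:
 assumes "r th * cos th * a + r th * sin th * b = 1"
 shows "supp1 th ((r th)\<^sup>2 * (a * sin th - b * cos th)) = a"
  and "supp2 th ((r th)\<^sup>2 * (a * sin th - b * cos th)) = b"
proof -
 have sc: "sin th * sin th = 1 - cos th * cos th"
  using sin_cos_squared_add[of th] by (simp add: power2_eq_square)
 have "r th ~= 0" using r_pos[of th] by simp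
 moreover have "(r th)\<^sup>2 * (a * sin th - b * cos th) * sin th + r th * cos th = a * (r th)\<^sup>2"
  "r th * sin th - (r th)\<^sup>2 * (a * sin th - b * cos th) * cos th = b * (r th)\<^sup>2"
  using assms sc by algebra+
 ultimately show "supp1 th ((r th)\<^sup>2 * (a * sin th - b * cos th)) = a"
  "supp2 th ((r th)\<^sup>2 * (a * sin th - b * cos th)) = b"
  by (simp_all add: supp1_def supp2_def)
qed

lemma supp_inner:
 "supp1 th rh * cos xi + supp2 th rh * sin xi = l th * cos (xi - th) - rh * (l th)\<^sup>2 * sin (xi - th)"
 using l_pos[of th] by (simp add: supp1_def supp2_def r_eq sin_diff cos_diff power2_eq_square field_simps)

text \<open>Membership in \<open>U\<close> means
  \<open>supp1 * cos xi + supp2 * sin xi <= l xi\<close> for all \<open>xi\<close>. Division by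
  \<open>sin (xi - th)\<close> turns this into a bound on the slope from the side where
  \<open>xi\<close> lies; at \<open>xi = th\<close> there is equality and at the antipode the
  inequality is trivial.\<close>

lemma supp_in_U_iff:
 "(supp1 th rh, supp2 th rh) \<in> U \<longleftrightarrow>
  (\<forall>xi. th < xi & xi < th + pi --> - rh * (l th)\<^sup>2 <= slope th xi) &
  (\<forall>xi. th - pi < xi & xi < th --> slope th xi <= - rh * (l th)\<^sup>2)" (is "_ \<longleftrightarrow> ?R & ?L")
proof -
 let ?p = "- rh * (l th)\<^sup>2"
 have in_U: "(supp1 th rh, supp2 th rh) \<in> U \<longleftrightarrow> (\<forall>xi. l th * cos (xi - th) + ?p * sin (xi - th) <= l xi)"
  unfolding in_U_iff_l supp_inner by simp
 have right: "?p <= slope th xi \<longleftrightarrow> l th * cos (xi - th) + ?p * sin (xi - th) <= l xi" if "th < xi" "xi < th + pi" for xi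
 proof -
  have "sin (xi - th) > 0" using that by (auto intro!: sin_gt_zero)
  then show ?thesis by (simp add: slope_def pos_le_divide_eq) argo
 qed
 have left: "slope th xi <= ?p \<longleftrightarrow> l th * cos (xi - th) + ?p * sin (xi - th) <= l xi" if "th - pi < xi" "xi < th" for xi
 proof -
  have "sin (th - xi) > 0" using that by (auto intro!: sin_gt_zero)
  then have "sin (xi - th) < 0" using sin_minus[of "th - xi"] by simp
  then show ?thesis by (simp add: slope_def neg_divide_le_eq) argo
 qed
 show ?thesis
 proof
  assume "(supp1 th rh, supp2 th rh) \<in> U"
  then show "?R & ?L" using in_U left right by blast
 next
  assume RL: "?R & ?L"
  show "(supp1 th rh, supp2 th rh) \<in> U"
   unfolding in_U
  proof
   fix xi
   \<comment> \<open>All terms have period \<open>2 * pi\<close>, so \<open>xi\<close> may be moved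
     into the period centred at \<open>th\<close>.\<close>
   obtain k :: int where k: "th - pi <= xi + 2 * pi * of_int k" "xi + 2 * pi * of_int k < th - pi + 2 * pi"
    by (rule shift_2pi)
   define et where "et = xi + 2 * pi * of_int k"
   have e: "et - th = (xi - th) + 2 * pi * of_int k" by (simp add: et_def)
   have sc: "sin (et - th) = sin (xi - th)" "cos (et - th) = cos (xi - th)"
    unfolding e by (simp_all add: sin_add cos_add)
   consider "et = th - pi" | "th - pi < et" "et < th" | "et = th" | "th < et" "et < th + pi"
    using k unfolding et_def by linarith
   then have "l th * cos (et - th) + ?p * sin (et - th) <= l et"
   proof cases
    case 1 then show ?thesis using l_pos[of th] l_pos[of et] by simp
   next
    case 2 then show ?thesis using left RL by blast
   next
    case 3 then show ?thesis by simp
   next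
    case 4 then show ?thesis using right RL by blast
   qed
   then show "l th * cos (xi - th) + ?p * sin (xi - th) <= l xi"
    unfolding sc unfolding et_def l_periodic .
  qed
 qed
qed

lemma at_left_unique_deriv:
 "(f has_real_derivative a) (at_left x) ==> (f has_real_derivative b) (at_left x) ==> a = b" for f :: "real \<Rightarrow> real"
 unfolding has_field_derivative_iff by (rule tendsto_unique[OF trivial_limit_at_left_real])

lemma at_right_unique_deriv:
 "(f has_real_derivative a) (at_right x) ==> (f has_real_derivative b) (at_right x) ==> a = b" for f :: "real \<Rightarrow> real"
 unfolding has_field_derivative_iff by (rule tendsto_unique[OF trivial_limit_at_right_real])

lemma r_derivative_of_l:
 assumes "(l has_real_derivative d) (at th within S)"
 shows "(r has_real_derivative - d / (l th)\<^sup>2) (at th within S)"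
proof -
 have "((%xi. 1 / l xi) has_real_derivative - d / (l th)\<^sup>2) (at th within S)"
  using l_pos[of th] by (auto intro!: derivative_eq_intros assms simp: power2_eq_square)
 moreover have "r = (%xi. 1 / l xi)" using r_eq by blast
 ultimately show ?thesis by simp
qed

text \<open>The right derivative of \<open>l\<close> is the infimum of the right slopes and the left
  derivative the supremum of the left slopes, so the conditions for membership in \<open>U\<close>
  reduce to two; \<open>r' = - l' / l^2\<close> translates them to \<open>r\<close>. Thus the
  freedom in \<open>r'\<close> is exactly the freedom in choosing a point on the face of
  \<open>U\<close> with normal angle \<open>th\<close>.\<close>

lemma between_iff_supp_in_U:
 "between_one_sided_derivs r th rh \<longleftrightarrow> (supp1 th rh, supp2 th rh) \<in> U"
proof -
 obtain dr where dr: "(l has_real_derivative dr) (at_right th)"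
  "!!xi. th < xi ==> xi < th + pi ==> dr <= slope th xi"
  "!!p. (!!xi. th < xi ==> xi < th + pi ==> p <= slope th xi) ==> p <= dr"
  using l_right_derivative[of th] by blast
 obtain dl where dl: "(l has_real_derivative dl) (at_left th)"
  "!!xi. th - pi < xi ==> xi < th ==> slope th xi <= dl"
  "!!p. (!!xi. th - pi < xi ==> xi < th ==> slope th xi <= p) ==> dl <= p"
  using l_left_derivative[of th] by blast
 have l2: "(l th)\<^sup>2 > 0" using l_pos[of th] by simp
 have "dl <= dr"
 proof (rule dl(3), rule dr(3))
  fix xi et assume *: "th - pi < xi" "xi < th" "th < et" "et < th + pi"
  have "slope th xi <= slope th (min et (xi + pi))" using * by (intro slope_left_right) auto
  also have "\<dots> <= slope th et" using * by (intro slope_right_mono) auto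
  finally show "slope th xi <= slope th et" .
 qed
 have "between_one_sided_derivs r th rh \<longleftrightarrow> rh \<in> closed_segment (- dl / (l th)\<^sup>2) (- dr / (l th)\<^sup>2)"
  unfolding between_one_sided_derivs_def
  using r_derivative_of_l[OF dr(1)] r_derivative_of_l[OF dl(1)] at_left_unique_deriv at_right_unique_deriv
  by metis
 also have "\<dots> \<longleftrightarrow> - dr / (l th)\<^sup>2 <= rh & rh <= - dl / (l th)\<^sup>2"
  using closed_segment_eq_real_ivl1[of "- dr / (l th)\<^sup>2" "- dl / (l th)\<^sup>2"] \<open>dl <= dr\<close> l2
   divide_right_mono[of "- dr" "- dl" "(l th)\<^sup>2"] by (simp add: closed_segment_commute)
 also have "\<dots> \<longleftrightarrow> dl <= - rh * (l th)\<^sup>2 & - rh * (l th)\<^sup>2 <= dr"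
  using l2 by (auto simp: field_simps)
 also have "\<dots> \<longleftrightarrow> (supp1 th rh, supp2 th rh) \<in> U"
  unfolding supp_in_U_iff using dr(2,3) dl(2,3) by (meson order_trans)
 finally show ?thesis .
qed

lemma l_Lipschitz: obtains M where "!!a b. \<bar>l a - l b\<bar> <= M * \<bar>a - b\<bar>"
proof -
 obtain B where B: "B > 0" "!!h. N h <= B * norm h" using N_upper_bound by blast
 have le: "l a - l b <= (B * 2) * \<bar>a - b\<bar>" for a b
 proof -
  have "N (cos a, sin a) <= N (cos b, sin b) + N (cos a - cos b, sin a - sin b)"
   using N_add[of "(cos b, sin b)" "(cos a - cos b, sin a - sin b)"] by simp
  moreover have "norm (cos a - cos b, sin a - sin b) <= \<bar>cos a - cos b\<bar> + \<bar>sin a - sin b\<bar>"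
   by (metis norm_Pair_le real_norm_def)
  then have "norm (cos a - cos b, sin a - sin b) <= 2 * \<bar>a - b\<bar>"
   using abs_sin_diff_le[of a b] abs_cos_diff_le[of a b] by linarith
  then have "B * norm (cos a - cos b, sin a - sin b) <= B * (2 * \<bar>a - b\<bar>)"
   using B(1) by (intro mult_left_mono) auto
  ultimately show ?thesis using B(2)[of "(cos a - cos b, sin a - sin b)"] by (simp add: l_def)
 qed
 have "\<bar>l a - l b\<bar> <= (B * 2) * \<bar>a - b\<bar>" for a b
  using le[of a b] le[of b a] by (simp add: abs_le_iff abs_minus_commute)
 then show ?thesis by (rule that)
qed

lemma l_lower_bound: obtains m where "m > 0" "!!xi. m <= l xi"
proof -
 obtain m where m: "m > 0" "!!h. m * norm h <= N h" using N_lower_bound by blast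
 have "norm (cos xi, sin xi) = 1" for xi :: real by (simp add: norm_Pair)
 then have "m <= l xi" for xi using m(2)[of "(cos xi, sin xi)"] by (simp add: l_def)
 then show ?thesis using that m(1) by blast
qed

lemma r_Lipschitz: obtains M where "!!a b. \<bar>r a - r b\<bar> <= M * \<bar>a - b\<bar>"
proof -
 obtain M where M: "!!a b. \<bar>l a - l b\<bar> <= M * \<bar>a - b\<bar>" using l_Lipschitz by blast
 obtain m where m: "m > 0" "!!xi. m <= l xi" using l_lower_bound by blast
 have "\<bar>r a - r b\<bar> <= M / m\<^sup>2 * \<bar>a - b\<bar>" for a b
 proof -
  have "r a - r b = (l b - l a) / (l a * l b)"
   using l_pos[of a] l_pos[of b] by (simp add: r_eq field_simps)
  then have "\<bar>r a - r b\<bar> = \<bar>l a - l b\<bar> / (l a * l b)"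
   using l_pos[of a] l_pos[of b] by (simp add: abs_divide abs_mult abs_minus_commute)
  also have "\<dots> <= \<bar>l a - l b\<bar> / (m * m)"
   using m l_pos by (intro divide_left_mono mult_mono mult_pos_pos) (auto intro: less_imp_le)
  also have "\<dots> <= M * \<bar>a - b\<bar> / (m * m)" using M m by (intro divide_right_mono) auto
  finally show ?thesis by (simp add: power2_eq_square)
 qed
 then show ?thesis by (rule that)
qed

text \<open>At a kink the left derivative is below the right one. For a rational slope
  \<open>p\<close> between them, the kink is a strict minimum of \<open>l xi - p * xi\<close> on
  some interval with rational ends, and these three rational numbers determine it.\<close>

lemma countable_not_differentiable_l: "countable {th. ~ (\<exists>d. (l has_real_derivative d) (at th))}"
proof -
 let ?C = "{th. ~ (\<exists>d. (l has_real_derivative d) (at th))}"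
 define G where "G p = {th. of_rat (fst p) < th & th < of_rat (fst (snd p)) &
   (\<forall>xi. of_rat (fst p) < xi & xi < of_rat (fst (snd p)) & xi ~= th -->
    l th - of_rat (snd (snd p)) * th < l xi - of_rat (snd (snd p)) * xi)}" for p :: "rat \<times> rat \<times> rat"
 have "?C \<subseteq> (\<Union>p. G p)"
 proof
  fix th assume th: "th \<in> ?C"
  obtain dr where dr: "(l has_real_derivative dr) (at_right th)"
   "!!xi. th < xi ==> xi < th + pi ==> dr <= slope th xi"
   "!!p. (!!xi. th < xi ==> xi < th + pi ==> p <= slope th xi) ==> p <= dr"
   using l_right_derivative[of th] by blast
  obtain dl where dl: "(l has_real_derivative dl) (at_left th)"
   "!!xi. th - pi < xi ==> xi < th ==> slope th xi <= dl"
   "!!p. (!!xi. th - pi < xi ==> xi < th ==> slope th xi <= p) ==> dl <= p"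
   using l_left_derivative[of th] by blast
  have "dl <= dr"
  proof (rule dl(3), rule dr(3))
   fix xi et assume *: "th - pi < xi" "xi < th" "th < et" "et < th + pi"
   have "slope th xi <= slope th (min et (xi + pi))" using * by (intro slope_left_right) auto
   also have "\<dots> <= slope th et" using * by (intro slope_right_mono) auto
   finally show "slope th xi <= slope th et" .
  qed
  moreover have "dl ~= dr"
  proof
   assume "dl = dr"
   then have "(l has_real_derivative dr) (at th)"
    using dl(1) dr(1) unfolding has_field_derivative_iff by (simp add: filterlim_at_split)
   then show False using th by blast
  qed
  ultimately obtain p where p: "dl < of_rat p" "of_rat p < dr" using of_rat_dense[of dl dr] by auto
  have "\<forall>\<^sub>F xi in at_right th. of_rat p < (l xi - l th) / (xi - th)"
   using dr(1) p(2) unfolding has_field_derivative_iff by (rule order_tendstoD)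
  then obtain b where b: "b > th" "!!xi. [|th < xi; xi < b|] ==> of_rat p < (l xi - l th) / (xi - th)"
   unfolding eventually_at_right_field by blast
  have "\<forall>\<^sub>F xi in at_left th. (l xi - l th) / (xi - th) < of_rat p"
   using dl(1) p(1) unfolding has_field_derivative_iff by (rule order_tendstoD)
  then obtain a where a: "a < th" "!!xi. [|a < xi; xi < th|] ==> (l xi - l th) / (xi - th) < of_rat p"
   unfolding eventually_at_left_field by blast
  have "l th - of_rat p * th < l xi - of_rat p * xi" if "xi ~= th" "\<bar>xi - th\<bar> < min (b - th) (th - a)" for xi
  proof (cases "th < xi")
   case True
   then show ?thesis using b(2)[of xi] that by (simp add: pos_less_divide_eq algebra_simps)
  next
   case False
   then have "xi < th" "a < xi" using that by auto
   then show ?thesis using a(2)[of xi] by (simp add: neg_divide_less_eq algebra_simps)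
  qed
  then have lt: "l th - of_rat p * th < l xi - of_rat p * xi" if "xi ~= th" "\<bar>xi - th\<bar> < min (b - th) (th - a)" for xi
   using that by blast
  obtain q1 where q1: "max a (th - (b - th)) < of_rat q1" "of_rat q1 < th"
   using of_rat_dense[of "max a (th - (b - th))" th] a(1) b(1) by auto
  obtain q2 where q2: "th < of_rat q2" "of_rat q2 < min b (th + (th - a))"
   using of_rat_dense[of th "min b (th + (th - a))"] a(1) b(1) by auto
  have "th \<in> G (q1, q2, p)" unfolding G_def fst_conv snd_conv
  proof (intro CollectI conjI allI impI)
   fix xi assume "of_rat q1 < xi & xi < of_rat q2 & xi ~= th"
   then show "l th - of_rat p * th < l xi - of_rat p * xi" using q1 q2 by (intro lt) auto
  qed (use q1 q2 in auto)
  then show "th \<in> (\<Union>p. G p)" by blast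
 qed
 moreover have "countable (G p)" for p
 proof (cases "G p = {}")
  case False
  then obtain t where t: "t \<in> G p" by blast
  have "s = t" if "s \<in> G p" for s
  proof (rule ccontr)
   assume "s ~= t"
   then have "l t - of_rat (snd (snd p)) * t < l s - of_rat (snd (snd p)) * s"
    "l s - of_rat (snd (snd p)) * s < l t - of_rat (snd (snd p)) * t"
    using t that by (simp_all add: G_def)
   then show False by simp
  qed
  then have "G p \<subseteq> {t}" by blast
  then show ?thesis using countable_subset by blast
 qed simp
 then have "countable (\<Union>p. G p)" by (intro countable_UN countableI_type)
 ultimately show ?thesis using countable_subset by blast
qed

text \<open>The chain rule can fail only when \<open>th\<close> passes a kink of \<open>l\<close>
  with nonzero speed. For each of the countably many kinks such times are isolated, hence countable.
  At zero speed the Lipschitz bound for \<open>r\<close> gives derivative 0 whatever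
  \<open>rh\<close> is.\<close>

lemma derivative_r_comp_AE:
 assumes th: "!!t. (th has_real_derivative D t) (at t)"
  and rh: "!!t. between_one_sided_derivs r (th t) (rh t)"
 shows "AE t in lebesgue. ((%t. r (th t)) has_real_derivative rh t * D t) (at t)"
proof -
 define C where "C = {th. ~ (\<exists>d. (l has_real_derivative d) (at th))}"
 have "countable (\<Union>c\<in>C. {t. th t = c & D t ~= 0})"
 proof (rule countable_UN)
  show "countable C" unfolding C_def by (rule countable_not_differentiable_l)
  fix c
  show "countable {t. th t = c & D t ~= 0}"
  proof (rule countable_if_isolated)
   fix t assume t: "t \<in> {t. th t = c & D t ~= 0}"
   have "((%s. (th s - th t) / (s - t)) \<longlongrightarrow> D t) (at t)" using th unfolding has_field_derivative_iff .
   then have "\<forall>\<^sub>F s in at t. (th s - th t) / (s - t) ~= 0"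
    using t by (intro tendsto_imp_eventually_ne) auto
   then obtain e where "e > 0" "!!s. [|s ~= t; dist s t < e|] ==> (th s - th t) / (s - t) ~= 0"
    unfolding eventually_at by blast
   then show "\<exists>e>0. \<forall>s\<in>{t. th t = c & D t ~= 0}. \<bar>s - t\<bar> < e --> s = t"
    using t by (intro exI[of _ e]) (auto simp: dist_real_def)
  qed
 qed
 then have "AE t in lebesgue. t \<notin> (\<Union>c\<in>C. {t. th t = c & D t ~= 0})"
  by (intro AE_not_in null_sets_completionI countable_imp_null_set_lborel)
 then show ?thesis
 proof eventually_elim
  fix t assume nb: "t \<notin> (\<Union>c\<in>C. {t. th t = c & D t ~= 0})"
  show "((%t. r (th t)) has_real_derivative rh t * D t) (at t)"
  proof (cases "D t = 0")
   case True
   obtain M where M: "!!a b. \<bar>r a - r b\<bar> <= M * \<bar>a - b\<bar>" using r_Lipschitz by blast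
   have "((%s. (th s - th t) / (s - t)) \<longlongrightarrow> 0) (at t)"
    using th[of t] True unfolding has_field_derivative_iff by simp
   then have "((%s. M * \<bar>(th s - th t) / (s - t)\<bar>) \<longlongrightarrow> M * \<bar>0\<bar>) (at t)"
    by (intro tendsto_intros)
   then have lim: "((%s. M * \<bar>(th s - th t) / (s - t)\<bar>) \<longlongrightarrow> 0) (at t)" by simp
   have "norm ((r (th s) - r (th t)) / (s - t)) <= M * \<bar>(th s - th t) / (s - t)\<bar>" for s
    using divide_right_mono[OF M[of "th s" "th t"], of "\<bar>s - t\<bar>"] by (simp add: abs_divide)
   then have "((%s. (r (th s) - r (th t)) / (s - t)) \<longlongrightarrow> 0) (at t)"
    by (intro Lim_null_comparison[OF always_eventually lim] allI)
   then show ?thesis using True unfolding has_field_derivative_iff by simp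
  next
   case False
   then obtain d where d: "(l has_real_derivative d) (at (th t))" using nb by (auto simp: C_def)
   have rd: "(r has_real_derivative - d / (l (th t))\<^sup>2) (at (th t))" by (rule r_derivative_of_l[OF d])
   obtain dl dr where dlr: "(r has_real_derivative dl) (at_left (th t))" "(r has_real_derivative dr) (at_right (th t))"
    "rh t \<in> closed_segment dl dr" using rh[of t] unfolding between_one_sided_derivs_def by blast
   have "dl = - d / (l (th t))\<^sup>2"
    by (rule at_left_unique_deriv[OF dlr(1) has_field_derivative_at_within[OF rd]])
   moreover have "dr = - d / (l (th t))\<^sup>2"
    by (rule at_right_unique_deriv[OF dlr(2) has_field_derivative_at_within[OF rd]])
   ultimately have "rh t = - d / (l (th t))\<^sup>2" using dlr(3) by simp
   then show ?thesis using DERIV_chain2[OF rd th[of t]] by simp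
  qed
 qed
qed

end

section \<open>Extremals in terms of the angle\<close>

text \<open>The meeting point of the two descriptions: extremals with an angle function and curves
  given by the explicit formulas are each shown equivalent to these data. The control is encoded by
  the value \<open>rh\<close> of \<open>r'\<close>, and the covector has been eliminated.\<close>

locale extremal_data = plane_quasinorm F for F +
 fixes ph1 ph2 ph3 ph4 ph5 :: real and g :: "real \<Rightarrow> pt" and th x y z v w rh :: "real \<Rightarrow> real"
 assumes g: "!!t. g t = (x t, y t, z t, v t, w t)"
  and rh_measurable: "rh \<in> borel_measurable lebesgue"
  and between: "!!t. between_one_sided_derivs r (th t) (rh t)"
  and lip: "loc_lipschitz x" "loc_lipschitz y" "loc_lipschitz z" "loc_lipschitz v" "loc_lipschitz w"
  and at_0: "x 0 = 0" "y 0 = 0" "z 0 = 0" "v 0 = 0" "w 0 = 0"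
  and dx: "AE t in lebesgue. (x has_real_derivative supp1 (th t) (rh t)) (at t)"
  and dy: "AE t in lebesgue. (y has_real_derivative supp2 (th t) (rh t)) (at t)"
  and dz: "AE t in lebesgue. (z has_real_derivative
   (x t * supp2 (th t) (rh t) - y t * supp1 (th t) (rh t)) / 2) (at t)"
  and dv: "AE t in lebesgue. (v has_real_derivative
   - (z t + x t * y t / 6) / 2 * supp1 (th t) (rh t) + (x t)\<^sup>2 / 12 * supp2 (th t) (rh t)) (at t)"
  and dw: "AE t in lebesgue. (w has_real_derivative
   - (y t)\<^sup>2 / 12 * supp1 (th t) (rh t) - (z t - x t * y t / 6) / 2 * supp2 (th t) (rh t)) (at t)"
  and dth: "!!t. (th has_real_derivative (ph3 + ph4 * x t + ph5 * y t) / (r (th t))\<^sup>2) (at t)"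
  and init: "r (th 0) * cos (th 0) = ph1" "r (th 0) * sin (th 0) = ph2"
begin

abbreviation "a t \<equiv> supp1 (th t) (rh t)"
abbreviation "b t \<equiv> supp2 (th t) (rh t)"

lemma r_nonzero: "r xi ~= 0" using r_pos[of xi] by simp

text \<open>The value of the covector on the field \<open>[X, Y]\<close>. It is the rate at which
  the momentum pair \<open>(H1, H2)\<close> turns.\<close>

definition "h3 t = ph3 + ph4 * x t + ph5 * y t"
definition "H1 t = r (th t) * cos (th t)"
definition "H2 t = r (th t) * sin (th t)"

lemma ab_in_U: "(a t, b t) \<in> U"
 using between[of t] by (simp add: between_iff_supp_in_U)

lemma H_dot: "H1 t * a t + H2 t * b t = 1"
 unfolding H1_def H2_def by (rule supp_dot)

lemma continuous_th: "continuous_on UNIV th"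
 using dth by (meson DERIV_isCont continuous_at_imp_continuous_on)

lemma continuous_h3: "continuous_on UNIV h3"
 unfolding h3_def using lip by (intro continuous_intros loc_lipschitz_continuous)

lemma deriv_th: "deriv th t = h3 t / (r (th t))\<^sup>2"
 using DERIV_imp_deriv[OF dth] by (simp add: h3_def)

lemma continuous_deriv_th: "continuous_on UNIV (deriv th)"
proof -
 have "continuous_on UNIV (%t. r (th t))"
  by (rule continuous_on_compose2[OF continuous_r continuous_th]) auto
 then show ?thesis
  unfolding deriv_th using r_nonzero by (intro continuous_intros continuous_h3) auto
qed

lemma th_deriv: "(th has_real_derivative deriv th t) (at t)"
 using dth[of t] by (simp add: deriv_th h3_def)

lemma lip_th: "loc_lipschitz th"
 by (rule C1_imp_loc_lipschitz[OF th_deriv continuous_deriv_th])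

lemma lip_H: "loc_lipschitz H1" "loc_lipschitz H2"
proof -
 obtain M where M: "!!a b. \<bar>r a - r b\<bar> <= M * \<bar>a - b\<bar>" using r_Lipschitz by blast
 show "loc_lipschitz H1" "loc_lipschitz H2"
  unfolding H1_def H2_def
  by (intro loc_lipschitz_mult loc_lipschitz_compose[OF M lip_th] loc_lipschitz_compose[OF abs_cos_diff_le lip_th]
    loc_lipschitz_compose[OF abs_sin_diff_le lip_th])+
qed

text \<open>Differentiating polar coordinates gives \<open>r' th' cos - r sin th'\<close> and its
  counterpart for \<open>H2\<close>; with \<open>r^2 th' = h3\<close> these are precisely multiples
  of the support point belonging to \<open>rh\<close>.\<close>

lemma dH: "AE t in lebesgue. (H1 has_real_derivative - h3 t * b t) (at t)"
 "AE t in lebesgue. (H2 has_real_derivative h3 t * a t) (at t)"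
proof -
 have dr: "AE t in lebesgue. ((%t. r (th t)) has_real_derivative rh t * deriv th t) (at t)"
  by (rule derivative_r_comp_AE[OF th_deriv between])
 from dr show "AE t in lebesgue. (H1 has_real_derivative - h3 t * b t) (at t)"
 proof eventually_elim
  fix t assume d: "((%t. r (th t)) has_real_derivative rh t * deriv th t) (at t)"
  have "(H1 has_real_derivative (rh t * deriv th t) * cos (th t) + r (th t) * (- sin (th t) * deriv th t)) (at t)"
   unfolding H1_def by (auto intro!: derivative_eq_intros d th_deriv)
  also have "(rh t * deriv th t) * cos (th t) + r (th t) * (- sin (th t) * deriv th t) = - h3 t * b t"
   by (simp add: deriv_th supp2_def algebra_simps add_divide_distrib diff_divide_distrib)
  finally show "(H1 has_real_derivative - h3 t * b t) (at t)" .
 qed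
 from dr show "AE t in lebesgue. (H2 has_real_derivative h3 t * a t) (at t)"
 proof eventually_elim
  fix t assume d: "((%t. r (th t)) has_real_derivative rh t * deriv th t) (at t)"
  have "(H2 has_real_derivative (rh t * deriv th t) * sin (th t) + r (th t) * (cos (th t) * deriv th t)) (at t)"
   unfolding H2_def by (auto intro!: derivative_eq_intros d th_deriv)
  also have "(rh t * deriv th t) * sin (th t) + r (th t) * (cos (th t) * deriv th t) = h3 t * a t"
   by (simp add: deriv_th supp1_def algebra_simps add_divide_distrib diff_divide_distrib)
  finally show "(H2 has_real_derivative h3 t * a t) (at t)" .
 qed
qed

lemma H2_eq: "H2 t = ph2 + ph3 * x t + ph4 * (x t)\<^sup>2 / 2 + ph5 * x t * y t / 2 - ph5 * z t"
proof (rule loc_lipschitz_eqI[OF lip_H(2) _ _ dH(2)])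
 show "loc_lipschitz (%t. ph2 + ph3 * x t + ph4 * (x t)\<^sup>2 / 2 + ph5 * x t * y t / 2 - ph5 * z t)"
  using lip by (intro loc_lipschitz_add loc_lipschitz_diff loc_lipschitz_mult loc_lipschitz_divide loc_lipschitz_power loc_lipschitz_const)
 show "H2 0 = ph2 + ph3 * x 0 + ph4 * (x 0)\<^sup>2 / 2 + ph5 * x 0 * y 0 / 2 - ph5 * z 0"
  by (simp add: H2_def init at_0)
 show "AE t in lebesgue. ((%t. ph2 + ph3 * x t + ph4 * (x t)\<^sup>2 / 2 + ph5 * x t * y t / 2 - ph5 * z t) has_real_derivative h3 t * a t) (at t)"
  using dx dy dz
  by eventually_elim (auto intro!: derivative_eq_intros simp: h3_def field_simps power2_eq_square)
qed

lemma H1_eq: "H1 t = ph1 - ph3 * y t - ph4 * x t * y t / 2 - ph5 * (y t)\<^sup>2 / 2 - ph4 * z t"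
proof (rule loc_lipschitz_eqI[OF lip_H(1) _ _ dH(1)])
 show "loc_lipschitz (%t. ph1 - ph3 * y t - ph4 * x t * y t / 2 - ph5 * (y t)\<^sup>2 / 2 - ph4 * z t)"
  using lip by (intro loc_lipschitz_add loc_lipschitz_diff loc_lipschitz_mult loc_lipschitz_divide loc_lipschitz_power loc_lipschitz_const)
 show "H1 0 = ph1 - ph3 * y 0 - ph4 * x 0 * y 0 / 2 - ph5 * (y 0)\<^sup>2 / 2 - ph4 * z 0"
  by (simp add: H1_def init at_0)
 show "AE t in lebesgue. ((%t. ph1 - ph3 * y t - ph4 * x t * y t / 2 - ph5 * (y t)\<^sup>2 / 2 - ph4 * z t) has_real_derivative - h3 t * b t) (at t)"
  using dx dy dz
  by eventually_elim (auto intro!: derivative_eq_intros simp: h3_def field_simps power2_eq_square)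
qed

text \<open>The derivative of the right-hand side is \<open>H1 t * a t + H2 t * b t\<close> once
  \<open>H1_eq\<close> and \<open>H2_eq\<close> are inserted, and this is 1 by maximality. The last
  missing coordinate is read off from this relation.\<close>

lemma time_eq:
 "t = ph1 * x t + ph2 * y t + 2 * ph3 * z t + 3 * ph4 * v t + ph4 / 2 * x t * z t + ph5 / 2 * y t * z t + 3 * ph5 * w t"
proof (rule loc_lipschitz_eqI[OF loc_lipschitz_id])
 show "loc_lipschitz (%t. ph1 * x t + ph2 * y t + 2 * ph3 * z t + 3 * ph4 * v t + ph4 / 2 * x t * z t + ph5 / 2 * y t * z t + 3 * ph5 * w t)"
  using lip by (intro loc_lipschitz_add loc_lipschitz_diff loc_lipschitz_mult loc_lipschitz_divide loc_lipschitz_power loc_lipschitz_const)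
 show "AE t in lebesgue. ((%t. t) has_real_derivative 1) (at t)" by simp
 show "AE t in lebesgue. ((%t. ph1 * x t + ph2 * y t + 2 * ph3 * z t + 3 * ph4 * v t + ph4 / 2 * x t * z t + ph5 / 2 * y t * z t + 3 * ph5 * w t) has_real_derivative 1) (at t)"
  using dx dy dz dv dw
 proof eventually_elim
  case (elim t)
  have K: "ph1 * a t + ph2 * b t + 2 * ph3 * ((x t * b t - y t * a t) / 2)
    + 3 * ph4 * (- (z t + x t * y t / 6) / 2 * a t + (x t)\<^sup>2 / 12 * b t)
    + (ph4 / 2 * x t * ((x t * b t - y t * a t) / 2) + ph4 / 2 * a t * z t)
    + (ph5 / 2 * y t * ((x t * b t - y t * a t) / 2) + ph5 / 2 * b t * z t)
    + 3 * ph5 * (- (y t)\<^sup>2 / 12 * a t - (z t - x t * y t / 6) / 2 * b t) = 1"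
   using H_dot[of t] unfolding H1_eq H2_eq by (simp add: field_simps power2_eq_square)
  show ?case
   using K elim by (auto intro!: derivative_eq_intros simp: field_simps)
 qed
qed (simp add: at_0)

text \<open>Conservation of energy, here a polynomial identity because \<open>H1\<close> and
  \<open>H2\<close> are already expressed by \<open>x\<close>, \<open>y\<close> and
  \<open>z\<close>.\<close>

lemma h3_squared: "(h3 t)\<^sup>2 = ph3\<^sup>2 + 2 * ph4 * (H2 t - ph2) - 2 * ph5 * (H1 t - ph1)"
 unfolding H1_eq H2_eq h3_def by (simp add: field_simps power2_eq_square)

lemma deriv_th_squared: "(deriv th t)\<^sup>2 = angle_rhs F (ph1, ph2, ph3, ph4, ph5) (th t)"
 using h3_squared[of t] by (simp add: deriv_th power_divide H1_def H2_def flip: power_mult)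

lemma z5:
 assumes "ph5 ~= 0"
 shows "z t = 1 / ph5 * (ph2 + (ph3 + ph4 * x t / 2 + ph5 * y t / 2) * x t - r (th t) * sin (th t))"
 using H2_eq[of t] assms by (simp add: H2_def field_simps power2_eq_square)

lemma z4:
 assumes "ph5 = 0" "ph4 ~= 0"
 shows "z t = 1 / ph4 * (ph1 - (ph3 + ph4 * x t / 2) * y t - r (th t) * cos (th t))"
 using H1_eq[of t] assms by (simp add: H1_def field_simps power2_eq_square)

lemma w5:
 assumes "ph5 ~= 0"
 shows "w t = 1 / (3 * ph5) * (t - ph1 * x t - ph2 * y t - 2 * ph3 * z t - 3 * ph4 * v t
           - ph4 / 2 * x t * z t - ph5 / 2 * y t * z t)"
proof -
 have "3 * ph5 * w t = t - ph1 * x t - ph2 * y t - 2 * ph3 * z t - 3 * ph4 * v t - ph4 / 2 * x t * z t - ph5 / 2 * y t * z t"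
  using time_eq[of t] by linarith
 from this[symmetric] show ?thesis using assms by simp
qed

lemma v4:
 assumes "ph5 = 0" "ph4 ~= 0"
 shows "v t = 1 / (3 * ph4) * (t - ph1 * x t - ph2 * y t - 2 * ph3 * z t - ph4 / 2 * x t * z t)"
proof -
 have "3 * ph4 * v t = t - ph1 * x t - ph2 * y t - 2 * ph3 * z t - ph4 / 2 * x t * z t"
  using time_eq[of t] assms(1) by simp
 from this[symmetric] show ?thesis using assms by simp
qed

text \<open>The equations of motion give \<open>3 * (v + x * z / 6)' = x * z' - z * x'\<close>
  almost everywhere.\<close>

lemma v5: "v t = 1 / 3 * (LINT ta=ereal 0..ereal t|lebesgue. (x ta * deriv z ta - z ta * deriv x ta)) - x t * z t / 6"
proof -
 have "(LINT ta=ereal 0..ereal t|lebesgue. (x ta * deriv z ta - z ta * deriv x ta)) = 3 * (v t + x t * z t / 6) - 3 * (v 0 + x 0 * z 0 / 6)"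
 proof (rule loc_lipschitz_interval_integral)
  show "loc_lipschitz (%t. 3 * (v t + x t * z t / 6))"
   using lip by (intro loc_lipschitz_add loc_lipschitz_mult loc_lipschitz_divide loc_lipschitz_const)
  show "AE t in lebesgue. ((%t. 3 * (v t + x t * z t / 6)) has_real_derivative x t * deriv z t - z t * deriv x t) (at t)"
   using dx dz dv
  proof eventually_elim
   case (elim t)
   show ?case
    unfolding DERIV_imp_deriv[OF elim(1)] DERIV_imp_deriv[OF elim(2)]
    using elim by (auto intro!: derivative_eq_intros simp: field_simps power2_eq_square)
  qed
 qed
 then show ?thesis by (simp add: at_0) (simp add: field_simps)
qed

lemma w4: "w t = 1 / 3 * (LINT ta=ereal 0..ereal t|lebesgue. (y ta * deriv z ta - z ta * deriv y ta)) - y t * z t / 6"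
proof -
 have "(LINT ta=ereal 0..ereal t|lebesgue. (y ta * deriv z ta - z ta * deriv y ta)) = 3 * (w t + y t * z t / 6) - 3 * (w 0 + y 0 * z 0 / 6)"
 proof (rule loc_lipschitz_interval_integral)
  show "loc_lipschitz (%t. 3 * (w t + y t * z t / 6))"
   using lip by (intro loc_lipschitz_add loc_lipschitz_mult loc_lipschitz_divide loc_lipschitz_const)
  show "AE t in lebesgue. ((%t. 3 * (w t + y t * z t / 6)) has_real_derivative y t * deriv z t - z t * deriv y t) (at t)"
   using dy dz dw
  proof eventually_elim
   case (elim t)
   show ?case
    unfolding DERIV_imp_deriv[OF elim(1)] DERIV_imp_deriv[OF elim(2)]
    using elim by (auto intro!: derivative_eq_intros simp: field_simps power2_eq_square)
  qed
 qed
 then show ?thesis by (simp add: at_0) (simp add: field_simps)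
qed

lemma formulas:
 assumes nz: "ph4\<^sup>2 + ph5\<^sup>2 ~= 0"
 shows "extremal_formulas F (ph1, ph2, ph3, ph4, ph5) g th"
proof -
 have x: "\<forall>t. x t = (LINT ta=ereal 0..ereal t|lebesgue. ((rh ta * sin (th ta) + r (th ta) * cos (th ta)) / (r (th ta))\<^sup>2))"
  using loc_lipschitz_interval_integral[OF lip(1) dx] by (simp add: supp1_def at_0)
 have y: "\<forall>t. y t = (LINT ta=ereal 0..ereal t|lebesgue. ((r (th ta) * sin (th ta) - rh ta * cos (th ta)) / (r (th ta))\<^sup>2))"
  using loc_lipschitz_interval_integral[OF lip(2) dy] by (simp add: supp2_def at_0)
 have th: "\<forall>t. (r (th t))\<^sup>2 * deriv th t = ph3 + ph4 * x t + ph5 * y t"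
  using r_nonzero by (simp add: deriv_th h3_def)
 have C1: "th C1_differentiable_on UNIV"
  unfolding C1_differentiable_on_def
  using th_deriv continuous_deriv_th has_real_derivative_iff_has_vector_derivative by blast
 have "(\<forall>t. g t = (x t, y t, z t, v t, w t)) &
    r (th 0) * cos (th 0) = ph1 & r (th 0) * sin (th 0) = ph2 &
    rh \<in> borel_measurable lebesgue &
    (\<forall>ta. between_one_sided_derivs r (th ta) (rh ta)) &
    (\<forall>t. x t = (LINT ta=ereal 0..ereal t|lebesgue.
        ((rh ta * sin (th ta) + r (th ta) * cos (th ta)) / (r (th ta))\<^sup>2))) &
    (\<forall>t. y t = (LINT ta=ereal 0..ereal t|lebesgue.
        ((r (th ta) * sin (th ta) - rh ta * cos (th ta)) / (r (th ta))\<^sup>2))) &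
    th C1_differentiable_on UNIV &
    (\<forall>t. (r (th t))\<^sup>2 * deriv th t = ph3 + ph4 * x t + ph5 * y t) &
    (\<forall>t. (deriv th t)\<^sup>2 = angle_rhs F (ph1, ph2, ph3, ph4, ph5) (th t)) &
    (ph5 ~= 0 -->
     (\<forall>t. z t = 1 / ph5 * (ph2 + (ph3 + ph4 * x t / 2 + ph5 * y t / 2) * x t - r (th t) * sin (th t)) &
       v t = 1 / 3 * (LINT ta=ereal 0..ereal t|lebesgue. (x ta * deriv z ta - z ta * deriv x ta))
           - x t * z t / 6 &
       w t = 1 / (3 * ph5) * (t - ph1 * x t - ph2 * y t - 2 * ph3 * z t - 3 * ph4 * v t
           - ph4 / 2 * x t * z t - ph5 / 2 * y t * z t))) &
    (ph5 = 0 & ph4 ~= 0 -->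
     (\<forall>t. z t = 1 / ph4 * (ph1 - (ph3 + ph4 * x t / 2) * y t - r (th t) * cos (th t)) &
       v t = 1 / (3 * ph4) * (t - ph1 * x t - ph2 * y t - 2 * ph3 * z t - ph4 / 2 * x t * z t) &
       w t = 1 / 3 * (LINT ta=ereal 0..ereal t|lebesgue. (y ta * deriv z ta - z ta * deriv y ta))
           - y t * z t / 6))"
  using z5 w5 z4 v4 v5 w4 g init rh_measurable between x y th C1 deriv_th_squared by blast
 then show ?thesis unfolding extremal_formulas.simps Let_def by blast
qed

end

section \<open>The gradient of the Hamiltonian and coordinatewise differentiation on the
  group\<close>

lemma gderiv_hamiltonian:
 "GDERIV (%q. hamiltonian (p1, p2, p3, p4, p5) q (a, b)) (x, y, z, v, w) :>
  (- p4 * y / 12 * a + (p3 / 2 + p4 * x / 6 + p5 * y / 12) * b,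
   (- p3 / 2 - p4 * x / 12 - p5 * y / 6) * a + p5 * x / 12 * b,
   - p4 / 2 * a - p5 / 2 * b, 0, 0)"
proof -
 have eq: "(%q. hamiltonian (p1, p2, p3, p4, p5) q (a, b)) =
  (%q. (p1 - p3 * fst (snd q) / 2 - p4 * fst q * fst (snd q) / 12 - p5 * (fst (snd q))\<^sup>2 / 12 - p4 * fst (snd (snd q)) / 2) * a
   + (p2 + p3 * fst q / 2 + p4 * (fst q)\<^sup>2 / 12 + p5 * fst q * fst (snd q) / 12 - p5 * fst (snd (snd q)) / 2) * b)"
 proof
  fix q :: pt
  obtain q1 q2 q3 q4 q5 where "q = (q1, q2, q3, q4, q5)" by (metis prod.exhaust)
  then show "hamiltonian (p1, p2, p3, p4, p5) q (a, b) =
   (p1 - p3 * fst (snd q) / 2 - p4 * fst q * fst (snd q) / 12 - p5 * (fst (snd q))\<^sup>2 / 12 - p4 * fst (snd (snd q)) / 2) * a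
   + (p2 + p3 * fst q / 2 + p4 * (fst q)\<^sup>2 / 12 + p5 * fst q * fst (snd q) / 12 - p5 * fst (snd (snd q)) / 2) * b"
   by (simp only: hamiltonian_def mom_X_explicit mom_Y_explicit fst_conv snd_conv)
 qed
 have d: "((%q::pt. (p1 - p3 * fst (snd q) / 2 - p4 * fst q * fst (snd q) / 12 - p5 * (fst (snd q))\<^sup>2 / 12 - p4 * fst (snd (snd q)) / 2) * a
   + (p2 + p3 * fst q / 2 + p4 * (fst q)\<^sup>2 / 12 + p5 * fst q * fst (snd q) / 12 - p5 * fst (snd (snd q)) / 2) * b) has_derivative
  (%h. (- p3 * fst (snd h) / 2 - p4 * (x * fst (snd h) + fst h * y) / 12 - p5 * (2 * y * fst (snd h)) / 12 - p4 * fst (snd (snd h)) / 2) * a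
   + (p3 * fst h / 2 + p4 * (2 * x * fst h) / 12 + p5 * (x * fst (snd h) + fst h * y) / 12 - p5 * fst (snd (snd h)) / 2) * b)) (at (x, y, z, v, w))"
  by (auto intro!: derivative_eq_intros) (simp add: fun_eq_iff field_simps)
 show ?thesis
  unfolding gderiv_def eq
 proof (rule has_derivative_eq_rhs[OF d], rule ext)
  fix h :: pt
  obtain q1 q2 q3 q4 q5 where h: "h = (q1, q2, q3, q4, q5)" by (metis prod.exhaust)
  show "(- p3 * fst (snd h) / 2 - p4 * (x * fst (snd h) + fst h * y) / 12 - p5 * (2 * y * fst (snd h)) / 12 - p4 * fst (snd (snd h)) / 2) * a
   + (p3 * fst h / 2 + p4 * (2 * x * fst h) / 12 + p5 * (x * fst (snd h) + fst h * y) / 12 - p5 * fst (snd (snd h)) / 2) * b =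
   h \<bullet> (- p4 * y / 12 * a + (p3 / 2 + p4 * x / 6 + p5 * y / 12) * b,
   (- p3 / 2 - p4 * x / 12 - p5 * y / 6) * a + p5 * x / 12 * b,
   - p4 / 2 * a - p5 / 2 * b, 0, 0)"
   by (simp add: h) (simp add: field_simps)
 qed
qed

lemma gderiv_unique: "GDERIV f q :> D ==> GDERIV f q :> D' ==> D = D'"
proof -
 assume "GDERIV f q :> D" "GDERIV f q :> D'"
 then have "(%h. h \<bullet> D) = (%h. h \<bullet> D')" unfolding gderiv_def by (rule has_derivative_unique)
 then have "(D - D') \<bullet> D = (D - D') \<bullet> D'" by (rule fun_cong)
 then have "(D - D') \<bullet> (D - D') = 0" by (simp add: inner_diff_right)
 then show "D = D'" by simp
qed

lemma has_vector_derivative_pt_iff: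
 "((%t. (x t, y t, z t, v t, w t) :: pt) has_vector_derivative (d1, d2, d3, d4, d5)) (at t within S) \<longleftrightarrow>
  (x has_real_derivative d1) (at t within S) & (y has_real_derivative d2) (at t within S) &
  (z has_real_derivative d3) (at t within S) & (v has_real_derivative d4) (at t within S) &
  (w has_real_derivative d5) (at t within S)"
proof -
 have pair: "((%t. (f t, h t)) has_vector_derivative (d, d')) (at t within S) \<longleftrightarrow>
  (f has_vector_derivative d) (at t within S) & (h has_vector_derivative d') (at t within S)"
  for f :: "real \<Rightarrow> 'a::real_normed_vector" and h :: "real \<Rightarrow> 'b::real_normed_vector" and d d'
 proof
  assume *: "((%t. (f t, h t)) has_vector_derivative (d, d')) (at t within S)"
  show "(f has_vector_derivative d) (at t within S) & (h has_vector_derivative d') (at t within S)"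
   using bounded_linear.has_vector_derivative[OF bounded_linear_fst *]
    bounded_linear.has_vector_derivative[OF bounded_linear_snd *] by simp
 next
  assume "(f has_vector_derivative d) (at t within S) & (h has_vector_derivative d') (at t within S)"
  then show "((%t. (f t, h t)) has_vector_derivative (d, d')) (at t within S)"
   by (blast intro: has_vector_derivative_Pair)
 qed
 show ?thesis unfolding pair has_real_derivative_iff_has_vector_derivative ..
qed

lemma loc_lipschitz_pt:
 assumes "loc_lipschitz x" "loc_lipschitz y" "loc_lipschitz z" "loc_lipschitz v" "loc_lipschitz w"
 shows "absolutely_continuous_on S (%t. (x t, y t, z t, v t, w t) :: pt)"
proof (rule Lipschitz_imp_absolutely_continuous_on)
 fix a b
 have ex: "\<exists>C. \<forall>s\<in>{a..b}. \<forall>t\<in>{a..b}. \<bar>f t - f s\<bar> <= C * \<bar>t - s\<bar>" if "loc_lipschitz f" for f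
  using that by (simp add: loc_lipschitz_def)
 obtain C1 where 1: "\<forall>s\<in>{a..b}. \<forall>t\<in>{a..b}. \<bar>x t - x s\<bar> <= C1 * \<bar>t - s\<bar>" using ex[OF assms(1)] by blast
 obtain C2 where 2: "\<forall>s\<in>{a..b}. \<forall>t\<in>{a..b}. \<bar>y t - y s\<bar> <= C2 * \<bar>t - s\<bar>" using ex[OF assms(2)] by blast
 obtain C3 where 3: "\<forall>s\<in>{a..b}. \<forall>t\<in>{a..b}. \<bar>z t - z s\<bar> <= C3 * \<bar>t - s\<bar>" using ex[OF assms(3)] by blast
 obtain C4 where 4: "\<forall>s\<in>{a..b}. \<forall>t\<in>{a..b}. \<bar>v t - v s\<bar> <= C4 * \<bar>t - s\<bar>" using ex[OF assms(4)] by blast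
 obtain C5 where 5: "\<forall>s\<in>{a..b}. \<forall>t\<in>{a..b}. \<bar>w t - w s\<bar> <= C5 * \<bar>t - s\<bar>" using ex[OF assms(5)] by blast
 have "norm ((x t, y t, z t, v t, w t) - (x s, y s, z s, v s, w s)) <= (C1 + C2 + C3 + C4 + C5) * \<bar>t - s\<bar>"
  if "s \<in> {a..b}" "t \<in> {a..b}" for s t
 proof -
  have "norm (p, q, l, m, n) <= \<bar>p\<bar> + (\<bar>q\<bar> + (\<bar>l\<bar> + (\<bar>m\<bar> + \<bar>n\<bar>)))" for p q l m n :: real
   using norm_Pair_le[of p "(q, l, m, n)"] norm_Pair_le[of q "(l, m, n)"] norm_Pair_le[of l "(m, n)"]
    norm_Pair_le[of m n] unfolding real_norm_def by linarith
  then have "norm (x t - x s, y t - y s, z t - z s, v t - v s, w t - w s) <=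
   \<bar>x t - x s\<bar> + (\<bar>y t - y s\<bar> + (\<bar>z t - z s\<bar> + (\<bar>v t - v s\<bar> + \<bar>w t - w s\<bar>)))" .
  also have "\<dots> <= C1 * \<bar>t - s\<bar> + (C2 * \<bar>t - s\<bar> + (C3 * \<bar>t - s\<bar> + (C4 * \<bar>t - s\<bar> + C5 * \<bar>t - s\<bar>)))"
   by (intro add_mono 1[rule_format] 2[rule_format] 3[rule_format] 4[rule_format] 5[rule_format] that)
  finally show ?thesis by (simp add: distrib_right)
 qed
 then show "\<exists>C. \<forall>s\<in>{a..b}. \<forall>t\<in>{a..b}. norm ((x t, y t, z t, v t, w t) - (x s, y s, z s, v s, w s)) <= C * \<bar>t - s\<bar>"
  by blast
qed

context extremal_data
begin

text \<open>The covector is rebuilt from the data: its last two components are constant,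
  \<open>p3\<close> integrates its adjoint equation, and \<open>p1\<close>, \<open>p2\<close> are
  found by solving \<open>mom_X = H1\<close> and \<open>mom_Y = H2\<close>.\<close>

definition "p3 t = ph3 + ph4 * x t / 2 + ph5 * y t / 2"
definition "p1 t = H1 t + p3 t * y t / 2 + ph4 * x t * y t / 12 + ph5 * (y t)\<^sup>2 / 12 + ph4 * z t / 2"
definition "p2 t = H2 t - p3 t * x t / 2 - ph4 * (x t)\<^sup>2 / 12 - ph5 * x t * y t / 12 + ph5 * z t / 2"

lemma extremal_with:
 assumes nz: "ph4\<^sup>2 + ph5\<^sup>2 ~= 0"
 shows "extremal_with F (ph1, ph2, ph3, ph4, ph5) g th"
proof -
 define u where "u t = (a t, b t)" for t
 define \<psi> where "\<psi> t = (p1 t, p2 t, p3 t, ph4, ph5)" for t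
 have g_eq: "g = (%t. (x t, y t, z t, v t, w t))" using g by blast
 have mX: "mom_X (\<psi> t) (g t) = H1 t" and mY: "mom_Y (\<psi> t) (g t) = H2 t" for t
  by (simp_all add: \<psi>_def g mom_X_explicit mom_Y_explicit p1_def p2_def)
 have lp3: "loc_lipschitz p3"
  unfolding p3_def using lip by (intro loc_lipschitz_add loc_lipschitz_mult loc_lipschitz_divide loc_lipschitz_const)
 have lp1: "loc_lipschitz p1"
  unfolding p1_def using lip lip_H lp3
  by (intro loc_lipschitz_add loc_lipschitz_mult loc_lipschitz_divide loc_lipschitz_power loc_lipschitz_const)
 have lp2: "loc_lipschitz p2"
  unfolding p2_def using lip lip_H lp3
  by (intro loc_lipschitz_add loc_lipschitz_diff loc_lipschitz_mult loc_lipschitz_divide loc_lipschitz_power loc_lipschitz_const)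
 note lp = lp3 lp1 lp2
 have "trajectory F UNIV g u"
  unfolding trajectory_def
 proof (intro conjI ballI)
  have "(%t. r (th t)) \<in> borel_measurable lebesgue" "th \<in> borel_measurable lebesgue"
   using continuous_th continuous_on_compose2[OF continuous_r[of UNIV] continuous_th subset_UNIV]
   by (auto intro!: borel_measurable_continuous_onI measurable_completion)
  then have "(%t. a t) \<in> borel_measurable lebesgue" "(%t. b t) \<in> borel_measurable lebesgue"
   unfolding supp1_def supp2_def using rh_measurable by measurable
  then have "u \<in> borel_measurable lebesgue" unfolding u_def by measurable
  then show "u \<in> borel_measurable (lebesgue_on UNIV)" by simp
  show "u t \<in> U" for t using ab_in_U by (simp add: u_def)
  show "absolutely_continuous_on UNIV g" unfolding g_eq by (rule loc_lipschitz_pt[OF lip])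
  show "AE t in lebesgue. t \<in> UNIV -->
   (g has_vector_derivative fst (u t) *\<^sub>R X_field (g t) + snd (u t) *\<^sub>R Y_field (g t)) (at t within UNIV)"
   using dx dy dz dv dw
  proof eventually_elim
   case (elim t)
   have eq: "fst (u t) *\<^sub>R X_field (g t) + snd (u t) *\<^sub>R Y_field (g t) =
    (a t, b t, (x t * b t - y t * a t) / 2, - (z t + x t * y t / 6) / 2 * a t + (x t)\<^sup>2 / 12 * b t,
    - (y t)\<^sup>2 / 12 * a t - (z t - x t * y t / 6) / 2 * b t)"
    by (simp add: u_def g algebra_simps diff_divide_distrib)
   have "(g has_vector_derivative fst (u t) *\<^sub>R X_field (g t) + snd (u t) *\<^sub>R Y_field (g t)) (at t)"
    unfolding eq unfolding g_eq has_vector_derivative_pt_iff using elim by blast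
   then show ?case by simp
  qed
 qed
 moreover have "g 0 = 0" by (simp add: g at_0 zero_prod_def)
 moreover have "absolutely_continuous_on UNIV \<psi>"
  unfolding \<psi>_def using lp by (intro loc_lipschitz_pt) auto
 moreover have "\<psi> t ~= 0" for t using nz by (auto simp: \<psi>_def zero_prod_def)
 moreover have "AE t in lebesgue. \<exists>D. GDERIV (%q. hamiltonian (\<psi> t) q (u t)) (g t) :> D & (\<psi> has_vector_derivative - D) (at t)"
  using dx dy dz dH
 proof eventually_elim
  case (elim t)
  have d3: "(p3 has_real_derivative ph4 / 2 * a t + ph5 / 2 * b t) (at t)"
   unfolding p3_def using elim by (auto intro!: derivative_eq_intros)
  have d1: "(p1 has_real_derivative - (- ph4 * y t / 12 * a t + (p3 t / 2 + ph4 * x t / 6 + ph5 * y t / 12) * b t)) (at t)"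
   unfolding p1_def
   using elim d3 by (auto intro!: derivative_eq_intros simp: p3_def h3_def field_simps power2_eq_square)
  have d2: "(p2 has_real_derivative - ((- p3 t / 2 - ph4 * x t / 12 - ph5 * y t / 6) * a t + ph5 * x t / 12 * b t)) (at t)"
   unfolding p2_def
   using elim d3 by (auto intro!: derivative_eq_intros simp: p3_def h3_def field_simps power2_eq_square)
  show ?case
  proof (intro exI conjI)
   show "GDERIV (%q. hamiltonian (\<psi> t) q (u t)) (g t) :>
    (- ph4 * y t / 12 * a t + (p3 t / 2 + ph4 * x t / 6 + ph5 * y t / 12) * b t,
     (- p3 t / 2 - ph4 * x t / 12 - ph5 * y t / 6) * a t + ph5 * x t / 12 * b t,
     - ph4 / 2 * a t - ph5 / 2 * b t, 0, 0)"
    unfolding \<psi>_def u_def g by (rule gderiv_hamiltonian)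
   show "(\<psi> has_vector_derivative - (- ph4 * y t / 12 * a t + (p3 t / 2 + ph4 * x t / 6 + ph5 * y t / 12) * b t,
     (- p3 t / 2 - ph4 * x t / 12 - ph5 * y t / 6) * a t + ph5 * x t / 12 * b t,
     - ph4 / 2 * a t - ph5 / 2 * b t, 0, 0)) (at t)"
    unfolding \<psi>_def uminus_prod_def fst_conv snd_conv has_vector_derivative_pt_iff
    using d1 d2 d3 by (simp add: add.commute)
  qed
 qed
 moreover have "AE t in lebesgue.
    hamiltonian (\<psi> t) (g t) (u t) = support_function U (mom_X (\<psi> t) (g t), mom_Y (\<psi> t) (g t)) &
    support_function U (mom_X (\<psi> t) (g t), mom_Y (\<psi> t) (g t)) = 1"
  unfolding hamiltonian_def mX mY
  using H_dot N_r by (auto simp: u_def N_def H1_def H2_def)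
 ultimately have "extremal F g u \<psi>" unfolding extremal_def by blast
 moreover have "\<psi> 0 = (ph1, ph2, ph3, ph4, ph5)"
  by (simp add: \<psi>_def p1_def p2_def p3_def at_0 H1_def H2_def init)
 moreover have "angle_function F g \<psi> th"
  unfolding angle_function_def mX mY using continuous_th by (simp add: H1_def H2_def)
 ultimately show ?thesis unfolding extremal_with_def by blast
qed

end

section \<open>Completing \<open>x\<close>, \<open>y\<close> and the angle to a full set of
  data\<close>

lemma loc_bounded_combination:
 fixes p q a b :: "real \<Rightarrow> real"
 assumes "continuous_on UNIV p" "continuous_on UNIV q" "!!t. \<bar>a t\<bar> <= B" "!!t. \<bar>b t\<bar> <= B"
 shows "\<exists>C. \<forall>t\<in>{c..d}. \<bar>p t * a t + q t * b t\<bar> <= C"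
proof -
 obtain P where P: "P > 0" "!!t. t \<in> {c..d} ==> \<bar>p t\<bar> <= P" using continuous_loc_bounded[OF assms(1)] by metis
 obtain Q where Q: "Q > 0" "!!t. t \<in> {c..d} ==> \<bar>q t\<bar> <= Q" using continuous_loc_bounded[OF assms(2)] by metis
 have "\<bar>p t * a t + q t * b t\<bar> <= P * B + Q * B" if "t \<in> {c..d}" for t
 proof -
  have "\<bar>p t * a t + q t * b t\<bar> <= \<bar>p t\<bar> * \<bar>a t\<bar> + \<bar>q t\<bar> * \<bar>b t\<bar>"
   by (metis abs_mult abs_triangle_ineq)
  also have "\<dots> <= P * B + Q * B" using P Q that assms(3,4) by (intro add_mono mult_mono) auto
  finally show ?thesis .
 qed
 then show ?thesis by blast
qed

context plane_quasinorm
begin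

lemma U_component_bound:
 obtains B where "!!a b. (a, b) \<in> U ==> \<bar>a\<bar> <= B & \<bar>b\<bar> <= B"
proof -
 obtain B where B: "B > 0" "!!u. u \<in> U ==> norm u <= B" using U_bounded by blast
 have "\<bar>a\<bar> <= B & \<bar>b\<bar> <= B" if "(a, b) \<in> U" for a b
  using norm_fst_le[of a b] norm_snd_le[of b a] B(2)[OF that] by auto
 then show ?thesis by (rule that)
qed

text \<open>Only \<open>x\<close>, \<open>y\<close> and \<open>th\<close> are coupled. The
  derivatives of \<open>z\<close>, then of \<open>v\<close> and \<open>w\<close>, are linear in the
  bounded controls with continuous coefficients that are already known, so these coordinates arise
  by successive integration.\<close>

lemma ex_extremal_data:
 assumes rhm: "rh \<in> borel_measurable lebesgue"
  and btw: "!!t. between_one_sided_derivs r (th t) (rh t)"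
  and x: "!!t. x t = (LINT ta=ereal 0..ereal t|lebesgue. supp1 (th ta) (rh ta))"
  and y: "!!t. y t = (LINT ta=ereal 0..ereal t|lebesgue. supp2 (th ta) (rh ta))"
  and dth: "!!t. (th has_real_derivative (ph3 + ph4 * x t + ph5 * y t) / (r (th t))\<^sup>2) (at t)"
  and init: "r (th 0) * cos (th 0) = ph1" "r (th 0) * sin (th 0) = ph2"
 shows "\<exists>z v w. extremal_data F ph1 ph2 ph3 ph4 ph5 (%t. (x t, y t, z t, v t, w t)) th x y z v w rh"
proof -
 let ?a = "%t. supp1 (th t) (rh t)"
 let ?b = "%t. supp2 (th t) (rh t)"
 define I where "I f t = (LINT ta=ereal 0..ereal t|lebesgue. f ta)" for f :: "real \<Rightarrow> real" and t
 obtain B where B: "!!a b. (a, b) \<in> U ==> \<bar>a\<bar> <= B & \<bar>b\<bar> <= B" using U_component_bound by blast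
 have ab: "\<bar>?a t\<bar> <= B" "\<bar>?b t\<bar> <= B" for t
  using B btw[of t] by (auto simp: between_iff_supp_in_U)
 have cth: "continuous_on UNIV th"
  using dth by (meson DERIV_isCont continuous_at_imp_continuous_on)
 have "(%t. r (th t)) \<in> borel_measurable lebesgue" "th \<in> borel_measurable lebesgue"
  using cth continuous_on_compose2[OF continuous_r[of UNIV] cth subset_UNIV]
  by (auto intro!: borel_measurable_continuous_onI measurable_completion)
 then have m: "?a \<in> borel_measurable lebesgue" "?b \<in> borel_measurable lebesgue"
  unfolding supp1_def supp2_def using rhm by measurable
 have II: "loc_lipschitz (I (%t. p t * ?a t + q t * ?b t))" "I (%t. p t * ?a t + q t * ?b t) 0 = 0"
  "AE t in lebesgue. (I (%t. p t * ?a t + q t * ?b t) has_real_derivative p t * ?a t + q t * ?b t) (at t)"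
  if p: "continuous_on UNIV p" and q: "continuous_on UNIV q" for p q
 proof -
  have pm: "p \<in> borel_measurable lebesgue" "q \<in> borel_measurable lebesgue"
   using p q by (auto intro!: borel_measurable_continuous_onI measurable_completion)
  have fm: "(%t. p t * ?a t + q t * ?b t) \<in> borel_measurable lebesgue"
   using m pm by measurable
  show "loc_lipschitz (I (%t. p t * ?a t + q t * ?b t))" "I (%t. p t * ?a t + q t * ?b t) 0 = 0"
   "AE t in lebesgue. (I (%t. p t * ?a t + q t * ?b t) has_real_derivative p t * ?a t + q t * ?b t) (at t)"
   using indefinite_integral_loc_bounded(1,2,3)[OF fm loc_bounded_combination[OF p q ab]]
   unfolding I_def by blast+
 qed
 have xI: "x = I (%t. 1 * ?a t + 0 * ?b t)" and yI: "y = I (%t. 0 * ?a t + 1 * ?b t)"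
  using x y by (auto simp: I_def)
 have X: "loc_lipschitz x" "x 0 = 0" "AE t in lebesgue. (x has_real_derivative ?a t) (at t)"
  using II[of "%t. 1" "%t. 0"] unfolding xI by auto
 have Y: "loc_lipschitz y" "y 0 = 0" "AE t in lebesgue. (y has_real_derivative ?b t) (at t)"
  using II[of "%t. 0" "%t. 1"] unfolding yI by auto
 note cx = loc_lipschitz_continuous[OF X(1)] and cy = loc_lipschitz_continuous[OF Y(1)]
 define z where "z = I (%t. (- y t / 2) * ?a t + (x t / 2) * ?b t)"
 have cz': "continuous_on UNIV (%t. - y t / 2)" "continuous_on UNIV (%t. x t / 2)"
  by (intro continuous_intros cx cy; simp)+
 have Z: "loc_lipschitz z" "z 0 = 0" "AE t in lebesgue. (z has_real_derivative (- y t / 2) * ?a t + (x t / 2) * ?b t) (at t)"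
  using II[OF cz'] unfolding z_def by auto
 note cz = loc_lipschitz_continuous[OF Z(1)]
 define v where "v = I (%t. (- (z t + x t * y t / 6) / 2) * ?a t + ((x t)\<^sup>2 / 12) * ?b t)"
 have cv': "continuous_on UNIV (%t. - (z t + x t * y t / 6) / 2)" "continuous_on UNIV (%t. (x t)\<^sup>2 / 12)"
  by (intro continuous_intros cx cy cz; simp)+
 have V: "loc_lipschitz v" "v 0 = 0" "AE t in lebesgue. (v has_real_derivative (- (z t + x t * y t / 6) / 2) * ?a t + ((x t)\<^sup>2 / 12) * ?b t) (at t)"
  using II[OF cv'] unfolding v_def by auto
 define w where "w = I (%t. (- (y t)\<^sup>2 / 12) * ?a t + (- (z t - x t * y t / 6) / 2) * ?b t)"
 have cw': "continuous_on UNIV (%t. - (y t)\<^sup>2 / 12)" "continuous_on UNIV (%t. - (z t - x t * y t / 6) / 2)"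
  by (intro continuous_intros cx cy cz; simp)+
 have W: "loc_lipschitz w" "w 0 = 0" "AE t in lebesgue. (w has_real_derivative (- (y t)\<^sup>2 / 12) * ?a t + (- (z t - x t * y t / 6) / 2) * ?b t) (at t)"
  using II[OF cw'] unfolding w_def by auto
 have "extremal_data F ph1 ph2 ph3 ph4 ph5 (%t. (x t, y t, z t, v t, w t)) th x y z v w rh"
 proof
  show "AE t in lebesgue. (z has_real_derivative (x t * ?b t - y t * ?a t) / 2) (at t)"
   using Z(3) by eventually_elim (simp add: field_simps)
  show "AE t in lebesgue. (w has_real_derivative - (y t)\<^sup>2 / 12 * ?a t - (z t - x t * y t / 6) / 2 * ?b t) (at t)"
   using W(3) by eventually_elim (simp add: algebra_simps diff_divide_distrib)
 qed (use X Y Z V W rhm btw dth init in simp_all)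
 then show ?thesis by blast
qed

text \<open>The formulas do not state the equations of motion for \<open>z\<close>,
  \<open>v\<close>, \<open>w\<close>. New coordinates \<open>z'\<close>, \<open>v'\<close>,
  \<open>w'\<close> are built by integration from the same \<open>x\<close>, \<open>y\<close>,
  \<open>th\<close>; they satisfy the same closed formulas, which determine first \<open>z\<close>
  and then \<open>v\<close> and \<open>w\<close>, so they coincide with the given ones.\<close>

lemma formulas_imp_data:
 assumes nz: "ph4\<^sup>2 + ph5\<^sup>2 ~= 0" and ef: "extremal_formulas F (ph1, ph2, ph3, ph4, ph5) g th"
 shows "\<exists>x y z v w rh. extremal_data F ph1 ph2 ph3 ph4 ph5 g th x y z v w rh"
proof -
 from ef obtain x y z v w rh where
  g: "\<forall>t. g t = (x t, y t, z t, v t, w t)" and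
  init: "r (th 0) * cos (th 0) = ph1" "r (th 0) * sin (th 0) = ph2" and
  rhm: "rh \<in> borel_measurable lebesgue" and
  btw: "\<forall>ta. between_one_sided_derivs r (th ta) (rh ta)" and
  x: "\<forall>t. x t = (LINT ta=ereal 0..ereal t|lebesgue. ((rh ta * sin (th ta) + r (th ta) * cos (th ta)) / (r (th ta))\<^sup>2))" and
  y: "\<forall>t. y t = (LINT ta=ereal 0..ereal t|lebesgue. ((r (th ta) * sin (th ta) - rh ta * cos (th ta)) / (r (th ta))\<^sup>2))" and
  C1: "th C1_differentiable_on UNIV" and
  d: "\<forall>t. (r (th t))\<^sup>2 * deriv th t = ph3 + ph4 * x t + ph5 * y t" and
  z5: "ph5 ~= 0 ==> (\<forall>t. z t = 1 / ph5 * (ph2 + (ph3 + ph4 * x t / 2 + ph5 * y t / 2) * x t - r (th t) * sin (th t)) &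
       v t = 1 / 3 * (LINT ta=ereal 0..ereal t|lebesgue. (x ta * deriv z ta - z ta * deriv x ta))
           - x t * z t / 6 &
       w t = 1 / (3 * ph5) * (t - ph1 * x t - ph2 * y t - 2 * ph3 * z t - 3 * ph4 * v t
           - ph4 / 2 * x t * z t - ph5 / 2 * y t * z t))" and
  z4: "ph5 = 0 & ph4 ~= 0 ==>
     (\<forall>t. z t = 1 / ph4 * (ph1 - (ph3 + ph4 * x t / 2) * y t - r (th t) * cos (th t)) &
       v t = 1 / (3 * ph4) * (t - ph1 * x t - ph2 * y t - 2 * ph3 * z t - ph4 / 2 * x t * z t) &
       w t = 1 / 3 * (LINT ta=ereal 0..ereal t|lebesgue. (y ta * deriv z ta - z ta * deriv y ta))
           - y t * z t / 6)"
  unfolding extremal_formulas.simps Let_def by blast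
 have x': "x t = (LINT ta=ereal 0..ereal t|lebesgue. supp1 (th ta) (rh ta))" for t
  using x unfolding supp1_def by blast
 have y': "y t = (LINT ta=ereal 0..ereal t|lebesgue. supp2 (th ta) (rh ta))" for t
  using y unfolding supp2_def by blast
 have dth: "(th has_real_derivative (ph3 + ph4 * x t + ph5 * y t) / (r (th t))\<^sup>2) (at t)" for t
 proof -
  obtain D where "(th has_real_derivative D) (at t)"
   using C1 unfolding C1_differentiable_on_def has_real_derivative_iff_has_vector_derivative by blast
  moreover have "D = (ph3 + ph4 * x t + ph5 * y t) / (r (th t))\<^sup>2"
   using d[rule_format, of t] DERIV_imp_deriv[OF calculation] r_pos[of "th t"] by (simp add: field_simps)
  ultimately show ?thesis by simp
 qed
 obtain z' v' w' where "extremal_data F ph1 ph2 ph3 ph4 ph5 (%t. (x t, y t, z' t, v' t, w' t)) th x y z' v' w' rh"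
  using ex_extremal_data[OF rhm _ x' y' dth init] btw by blast
 then interpret D: extremal_data F ph1 ph2 ph3 ph4 ph5 "%t. (x t, y t, z' t, v' t, w' t)" th x y z' v' w' rh .
 have "g = (%t. (x t, y t, z' t, v' t, w' t))"
 proof (cases "ph5 = 0")
  case True
  then have p4: "ph4 ~= 0" using nz by simp
  have zz: "z = z'"
   using z4 True p4 D.z4 by (simp add: fun_eq_iff)
  moreover have "v = v'" using z4 True p4 D.v4 zz by (simp add: fun_eq_iff)
  moreover have "w = w'" using z4 True p4 D.w4 zz by (simp add: fun_eq_iff)
  ultimately show ?thesis using g by auto
 next
  case False
  have zz: "z = z'"
   using z5 False D.z5 by (simp add: fun_eq_iff)
  moreover have vv: "v = v'" using z5 False D.v5 zz by (simp add: fun_eq_iff)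
  moreover have "w = w'" using z5 False D.w5 zz vv by (simp add: fun_eq_iff)
  ultimately show ?thesis using g by auto
 qed
 then show ?thesis using D.extremal_data_axioms by blast
qed

end

section \<open>The polar angle along an extremal\<close>

lemma abs_le_twice_abs_sin:
 fixes a :: real
 assumes "\<bar>a\<bar> <= 2 / 3"
 shows "\<bar>a\<bar> <= 2 * \<bar>sin a\<bar>"
proof -
 have *: "a <= 2 * sin a" if a: "0 <= a" "a <= 2 / 3" for a :: real
 proof -
  have "2 * sin 0 - 0 <= 2 * sin a - a"
  proof (rule DERIV_nonneg_imp_nondecreasing[OF a(1)])
   fix s assume s: "0 <= s" "s <= a"
   \<comment> \<open>The bound \<open>2 / 3\<close> is used because \<open>pi >= 2\<close> puts it
     below \<open>pi / 3\<close>, where the cosine is still at least \<open>1 / 2\<close>.\<close>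
   have "cos (pi / 3) <= cos s" using s a pi_ge_two by (intro cos_monotone_0_pi_le) auto
   then have "0 <= 2 * cos s - 1" by (simp add: cos_60)
   then show "\<exists>y. ((%s. 2 * sin s - s) has_real_derivative y) (at s) & 0 <= y"
    by (intro exI[of _ "2 * cos s - 1"]) (auto intro!: derivative_eq_intros)
  qed
  then show ?thesis by simp
 qed
 show ?thesis using *[of a] *[of "- a"] assms by (cases "0 <= a") auto
qed

context plane_quasinorm
begin

text \<open>The angle is the imaginary part of a continuous logarithm, which exists because the line
  is contractible and the momentum never vanishes; \<open>N = 1\<close> forces the modulus to be
  \<open>r\<close>.\<close>

lemma angle_exists:
 fixes H1 H2 :: "real \<Rightarrow> real"
 assumes c: "continuous_on UNIV H1" "continuous_on UNIV H2" and N: "!!t. N (H1 t, H2 t) = 1"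
 shows "\<exists>th. continuous_on UNIV th & (\<forall>t. H1 t = r (th t) * cos (th t) & H2 t = r (th t) * sin (th t))"
proof -
 define h where "h t = Complex (H1 t) (H2 t)" for t :: real
 have "continuous_on UNIV h"
  unfolding h_def Complex_eq by (intro continuous_intros c)
 moreover have "h t ~= 0" for t
  using N[of t] N_zero by (auto simp: h_def zero_prod_def complex_eq_iff)
 ultimately obtain L where L: "continuous_on UNIV L" "!!t. h t = exp (L t)"
  using continuous_logarithm_on_contractible[of UNIV h] by (metis UNIV_I contractible_UNIV)
 define th where "th t = Im (L t)" for t
 have "continuous_on UNIV th" unfolding th_def by (intro continuous_intros L)
 moreover have "H1 t = r (th t) * cos (th t) & H2 t = r (th t) * sin (th t)" for t
 proof -
  have H: "H1 t = exp (Re (L t)) * cos (th t)" "H2 t = exp (Re (L t)) * sin (th t)"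
   using arg_cong[OF L(2)[of t], of Re] arg_cong[OF L(2)[of t], of Im]
   by (simp_all add: h_def Re_exp Im_exp th_def)
  have "exp (Re (L t)) * l (th t) = 1"
   using N[of t] N_polar[of "exp (Re (L t))" "th t"] by (simp add: H)
  then have "exp (Re (L t)) = r (th t)" using l_pos[of "th t"] by (simp add: r_eq field_simps)
  then show ?thesis using H by simp
 qed
 ultimately show ?thesis by blast
qed

text \<open>The cross product of two points of the curve. It expresses angle differences by the
  momenta, whose regularity is known.\<close>

lemma angle_cross:
 "sin (be - al) = (r al * cos al * (r be * sin be) - r al * sin al * (r be * cos be)) * (l al * l be)"
 using l_pos[of al] l_pos[of be] by (simp add: r_eq sin_diff field_simps)

text \<open>For near times the angle difference is at most twice its sine, which by
  \<open>angle_cross\<close> is bounded by increments of \<open>H1\<close> and \<open>H2\<close>.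
  For times at least \<open>de\<close> apart the crude bound \<open>2 * M\<close> on the difference
  suffices, whence the summand \<open>2 * M / de\<close> of the constant.\<close>

lemma angle_loc_lipschitz:
 assumes c: "continuous_on UNIV th" and H1: "loc_lipschitz H1" and H2: "loc_lipschitz H2"
  and H: "!!t. H1 t = r (th t) * cos (th t)" "!!t. H2 t = r (th t) * sin (th t)"
 shows "loc_lipschitz th"
 unfolding loc_lipschitz_def
proof (intro allI)
 fix A B :: real
 obtain C1 where C1: "C1 > 0" "!!s t. [|s \<in> {A..B}; t \<in> {A..B}|] ==> \<bar>H1 t - H1 s\<bar> <= C1 * \<bar>t - s\<bar>"
  using loc_lipschitzE[OF H1] by metis
 obtain C2 where C2: "C2 > 0" "!!s t. [|s \<in> {A..B}; t \<in> {A..B}|] ==> \<bar>H2 t - H2 s\<bar> <= C2 * \<bar>t - s\<bar>"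
  using loc_lipschitzE[OF H2] by metis
 have "uniformly_continuous_on {A..B} th"
  using c by (intro compact_uniformly_continuous) (auto intro: continuous_on_subset)
 then obtain de where de: "de > 0" "!!s t. [|s \<in> {A..B}; t \<in> {A..B}; \<bar>t - s\<bar> < de|] ==> \<bar>th t - th s\<bar> < 2 / 3"
  unfolding uniformly_continuous_on_def dist_real_def
  by (metis divide_pos_pos zero_less_numeral)
 obtain M where M: "M > 0" "!!t. t \<in> {A..B} ==> \<bar>th t\<bar> <= M"
  using continuous_loc_bounded[OF c] by metis
 have cl: "continuous_on UNIV (%t. l (th t))"
  by (rule continuous_on_compose2[OF continuous_l[of UNIV] c]) auto
 obtain P where P: "P > 0" "!!t. t \<in> {A..B} ==> \<bar>l (th t)\<bar> <= P"
  using continuous_loc_bounded[OF cl] by metis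
 obtain Q1 where Q1: "Q1 > 0" "!!t. t \<in> {A..B} ==> \<bar>H1 t\<bar> <= Q1"
  using continuous_loc_bounded[OF loc_lipschitz_continuous[OF H1]] by metis
 obtain Q2 where Q2: "Q2 > 0" "!!t. t \<in> {A..B} ==> \<bar>H2 t\<bar> <= Q2"
  using continuous_loc_bounded[OF loc_lipschitz_continuous[OF H2]] by metis
 let ?C = "2 * ((Q1 * C2 + Q2 * C1) * (P * P)) + 2 * M / de"
 have Cp: "2 * ((Q1 * C2 + Q2 * C1) * (P * P)) \<ge> 0" "2 * M / de \<ge> 0"
  using C1(1) C2(1) P(1) Q1(1) Q2(1) M(1) de(1) by (auto intro!: mult_nonneg_nonneg add_nonneg_nonneg)
 have "\<bar>th t - th s\<bar> <= ?C * \<bar>t - s\<bar>" if st: "s \<in> {A..B}" "t \<in> {A..B}" for s t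
 proof (cases "\<bar>t - s\<bar> < de")
  case True
  have "\<bar>th t - th s\<bar> <= 2 * \<bar>sin (th t - th s)\<bar>"
   using de(2)[OF st True] by (intro abs_le_twice_abs_sin) simp
  also have "sin (th t - th s) = (H1 s * (H2 t - H2 s) - H2 s * (H1 t - H1 s)) * (l (th s) * l (th t))"
   unfolding angle_cross[of "th t" "th s"] H by (simp add: algebra_simps)
  also have "\<bar>\<dots>\<bar> <= (Q1 * (C2 * \<bar>t - s\<bar>) + Q2 * (C1 * \<bar>t - s\<bar>)) * (P * P)"
   unfolding abs_mult
  proof (rule mult_mono)
   show "\<bar>H1 s * (H2 t - H2 s) - H2 s * (H1 t - H1 s)\<bar> <= Q1 * (C2 * \<bar>t - s\<bar>) + Q2 * (C1 * \<bar>t - s\<bar>)"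
    using Q1 Q2 C1 C2 st
    by (intro order_trans[OF abs_triangle_ineq4] add_mono) (auto simp: abs_mult intro!: mult_mono)
   show "\<bar>l (th s)\<bar> * \<bar>l (th t)\<bar> <= P * P" using P st by (intro mult_mono) auto
  qed (use Q1 Q2 C1 C2 in \<open>auto intro!: add_nonneg_nonneg mult_nonneg_nonneg\<close>)
  also have "2 * ((Q1 * (C2 * \<bar>t - s\<bar>) + Q2 * (C1 * \<bar>t - s\<bar>)) * (P * P)) = 2 * ((Q1 * C2 + Q2 * C1) * (P * P)) * \<bar>t - s\<bar>"
   by (simp add: algebra_simps)
  also have "\<dots> <= ?C * \<bar>t - s\<bar>" using Cp by (intro mult_right_mono) auto
  finally show ?thesis by simp
 next
  case False
  have "\<bar>th t - th s\<bar> <= 2 * M" using M(2)[OF st(1)] M(2)[OF st(2)] by linarith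
  also have "\<dots> = 2 * M / de * de" using de by simp
  also have "\<dots> <= 2 * M / de * \<bar>t - s\<bar>" using False Cp by (intro mult_left_mono) auto
  also have "\<dots> <= ?C * \<bar>t - s\<bar>" using Cp by (intro mult_right_mono) auto
  finally show ?thesis .
 qed
 then show "\<exists>C. \<forall>s\<in>{A..B}. \<forall>t\<in>{A..B}. \<bar>th t - th s\<bar> <= C * \<bar>t - s\<bar>" by blast
qed

text \<open>The sine of \<open>th s - th t\<close> is a cross product of momenta times continuous
  factors, hence differentiable at \<open>s = t\<close>; near \<open>t\<close> the angle is
  recovered by \<open>arcsin\<close>.\<close>

lemma angle_has_derivative:
 assumes c: "continuous_on UNIV th"
  and H: "!!t. H1 t = r (th t) * cos (th t)" "!!t. H2 t = r (th t) * sin (th t)"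
  and d: "(H1 has_real_derivative d1) (at t)" "(H2 has_real_derivative d2) (at t)"
 shows "(th has_real_derivative (H1 t * d2 - H2 t * d1) / (r (th t))\<^sup>2) (at t)"
proof -
 have ct: "isCont th t" using c by (simp add: continuous_on_eq_continuous_at)
 have cl: "isCont (%s. l (th s)) t"
  using ct continuous_l[of UNIV] by (intro isCont_o2[OF ct]) (simp add: continuous_on_eq_continuous_at)
 define q where "q s = H1 t * H2 s - H2 t * H1 s" for s
 have q: "(q has_real_derivative H1 t * d2 - H2 t * d1) (at t)"
  unfolding q_def using d by (auto intro!: derivative_eq_intros)
 have q0: "q t = 0" by (simp add: q_def)
 have sin: "sin (th s - th t) = q s * (l (th t) * l (th s))" for s
  unfolding angle_cross q_def H ..
 have "((%s. (q s - q t) / (s - t)) \<longlongrightarrow> H1 t * d2 - H2 t * d1) (at t)"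
  using q unfolding has_field_derivative_iff .
 then have "((%s. (q s - q t) / (s - t) * (l (th t) * l (th s))) \<longlongrightarrow> (H1 t * d2 - H2 t * d1) * (l (th t) * l (th t))) (at t)"
  using cl unfolding isCont_def by (intro tendsto_intros)
 moreover have "(q s - q t) / (s - t) * (l (th t) * l (th s)) = (sin (th s - th t) - sin (th t - th t)) / (s - t)" for s
  using q0 by (simp add: sin)
 then have "(%s. (q s - q t) / (s - t) * (l (th t) * l (th s))) = (%s. (sin (th s - th t) - sin (th t - th t)) / (s - t))" by blast
 moreover have "(H1 t * d2 - H2 t * d1) * (l (th t) * l (th t)) = (H1 t * d2 - H2 t * d1) / (r (th t))\<^sup>2"
  using l_pos[of "th t"] by (simp add: r_eq power2_eq_square)
 ultimately have ds: "((%s. sin (th s - th t)) has_real_derivative (H1 t * d2 - H2 t * d1) / (r (th t))\<^sup>2) (at t)"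
  unfolding has_field_derivative_iff by (simp only:)
 have "((%s. th t + arcsin (sin (th s - th t))) has_real_derivative (H1 t * d2 - H2 t * d1) / (r (th t))\<^sup>2) (at t)"
 proof -
  have "(arcsin has_real_derivative inverse (sqrt (1 - (sin (th t - th t))\<^sup>2))) (at (sin (th t - th t)))"
   by (rule DERIV_arcsin) auto
  from DERIV_add[OF DERIV_const DERIV_chain2[OF this ds], of "th t"] show ?thesis by simp
 qed
 moreover have "\<forall>\<^sub>F s in nhds t. \<bar>th s - th t\<bar> < 1"
 proof -
  have "\<forall>\<^sub>F s in at t. dist (th s) (th t) < 1" using ct unfolding isCont_def by (rule tendstoD) simp
  then show ?thesis by (simp add: dist_real_def eventually_nhds_conv_at)
 qed
 then have "\<forall>\<^sub>F s in nhds t. th t + arcsin (sin (th s - th t)) = th s"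
 proof eventually_elim
  fix s assume "\<bar>th s - th t\<bar> < 1"
  then have "arcsin (sin (th s - th t)) = th s - th t" using pi_ge_two by (intro arcsin_sin) auto
  then show "th t + arcsin (sin (th s - th t)) = th s" by simp
 qed
 ultimately show ?thesis by (subst (asm) DERIV_cong_ev[OF refl _ refl])
qed

text \<open>Pontryagin's conditions in coordinates. The last two covector components are constant,
  the third is affine in \<open>x\<close> and \<open>y\<close>, and maximality makes the control a
  support point of \<open>U\<close>; what remains is to pass from statements almost everywhere to
  the everywhere statements in the data.\<close>

lemma extremal_imp_data:
 assumes ext: "extremal F g u \<psi>" and \<psi>0: "\<psi> 0 = (ph1, ph2, ph3, ph4, ph5)"
 shows "\<exists>th. angle_function F g \<psi> th"
  and "angle_function F g \<psi> th ==> \<exists>x y z v w rh. extremal_data F ph1 ph2 ph3 ph4 ph5 g th x y z v w rh"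
proof -
 have traj: "trajectory F UNIV g u" and g0: "g 0 = 0" and ac\<psi>: "absolutely_continuous_on UNIV \<psi>"
  and d\<psi>: "AE t in lebesgue. \<exists>D. GDERIV (%q. hamiltonian (\<psi> t) q (u t)) (g t) :> D & (\<psi> has_vector_derivative - D) (at t)"
  and mx: "AE t in lebesgue. hamiltonian (\<psi> t) (g t) (u t) = support_function U (mom_X (\<psi> t) (g t), mom_Y (\<psi> t) (g t)) &
    support_function U (mom_X (\<psi> t) (g t), mom_Y (\<psi> t) (g t)) = 1"
  using ext unfolding extremal_def by blast+
 have um: "u \<in> borel_measurable lebesgue" and uU: "!!t. u t \<in> U" and acg: "absolutely_continuous_on UNIV g"
  and dg: "AE t in lebesgue. (g has_vector_derivative fst (u t) *\<^sub>R X_field (g t) + snd (u t) *\<^sub>R Y_field (g t)) (at t)"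
  using traj unfolding trajectory_def by auto
 define a where "a t = fst (u t)" for t
 define b where "b t = snd (u t)" for t
 define x where "x t = fst (g t)" for t
 define y where "y t = fst (snd (g t))" for t
 define z where "z t = fst (snd (snd (g t)))" for t
 define v where "v t = fst (snd (snd (snd (g t))))" for t
 define w where "w t = snd (snd (snd (snd (g t))))" for t
 define p1 where "p1 t = fst (\<psi> t)" for t
 define p2 where "p2 t = fst (snd (\<psi> t))" for t
 define p3 where "p3 t = fst (snd (snd (\<psi> t)))" for t
 define p4 where "p4 t = fst (snd (snd (snd (\<psi> t))))" for t
 define p5 where "p5 t = snd (snd (snd (snd (\<psi> t))))" for t
 have u_eq: "u t = (a t, b t)" for t by (simp add: a_def b_def)
 have g_eq: "g t = (x t, y t, z t, v t, w t)" for t by (simp add: x_def y_def z_def v_def w_def)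
 have \<psi>_eq: "\<psi> t = (p1 t, p2 t, p3 t, p4 t, p5 t)" for t by (simp add: p1_def p2_def p3_def p4_def p5_def)
 have at0: "x 0 = 0" "y 0 = 0" "z 0 = 0" "v 0 = 0" "w 0 = 0"
  by (simp_all add: x_def y_def z_def v_def w_def g0)
 have p0: "p1 0 = ph1" "p2 0 = ph2" "p3 0 = ph3" "p4 0 = ph4" "p5 0 = ph5"
  by (simp_all add: p1_def p2_def p3_def p4_def p5_def \<psi>0)
 obtain B where B: "!!a b. (a, b) \<in> U ==> \<bar>a\<bar> <= B & \<bar>b\<bar> <= B" using U_component_bound by blast
 have ab: "\<bar>a t\<bar> <= B" "\<bar>b t\<bar> <= B" for t using B uU[of t] by (auto simp: u_eq)
 have comp: "absolutely_continuous_on UNIV (%t. fst (f t))" "absolutely_continuous_on UNIV (%t. fst (snd (f t)))"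
  "absolutely_continuous_on UNIV (%t. fst (snd (snd (f t))))" "absolutely_continuous_on UNIV (%t. fst (snd (snd (snd (f t)))))"
  "absolutely_continuous_on UNIV (%t. snd (snd (snd (snd (f t)))))"
  if "absolutely_continuous_on UNIV f" for f :: "real \<Rightarrow> pt"
 proof -
  have n1: "norm (fst q) <= norm q" "norm (snd q) <= norm q" for q :: "'a::real_normed_vector \<times> 'b::real_normed_vector"
   using norm_fst_le[of "fst q" "snd q"] norm_snd_le[of "snd q" "fst q"] by simp_all
  have n: "norm (fst q) <= norm q" "norm (fst (snd q)) <= norm q" "norm (fst (snd (snd q))) <= norm q"
   "norm (fst (snd (snd (snd q)))) <= norm q" "norm (snd (snd (snd (snd q)))) <= norm q" for q :: pt
   by (meson n1 order_trans)+
  show "absolutely_continuous_on UNIV (%t. fst (f t))" "absolutely_continuous_on UNIV (%t. fst (snd (f t)))"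
   "absolutely_continuous_on UNIV (%t. fst (snd (snd (f t))))" "absolutely_continuous_on UNIV (%t. fst (snd (snd (snd (f t)))))"
   "absolutely_continuous_on UNIV (%t. snd (snd (snd (snd (f t)))))"
   using n[of "f _ - f _"] by (auto intro!: absolutely_continuous_on_norm_le[OF that])
 qed
 note ac = comp[OF acg, folded x_def y_def z_def v_def w_def] comp[OF ac\<psi>, folded p1_def p2_def p3_def p4_def p5_def]
 have cont: "continuous_on UNIV f" if "absolutely_continuous_on UNIV f" for f :: "real \<Rightarrow> real"
 proof (intro continuous_at_imp_continuous_on ballI)
  fix t :: real
  have "absolutely_continuous_on {t - 1..t + 1} f"
   using that unfolding absolutely_continuous_on_def by blast
  then have "continuous_on {t - 1..t + 1} f" by (rule absolutely_continuous_on_imp_continuous_on)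
  then show "isCont f t" by (rule continuous_on_interior) simp
 qed
 note c = ac[THEN cont]
 have dgc: "AE t in lebesgue. (x has_real_derivative a t) (at t) & (y has_real_derivative b t) (at t) &
  (z has_real_derivative (x t * b t - y t * a t) / 2) (at t) &
  (v has_real_derivative - (z t + x t * y t / 6) / 2 * a t + (x t)\<^sup>2 / 12 * b t) (at t) &
  (w has_real_derivative - (y t)\<^sup>2 / 12 * a t - (z t - x t * y t / 6) / 2 * b t) (at t)"
  using dg
 proof eventually_elim
  case (elim t)
  have eq: "fst (u t) *\<^sub>R X_field (g t) + snd (u t) *\<^sub>R Y_field (g t) =
    (a t, b t, (x t * b t - y t * a t) / 2, - (z t + x t * y t / 6) / 2 * a t + (x t)\<^sup>2 / 12 * b t,
    - (y t)\<^sup>2 / 12 * a t - (z t - x t * y t / 6) / 2 * b t)"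
   by (simp add: u_eq g_eq algebra_simps diff_divide_distrib)
  have "g = (%t. (x t, y t, z t, v t, w t))" using g_eq by blast
  then show ?case using elim unfolding eq by (simp only: has_vector_derivative_pt_iff)
 qed
 have d\<psi>c: "AE t in lebesgue.
  (p1 has_real_derivative - (- p4 t * y t / 12 * a t + (p3 t / 2 + p4 t * x t / 6 + p5 t * y t / 12) * b t)) (at t) &
  (p2 has_real_derivative - ((- p3 t / 2 - p4 t * x t / 12 - p5 t * y t / 6) * a t + p5 t * x t / 12 * b t)) (at t) &
  (p3 has_real_derivative - (- p4 t / 2 * a t - p5 t / 2 * b t)) (at t) &
  (p4 has_real_derivative 0) (at t) & (p5 has_real_derivative 0) (at t)"
  using d\<psi>
 proof eventually_elim
  case (elim t)
  then obtain D where D: "GDERIV (%q. hamiltonian (\<psi> t) q (u t)) (g t) :> D" "(\<psi> has_vector_derivative - D) (at t)" by blast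
  have Deq: "D = (- p4 t * y t / 12 * a t + (p3 t / 2 + p4 t * x t / 6 + p5 t * y t / 12) * b t,
   (- p3 t / 2 - p4 t * x t / 12 - p5 t * y t / 6) * a t + p5 t * x t / 12 * b t,
   - p4 t / 2 * a t - p5 t / 2 * b t, 0, 0)"
   by (rule gderiv_unique[OF D(1)]) (unfold \<psi>_eq u_eq g_eq, rule gderiv_hamiltonian)
  have \<psi>f: "\<psi> = (%t. (p1 t, p2 t, p3 t, p4 t, p5 t))" using \<psi>_eq by blast
  show ?case using D(2) unfolding Deq uminus_prod_def fst_conv snd_conv
   by (subst (asm) \<psi>f) (simp only: has_vector_derivative_pt_iff minus_zero)
 qed
 \<comment> \<open>Every derivative is linear in the bounded controls with continuous coefficients.
   The covector components are treated in the order 4, 5, 3, 1, 2, in which the coefficients become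
   explicit.\<close>
 have L: "loc_lipschitz f" if "absolutely_continuous_on UNIV f" "continuous_on UNIV p" "continuous_on UNIV q"
  "AE t in lebesgue. (f has_real_derivative p t * a t + q t * b t) (at t)" for f p q
 proof (rule absolutely_continuous_loc_lipschitz[OF that(1,4)])
  note pq = that(2,3)
  fix c d show "\<exists>B. AE t in lebesgue. t \<in> {c..d} --> \<bar>p t * a t + q t * b t\<bar> <= B"
  proof -
   obtain C where "\<forall>t\<in>{c..d}. \<bar>p t * a t + q t * b t\<bar> <= C"
    using loc_bounded_combination[OF pq, of a B b c d] ab by blast
   then show ?thesis by (intro exI[of _ C] AE_I2) blast
  qed
 qed
 have lx: "loc_lipschitz x"
  by (rule L[OF ac(1), of "%t. 1" "%t. 0"]) (use dgc in \<open>auto elim!: eventually_mono\<close>)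
 have ly: "loc_lipschitz y"
  by (rule L[OF ac(2), of "%t. 0" "%t. 1"]) (use dgc in \<open>auto elim!: eventually_mono\<close>)
 have lz: "loc_lipschitz z"
 proof (rule L[OF ac(3)])
  show "continuous_on UNIV (%t. - y t / 2)" "continuous_on UNIV (%t. x t / 2)"
   by (intro continuous_intros c; simp)+
  show "AE t in lebesgue. (z has_real_derivative - y t / 2 * a t + x t / 2 * b t) (at t)"
   using dgc by eventually_elim (simp add: field_simps)
 qed
 have lv: "loc_lipschitz v"
 proof (rule L[OF ac(4)])
  show "continuous_on UNIV (%t. - (z t + x t * y t / 6) / 2)" "continuous_on UNIV (%t. (x t)\<^sup>2 / 12)"
   by (intro continuous_intros c; simp)+
  show "AE t in lebesgue. (v has_real_derivative - (z t + x t * y t / 6) / 2 * a t + (x t)\<^sup>2 / 12 * b t) (at t)"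
   using dgc by eventually_elim blast
 qed
 have lw: "loc_lipschitz w"
 proof (rule L[OF ac(5)])
  show "continuous_on UNIV (%t. - (y t)\<^sup>2 / 12)" "continuous_on UNIV (%t. - (z t - x t * y t / 6) / 2)"
   by (intro continuous_intros c; simp)+
  show "AE t in lebesgue. (w has_real_derivative - (y t)\<^sup>2 / 12 * a t + - (z t - x t * y t / 6) / 2 * b t) (at t)"
   using dgc by eventually_elim (simp add: algebra_simps diff_divide_distrib)
 qed
 have l4: "loc_lipschitz p4" by (rule L[OF ac(9), of "%t. 0" "%t. 0"]) (use d\<psi>c in \<open>auto elim!: eventually_mono\<close>)
 have l5: "loc_lipschitz p5" by (rule L[OF ac(10), of "%t. 0" "%t. 0"]) (use d\<psi>c in \<open>auto elim!: eventually_mono\<close>)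
 have d0: "AE t in lebesgue. ((%t. k) has_real_derivative 0) (at t)" for k :: real by simp
 have p4: "p4 t = ph4" for t
  by (rule loc_lipschitz_eqI[OF l4 loc_lipschitz_const p0(4) _ d0]) (use d\<psi>c in \<open>auto elim!: eventually_mono\<close>)
 have p5: "p5 t = ph5" for t
  by (rule loc_lipschitz_eqI[OF l5 loc_lipschitz_const p0(5) _ d0]) (use d\<psi>c in \<open>auto elim!: eventually_mono\<close>)
 have l3: "loc_lipschitz p3"
 proof (rule L[OF ac(8)])
  show "AE t in lebesgue. (p3 has_real_derivative ph4 / 2 * a t + ph5 / 2 * b t) (at t)"
   using d\<psi>c unfolding p4 p5 by eventually_elim (simp add: add.commute)
 qed auto
 have p3: "p3 t = ph3 + ph4 * x t / 2 + ph5 * y t / 2" for t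
 proof (rule loc_lipschitz_eqI[OF l3])
  show "loc_lipschitz (%t. ph3 + ph4 * x t / 2 + ph5 * y t / 2)"
   using lx ly by (intro loc_lipschitz_add loc_lipschitz_mult loc_lipschitz_divide loc_lipschitz_const)
  show "AE t in lebesgue. (p3 has_real_derivative ph4 / 2 * a t + ph5 / 2 * b t) (at t)"
   using d\<psi>c unfolding p4 p5 by eventually_elim (simp add: add.commute)
  show "AE t in lebesgue. ((%t. ph3 + ph4 * x t / 2 + ph5 * y t / 2) has_real_derivative ph4 / 2 * a t + ph5 / 2 * b t) (at t)"
   using dgc by eventually_elim (auto intro!: derivative_eq_intros)
 qed (simp add: p0 at0)
 note c3 = loc_lipschitz_continuous[OF l3]
 have l1: "loc_lipschitz p1"
 proof (rule L[OF ac(6)])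
  show "continuous_on UNIV (%t. ph4 * y t / 12)" "continuous_on UNIV (%t. - (p3 t / 2 + ph4 * x t / 6 + ph5 * y t / 12))"
   by (intro continuous_intros c c3; simp)+
  show "AE t in lebesgue. (p1 has_real_derivative ph4 * y t / 12 * a t + - (p3 t / 2 + ph4 * x t / 6 + ph5 * y t / 12) * b t) (at t)"
   using d\<psi>c unfolding p4 p5 by eventually_elim (simp add: algebra_simps)
 qed
 have l2: "loc_lipschitz p2"
 proof (rule L[OF ac(7)])
  show "continuous_on UNIV (%t. p3 t / 2 + ph4 * x t / 12 + ph5 * y t / 6)" "continuous_on UNIV (%t. - (ph5 * x t / 12))"
   by (intro continuous_intros c c3; simp)+
  show "AE t in lebesgue. (p2 has_real_derivative (p3 t / 2 + ph4 * x t / 12 + ph5 * y t / 6) * a t + - (ph5 * x t / 12) * b t) (at t)"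
   using d\<psi>c unfolding p4 p5 by eventually_elim (simp add: algebra_simps)
 qed
 define H1 where "H1 t = mom_X (\<psi> t) (g t)" for t
 define H2 where "H2 t = mom_Y (\<psi> t) (g t)" for t
 have H1: "H1 = (%t. p1 t - p3 t * y t / 2 - ph4 * x t * y t / 12 - ph5 * (y t)\<^sup>2 / 12 - ph4 * z t / 2)"
  unfolding H1_def \<psi>_eq g_eq mom_X_explicit p4 p5 ..
 have H2: "H2 = (%t. p2 t + p3 t * x t / 2 + ph4 * (x t)\<^sup>2 / 12 + ph5 * x t * y t / 12 - ph5 * z t / 2)"
  unfolding H2_def \<psi>_eq g_eq mom_Y_explicit p4 p5 ..
 have lH1: "loc_lipschitz H1" unfolding H1 using l1 l3 lx ly lz
  by (intro loc_lipschitz_add loc_lipschitz_diff loc_lipschitz_mult loc_lipschitz_divide loc_lipschitz_power loc_lipschitz_const)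
 have lH2: "loc_lipschitz H2" unfolding H2 using l2 l3 lx ly lz
  by (intro loc_lipschitz_add loc_lipschitz_diff loc_lipschitz_mult loc_lipschitz_divide loc_lipschitz_power loc_lipschitz_const)
 define h3 where "h3 t = ph3 + ph4 * x t + ph5 * y t" for t
 have dH1: "AE t in lebesgue. (H1 has_real_derivative - h3 t * b t) (at t)"
  using dgc d\<psi>c
 proof eventually_elim
  case (elim t)
  then show ?case unfolding H1 unfolding p4 p5
   by (auto intro!: derivative_eq_intros simp: p3 h3_def field_simps power2_eq_square)
 qed
 have dH2: "AE t in lebesgue. (H2 has_real_derivative h3 t * a t) (at t)"
  using dgc d\<psi>c
 proof eventually_elim
  case (elim t)
  then show ?case unfolding H2 unfolding p4 p5
   by (auto intro!: derivative_eq_intros simp: p3 h3_def field_simps power2_eq_square)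
 qed
 note cH = loc_lipschitz_continuous[OF lH1] loc_lipschitz_continuous[OF lH2]
 have dot: "AE t in lebesgue. H1 t * a t + H2 t * b t = 1"
  using mx by eventually_elim (simp add: hamiltonian_def H1_def H2_def u_eq)
 have "AE t in lebesgue. N (H1 t, H2 t) = 1"
  using mx by eventually_elim (simp add: N_def H1_def H2_def)
 \<comment> \<open>The normalization is given almost everywhere; both sides are continuous, so it
   holds at every time, as the polar angle requires.\<close>
 then have N1: "N (H1 t, H2 t) = 1" for t
 proof (rule AE_continuous_eq[rotated 2])
  show "continuous_on UNIV (%t. N (H1 t, H2 t))"
   by (rule continuous_on_compose2[OF continuous_N]) (auto intro!: continuous_intros cH)
 qed simp
 show "\<exists>th. angle_function F g \<psi> th"
  using angle_exists[OF cH N1] unfolding angle_function_def H1_def H2_def by blast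
 assume "angle_function F g \<psi> th"
 then have cth: "continuous_on UNIV th" and Hr: "!!t. H1 t = r (th t) * cos (th t)" "!!t. H2 t = r (th t) * sin (th t)"
  unfolding angle_function_def H1_def H2_def by blast+
 have lth: "loc_lipschitz th" by (rule angle_loc_lipschitz[OF cth lH1 lH2 Hr])
 have dth': "AE t in lebesgue. (th has_real_derivative h3 t / (r (th t))\<^sup>2) (at t)"
  using dH1 dH2 dot
 proof eventually_elim
  case (elim t)
  have "H1 t * (h3 t * a t) - H2 t * (- h3 t * b t) = h3 t * (H1 t * a t + H2 t * b t)" by (simp add: algebra_simps)
  then have "H1 t * (h3 t * a t) - H2 t * (- h3 t * b t) = h3 t" using elim(3) by simp
  then show ?case using angle_has_derivative[OF cth Hr elim(1,2)] by simp
 qed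
 have ch: "continuous_on UNIV (%t. h3 t / (r (th t))\<^sup>2)"
  unfolding h3_def using r_pos
  by (intro continuous_intros c continuous_on_compose2[OF continuous_r[of UNIV] cth]) (auto simp: less_imp_neq[symmetric])
 \<comment> \<open>The derivative of \<open>th\<close> is known only almost everywhere, but it
   agrees there with a continuous function. Comparison with a classical antiderivative of that
   function gives it everywhere.\<close>
 obtain J where J: "!!t. (J has_real_derivative h3 t / (r (th t))\<^sup>2) (at t)"
  using einterval_antiderivative[of "-\<infinity>" \<infinity> "%t. h3 t / (r (th t))\<^sup>2"] ch
  unfolding has_real_derivative_iff_has_vector_derivative by (auto simp: continuous_on_eq_continuous_at)
 have Jt: "J t - J 0 + th 0 = th t" for t
 proof (rule sym, rule loc_lipschitz_eqI[OF lth _ _ dth'])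
  show "loc_lipschitz (%t. J t - J 0 + th 0)"
   by (intro loc_lipschitz_add loc_lipschitz_diff loc_lipschitz_const C1_imp_loc_lipschitz[OF J ch])
  show "AE t in lebesgue. ((%t. J t - J 0 + th 0) has_real_derivative h3 t / (r (th t))\<^sup>2) (at t)"
   by (intro AE_I2) (auto intro!: derivative_eq_intros J)
 qed simp
 have Jth: "(%t. J t - J 0 + th 0) = th" unfolding fun_eq_iff using Jt by blast
 have dth: "(th has_real_derivative h3 t / (r (th t))\<^sup>2) (at t)" for t
 proof -
  have "((%t. J t - J 0 + th 0) has_real_derivative h3 t / (r (th t))\<^sup>2) (at t)"
   by (auto intro!: derivative_eq_intros J)
  then show ?thesis unfolding Jth .
 qed
 define rh0 where "rh0 t = (r (th t))\<^sup>2 * (a t * sin (th t) - b t * cos (th t))" for t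
 \<comment> \<open>On the null set where the maximum condition fails, the control need not be a
   support point. There any admissible value of \<open>r'\<close> is taken, which does not disturb
   measurability because Lebesgue measure is complete.\<close>
 have "\<exists>rh. between_one_sided_derivs r (th t) rh & (H1 t * a t + H2 t * b t = 1 --> rh = rh0 t)" for t
 proof (cases "H1 t * a t + H2 t * b t = 1")
  case True
  then have "supp1 (th t) (rh0 t) = a t" "supp2 (th t) (rh0 t) = b t"
   unfolding rh0_def Hr by (rule supp_eq)+
  then show ?thesis using uU[of t] by (intro exI[of _ "rh0 t"]) (simp add: between_iff_supp_in_U u_eq)
 next
  case False
  obtain dl where "(l has_real_derivative dl) (at_left (th t))" using l_left_derivative by blast
  moreover obtain dr where "(l has_real_derivative dr) (at_right (th t))" using l_right_derivative by blast
  ultimately have "between_one_sided_derivs r (th t) (- dr / (l (th t))\<^sup>2)"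
   unfolding between_one_sided_derivs_def using r_derivative_of_l by blast
  then show ?thesis using False by blast
 qed
 then obtain rh where btw: "!!t. between_one_sided_derivs r (th t) (rh t)"
  and rh: "!!t. H1 t * a t + H2 t * b t = 1 ==> rh t = rh0 t" by metis
 have rh0m: "rh0 \<in> borel_measurable lebesgue"
 proof -
  have "(%t. r (th t)) \<in> borel_measurable lebesgue" "th \<in> borel_measurable lebesgue"
   using cth continuous_on_compose2[OF continuous_r[of UNIV] cth subset_UNIV]
   by (auto intro!: borel_measurable_continuous_onI measurable_completion)
  moreover have "a \<in> borel_measurable lebesgue" "b \<in> borel_measurable lebesgue"
   unfolding a_def b_def
   by (intro measurable_compose[OF um] borel_measurable_continuous_onI continuous_on_fst continuous_on_snd continuous_on_id)+
  ultimately show ?thesis unfolding rh0_def by measurable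
 qed
 have rhm: "rh \<in> borel_measurable lebesgue"
  by (rule borel_measurable_AE[OF rh0m]) (use dot rh in \<open>auto elim!: eventually_mono\<close>)
 have sab: "AE t in lebesgue. supp1 (th t) (rh t) = a t & supp2 (th t) (rh t) = b t"
  using dot
 proof eventually_elim
  case (elim t)
  show ?case using supp_eq[OF elim[unfolded Hr]] rh[OF elim] by (simp add: rh0_def)
 qed
 have "extremal_data F ph1 ph2 ph3 ph4 ph5 g th x y z v w rh"
 proof
  show "AE t in lebesgue. (x has_real_derivative supp1 (th t) (rh t)) (at t)"
   "AE t in lebesgue. (y has_real_derivative supp2 (th t) (rh t)) (at t)"
   "AE t in lebesgue. (z has_real_derivative (x t * supp2 (th t) (rh t) - y t * supp1 (th t) (rh t)) / 2) (at t)"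
   "AE t in lebesgue. (v has_real_derivative - (z t + x t * y t / 6) / 2 * supp1 (th t) (rh t) + (x t)\<^sup>2 / 12 * supp2 (th t) (rh t)) (at t)"
   "AE t in lebesgue. (w has_real_derivative - (y t)\<^sup>2 / 12 * supp1 (th t) (rh t) - (z t - x t * y t / 6) / 2 * supp2 (th t) (rh t)) (at t)"
   using sab dgc by (eventually_elim, simp)+
  show "r (th 0) * cos (th 0) = ph1" "r (th 0) * sin (th 0) = ph2"
   unfolding Hr[symmetric] H1 H2 by (simp_all add: at0 p0)
 qed (use g_eq rhm btw lx ly lz lv lw at0 dth in \<open>simp_all add: h3_def\<close>)
 then show "\<exists>x y z v w rh. extremal_data F ph1 ph2 ph3 ph4 ph5 g th x y z v w rh" by blast
qed

theorem extremal_with_iff_data: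
 assumes "ph4\<^sup>2 + ph5\<^sup>2 ~= 0"
 shows "extremal_with F (ph1, ph2, ph3, ph4, ph5) g th \<longleftrightarrow>
  (\<exists>x y z v w rh. extremal_data F ph1 ph2 ph3 ph4 ph5 g th x y z v w rh)"
proof
 assume "extremal_with F (ph1, ph2, ph3, ph4, ph5) g th"
 then show "\<exists>x y z v w rh. extremal_data F ph1 ph2 ph3 ph4 ph5 g th x y z v w rh"
  unfolding extremal_with_def using extremal_imp_data(2) by blast
next
 assume "\<exists>x y z v w rh. extremal_data F ph1 ph2 ph3 ph4 ph5 g th x y z v w rh"
 then show "extremal_with F (ph1, ph2, ph3, ph4, ph5) g th"
  using extremal_data.extremal_with[OF _ assms] by blast
qed

theorem extremal_with_iff_formulas:
 assumes "ph4\<^sup>2 + ph5\<^sup>2 ~= 0"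
 shows "extremal_with F (ph1, ph2, ph3, ph4, ph5) g th \<longleftrightarrow> extremal_formulas F (ph1, ph2, ph3, ph4, ph5) g th"
 unfolding extremal_with_iff_data[OF assms]
 using formulas_imp_data[OF assms] extremal_data.formulas[OF _ assms] by blast

end

section \<open>The equation \<open>th'\<^sup>2 = R th\<close>\<close>

text \<open>Since only the square is prescribed, continuity of the derivative is what forbids jumps
  between the two roots: the sign can change only at a zero of \<open>R\<close>, where a solution
  may rest, turn or pass.\<close>

definition sol :: "(real \<Rightarrow> real) \<Rightarrow> (real \<Rightarrow> real) \<Rightarrow> bool" where
 "sol R th \<longleftrightarrow> (\<forall>t. (th has_real_derivative deriv th t) (at t)) & continuous_on UNIV (deriv th) &
  (\<forall>t. (deriv th t)\<^sup>2 = R (th t))"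

text \<open>Travel time per unit of angle. At a zero of \<open>R\<close> the value is 0 by the
  convention for division, which is harmless because zeros occur only as end points of the integrals
  that matter.\<close>

definition ker :: "(real \<Rightarrow> real) \<Rightarrow> real \<Rightarrow> real" where
 "ker R xi = 1 / sqrt (R xi)"

lemma solI:
 assumes "!!t. (th has_real_derivative D t) (at t)" "continuous_on UNIV D" "!!t. (D t)\<^sup>2 = R (th t)"
 shows "sol R th" "deriv th t = D t"
proof -
 have "deriv th = D" using DERIV_imp_deriv[OF assms(1)] by blast
 then show "sol R th" "deriv th t = D t" using assms by (simp_all add: sol_def)
qed

lemma sol_deriv: "sol R th ==> (th has_real_derivative deriv th t) (at t)"
 and sol_continuous_deriv: "sol R th ==> continuous_on S (deriv th)"
 and sol_eq: "sol R th ==> (deriv th t)\<^sup>2 = R (th t)"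
 by (auto simp: sol_def intro: continuous_on_subset)

lemma sol_continuous: "sol R th ==> continuous_on S th"
 by (meson DERIV_isCont continuous_at_imp_continuous_on sol_deriv)

lemma sol_nonneg: "sol R th ==> 0 <= R (th t)"
 using sol_eq[of R th t] by (metis zero_le_power2)

section \<open>Symmetries: time shift and reversal, reflection and translation of the angle\<close>

lemma sol_affine:
 assumes "sol R th" "c = 1 \<or> c = -1"
 shows "sol R (%t. th (c * t + s))" "deriv (%t. th (c * t + s)) t = c * deriv th (c * t + s)"
proof -
 have d: "((%t. th (c * t + s)) has_real_derivative c * deriv th (c * t + s)) (at t)" for t
 proof -
  have "((%t. c * t + s) has_real_derivative c) (at t)" by (auto intro!: derivative_eq_intros)
  from DERIV_chain2[OF sol_deriv[OF assms(1)] this] show ?thesis by (simp add: mult.commute)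
 qed
 have cont: "continuous_on UNIV (%t. c * deriv th (c * t + s))"
  by (intro continuous_intros continuous_on_compose2[OF sol_continuous_deriv[OF assms(1), of UNIV]]) auto
 have "(c * deriv th (c * t + s))\<^sup>2 = R (th (c * t + s))" for t
  using sol_eq[OF assms(1), of "c * t + s"] assms(2) by (auto simp: power_mult_distrib)
 from solI[OF d cont this] show "sol R (%t. th (c * t + s))" "deriv (%t. th (c * t + s)) t = c * deriv th (c * t + s)"
  by auto
qed

lemma sol_reverse:
 assumes "sol R th"
 shows "sol R (%t. th (s - t))" "deriv (%t. th (s - t)) t = - deriv th (s - t)"
 using sol_affine[OF assms, of "-1" s] by simp_all

lemma sol_shift:
 assumes "sol R th"
 shows "sol R (%t. th (t + s))" "deriv (%t. th (t + s)) t = deriv th (t + s)"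
 using sol_affine[OF assms, of 1 s] by simp_all

lemma sol_mirror:
 assumes "sol R th"
 shows "sol (%xi. R (- xi)) (%t. - th t)" "deriv (%t. - th t) t = - deriv th t"
proof -
 have d: "((%t. - th t) has_real_derivative - deriv th t) (at t)" for t
  by (intro DERIV_minus sol_deriv[OF assms])
 have c: "continuous_on UNIV (%t. - deriv th t)" by (intro continuous_intros sol_continuous_deriv[OF assms])
 from solI[OF d c, of "%xi. R (- xi)"] sol_eq[OF assms]
 show "sol (%xi. R (- xi)) (%t. - th t)" "deriv (%t. - th t) t = - deriv th t" by auto
qed

lemma sol_translate:
 assumes "sol R th" and R: "!!xi. R (xi + c) = R xi"
 shows "sol R (%t. th t + c)" "deriv (%t. th t + c) t = deriv th t"
proof -
 have d: "((%t. th t + c) has_real_derivative deriv th t) (at t)" for t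
  using sol_deriv[OF assms(1)] by (auto intro!: derivative_eq_intros)
 from solI[OF d sol_continuous_deriv[OF assms(1)], of R] sol_eq[OF assms(1)] R
 show "sol R (%t. th t + c)" "deriv (%t. th t + c) t = deriv th t" by auto
qed

lemma ker_mirror: "ker (%xi. R (- xi)) = (%xi. ker R (- xi))"
 by (simp add: ker_def fun_eq_iff)

lemma integral_mirror:
 fixes f :: "real \<Rightarrow> real"
 shows "((%x. f (- x)) has_integral i) {- b..- a} \<longleftrightarrow> (f has_integral i) {a..b}"
  and "(%x. f (- x)) integrable_on {- b..- a} \<longleftrightarrow> f integrable_on {a..b}"
  and "integral {- b..- a} (%x. f (- x)) = integral {a..b} f"
proof -
 show *: "((%x. f (- x)) has_integral i) {- b..- a} \<longleftrightarrow> (f has_integral i) {a..b}" for i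
  using has_integral_reflect_real[of f i b a] by simp
 show "(%x. f (- x)) integrable_on {- b..- a} \<longleftrightarrow> f integrable_on {a..b}"
  using * by (simp add: integrable_on_def)
 show "integral {- b..- a} (%x. f (- x)) = integral {a..b} f"
  unfolding integral_def integrable_on_def * ..
qed

text \<open>The inverse of \<open>th\<close> has derivative \<open>ker R\<close> in the interior and
  is continuous up to the ends, where \<open>R\<close> may vanish. So the improper integral
  converges, and its value is the elapsed time.\<close>

lemma flight_up:
 assumes S: "sol R th" and st: "s < t" and pos: "!!ta. [|s < ta; ta < t|] ==> deriv th ta > 0"
 shows "strict_mono_on {s..t} th" "th s < th t" "(ker R has_integral t - s) {th s..th t}"
proof -
 have less: "th al < th be" if "s <= al" "al < be" "be <= t" for al be
  using that(2)
 proof (rule DERIV_pos_imp_increasing_open)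
  show "\<exists>y. (th has_real_derivative y) (at x) & 0 < y" if "al < x" "x < be" for x
   using sol_deriv[OF S] pos[of x] that \<open>s <= al\<close> \<open>be <= t\<close> by force
  show "continuous_on {al..be} th" by (rule sol_continuous[OF S])
 qed
 show "strict_mono_on {s..t} th" using less by (auto intro!: strict_mono_onI)
 show lt: "th s < th t" using less st by simp
 define g where "g = inv_into {s..t} th"
 have inj: "inj_on th {s..t}"
  by (rule inj_onI) (metis less atLeastAtMost_iff less_irrefl linorder_neqE_linordered_idom)
 have g: "g (th ta) = ta" if "ta \<in> {s..t}" for ta unfolding g_def by (rule inv_into_f_f[OF inj that])
 have im: "th ` {s..t} = {th s..th t}"
 proof (intro equalityI subsetI)
  fix xi assume "xi \<in> th ` {s..t}"
  then obtain ta where ta: "ta \<in> {s..t}" "xi = th ta" by blast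
  have "th s <= th ta" using less[of s ta] ta(1) by (cases "s = ta") auto
  moreover have "th ta <= th t" using less[of ta t] ta(1) by (cases "ta = t") auto
  ultimately show "xi \<in> {th s..th t}" using ta(2) by simp
 next
  fix xi assume "xi \<in> {th s..th t}"
  then show "xi \<in> th ` {s..t}"
   using IVT'[of th s xi t] st sol_continuous[OF S] by fastforce
 qed
 have cg: "continuous_on {th s..th t} g"
  unfolding im[symmetric] by (rule continuous_on_inv[OF sol_continuous[OF S]]) (auto simp: g)
 have thg: "th (g xi) = xi" "g xi \<in> {s..t}" if "xi \<in> {th s..th t}" for xi
  using that f_inv_into_f[of xi th "{s..t}"] inv_into_into[of xi th "{s..t}"] unfolding g_def im by auto
 have "(ker R has_integral g (th t) - g (th s)) {th s..th t}"
 proof (rule fundamental_theorem_of_calculus_interior[OF less_imp_le[OF lt] cg])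
  fix xi assume xi: "xi \<in> {th s<..<th t}"
  then have gin: "g xi \<in> {s..t}" and thgx: "th (g xi) = xi" using thg[of xi] by auto
  moreover have "g xi ~= s" "g xi ~= t" using thgx xi by auto
  ultimately have D: "deriv th (g xi) > 0" by (intro pos) auto
  have "(g has_real_derivative inverse (deriv th (g xi))) (at xi)"
  proof (rule DERIV_inverse_function[of th _ g xi "th s" "th t"])
   show "isCont g xi" using cg xi by (intro continuous_on_interior[OF cg]) (simp add: interior_atLeastAtMost_real)
  qed (use xi D sol_deriv[OF S] thg in auto)
  moreover have "inverse (deriv th (g xi)) = ker R xi"
   using sol_eq[OF S, of "g xi"] D thgx by (simp add: ker_def inverse_eq_divide real_sqrt_unique)
  ultimately show "(g has_vector_derivative ker R xi) (at xi)"
   by (simp add: has_real_derivative_iff_has_vector_derivative)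
 qed
 then show "(ker R has_integral t - s) {th s..th t}" using g st by simp
qed

lemma flight_down:
 assumes S: "sol R th" and st: "s < t" and neg: "!!ta. [|s < ta; ta < t|] ==> deriv th ta < 0"
 shows "th t < th s" "(ker R has_integral t - s) {th t..th s}"
 using flight_up[OF sol_mirror(1)[OF S] st] neg
 by (auto simp: sol_mirror(2)[OF S] ker_mirror integral_mirror(1))

lemma deriv_sign:
 assumes S: "sol R th" and R: "!!ta. [|s < ta; ta < t|] ==> R (th ta) ~= 0"
 shows "(\<forall>ta. s < ta & ta < t --> deriv th ta > 0) \<or> (\<forall>ta. s < ta & ta < t --> deriv th ta < 0)"
proof (rule ccontr)
 assume "~ ?thesis"
 then obtain al be where ab: "s < al" "al < t" "deriv th al <= 0" "s < be" "be < t" "0 <= deriv th be"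
  by (metis not_le)
 have c: "continuous_on {min al be..max al be} (deriv th)" by (rule sol_continuous_deriv[OF S])
 have "\<exists>ta. min al be <= ta & ta <= max al be & deriv th ta = 0"
 proof (cases "al <= be")
  case True
  then show ?thesis using IVT'[of "deriv th" al 0 be] ab c by auto
 next
  case False
  then show ?thesis using IVT2'[of "deriv th" al 0 be] ab c by auto
 qed
 then obtain ta where "min al be <= ta" "ta <= max al be" "deriv th ta = 0" by blast
 then show False using R[of ta] sol_eq[OF S, of ta] ab by auto
qed

text \<open>\<open>s'\<close> is the last time with value \<open>p\<close>, and \<open>t'\<close>
  the first time after it with value \<open>q\<close>; by the intermediate value theorem the
  function cannot leave the band in between.\<close>

lemma crossing:
 fixes f :: "real \<Rightarrow> real"
 assumes c: "continuous_on {s..t} f" and st: "s <= t" and f: "f s = p" "f t = q" "p < q"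
 obtains s' t' where "s <= s'" "s' < t'" "t' <= t" "f s' = p" "f t' = q" "!!ta. [|s' < ta; ta < t'|] ==> p < f ta & f ta < q"
proof -
 define A where "A = {ta\<in>{s..t}. f ta = p}"
 have "closed A" unfolding A_def
  using continuous_closed_preimage_constant[OF c] by (simp add: vimage_def Collect_conj_eq[symmetric])
 moreover have "bounded A" unfolding A_def by (rule bounded_subset[OF bounded_closed_interval[of s t]]) auto
 ultimately have "compact A" using compact_eq_bounded_closed by blast
 moreover have "A ~= {}" using st f by (auto simp: A_def)
 ultimately obtain s' where s': "s' \<in> A" "!!ta. ta \<in> A ==> ta <= s'"
  using compact_attains_sup[of A] by blast
 have cs: "continuous_on {s'..t} f" using s' c by (auto simp: A_def intro: continuous_on_subset)
 define B where "B = {ta\<in>{s'..t}. f ta = q}"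
 have "closed B" unfolding B_def
  using continuous_closed_preimage_constant[OF cs] by (simp add: vimage_def Collect_conj_eq[symmetric])
 moreover have "bounded B" unfolding B_def by (rule bounded_subset[OF bounded_closed_interval[of s' t]]) auto
 ultimately have "compact B" using compact_eq_bounded_closed by blast
 moreover have "B ~= {}" using s' f by (auto simp: A_def B_def)
 ultimately obtain t' where t': "t' \<in> B" "!!ta. ta \<in> B ==> t' <= ta"
  using compact_attains_inf[of B] by blast
 have lt: "s' < t'" using s'(1) t'(1) f by (cases "s' = t'") (auto simp: A_def B_def)
 have "p < f ta & f ta < q" if ta: "s' < ta" "ta < t'" for ta
 proof (rule conjI; rule ccontr)
  assume "~ p < f ta"
  then obtain x where "ta <= x" "x <= t'" "f x = p"
   using IVT'[of f ta p t'] ta t'(1) f continuous_on_subset[OF cs, of "{ta..t'}"] by (auto simp: B_def)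
  then have "x \<in> A" using s'(1) t'(1) ta by (auto simp: A_def B_def)
  then show False using s'(2) \<open>ta <= x\<close> ta by fastforce
 next
  assume "~ f ta < q"
  then obtain x where "s' <= x" "x <= ta" "f x = q"
   using IVT'[of f s' q ta] ta s'(1) t'(1) f continuous_on_subset[OF cs, of "{s'..ta}"] by (auto simp: A_def B_def)
  then have "x \<in> B" using t'(1) ta by (auto simp: B_def)
  then show False using t'(2) \<open>x <= ta\<close> ta by fastforce
 qed
 then show ?thesis using that[of s' t'] s'(1) t'(1) lt by (auto simp: A_def B_def)
qed

lemma sol_crossing:
 assumes S: "sol R th" and pq: "p < q" "th s = p" "th t = q"
 obtains th' s' t' where "sol R th'" "s' < t'" "th' s' = p" "th' t' = q"
  "!!ta. [|s' < ta; ta < t'|] ==> p < th' ta & th' ta < q"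
proof (cases "s <= t")
 case True
 then show ?thesis
  using crossing[OF sol_continuous[OF S] _ pq(2,3,1)] that[OF S] by metis
next
 case False
 let ?th = "%ta. th (s + t - ta)"
 have S': "sol R ?th" by (rule sol_reverse(1)[OF S])
 have "?th t = p" "?th s = q" "t <= s" using pq False by auto
 then obtain s' t' where "s' < t'" "?th s' = p" "?th t' = q" "!!ta. [|s' < ta; ta < t'|] ==> p < ?th ta & ?th ta < q"
  using crossing[OF sol_continuous[OF S'] _ _ _ pq(1), of t s] by metis
 then show ?thesis using that[OF S'] by blast
qed

text \<open>The necessary half of the criterion for reaching a zero: a passage from \<open>p\<close>
  to \<open>q\<close> takes finite time, and that time is the integral.\<close>

lemma connect_integrable:
 assumes S: "sol R th" and pq: "p < q" "th s = p" "th t = q" and R: "!!xi. [|p < xi; xi < q|] ==> R xi > 0"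
 shows "ker R integrable_on {p..q}"
proof -
 obtain th' s' t' where S': "sol R th'" and st: "s' < t'" "th' s' = p" "th' t' = q"
  and btw: "!!ta. [|s' < ta; ta < t'|] ==> p < th' ta & th' ta < q"
  using sol_crossing[OF S pq] by blast
 have "(\<forall>ta. s' < ta & ta < t' --> deriv th' ta > 0) \<or> (\<forall>ta. s' < ta & ta < t' --> deriv th' ta < 0)"
  using R btw by (intro deriv_sign[OF S']) (metis less_irrefl)
 moreover have "~ (\<forall>ta. s' < ta & ta < t' --> deriv th' ta < 0)"
  using flight_down(1)[OF S' st(1)] st pq by auto
 ultimately have "(ker R has_integral t' - s') {p..q}"
  using flight_up(3)[OF S' st(1)] st by auto
 then show ?thesis by blast
qed

text \<open>Inside an arc of zeros the derivative vanishes, so a solution cannot move through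
  it.\<close>

lemma no_flat_crossing:
 assumes S: "sol R th" and pq: "p < q" "th s = p" "th t = q" and R: "!!xi. [|p < xi; xi < q|] ==> R xi = 0"
 shows False
proof -
 obtain th' s' t' where S': "sol R th'" and st: "s' < t'" "th' s' = p" "th' t' = q"
  and btw: "!!ta. [|s' < ta; ta < t'|] ==> p < th' ta & th' ta < q"
  using sol_crossing[OF S pq] by blast
 have "th' t' = th' s'"
 proof (rule DERIV_isconst_end[OF st(1) sol_continuous[OF S']])
  fix x assume "s' < x" "x < t'"
  then have "deriv th' x = 0" using sol_eq[OF S', of x] R[of "th' x"] btw by simp
  then show "(th' has_real_derivative 0) (at x)" using sol_deriv[OF S', of x] by simp
 qed
 then show False using st pq by simp
qed

text \<open>Up to its first zero the derivative is positive and \<open>th\<close> has increased, so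
  the value at that time still lies where \<open>R > 0\<close>, a contradiction.\<close>

lemma deriv_stays_positive:
 assumes S: "sol R th" and pos: "deriv th s > 0" and R: "!!xi. [|th s <= xi; xi < q|] ==> R xi > 0"
  and below: "!!ta. [|s <= ta; ta <= t|] ==> th ta < q" and st: "s <= t"
 shows "deriv th t > 0"
proof (rule ccontr)
 assume "~ deriv th t > 0"
 then have 0: "deriv th t <= 0" by simp
 show False
 proof -
  define Z where "Z = {ta\<in>{s..t}. deriv th ta = 0}"
  have "closed Z" unfolding Z_def
   using continuous_closed_preimage_constant[OF sol_continuous_deriv[OF S], of "{s..t}" 0] by (simp add: vimage_def Collect_conj_eq[symmetric])
  moreover have "bounded Z" unfolding Z_def by (rule bounded_subset[OF bounded_closed_interval[of s t]]) auto
  ultimately have "compact Z" using compact_eq_bounded_closed by blast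
  moreover have "Z ~= {}"
   using IVT2'[of "deriv th" t 0 s] 0 pos st sol_continuous_deriv[OF S] by (auto simp: Z_def)
  ultimately obtain z where z: "z \<in> Z" "!!ta. ta \<in> Z ==> z <= ta"
   using compact_attains_inf[of Z] by blast
  have sz: "s < z" using z(1) pos by (cases "s = z") (auto simp: Z_def)
  have "deriv th ta > 0" if ta: "s < ta" "ta < z" for ta
  proof (rule ccontr)
   assume "~ deriv th ta > 0"
   then obtain x where "s <= x" "x <= ta" "deriv th x = 0"
    using IVT2'[of "deriv th" ta 0 s] ta pos sol_continuous_deriv[OF S] by (auto simp: not_less)
   then have "x \<in> Z" using ta z(1) by (auto simp: Z_def)
   then show False using z(2) \<open>x <= ta\<close> ta by fastforce
  qed
  then have "th s < th z" by (rule flight_up(2)[OF S sz])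
  moreover have "th z < q" using z(1) by (intro below) (auto simp: Z_def)
  ultimately have "R (th z) > 0" by (intro R) auto
  then show False using sol_eq[OF S, of z] z(1) by (auto simp: Z_def)
 qed
qed

section \<open>Travel times as integrals of \<open>ker R\<close>\<close>

lemma ker_integral_mono:
 assumes i: "ker R integrable_on {p..q}" and sub: "p <= p'" "q' <= q" and R: "!!xi. [|p < xi; xi < q|] ==> R xi > 0"
 shows "ker R integrable_on {p'..q'}" "integral {p'..q'} (ker R) <= integral {p..q} (ker R)"
  "0 <= integral {p..q} (ker R)"
proof -
 show i': "ker R integrable_on {p'..q'}" using sub by (intro integrable_subinterval_real[OF i]) auto
 have ig: "integral {a..b} (ker R) = integral {a<..<b} (ker R)" "ker R integrable_on {a<..<b} \<longleftrightarrow> ker R integrable_on {a..b}" for a b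
  by (simp_all add: integral_open_interval_real integrable_on_Icc_iff_Ioo)
 have nn: "0 <= ker R xi" if "xi \<in> {p<..<q}" for xi using R[of xi] that by (simp add: ker_def)
 show "integral {p'..q'} (ker R) <= integral {p..q} (ker R)" unfolding ig(1)
  using sub i i' nn by (intro integral_subset_le) (auto simp: ig(2))
 show "0 <= integral {p..q} (ker R)" unfolding ig(1)
  using i nn by (intro integral_nonneg) (auto simp: ig(2))
qed

lemma ker_continuous:
 assumes "continuous_on UNIV R" "!!xi. xi \<in> S ==> R xi > 0"
 shows "continuous_on S (ker R)"
 unfolding ker_def using assms by (intro continuous_intros) (auto intro: continuous_on_subset simp: less_imp_neq[symmetric])

lemma ker_integral_pos:
 assumes c: "continuous_on UNIV R" and i: "ker R integrable_on {p..q}" and pq: "p < q"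
  and R: "!!xi. [|p < xi; xi < q|] ==> R xi > 0"
 shows "0 < integral {p..q} (ker R)"
proof -
 \<comment> \<open>On the middle third \<open>ker R\<close> is continuous and has a positive
   minimum; near the ends of \<open>{p..q}\<close> it may be unbounded.\<close>
 define p' where "p' = (2 * p + q) / 3"
 define q' where "q' = (p + 2 * q) / 3"
 have pq': "p < p'" "p' < q'" "q' < q" using pq by (auto simp: p'_def q'_def field_simps)
 have "continuous_on {p'..q'} (ker R)" using R pq' by (intro ker_continuous[OF c]) auto
 then obtain m where m: "m \<in> {p'..q'}" "!!xi. xi \<in> {p'..q'} ==> ker R m <= ker R xi"
  using continuous_attains_inf[of "{p'..q'}" "ker R"] pq' by auto
 have "ker R m > 0" using R[of m] m(1) pq' by (simp add: ker_def)
 then have "0 < ker R m * (q' - p')" using pq' by simp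
 also have "ker R m * (q' - p') = integral {p'..q'} (%_. ker R m)" using pq' by simp
 also have "\<dots> <= integral {p'..q'} (ker R)"
  using m(2) ker_integral_mono(1)[OF i _ _ R, of p' q'] pq' by (intro integral_le) auto
 also have "\<dots> <= integral {p..q} (ker R)" using pq' by (intro ker_integral_mono(2)[OF i _ _ R]) auto
 finally show ?thesis .
qed

text \<open>The sufficient half of the criterion: a solution that moves towards \<open>q\<close>
  arrives there at the time given by the integral, even if \<open>R q = 0\<close>, because it can
  neither stop nor turn before.\<close>

lemma flight_reach:
 assumes S: "sol R th" and pos: "deriv th s > 0" and pq: "th s < q"
  and R: "!!xi. [|th s <= xi; xi < q|] ==> R xi > 0" and i: "ker R integrable_on {th s..q}"
 defines "M \<equiv> integral {th s..q} (ker R)"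
 shows "th (s + M) = q" "M > 0" "!!ta. [|s <= ta; ta < s + M|] ==> deriv th ta > 0"
proof -
 have R': "R xi > 0" if "th s < xi" "xi < q" for xi using R that by auto
 have M0: "0 <= M" unfolding M_def by (rule ker_integral_mono(3)[OF i order_refl order_refl R'])
 \<comment> \<open>Any horizon beyond \<open>M\<close> would do: a flight of duration
   \<open>M + 1\<close> that stays below \<open>q\<close> contradicts the bound \<open>M\<close> on
   its travel time.\<close>
 have "\<exists>ta\<in>{s..s + M + 1}. q <= th ta"
 proof (rule ccontr)
  assume "~ (\<exists>ta\<in>{s..s + M + 1}. q <= th ta)"
  then have below: "th ta < q" if "s <= ta" "ta <= s + M + 1" for ta using that by (auto simp: not_le)
  have "deriv th ta > 0" if "s < ta" "ta < s + M + 1" for ta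
   using that by (intro deriv_stays_positive[OF S pos R below]) auto
  from flight_up(3)[OF S _ this, of s "s + M + 1"] have 1: "(ker R has_integral M + 1) {th s..th (s + M + 1)}"
   using M0 by (simp add: add.assoc)
  have "th (s + M + 1) <= q" using below[of "s + M + 1"] M0 by simp
  then have "integral {th s..th (s + M + 1)} (ker R) <= integral {th s..q} (ker R)"
   by (intro ker_integral_mono(2)[OF i _ _ R']) auto
  then show False using integral_unique[OF 1] by (simp add: M_def)
 qed
 then obtain ta1 where ta1: "s <= ta1" "q <= th ta1" by auto
 then obtain ta2 where ta2: "s <= ta2" "th ta2 = q"
  using IVT'[of th s q ta1] pq sol_continuous[OF S] by auto
 define Z where "Z = {ta\<in>{s..ta2}. th ta = q}"
 have "closed Z" unfolding Z_def
  using continuous_closed_preimage_constant[OF sol_continuous[OF S], of "{s..ta2}" q] by (simp add: vimage_def Collect_conj_eq[symmetric])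
 moreover have "bounded Z" unfolding Z_def by (rule bounded_subset[OF bounded_closed_interval[of s ta2]]) auto
 ultimately have "compact Z" using compact_eq_bounded_closed by blast
 moreover have "Z ~= {}" using ta2 by (auto simp: Z_def)
 ultimately obtain z where z: "z \<in> Z" "!!ta. ta \<in> Z ==> z <= ta"
  using compact_attains_inf[of Z] by blast
 have sz: "s < z" using z(1) pq by (cases "s = z") (auto simp: Z_def)
 have below: "th ta < q" if ta: "s <= ta" "ta < z" for ta
 proof (rule ccontr)
  assume "~ th ta < q"
  then obtain x where "s <= x" "x <= ta" "th x = q"
   using IVT'[of th s q ta] ta pq sol_continuous[OF S] by (auto simp: not_less)
  then have "x \<in> Z" using ta z(1) by (auto simp: Z_def)
  then show False using z(2) \<open>x <= ta\<close> ta by fastforce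
 qed
 have pz: "deriv th ta > 0" if "s <= ta" "ta < z" for ta
  using that below by (intro deriv_stays_positive[OF S pos R]) auto
 have "(ker R has_integral z - s) {th s..th z}" using flight_up(3)[OF S sz pz] by simp
 then have "z - s = M" using z(1) unfolding M_def by (auto simp: Z_def intro!: integral_unique[symmetric])
 then have zM: "z = s + M" by simp
 show "th (s + M) = q" "M > 0" using z(1) zM sz by (auto simp: Z_def)
 show "deriv th ta > 0" if "s <= ta" "ta < s + M" for ta using pz that zM by simp
qed

text \<open>At the ends of \<open>{a..b}\<close> the equation alone would allow a rest of any
  length. Excluding rests on nondegenerate intervals is what restores uniqueness.\<close>

definition oscillates :: "(real \<Rightarrow> real) \<Rightarrow> real \<Rightarrow> real \<Rightarrow> (real \<Rightarrow> real) \<Rightarrow> bool" where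
 "oscillates R a b th \<longleftrightarrow> sol R th & (\<forall>t. th t \<in> {a..b}) & (\<forall>s t. s < t --> (\<exists>ta\<in>{s..t}. th ta ~= th s))"

lemma oscillates_reverse:
 assumes "oscillates R a b th"
 shows "oscillates R a b (%t. th (s - t))"
proof -
 have "\<exists>ta\<in>{u..t}. th (s - ta) ~= th (s - u)" if ut: "u < t" for u t
 proof (rule ccontr)
  assume "~ ?thesis"
  then have *: "th (s - ta) = th (s - u)" if "ta \<in> {u..t}" for ta using that by blast
  obtain ta where "ta \<in> {s - t..s - u}" "th ta ~= th (s - t)"
   using assms ut unfolding oscillates_def by (meson diff_strict_left_mono)
  then show False using *[of "s - ta"] *[of t] ut by auto
 qed
 then show ?thesis using assms sol_reverse(1) unfolding oscillates_def by blast
qed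

lemma oscillates_mirror:
 assumes "oscillates R a b th"
 shows "oscillates (%xi. R (- xi)) (- b) (- a) (%t. - th t)"
 using assms sol_mirror(1) unfolding oscillates_def by auto


text \<open>The difficulty is the start at \<open>b\<close>, where \<open>R\<close> may vanish and
  nothing is known about the derivative. It is resolved by following the solution backwards from a
  slightly later time with value below \<open>b\<close>; once a falling flight is found,
  \<open>flight_reach\<close> describes it completely.\<close>

lemma turn:
 assumes O: "oscillates R a b th" and c: "continuous_on UNIV R" and ab: "a < b" and i: "ker R integrable_on {a..b}"
  and R: "!!xi. [|a < xi; xi < b|] ==> R xi > 0" and s: "th s = b"
 defines "T \<equiv> integral {a..b} (ker R)"
 shows "T > 0" "th (s + T) = a" "!!ta. [|s < ta; ta < s + T|] ==> deriv th ta < 0"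
  "!!ta. [|s <= ta; ta <= s + T|] ==> integral {th ta..b} (ker R) = ta - s"
proof -
 have S: "sol R th" and in_ab: "!!t. th t \<in> {a..b}"
  and nc: "!!s t. s < t ==> \<exists>ta\<in>{s..t}. th ta ~= th s" using O unfolding oscillates_def by blast+
 note mono = ker_integral_mono[OF i _ _ R]
 have comb: "integral {a..xi} (ker R) + integral {xi..b} (ker R) = T" if "xi \<in> {a..b}" for xi
  unfolding T_def using Henstock_Kurzweil_Integration.integral_combine[of a xi b "ker R"] i that by auto
 have fwd_up: "th (t + integral {th t..b} (ker R)) = b" "integral {th t..b} (ker R) > 0"
   "!!ta. [|t <= ta; ta < t + integral {th t..b} (ker R)|] ==> deriv th ta > 0"
  if t: "a < th t" "th t < b" "deriv th t > 0" and S: "sol R th" for th t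
  using flight_reach[OF S t(3,2) _ mono(1)] t R by auto
 have fwd_down: "th (t + integral {a..th t} (ker R)) = a" "integral {a..th t} (ker R) > 0"
   "!!ta. [|t <= ta; ta < t + integral {a..th t} (ker R)|] ==> deriv th ta < 0"
  if t: "a < th t" "th t < b" "deriv th t < 0" and S: "sol R th" for th t
 proof -
  have i': "ker R integrable_on {a..th t}" using t by (intro mono(1)) auto
  have "ker (%xi. R (- xi)) integrable_on {- th t..- a}"
   unfolding ker_mirror using i' by (simp add: integral_mirror)
  from flight_reach[OF sol_mirror(1)[OF S] _ _ _ this] t R
  show "th (t + integral {a..th t} (ker R)) = a" "integral {a..th t} (ker R) > 0"
   "!!ta. [|t <= ta; ta < t + integral {a..th t} (ker R)|] ==> deriv th ta < 0"
   by (auto simp: sol_mirror(2)[OF S] ker_mirror integral_mirror(3))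
 qed
 \<comment> \<open>Near time \<open>s\<close> the solution stays above the midpoint
   \<open>m\<close>, so any descent to \<open>a\<close> takes at least the time from
   \<open>m\<close> to \<open>a\<close>. \<open>ep\<close> is chosen so that no flight downwards can
   end within a window of this length.\<close>
 define m where "m = (a + b) / 2"
 have m: "a < m" "m < b" using ab by (auto simp: m_def)
 have im: "ker R integrable_on {a..m}" using m by (intro mono(1)) auto
 have m0: "0 < integral {a..m} (ker R)" using m R by (intro ker_integral_pos[OF c im]) auto
 have "\<forall>\<^sub>F t in at s. m < th t"
  using sol_continuous[OF S, of UNIV] m s
  by (intro order_tendstoD(1)) (auto simp: continuous_on_eq_continuous_at isCont_def)
 then obtain ep0 where ep0: "ep0 > 0" "!!t. [|t ~= s; dist t s < ep0|] ==> m < th t"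
  unfolding eventually_at by blast
 define ep where "ep = min ep0 (integral {a..m} (ker R))"
 have ep: "ep > 0" using ep0 m0 by (simp add: ep_def)
 have near: "m < th t" if "s < t" "t < s + ep" for t
  using ep0(2)[of t] that by (auto simp: ep_def dist_real_def)
 have long: "ep <= integral {a..th t} (ker R)" if "s < t" "t < s + ep" "th t < b" for t
 proof -
  have "integral {a..m} (ker R) <= integral {a..th t} (ker R)"
   using near[OF that(1,2)] that(3) R in_ab[of t] by (intro ker_integral_mono(2) mono(1)) auto
  then show ?thesis by (simp add: ep_def)
 qed
 \<comment> \<open>If the solution rose at \<open>t\<close>, the reversed solution would fall from
   \<open>th t\<close> for at least the time \<open>ep\<close>, hence throughout the way back to
   \<open>s\<close>; then \<open>th s < th t\<close>, against \<open>th s = b\<close>.\<close>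
 have dec: "deriv th t < 0" if t: "s < t" "t < s + ep" "th t < b" for t
 proof (rule ccontr)
  assume "~ deriv th t < 0"
  moreover have "deriv th t ~= 0"
   using sol_eq[OF S, of t] R[of "th t"] near[OF t(1,2)] m t(3) by auto
  ultimately have pos: "deriv th t > 0" by simp
  let ?th = "%ta. th (t + s - ta)"
  have S': "sol R ?th" and d': "!!ta. deriv ?th ta = - deriv th (t + s - ta)" by (rule sol_reverse[OF S])+
  have "?th s = th t" by simp
  have "deriv th ta > 0" if "s < ta" "ta < t" for ta
  proof -
   have "deriv ?th (t + s - ta) < 0"
    by (rule fwd_down(3)[OF _ _ _ S', of s]) (use t near[OF t(1,2)] m pos d' long[OF t] that in auto)
   then show ?thesis by (simp add: d')
  qed
  then have "th s < th t" by (rule flight_up(2)[OF S t(1)])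
  then show False using s t(3) by simp
 qed
 obtain t where t: "s < t" "t < s + ep" "th t < b"
 proof -
  obtain ta where ta: "ta \<in> {s..s + ep / 2}" "th ta ~= b" using nc[of s "s + ep / 2"] ep s by auto
  then have "s < ta" using s by (cases "ta = s") auto
  then show ?thesis using that[of ta] ta ep in_ab[of ta] by auto
 qed
 let ?th = "%ta. th (t + s - ta)"
 have S': "sol R ?th" and d': "!!ta. deriv ?th ta = - deriv th (t + s - ta)" by (rule sol_reverse[OF S])+
 define I where "I = integral {th t..b} (ker R)"
 have bwd: "th (t - I) = b" "I > 0" "!!ta. [|t - I < ta; ta <= t|] ==> deriv th ta < 0"
 proof -
  have h: "a < ?th s" "?th s < b" "deriv ?th s > 0" using t near[OF t(1,2)] m d' dec[OF t] by auto
  show "th (t - I) = b" "I > 0" using fwd_up(1,2)[OF h S'] by (auto simp: I_def)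
  show "deriv th ta < 0" if "t - I < ta" "ta <= t" for ta
   using fwd_up(3)[OF h S', of "t + s - ta"] that by (auto simp: I_def d')
 qed
 have less_b: "th ta < b" if "t - I < ta" "ta <= t" for ta
  using flight_down(1)[OF S that(1)] bwd(1,3) that by auto
 have "t - I \<ge> s" using less_b[of s] t(1) s by force
 \<comment> \<open>Otherwise the absence of rests yields a time between \<open>s\<close> and
   \<open>t - I\<close> with value below \<open>b\<close>. By \<open>dec\<close> the solution falls
   from there at least until \<open>t - I\<close>, where its value is \<open>b\<close>.\<close>
 have "t - I = s"
 proof (rule ccontr)
  assume "t - I ~= s"
  then have ts: "s < t - I" using \<open>t - I \<ge> s\<close> by simp
  obtain ta where ta: "ta \<in> {s..t - I}" "th ta ~= b" using nc[OF ts] s by auto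
  have ta': "s < ta" "ta < t - I" "ta < s + ep" "th ta < b"
   using ta s bwd(1,2) t(2) in_ab[of ta] by (auto simp: order.order_iff_strict)
  have "deriv th x < 0" if "ta < x" "x < t - I" for x
   by (rule fwd_down(3)[OF _ _ dec[OF ta'(1,3,4)] S])
    (use ta' near[OF ta'(1,3)] m long[OF ta'(1,3,4)] that t bwd(2) in auto)
  from flight_down(1)[OF S ta'(2) this] have "th (t - I) < th ta" .
  then show False using bwd(1) in_ab[of ta] by auto
 qed
 then have tI: "t = s + I" by simp
 have ht: "a < th t" using near[OF t(1,2)] m by simp
 note fd = fwd_down[OF ht t(3) dec[OF t] S]
 have T: "t + integral {a..th t} (ker R) = s + T"
  using comb[OF in_ab[of t]] tI unfolding I_def by linarith
 show "T > 0" using T t(1) fd(2) by linarith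
 show "th (s + T) = a" using fd(1) unfolding T .
 show neg: "deriv th ta < 0" if "s < ta" "ta < s + T" for ta
 proof (cases "ta <= t")
  case True
  then show ?thesis using that tI by (intro bwd(3)) linarith+
 next
  case False
  then show ?thesis using that T by (intro fd(3)) linarith+
 qed
 show "integral {th ta..b} (ker R) = ta - s" if "s <= ta" "ta <= s + T" for ta
 proof (cases "ta = s")
  case False
  then show ?thesis
   using flight_down(2)[OF S, of s ta] neg that s by (auto intro!: integral_unique)
 qed (simp add: s)
qed

text \<open>The time since leaving \<open>b\<close> equals the integral from the current value to
  \<open>b\<close>, and this integral is strictly monotone in the value.\<close>

lemma turn_unique:
 assumes O: "oscillates R a b th" and O': "oscillates R a b th'"
  and c: "continuous_on UNIV R" and ab: "a < b" and i: "ker R integrable_on {a..b}"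
  and R: "!!xi. [|a < xi; xi < b|] ==> R xi > 0" and s: "th s = b" "th' s = b"
  and ta: "s <= ta" "ta <= s + integral {a..b} (ker R)"
 shows "th ta = th' ta"
proof -
 have *: "~ p < q" if "p \<in> {a..b}" "q \<in> {a..b}" "integral {p..b} (ker R) = integral {q..b} (ker R)" for p q
 proof
  assume "p < q"
  have "integral {p..q} (ker R) + integral {q..b} (ker R) = integral {p..b} (ker R)"
   using that \<open>p < q\<close> ker_integral_mono(1)[OF i _ _ R]
   by (intro Henstock_Kurzweil_Integration.integral_combine) auto
  moreover have "0 < integral {p..q} (ker R)"
   using that \<open>p < q\<close> R by (intro ker_integral_pos[OF c ker_integral_mono(1)[OF i _ _ R]]) auto
  ultimately show False using that by simp
 qed
 have "th ta \<in> {a..b}" "th' ta \<in> {a..b}" using O O' unfolding oscillates_def by blast+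
 moreover have "integral {th ta..b} (ker R) = integral {th' ta..b} (ker R)"
  using turn(4)[OF O c ab i R s(1) ta] turn(4)[OF O' c ab i R s(2) ta] by simp
 ultimately show ?thesis using *[of "th ta" "th' ta"] *[of "th' ta" "th ta"] by linarith
qed

lemma turn_low:
 assumes O: "oscillates R a b th" and c: "continuous_on UNIV R" and ab: "a < b" and i: "ker R integrable_on {a..b}"
  and R: "!!xi. [|a < xi; xi < b|] ==> R xi > 0" and s: "th s = a"
 shows "th (s + integral {a..b} (ker R)) = b"
  and "[|oscillates R a b th'; th' s = a; s <= ta; ta <= s + integral {a..b} (ker R)|] ==> th ta = th' ta"
proof -
 have c': "continuous_on UNIV (%xi. R (- xi))"
  by (rule continuous_on_compose2[OF c]) (auto intro!: continuous_intros)
 have i': "ker (%xi. R (- xi)) integrable_on {- b..- a}"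
  using i by (simp add: ker_mirror integral_mirror)
 have R': "R (- xi) > 0" if "- b < xi" "xi < - a" for xi using that R[of "- xi"] by simp
 have int: "integral {- b..- a} (ker (%xi. R (- xi))) = integral {a..b} (ker R)"
  by (simp add: ker_mirror integral_mirror)
 have s': "- th s = - a" and ab': "- b < - a" using s ab by auto
 show "th (s + integral {a..b} (ker R)) = b"
  using turn(2)[OF oscillates_mirror[OF O] c' ab' i' R' s'] by (simp add: int)
 show "th ta = th' ta" if "oscillates R a b th'" "th' s = a" "s <= ta" "ta <= s + integral {a..b} (ker R)"
  using turn_unique[OF oscillates_mirror[OF O] oscillates_mirror[OF that(1)] c' ab' i' R' s', of ta] that by (simp add: int)
qed

text \<open>After each time \<open>T\<close> the solution is at the other end point, so agreement
  propagates by induction over such steps.\<close>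

lemma oscillation_unique:
 assumes O: "oscillates R a b th" and O': "oscillates R a b th'"
  and c: "continuous_on UNIV R" and ab: "a < b" and i: "ker R integrable_on {a..b}"
  and R: "!!xi. [|a < xi; xi < b|] ==> R xi > 0" and s: "th s \<in> {a, b}" "th' s = th s" and ta: "s <= ta"
 shows "th ta = th' ta"
proof -
 define T where "T = integral {a..b} (ker R)"
 have T: "T > 0" unfolding T_def by (rule ker_integral_pos[OF c i ab R])
 have step: "(\<forall>x\<in>{u..u + T}. th x = th' x) & th (u + T) \<in> {a, b}" if u: "th u \<in> {a, b}" "th' u = th u" for u
 proof (cases "th u = b")
  case True
  then show ?thesis
   using turn_unique[OF O O' c ab i R, of u] turn(2)[OF O c ab i R, of u] u by (auto simp: T_def)
 next
  case False
  then have "th u = a" using u by simp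
  then show ?thesis
   using turn_low[OF O c ab i R, of u] O' u by (auto simp: T_def)
 qed
 have main: "(\<forall>x\<in>{s..s + real n * T}. th x = th' x) & th (s + real n * T) \<in> {a, b}" for n
 proof (induction n)
  case (Suc n)
  have "s + real n * T \<in> {s..s + real n * T}" using T by simp
  then have "th' (s + real n * T) = th (s + real n * T)" using Suc by metis
  from step[OF _ this] Suc
  have 1: "\<forall>x\<in>{s + real n * T..s + real n * T + T}. th x = th' x" "th (s + real n * T + T) \<in> {a, b}" by blast+
  have "s + real (Suc n) * T = s + real n * T + T" by (simp add: algebra_simps)
  then show ?case using 1 Suc by (metis atLeastAtMost_iff linear)
 qed (use s in auto)
 obtain n where "(ta - s) / T < real n" using reals_Archimedean2 by blast
 then have "ta \<in> {s..s + real n * T}" using ta T by (simp add: field_simps)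
 then show ?thesis using main[of n] by blast
qed

text \<open>The solution reversed about \<open>s\<close> also oscillates and has the same value at
  \<open>s\<close>, so forward uniqueness identifies the two.\<close>

lemma oscillation_symmetric:
 assumes O: "oscillates R a b th"
  and c: "continuous_on UNIV R" and ab: "a < b" and i: "ker R integrable_on {a..b}"
  and R: "!!xi. [|a < xi; xi < b|] ==> R xi > 0" and s: "th s \<in> {a, b}"
 shows "th (s + ta) = th (s - ta)" "deriv th (s + ta) = - deriv th (s - ta)"
proof -
 have *: "th (s + ta) = th (s - ta)" if "0 <= ta" for ta
  using oscillation_unique[OF O oscillates_reverse[OF O, of "2 * s"] c ab i R s _, of "s + ta"] that by simp
 have **: "th (s + ta) = th (s - ta)" for ta
  using *[of ta] *[of "- ta"] by (cases "0 <= ta") auto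
 then show "th (s + ta) = th (s - ta)" .
 have S: "sol R th" using O unfolding oscillates_def by blast
 have "th = (%t. th (2 * s - t))" using **[of "_ - s"] by (auto simp: fun_eq_iff)
 then have "deriv th (s + ta) = deriv (%t. th (2 * s - t)) (s + ta)" by metis
 then show "deriv th (s + ta) = - deriv th (s - ta)" by (simp add: sol_reverse(2)[OF S])
qed

subsection \<open>Construction of solutions\<close>

text \<open>By the mean value theorem the difference quotients at \<open>x\<close> are values of
  \<open>D\<close> nearby. It supplies the derivative at times where a solution starts or ends a
  rest.\<close>

lemma DERIV_removable:
 fixes f D :: "real \<Rightarrow> real"
 assumes f: "isCont f x" and D: "isCont D x" and ev: "\<forall>\<^sub>F y in at x. (f has_real_derivative D y) (at y)"
 shows "(f has_real_derivative D x) (at x)"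
 unfolding has_field_derivative_iff
proof (rule LIM_I)
 fix e :: real assume e: "0 < e"
 obtain d1 where d1: "d1 > 0" "!!y. [|y ~= x; dist y x < d1|] ==> (f has_real_derivative D y) (at y)"
  using ev unfolding eventually_at by blast
 obtain d2 where d2: "d2 > 0" "!!y. dist y x < d2 ==> dist (D y) (D x) < e"
  using D e unfolding continuous_at_eps_delta by blast
 have "norm ((f y - f x) / (y - x) - D x) < e" if y: "y ~= x" "norm (y - x) < min d1 d2" for y
 proof -
  define p q where "p = min x y" and "q = max x y"
  have pq: "p < q" using y by (auto simp: p_def q_def)
  have near: "dist z x < min d1 d2" if "z \<in> {p..q}" for z
   using that y by (auto simp: p_def q_def dist_real_def min_def max_def split: if_splits)
  have "isCont f z" if "z \<in> {p..q}" for z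
   using f d1(2)[of z] near[OF that] DERIV_isCont by (cases "z = x") auto
  then have "continuous_on {p..q} f" by (simp add: continuous_at_imp_continuous_on)
  moreover have "(f has_derivative (*) (D z)) (at z)" if "p < z" "z < q" for z
   using d1(2)[of z] near[of z] that by (auto simp: has_field_derivative_def p_def q_def min_def max_def split: if_splits)
  ultimately obtain z where z: "p < z" "z < q" "f q - f p = D z * (q - p)"
   using mvt[OF pq, of f "%z. (*) (D z)"] by blast
  have "(f y - f x) / (y - x) = D z"
  proof (cases "x < y")
   case True then show ?thesis using z by (simp add: p_def q_def)
  next
   case False
   then have "y < x" using y by simp
   then have "f x - f y = D z * (x - y)" using z by (simp add: p_def q_def)
   then have "f y - f x = D z * (y - x)" by (simp add: algebra_simps)
   then show ?thesis using y by simp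
  qed
  then show ?thesis using d2(2)[of z] near[of z] z by (simp add: dist_real_def)
 qed
 then show "\<exists>s>0. \<forall>y. y ~= x & norm (y - x) < s --> norm ((f y - f x) / (y - x) - D x) < e"
  using d1(1) d2(1) by (intro exI[of _ "min d1 d2"]) auto
qed

lemma sol_local:
 assumes "!!t. \<exists>f. sol R f & (\<forall>\<^sub>F s in nhds t. th s = f s)"
 shows "sol R th"
proof -
 obtain f where f: "!!t. sol R (f t)" "!!t. \<forall>\<^sub>F s in nhds t. th s = f t s" using assms by metis
 define D where "D t = deriv (f t) t" for t
 have d: "(th has_real_derivative D t) (at t)" for t
  using sol_deriv[OF f(1), of t t] DERIV_cong_ev[OF refl f(2)[of t] refl] unfolding D_def by simp
 have De: "\<forall>\<^sub>F s in nhds t. D s = deriv (f t) s" for t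
 proof -
  have "\<forall>\<^sub>F s in nhds t. \<forall>\<^sub>F s' in nhds s. th s' = f t s'" using f(2)[of t] eventually_eventually by blast
  then show ?thesis
  proof eventually_elim
   case (elim s)
   have "(th has_real_derivative deriv (f t) s) (at s)"
    using sol_deriv[OF f(1), of t s] DERIV_cong_ev[OF refl elim refl] by simp
   then show ?case using d[of s] DERIV_unique by blast
  qed
 qed
 have "isCont D t" for t
  using isCont_cong[OF De[of t]] sol_continuous_deriv[OF f(1), of UNIV t]
  by (simp add: continuous_on_eq_continuous_at)
 then have c: "continuous_on UNIV D" by (simp add: continuous_at_imp_continuous_on)
 have "th t = f t t" for t using eventually_nhds_x_imp_x[OF f(2)[of t]] .
 then have "(D t)\<^sup>2 = R (th t)" for t using sol_eq[OF f(1), of t t] by (simp add: D_def)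
 from solI(1)[OF d c this] show ?thesis .
qed

lemma sol_deriv_cong:
 assumes "sol R f" "\<forall>\<^sub>F s in nhds t. th s = f s"
 shows "deriv th t = deriv f t"
 by (rule deriv_cong_ev[OF assms(2) refl])

lemma sol_glue:
 assumes f: "sol R f" and g: "sol R g" and eq: "f s = g s" "deriv f s = deriv g s"
 defines "h \<equiv> %t. if t <= s then f t else g t"
 shows "sol R h" "t < s ==> deriv h t = deriv f t" "s < t ==> deriv h t = deriv g t"
proof -
 define D where "D t = (if t <= s then deriv f t else deriv g t)" for t
 have left: "\<forall>\<^sub>F x in nhds t. h x = f x" if "t < s" for t
  using eventually_nhds_in_open[of "{..<s}" t] that by (auto simp: h_def elim!: eventually_mono)
 have right: "\<forall>\<^sub>F x in nhds t. h x = g x" if "s < t" for t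
  using eventually_nhds_in_open[of "{s<..}" t] that by (auto simp: h_def elim!: eventually_mono)
 have cont: "continuous_on UNIV (%t. if t <= s then p t else q t)"
  if "continuous_on UNIV p" "continuous_on UNIV q" "p s = q s" for p q :: "real \<Rightarrow> real"
 proof -
  have "continuous_on ({..s} \<union> {s..}) (%t. if t <= s then p t else q t)"
   using that by (intro continuous_on_If) (auto intro: continuous_on_subset)
  moreover have "{..s} \<union> {s..} = UNIV" by auto
  ultimately show ?thesis by simp
 qed
 have ch: "continuous_on UNIV h" unfolding h_def
  by (rule cont[OF sol_continuous[OF f] sol_continuous[OF g] eq(1)])
 have cD: "continuous_on UNIV D" unfolding D_def
  by (rule cont[OF sol_continuous_deriv[OF f] sol_continuous_deriv[OF g] eq(2)])
 have d0: "(h has_real_derivative D t) (at t)" if "t ~= s" for t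
 proof (cases "t < s")
  case True
  then show ?thesis using DERIV_cong_ev[OF refl left[OF True] refl] sol_deriv[OF f, of t] by (simp add: D_def)
 next
  case False
  then have "s < t" using that by simp
  then show ?thesis using DERIV_cong_ev[OF refl right refl] sol_deriv[OF g, of t] by (simp add: D_def)
 qed
 have d: "(h has_real_derivative D t) (at t)" for t
 proof (cases "t = s")
  case True
  show ?thesis
  proof (rule DERIV_removable)
   show "isCont h t" "isCont D t" using ch cD by (simp_all add: continuous_on_eq_continuous_at)
   show "\<forall>\<^sub>F y in at t. (h has_real_derivative D y) (at y)"
    using d0 True unfolding eventually_at by (intro exI[of _ 1]) auto
  qed
 qed (rule d0)
 have "(D t)\<^sup>2 = R (h t)" for t
  using sol_eq[OF f, of t] sol_eq[OF g, of t] by (simp add: D_def h_def)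
 note so = solI[where th = h and R = R, OF d cD this]
 show "sol R h" by (rule so(1))
 show "deriv h t = deriv f t" if "t < s" using so(2)[of t] that by (simp add: D_def)
 show "deriv h t = deriv g t" if "s < t" using so(2)[of t] that by (simp add: D_def)
qed

text \<open>The solution that rests at \<open>a\<close> until time \<open>0\<close> and then rises towards \<open>b\<close>.\<close>

definition is_departure :: "(real \<Rightarrow> real) \<Rightarrow> real \<Rightarrow> real \<Rightarrow> (real \<Rightarrow> real) \<Rightarrow> bool" where
 "is_departure R a b Ph \<longleftrightarrow> sol R Ph & (\<forall>t\<le>0. Ph t = a) & (\<forall>t>0. a < Ph t) & (\<forall>t. Ph t <= b) &
  (\<forall>xi. a < xi & xi < b --> Ph (integral {a..xi} (ker R)) = xi & deriv Ph (integral {a..xi} (ker R)) > 0) &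
  (ker R integrable_on {a..b} --> (\<forall>t\<ge>integral {a..b} (ker R). Ph t = b) &
    strict_mono_on {0..integral {a..b} (ker R)} Ph)"

text \<open>It is the inverse of the time function \<open>H\<close>, written as a supremum so that the times outside the
 range of \<open>H\<close> are covered.\<close>

lemma departure:
 assumes c: "continuous_on UNIV R" and ab: "a < b" and Rpos: "!!xi. [|a < xi; xi < b|] ==> R xi > 0"
  and R0: "R a = 0" "R b = 0" and int: "!!xi. [|a < xi; xi < b|] ==> ker R integrable_on {a..xi}"
 shows "\<exists>Ph. is_departure R a b Ph"
proof -
 define H where "H xi = integral {a..xi} (ker R)" for xi
 have Hcomb: "H xi + integral {xi..et} (ker R) = H et" if "a <= xi" "xi <= et" "et < b" for xi et
 proof (cases "a < et")
  case True
  then show ?thesis unfolding H_def using that int[of et] by (intro Henstock_Kurzweil_Integration.integral_combine) auto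
 next
  case False
  then have "xi = a" "et = a" using that by auto
  then show ?thesis by (simp add: H_def)
 qed
 have Hless: "H xi < H et" if "a <= xi" "xi < et" "et < b" for xi et
 proof -
  have "0 < integral {xi..et} (ker R)"
  proof (rule ker_integral_pos[OF c])
   show "ker R integrable_on {xi..et}" by (rule integrable_subinterval_real[OF int[of et]]) (use that in auto)
  qed (use that Rpos in auto)
  then show ?thesis using Hcomb[of xi et] that by simp
 qed
 have Ha: "H a = 0" by (simp add: H_def)
 have Hpos: "0 < H xi" if "a < xi" "xi < b" for xi using Hless[of a xi] that Ha by simp
 have Hcont: "continuous_on {a..xi} H" if "a < xi" "xi < b" for xi
  unfolding H_def by (rule indefinite_integral_continuous_1[OF int[OF that]])
 have Hc: "(H \<longlongrightarrow> H xi) (at xi within {a..<b})" if "a <= xi" "xi < b" for xi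
 proof -
  define et where "et = (xi + b) / 2"
  have et: "xi < et" "et < b" using that by (auto simp: et_def)
  have "(H \<longlongrightarrow> H xi) (at xi within {a..et})"
   using Hcont[of et] et that by (auto simp: continuous_on_def)
  moreover have "at xi within {a..et} = at xi within {a..<b}"
   using et by (intro at_within_nhd[of xi "{..<et}"]) auto
  ultimately show ?thesis by simp
 qed
 have up: "\<exists>et. xi < et & et < b & H et < t" if "a <= xi" "xi < b" "H xi < t" for xi t
 proof -
  have "\<forall>\<^sub>F et in at xi within {a..<b}. H et < t" using Hc[OF that(1,2)] that(3) by (rule order_tendstoD)
  then obtain d where d: "d > 0" "!!et. [|et \<in> {a..<b}; et ~= xi; dist et xi < d|] ==> H et < t"
   unfolding eventually_at by blast
  define de where "de = min (d / 2) ((b - xi) / 2)"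
  have de: "0 < de" "de <= d / 2" "de <= (b - xi) / 2"
  proof -
   show "0 < de" using d(1) that by (simp add: de_def)
  qed (simp_all only: de_def min.cobounded1 min.cobounded2)
  have "xi + de < b" using de(3) that(2) by (simp add: field_simps)
  moreover have "H (xi + de) < t" using de d(1) that(1) calculation by (intro d(2)) (auto simp: dist_real_def)
  ultimately show ?thesis using de(1) by (intro exI[of _ "xi + de"]) auto
 qed
 have down: "\<exists>et. a < et & et < xi & t < H et" if "a < xi" "xi < b" "t < H xi" for xi t
 proof -
  have "\<forall>\<^sub>F et in at xi within {a..<b}. t < H et" using Hc[of xi] that by (intro order_tendstoD(1)) auto
  then obtain d where d: "d > 0" "!!et. [|et \<in> {a..<b}; et ~= xi; dist et xi < d|] ==> t < H et"
   unfolding eventually_at by blast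
  define de where "de = min (d / 2) ((xi - a) / 2)"
  have de: "0 < de" "de <= d / 2" "de <= (xi - a) / 2"
  proof -
   show "0 < de" using d(1) that by (simp add: de_def)
  qed (simp_all only: de_def min.cobounded1 min.cobounded2)
  have "a < xi - de" using de(3) that(1) by (simp add: field_simps)
  moreover have "t < H (xi - de)" using de d(1) that(2) calculation by (intro d(2)) (auto simp: dist_real_def)
  ultimately show ?thesis using de(1) by (intro exI[of _ "xi - de"]) auto
 qed
 \<comment> \<open>Inserting \<open>a\<close> keeps the set nonempty and gives the supremum
   \<open>a\<close> for times up to 0. For times beyond the range of \<open>H\<close> the supremum
   is \<open>b\<close>.\<close>
 define A where "A t = insert a {xi. a < xi & xi < b & H xi <= t}" for t
 define Ph where "Ph t = Sup (A t)" for t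
 have bdd: "bdd_above (A t)" for t using ab by (intro bdd_aboveI[of _ b]) (auto simp: A_def)
 have ge_a: "a <= Ph t" for t unfolding Ph_def by (rule cSup_upper[OF _ bdd]) (simp add: A_def)
 have le_b: "Ph t <= b" for t unfolding Ph_def by (rule cSup_least) (use ab in \<open>auto simp: A_def\<close>)
 \<comment> \<open>This equivalence and its counterpart \<open>lt\<close> carry the whole
   construction: inverse relations, continuity and the behaviour outside the range of
   \<open>H\<close> all follow from them.\<close>
 have gt: "xi < Ph t \<longleftrightarrow> H xi < t" if xi: "a < xi" "xi < b" for xi t
 proof
  assume "xi < Ph t"
  then obtain et where et: "et \<in> A t" "xi < et" unfolding Ph_def using less_cSup_iff[OF _ bdd] by (auto simp: A_def)
  then show "H xi < t" using Hless[of xi et] xi by (auto simp: A_def)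
 next
  assume "H xi < t"
  then obtain et where "xi < et" "et < b" "H et < t" using up[of xi t] xi by auto
  then have "et \<in> A t" using xi by (auto simp: A_def)
  then have "et <= Ph t" unfolding Ph_def by (rule cSup_upper[OF _ bdd])
  then show "xi < Ph t" using \<open>xi < et\<close> by simp
 qed
 have lt: "Ph t < xi \<longleftrightarrow> t < H xi" if xi: "a < xi" "xi < b" for xi t
 proof
  assume "Ph t < xi"
  then have "xi \<notin> A t" unfolding Ph_def using cSup_upper[OF _ bdd, of xi t] by auto
  then show "t < H xi" using xi by (auto simp: A_def)
 next
  assume "t < H xi"
  then obtain et where et: "a < et" "et < xi" "t < H et" using down[of xi t] xi by auto
  have "Ph t <= et" unfolding Ph_def
  proof (rule cSup_least)
   fix x assume "x \<in> A t"
   then show "x <= et" using et Hless[of et x] by (cases "x <= et") (auto simp: A_def)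
  qed (simp add: A_def)
  then show "Ph t < xi" using et by simp
 qed
 have inv: "Ph (H xi) = xi" if "a < xi" "xi < b" for xi
  using gt[OF that, of "H xi"] lt[OF that, of "H xi"] by simp
 have inv': "H (Ph t) = t" if "a < Ph t" "Ph t < b" for t
  using gt[OF that, of t] lt[OF that, of t] by simp
 have at_a: "Ph t = a" if "t <= 0" for t
 proof (rule ccontr)
  assume "Ph t ~= a"
  then have "a < Ph t" using ge_a[of t] by simp
  define xi where "xi = (a + Ph t) / 2"
  have xi: "a < xi" "xi < Ph t" "xi < b" using \<open>a < Ph t\<close> le_b[of t] by (auto simp: xi_def)
  then show False using gt[of xi t] Hpos[of xi] that by simp
 qed
 have above: "a < Ph t" if "0 < t" for t
 proof -
  obtain et where "a < et" "et < b" "H et < t" using up[of a t] \<open>0 < t\<close> Ha ab by auto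
  then show ?thesis using gt[of et t] by simp
 qed
 have mono: "Ph s <= Ph t" if "s <= t" for s t
  unfolding Ph_def using that bdd by (intro cSup_subset_mono) (auto simp: A_def)
 have cont: "isCont Ph t" for t
  unfolding isCont_def
 proof (rule order_tendstoI)
  fix y assume y: "y < Ph t"
  show "\<forall>\<^sub>F s in at t. y < Ph s"
  proof (cases "y < a")
   case True
   then show ?thesis using ge_a by (intro always_eventually allI) (rule less_le_trans)
  next
   case False
   define xi where "xi = (y + Ph t) / 2"
   have xi: "a < xi" "y < xi" "xi < Ph t" "xi < b" using y False le_b[of t] by (auto simp: xi_def)
   then have "H xi < t" using gt by blast
   then have "\<forall>\<^sub>F s in at t. H xi < s" using order_tendstoD(1)[OF tendsto_ident_at] by blast
   then show ?thesis by eventually_elim (use gt[OF xi(1,4)] xi(2) in \<open>meson less_trans\<close>)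
  qed
 next
  fix y assume y: "Ph t < y"
  show "\<forall>\<^sub>F s in at t. Ph s < y"
  proof (cases "b < y")
   case True
   then show ?thesis using le_b by (intro always_eventually allI) (rule le_less_trans)
  next
   case False
   define xi where "xi = (y + Ph t) / 2"
   have xi: "xi < b" "xi < y" "Ph t < xi" "a < xi" using y False ge_a[of t] by (auto simp: xi_def)
   then have "t < H xi" using lt by blast
   then have "\<forall>\<^sub>F s in at t. s < H xi" using order_tendstoD(2)[OF tendsto_ident_at] by blast
   then show ?thesis by eventually_elim (use lt[OF xi(4,1)] xi(2) in \<open>meson less_trans\<close>)
  qed
 qed
 then have contU: "continuous_on UNIV Ph" by (simp add: continuous_at_imp_continuous_on)
 have Rnn: "0 <= R (Ph t)" for t
  using Rpos[of "Ph t"] R0 ge_a[of t] le_b[of t] by (cases "Ph t = a"; cases "Ph t = b") auto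
 define D where "D t = sqrt (R (Ph t))" for t
 have cD: "continuous_on UNIV D" unfolding D_def
  by (intro continuous_intros continuous_on_compose2[OF c contU]) auto
 have d_mid: "(Ph has_real_derivative D t) (at t)" if t: "a < Ph t" "Ph t < b" for t
 proof -
  have "\<forall>\<^sub>F s in nhds t. a < Ph s & Ph s < b"
   using cont[of t] t unfolding isCont_def
   by (auto simp: eventually_nhds_conv_at intro!: eventually_conj order_tendstoD)
  then obtain e where e: "e > 0" "!!s. dist s t < e ==> a < Ph s & Ph s < b"
   unfolding eventually_nhds_metric by blast
  have dH: "(H has_real_derivative ker R (Ph t)) (at (Ph t))"
  proof -
   define et where "et = (Ph t + b) / 2"
   have et: "Ph t < et" "et < b" using t by (auto simp: et_def)
   have "isCont (ker R) (Ph t)"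
    using c t Rpos unfolding ker_def
    by (intro continuous_intros) (auto simp: continuous_on_eq_continuous_at less_imp_neq[symmetric])
   then have "((%u. integral {a..u} (ker R)) has_vector_derivative ker R (Ph t)) (at (Ph t) within {a..et})"
    using integral_has_vector_derivative_continuous_at[of "ker R" a et "Ph t" "{}"] int[of et] et t
    by (auto simp: continuous_at_imp_continuous_at_within)
   moreover have "at (Ph t) within {a..et} = at (Ph t)" using et t by (intro at_within_interior) simp
   ultimately show ?thesis
    unfolding H_def[symmetric] has_real_derivative_iff_has_vector_derivative by (simp add: H_def[abs_def])
  qed
  have "(Ph has_real_derivative inverse (ker R (Ph t))) (at t)"
  proof (rule DERIV_inverse_function[where f = H and g = Ph and x = t, OF dH, of "t - e" "t + e"])
   show "ker R (Ph t) ~= 0" using Rpos[OF t] by (simp add: ker_def)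
   show "H (Ph y) = y" if "t - e < y" "y < t + e" for y
    using e(2)[of y] that inv'[of y] by (auto simp: dist_real_def abs_less_iff)
  qed (use e(1) cont in auto)
  then show ?thesis by (simp add: D_def ker_def inverse_eq_divide)
 qed
 have d_const: "(Ph has_real_derivative D t) (at t)" if "\<forall>\<^sub>F s in nhds t. Ph s = k" "k = a \<or> k = b" for t k
 proof -
  have "(Ph has_real_derivative 0) (at t)"
   using DERIV_cong_ev[OF refl that(1) refl, of 0] by simp
  moreover have "Ph t = k" using eventually_nhds_x_imp_x[OF that(1)] .
  ultimately show ?thesis using that(2) R0 by (auto simp: D_def)
 qed
 \<comment> \<open>Between \<open>a\<close> and \<open>b\<close> the inverse function rule applies
   and on rests the function is constant; at the two possible transition times the derivative is
   found as a removable limit.\<close>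
 have d: "(Ph has_real_derivative D t) (at t)" for t
 proof -
  have cc: "isCont Ph t" "isCont D t" using cont cD by (simp_all add: continuous_on_eq_continuous_at)
  consider "a < Ph t" "Ph t < b" | "Ph t = a" | "Ph t = b" using ge_a[of t] le_b[of t] by linarith
  then show ?thesis
  proof cases
   case 1 then show ?thesis by (rule d_mid)
  next
   case 2
   then have t0: "t <= 0" using above[of t] by force
   have neg: "(Ph has_real_derivative D s) (at s)" if "s < 0" for s
    by (rule d_const[where t = s and k = a]) (use eventually_nhds_in_open[of "{..<0}" s] that at_a in \<open>auto elim!: eventually_mono\<close>)
   show ?thesis
   proof (cases "t < 0")
    case False
    have "\<forall>\<^sub>F s in at t. Ph s < b" using cont[of t] 2 ab unfolding isCont_def by (intro order_tendstoD) auto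
    then have "\<forall>\<^sub>F s in at t. (Ph has_real_derivative D s) (at s)"
     unfolding eventually_at_filter
    proof eventually_elim
     case (elim s)
     then show ?case using neg[of s] d_mid[of s] above[of s] t0 False by (cases "s < 0") auto
    qed
    then show ?thesis by (rule DERIV_removable[OF cc])
   qed (rule neg)
  next
   case 3
   have bs: "Ph s = b" if "t <= s" for s using mono[OF that] le_b[of s] 3 by simp
   have after: "(Ph has_real_derivative D s) (at s)" if "t0 < s" "!!x. t0 < x ==> Ph x = b" for s t0
    by (rule d_const[where t = s and k = b]) (use eventually_nhds_in_open[of "{t0<..}" s] that in \<open>auto elim!: eventually_mono\<close>)
   show ?thesis
   proof (cases "\<exists>t1<t. Ph t1 = b")
    case True
    then obtain t1 where t1: "t1 < t" "Ph t1 = b" by blast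
    have "Ph x = b" if "t1 < x" for x using mono[of t1 x] that le_b[of x] t1 by simp
    then show ?thesis using t1 after by blast
   next
    case False
    have "\<forall>\<^sub>F s in at t. a < Ph s" using cont[of t] 3 ab unfolding isCont_def by (intro order_tendstoD) auto
    then have "\<forall>\<^sub>F s in at t. (Ph has_real_derivative D s) (at s)"
     unfolding eventually_at_filter
    proof eventually_elim
     case (elim s)
     show ?case
     proof (cases "t < s")
      case True
      then show ?thesis using bs by (intro impI after[of t]) auto
     next
      case notless: False
      show ?thesis
      proof (intro impI)
       assume "s ~= t"
       then have "s < t" using notless by simp
       then have "Ph s < b" using False le_b[of s] by force
       then show "(Ph has_real_derivative D s) (at s)" using d_mid elim \<open>s ~= t\<close> by blast
      qed
     qed
    qed
    then show ?thesis by (rule DERIV_removable[OF cc])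
   qed
  qed
 qed
 have sq: "(D t)\<^sup>2 = R (Ph t)" for t using Rnn[of t] by (simp add: D_def)
 note so = solI[where R = R and th = Ph, OF d cD sq]
 have full: "H xi < integral {a..b} (ker R)" if "ker R integrable_on {a..b}" "a <= xi" "xi < b" for xi
 proof -
  have "0 < integral {xi..b} (ker R)"
   using that Rpos by (intro ker_integral_pos[OF c] integrable_subinterval_real[OF that(1)]) auto
  moreover have "H xi + integral {xi..b} (ker R) = integral {a..b} (ker R)"
   unfolding H_def using that by (intro Henstock_Kurzweil_Integration.integral_combine) auto
  ultimately show ?thesis by simp
 qed
 have at_b: "Ph t = b" if "ker R integrable_on {a..b}" "integral {a..b} (ker R) <= t" for t
 proof (rule ccontr)
  assume "Ph t ~= b"
  then have "Ph t < b" using le_b[of t] by simp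
  define xi where "xi = (Ph t + b) / 2"
  have xi: "Ph t < xi" "xi < b" "a < xi" using \<open>Ph t < b\<close> ge_a[of t] by (auto simp: xi_def)
  then show False using lt[of xi t] full[of xi] that by simp
 qed
 have mid: "Ph t < b" if i: "ker R integrable_on {a..b}" and "t < integral {a..b} (ker R)" for t
 proof (rule ccontr)
  assume "~ Ph t < b"
  then have b: "Ph t = b" using le_b[of t] by simp
  have "continuous_on {a..b} (%xi. integral {a..xi} (ker R))" by (rule indefinite_integral_continuous_1[OF i])
  then have "((%xi. integral {a..xi} (ker R)) \<longlongrightarrow> integral {a..b} (ker R)) (at b within {a..b})"
   using ab by (auto simp: continuous_on_def)
  then have "\<forall>\<^sub>F xi in at b within {a..b}. t < integral {a..xi} (ker R)" using that(2) by (rule order_tendstoD)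
  then obtain e where e: "e > 0" "!!xi. [|xi \<in> {a..b}; xi ~= b; dist xi b < e|] ==> t < integral {a..xi} (ker R)"
   unfolding eventually_at by blast
  define xi where "xi = b - min (e / 2) ((b - a) / 2)"
  have "min (e / 2) ((b - a) / 2) <= (b - a) / 2" "min (e / 2) ((b - a) / 2) <= e / 2" by (simp_all only: min.cobounded1 min.cobounded2)
  moreover have "(b - a) / 2 < b - a" "0 < min (e / 2) ((b - a) / 2)" using ab e(1) by auto
  ultimately have xi: "a < xi" "xi < b" "dist xi b < e" using e(1) by (auto simp: xi_def dist_real_def)
  have "t < H xi" unfolding H_def using xi by (intro e(2)) auto
  then show False using lt[OF xi(1,2), of t] xi b by simp
 qed
 have "is_departure R a b Ph"
  unfolding is_departure_def
 proof (intro conjI allI impI)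
  show "sol R Ph" by (rule so(1))
  show "Ph (integral {a..xi} (ker R)) = xi" if "a < xi & xi < b" for xi using inv[of xi] that by (simp add: H_def)
  show "deriv Ph (integral {a..xi} (ker R)) > 0" if "a < xi & xi < b" for xi
   using so(2)[of "H xi"] inv[of xi] Rpos[of xi] that by (simp add: H_def D_def)
  show "strict_mono_on {0..integral {a..b} (ker R)} Ph" if i: "ker R integrable_on {a..b}"
  proof -
   have T: "0 < integral {a..b} (ker R)" by (rule ker_integral_pos[OF c i ab Rpos])
   have "deriv Ph ta > 0" if "0 < ta" "ta < integral {a..b} (ker R)" for ta
    using so(2)[of ta] above[OF that(1)] mid[OF i that(2)] Rpos by (simp add: D_def)
   then show ?thesis by (rule flight_up(1)[OF so(1) T])
  qed
 qed (use at_a above le_b at_b in auto)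
 then show ?thesis by blast
qed

lemma is_departureD:
 assumes "is_departure R a b Ph"
 shows "sol R Ph" "t <= 0 ==> Ph t = a" "0 < t ==> a < Ph t" "Ph t <= b"
  "[|a < xi; xi < b|] ==> Ph (integral {a..xi} (ker R)) = xi"
  "[|a < xi; xi < b|] ==> deriv Ph (integral {a..xi} (ker R)) > 0"
  "[|ker R integrable_on {a..b}; integral {a..b} (ker R) <= t|] ==> Ph t = b"
  "ker R integrable_on {a..b} ==> strict_mono_on {0..integral {a..b} (ker R)} Ph"
 using assms unfolding is_departure_def by blast+

section \<open>Rests at zeros of \<open>R\<close>\<close>

lemma sol_deriv_at_zero: "sol R th ==> R (th t) = 0 ==> deriv th t = 0"
 using sol_eq[of R th t] by simp

lemma sol_const:
 assumes "R c = 0"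
 shows "sol R (%t. c)"
 using solI(1)[of "%t. c" "%t. 0" R] assms by simp

text \<open>A reversed departure arrives at \<open>a\<close> at time 0, and a departure shifted by
  \<open>L\<close> leaves at time \<open>L\<close>. The cut is placed at \<open>L / 2\<close>, in
  the middle of the rest, where both pieces have value \<open>a\<close> and derivative 0.\<close>

lemma pause:
 assumes S: "sol R Ph" and a: "!!t. t <= 0 ==> Ph t = a" "!!t. 0 < t ==> Ph t ~= a" and R: "R a = 0" and L: "0 < L"
 defines "B \<equiv> %t. if t <= L / 2 then Ph (- t) else Ph (t - L)"
 shows "sol R B" "maximal_constancy B a 0 L" "t < 0 ==> deriv B t = - deriv Ph (- t)" "L < t ==> deriv B t = deriv Ph (t - L)"
  "t <= L ==> B t = Ph (- t)" "0 <= t ==> B t = Ph (t - L)"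
proof -
 have f: "sol R (%t. Ph (- t))" "!!t. deriv (%t. Ph (- t)) t = - deriv Ph (- t)"
  using sol_reverse[OF S, of 0] by simp_all
 have g: "sol R (%t. Ph (t - L))" "!!t. deriv (%t. Ph (t - L)) t = deriv Ph (t - L)"
  using sol_shift[OF S, of "- L"] by simp_all
 have rest: "deriv Ph t = 0" if "t <= 0" for t
  using sol_deriv_at_zero[OF S, of t] a(1)[OF that] R by simp
 have e1: "Ph (- (L / 2)) = Ph (L / 2 - L)" using a(1)[of "- (L / 2)"] a(1)[of "L / 2 - L"] L by simp
 have e2: "deriv (%t. Ph (- t)) (L / 2) = deriv (%t. Ph (t - L)) (L / 2)"
  using rest[of "- (L / 2)"] rest[of "L / 2 - L"] L by (simp add: f(2) g(2))
 note gl = sol_glue[OF f(1) g(1) e1 e2, folded B_def]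
 show "sol R B" by (rule gl(1))
 show "deriv B t = - deriv Ph (- t)" if "t < 0" using gl(2)[of t] that L f(2) by simp
 show "deriv B t = deriv Ph (t - L)" if "L < t" using gl(3)[of t] that L g(2) by simp
 show l: "B t = Ph (- t)" if "t <= L" for t
  using that a(1)[of "- t"] a(1)[of "t - L"] L by (cases "t <= L / 2") (auto simp: B_def)
 show r: "B t = Ph (t - L)" if "0 <= t" for t
  using that a(1)[of "- t"] a(1)[of "t - L"] L by (cases "t <= L / 2") (auto simp: B_def)
 show "maximal_constancy B a 0 L"
  unfolding maximal_constancy_def
 proof (intro conjI ballI allI impI)
  show "B t = a" if "t \<in> {0..L}" for t using r[of t] that a(1)[of "t - L"] by simp
  fix a' b' assume *: "a' <= 0 & L <= b' & (\<forall>t\<in>{a'..b'}. B t = a)"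
  then have "B a' = a" "B b' = a" using L by auto
  then have "Ph (- a') = a" "Ph (b' - L) = a" using l[of a'] r[of b'] * L by auto
  then have "~ 0 < - a'" "~ 0 < b' - L" using a(2) by blast+
  then show "a' = 0" "b' = L" using * by auto
 qed
qed

lemma maximal_constancy_shift:
 assumes "maximal_constancy th c a b"
 shows "maximal_constancy (%t. th (t + s)) c (a - s) (b - s)"
 unfolding maximal_constancy_def
proof (intro conjI ballI allI impI)
 show "th (t + s) = c" if "t \<in> {a - s..b - s}" for t
  using assms that unfolding maximal_constancy_def by auto
 fix a' b' assume *: "a' <= a - s & b - s <= b' & (\<forall>t\<in>{a'..b'}. th (t + s) = c)"
 have "th t = c" if "t \<in> {a' + s..b' + s}" for t
  using *[THEN conjunct2, THEN conjunct2, rule_format, of "t - s"] that by auto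
 moreover have "a' + s <= a" "b <= b' + s" using * by auto
 ultimately have "a' + s = a & b' + s = b" using assms unfolding maximal_constancy_def by blast
 then show "a' = a - s" "b' = b - s" by auto
qed

lemma maximal_constancy_minus:
 assumes "maximal_constancy th c a b"
 shows "maximal_constancy (%t. - th t) (- c) a b"
 using assms unfolding maximal_constancy_def neg_equal_iff_equal .

text \<open>A source of non-uniqueness: cut at the middle \<open>m\<close> of a maximal rest and
  stay at \<open>c\<close> on the side of \<open>m\<close> away from time 0. The initial data are
  unchanged, but the rest is now longer than maximality allows for \<open>th\<close>.\<close>

lemma rest_forever:
 assumes S: "sol R th" and R: "R c = 0" and mc: "maximal_constancy th c a b" and ab: "a < b"
 obtains th' where "sol R th'" "th' ~= th" "th' 0 = th 0" "deriv th' 0 = deriv th 0"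
proof -
 define m where "m = (a + b) / 2"
 have m: "a < m" "m < b" using ab by (auto simp: m_def)
 have cm: "th t = c" if "t \<in> {a..b}" for t using mc that unfolding maximal_constancy_def by blast
 have mcD: "a' = a & b' = b" if "a' <= a" "b <= b'" "!!t. t \<in> {a'..b'} ==> th t = c" for a' b'
  using mc that unfolding maximal_constancy_def by blast
 have dm: "deriv th m = 0" using sol_deriv_at_zero[OF S, of m] cm[of m] m R by simp
 have K: "sol R (%t. c)" using sol_const[of R c] R .
 have same: "deriv th' 0 = deriv th 0" if "sol R th'" "\<forall>\<^sub>F s in nhds 0. th' s = th s" for th'
  by (rule sol_deriv_cong[OF S that(2)])
 show ?thesis
 proof (cases "m \<ge> 0")
  case True
  define th' where "th' t = (if t <= m then th t else c)" for t
  have S': "sol R th'" unfolding th'_def using sol_glue(1)[OF S K, of m] cm[of m] m dm by simp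
  have "th' ~= th"
  proof
   assume "th' = th"
   then have *: "th t = th' t" for t by (rule fun_cong[OF sym])
   have "th t = c" if "t \<in> {a..b + 1}" for t
   proof (cases "t <= m")
    case True then show ?thesis using that m by (intro cm) auto
   next
    case False then show ?thesis unfolding * by (simp add: th'_def)
   qed
   then show False using mcD[of a "b + 1"] by simp
  qed
  moreover have "th' 0 = th 0" using True by (simp add: th'_def)
  moreover have "deriv th' 0 = deriv th 0"
  proof (cases "m = 0")
   case True
   have "th' 0 = c" "th 0 = c" using cm[of m] m True by (auto simp: th'_def)
   then show ?thesis using sol_deriv_at_zero[OF S', of 0] sol_deriv_at_zero[OF S, of 0] R by simp
  next
   case False
   then have "\<forall>\<^sub>F s in nhds 0. s \<in> {..<m}" using True by (intro eventually_nhds_in_open) auto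
   then show ?thesis by (intro same[OF S']) (auto elim!: eventually_mono simp: th'_def)
  qed
  ultimately show ?thesis using that S' by blast
 next
  case False
  define th' where "th' t = (if t <= m then c else th t)" for t
  have S': "sol R th'" unfolding th'_def using sol_glue(1)[OF K S, of m] cm[of m] m dm by simp
  have "th' ~= th"
  proof
   assume "th' = th"
   then have *: "th t = th' t" for t by (rule fun_cong[OF sym])
   have "th t = c" if "t \<in> {a - 1..b}" for t
   proof (cases "t <= m")
    case True then show ?thesis unfolding * by (simp add: th'_def)
   next
    case False then show ?thesis using that m by (intro cm) auto
   qed
   then show False using mcD[of "a - 1" b] by simp
  qed
  moreover have "th' 0 = th 0" using False by (simp add: th'_def)
  moreover have "deriv th' 0 = deriv th 0"
  proof -
   have "\<forall>\<^sub>F s in nhds 0. s \<in> {m<..}" using False by (intro eventually_nhds_in_open) auto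
   then show ?thesis by (intro same[OF S']) (auto elim!: eventually_mono simp: th'_def)
  qed
  ultimately show ?thesis using that S' by blast
 qed
qed

section \<open>Chains of flights and rests indexed by all integers\<close>

lemma int_recursion:
 fixes s :: "int \<Rightarrow> 'a::ab_group_add"
 obtains a where "a 0 = c" "!!n. a (n + 1) = a n + s n"
proof -
 define a where "a n = c + (if 0 <= n then \<Sum>i\<in>{0..<n}. s i else - (\<Sum>i\<in>{n..<0}. s i))" for n
 have "a 0 = c" by (simp add: a_def)
 moreover have "a (n + 1) = a n + s n" for n
 proof -
  consider "0 <= n" | "n = -1" | "n < -1" by linarith
  then show ?thesis
  proof cases
   case 1
   have "{0..<n + 1} = insert n {0..<n}" using 1 by auto
   then show ?thesis using 1 by (simp add: a_def add.commute add.left_commute)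
  next
   case 2
   have "{- 1..<0} = {- 1 :: int}" by auto
   then show ?thesis using 2 by (simp add: a_def)
  next
   case 3
   have "{n..<0} = insert n {n + 1..<0}" using 3 by auto
   then show ?thesis using 3 by (simp add: a_def)
  qed
 qed
 ultimately show ?thesis by (rule that)
qed

lemma int_index:
 fixes a :: "int \<Rightarrow> real"
 assumes T: "T > 0" and a: "!!n. a n + T <= a (n + 1)"
 obtains n where "a n <= x" "x < a (n + 1)"
proof -
 have up: "a 0 + of_nat k * T <= a (int k)" for k
 proof (induction k)
  case (Suc k)
  then show ?case using a[of "int k"] by (simp add: algebra_simps)
 qed simp
 have down: "a (- int k) <= a 0 - of_nat k * T" for k
 proof (induction k)
  case (Suc k)
  then show ?case using a[of "- int (Suc k)"] by (simp add: algebra_simps)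
 qed simp
 obtain k where "(x - a 0) / T < real k" using reals_Archimedean2 by blast
 then have hi: "x < a (int k)" using up[of k] T by (simp add: field_simps)
 obtain j where "(a 0 - x) / T < real j" using reals_Archimedean2 by blast
 then have lo: "a (- int j) <= x" using down[of j] T by (simp add: field_simps)
 have "\<exists>n. a n <= x & x < a (n + 1)"
 proof (rule ccontr)
  assume "~ ?thesis"
  then have step: "a n <= x ==> a (n + 1) <= x" for n by (meson not_le)
  have "a n <= x" if "- int j <= n" for n using that
  proof (induction n rule: int_ge_induct)
   case (step i)
   then show ?case using \<open>!!n. a n <= x ==> a (n + 1) <= x\<close> by blast
  qed (rule lo)
  then have "a (int k) <= x" by simp
  then show False using hi by simp
 qed
 then show ?thesis using that by blast
qed

text \<open>The lower bound \<open>T\<close> on the steps keeps the nodes from accumulating, so the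
  pieces cover all times and only neighbouring pieces have to match.\<close>

lemma sol_chain:
 assumes T: "T > 0" and a: "!!n::int. a n + T <= a (n + 1)" and f: "!!n. sol R (f n)"
  and eq: "!!n. f n (a (n + 1)) = f (n + 1) (a (n + 1))" "!!n. deriv (f n) (a (n + 1)) = deriv (f (n + 1)) (a (n + 1))"
 obtains th where "sol R th" "!!n t. [|a n <= t; t <= a (n + 1)|] ==> th t = f n t"
proof -
 define N where "N x = (SOME n. a n <= x & x < a (n + 1))" for x
 have N: "a (N x) <= x" "x < a (N x + 1)" for x
 proof -
  obtain n where "a n <= x" "x < a (n + 1)" using int_index[of T a x, OF T a] by blast
  then have "a (N x) <= x & x < a (N x + 1)"
   unfolding N_def by (intro someI[of "%n. a n <= x & x < a (n + 1)"]) auto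
  then show "a (N x) <= x" "x < a (N x + 1)" by auto
 qed
 have less: "a m < a n" if "m < n" for m n
  using that
 proof (induction n rule: int_gr_induct)
  case base then show ?case using a[of m] T by simp
 next
  case (step i) then show ?case using a[of i] T by simp
 qed
 have uniq: "N x = n" if "a n <= x" "x < a (n + 1)" for n x
 proof (rule ccontr)
  assume "N x ~= n"
  then consider "N x + 1 <= n" | "n + 1 <= N x" by linarith
  then show False
  proof cases
   case 1
   then have "a (N x + 1) <= a n" using less[of "N x + 1" n] by (cases "N x + 1 = n") auto
   then show False using that N(2)[of x] by simp
  next
   case 2
   then have "a (n + 1) <= a (N x)" using less[of "n + 1" "N x"] by (cases "n + 1 = N x") auto
   then show False using that N(1)[of x] by simp
  qed
 qed
 define th where "th x = f (N x) x" for x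
 have th: "th t = f n t" if "a n <= t" "t <= a (n + 1)" for n t
 proof (cases "t = a (n + 1)")
  case True
  have "N t = n + 1" using a[of "n + 1"] T True by (intro uniq) auto
  then show ?thesis using eq(1)[of n] True by (simp add: th_def)
 next
  case False
  then have "N t = n" using that by (intro uniq) auto
  then show ?thesis by (simp add: th_def)
 qed
 have "sol R th"
 proof (rule sol_local)
  fix t
  define n where "n = N t"
  show "\<exists>h. sol R h & (\<forall>\<^sub>F s in nhds t. th s = h s)"
  proof (cases "a n < t")
   case True
   have "\<forall>\<^sub>F s in nhds t. s \<in> {a n<..<a (n + 1)}"
    using True N(2)[of t] by (intro eventually_nhds_in_open) (auto simp: n_def)
   then have "\<forall>\<^sub>F s in nhds t. th s = f n s" by eventually_elim (auto intro!: th)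
   then show ?thesis using f by blast
  next
   case False
   then have t: "t = a n" using N(1)[of t] by (simp add: n_def)
   define m where "m = n - 1"
   have mn: "n = m + 1" by (simp add: m_def)
   let ?h = "%s. if s <= a n then f m s else f n s"
   have "sol R ?h" using eq[of m] by (intro sol_glue(1)[OF f f]) (simp_all add: mn)
   moreover have "\<forall>\<^sub>F s in nhds t. s \<in> {a m<..<a (n + 1)}"
    using a[of m] a[of n] T t by (intro eventually_nhds_in_open) (auto simp: mn)
   then have "\<forall>\<^sub>F s in nhds t. th s = ?h s"
    by eventually_elim (auto intro!: th simp: mn)
   ultimately show ?thesis by blast
  qed
 qed
 then show ?thesis using that th by blast
qed

text \<open>Zeros are \<open>2 * pi\<close> apart, so a rest may be followed by a flight in either
  direction. The integers \<open>k n\<close> record the position in whole turns, and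
  \<open>a n\<close> advances by the rest \<open>L n\<close> and the flight time \<open>T\<close>.
  The values during the flight with index 0 are included so that the initial condition can be met by
  shifting the start.\<close>

lemma alternating_solution:
 fixes R :: "real \<Rightarrow> real" and k0 :: int and up :: "int \<Rightarrow> bool"
 assumes c: "continuous_on UNIV R" and per: "!!xi k. R (xi + 2 * pi * of_int k) = R xi"
  and Rpos: "!!xi. [|al < xi; xi < al + 2 * pi|] ==> R xi > 0" and R0: "R al = 0"
  and int: "ker R integrable_on {al..al + 2 * pi}" and L: "!!n. 0 <= L n"
 defines "T \<equiv> integral {al..al + 2 * pi} (ker R)"
 obtains th a where "sol R th" "alternates th al up L a" "a 0 = a0" "!!n. a (n + 1) = a n + L n + T" "T > 0"
  "!!t. [|a0 <= t; t <= a0 + L 0|] ==> th t = al + 2 * pi * of_int k0"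
  "!!xi. [|up 0; al < xi; xi < al + 2 * pi|] ==> th (a0 + L 0 + integral {al..xi} (ker R)) = xi + 2 * pi * of_int k0"
  "!!xi. [|up 0; al < xi; xi < al + 2 * pi|] ==> deriv th (a0 + L 0 + integral {al..xi} (ker R)) > 0"
  "!!xi. [|~ up 0; al < xi; xi < al + 2 * pi|] ==> th (a0 + L 0 + T - integral {al..xi} (ker R)) = xi + 2 * pi * of_int (k0 - 1)"
  "!!xi. [|~ up 0; al < xi; xi < al + 2 * pi|] ==> deriv th (a0 + L 0 + T - integral {al..xi} (ker R)) < 0"
  "!!n. (\<forall>m. up m) ==> th (a n) = al + 2 * pi * of_int (k0 + n)"
  "!!n. (\<forall>m. ~ up m) ==> th (a n) = al + 2 * pi * of_int (k0 - n)"
proof -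
 have ab: "al < al + 2 * pi" by simp
 have R0': "R (al + 2 * pi) = 0" using per[of al 1] R0 by simp
 have int': "ker R integrable_on {al..xi}" if "xi <= al + 2 * pi" for xi
  by (rule integrable_subinterval_real[OF int]) (use that in auto)
 have T: "T > 0" unfolding T_def by (rule ker_integral_pos[OF c int ab Rpos])
 have int'': "ker R integrable_on {al..xi}" if "al < xi" "xi < al + 2 * pi" for xi using that(2) by (intro int') simp
 obtain Ph where dep: "is_departure R al (al + 2 * pi) Ph"
  using departure[OF c ab Rpos R0 R0' int''] by blast
 note S = is_departureD(1)[OF dep] and Ph = is_departureD(2-8)[OF dep]
 have PhT: "Ph t = al + 2 * pi" if "T <= t" for t using Ph(6)[OF int] that by (simp add: T_def)
 have mono: "strict_mono_on {0..T} Ph" using Ph(7)[OF int] by (simp add: T_def)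
 obtain a where a: "a 0 = a0" "!!n. a (n + 1) = a n + (L n + T)" using int_recursion[of a0 "%n. L n + T"] by blast
 obtain k :: "int \<Rightarrow> int" where k: "k 0 = k0" "!!n. k (n + 1) = k n + (if up n then 1 else -1)"
  using int_recursion[of k0 "%n. if up n then 1 else -1"] by blast
 \<comment> \<open>An upward piece is the departure started at \<open>a n + L n\<close>. A downward
   piece is the reversed departure, which runs from \<open>al + 2 * pi\<close> to \<open>al\<close>;
   the offset \<open>k n - 1\<close> makes it start at the level \<open>k n\<close>.\<close>
 define f where "f n = (if up n then (%t. Ph (1 * t + (- a n - L n)) + 2 * pi * of_int (k n))
  else (%t. Ph (- 1 * t + (T + a n + L n)) + 2 * pi * of_int (k n - 1)))" for n
 have Sf: "sol R (f n)" for n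
 proof (cases "up n")
  case True
  show ?thesis unfolding f_def if_P[OF True] by (rule sol_translate(1)[OF sol_affine(1)[OF S] per]) simp
 next
  case False
  show ?thesis unfolding f_def if_not_P[OF False] by (rule sol_translate(1)[OF sol_affine(1)[OF S] per]) simp
 qed
 have df: "deriv (f n) t = (if up n then deriv Ph (t + (- a n - L n)) else - deriv Ph (- t + (T + a n + L n)))" for n t
 proof (cases "up n")
  case True
  show ?thesis unfolding f_def if_P[OF True]
   unfolding sol_translate(2)[OF sol_affine(1)[OF S disjI1[OF refl]] per] sol_affine(2)[OF S disjI1[OF refl]] by simp
 next
  case False
  show ?thesis unfolding f_def if_not_P[OF False]
   unfolding sol_translate(2)[OF sol_affine(1)[OF S disjI2[OF refl]] per] sol_affine(2)[OF S disjI2[OF refl]] by simp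
 qed
 have fk: "f n t = al + 2 * pi * of_int (k n)" if "t <= a n + L n" for n t
  using that Ph(1)[of "t + (- a n - L n)"] PhT[of "- t + (T + a n + L n)"] by (auto simp: f_def algebra_simps)
 have fk': "f n t = al + 2 * pi * of_int (k (n + 1))" if "a (n + 1) <= t" for n t
 proof (cases "up n")
  case True
  have "Ph (t + (- a n - L n)) = al + 2 * pi" by (rule PhT) (use that a(2)[of n] in simp)
  then show ?thesis unfolding k(2) by (simp add: f_def True ring_distribs)
 next
  case False
  have "Ph (- t + (T + a n + L n)) = al" by (rule Ph(1)) (use that a(2)[of n] in simp)
  then show ?thesis unfolding k(2) by (simp add: f_def False ring_distribs)
 qed
 have z: "R (al + 2 * pi * of_int j) = 0" for j using per[of al j] R0 by simp
 have eq: "f n (a (n + 1)) = f (n + 1) (a (n + 1))" for n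
  using fk'[of n "a (n + 1)"] fk[of "a (n + 1)" "n + 1"] L[of "n + 1"] by simp
 have deq: "deriv (f n) (a (n + 1)) = deriv (f (n + 1)) (a (n + 1))" for n
  using sol_deriv_at_zero[OF Sf, of n "a (n + 1)"] sol_deriv_at_zero[OF Sf, of "n + 1" "a (n + 1)"]
   fk'[of n "a (n + 1)"] fk[of "a (n + 1)" "n + 1"] L[of "n + 1"] z by simp
 have astep: "a n + T <= a (n + 1)" for n using a(2)[of n] L[of n] by simp
 obtain th where Sth: "sol R th" and th: "!!n t. [|a n <= t; t <= a (n + 1)|] ==> th t = f n t"
  using sol_chain[where a = a and f = f, OF T astep Sf eq deq] by blast
 have dth: "deriv th t = deriv (f n) t" if "a n < t" "t < a (n + 1)" for n t
 proof (rule sol_deriv_cong[OF Sf])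
  have "\<forall>\<^sub>F s in nhds t. s \<in> {a n<..<a (n + 1)}" using that by (intro eventually_nhds_in_open) auto
  then show "\<forall>\<^sub>F s in nhds t. th s = f n s" by eventually_elim (auto intro!: th)
 qed
 have Iin: "0 < integral {al..xi} (ker R)" "integral {al..xi} (ker R) < T" if "al < xi" "xi < al + 2 * pi" for xi
 proof -
  show "0 < integral {al..xi} (ker R)" using that int'[of xi] Rpos by (intro ker_integral_pos[OF c]) auto
  have "ker R integrable_on {xi..al + 2 * pi}" by (rule integrable_subinterval_real[OF int]) (use that in auto)
  then have "0 < integral {xi..al + 2 * pi} (ker R)" using that Rpos by (intro ker_integral_pos[OF c]) auto
  moreover have "integral {al..xi} (ker R) + integral {xi..al + 2 * pi} (ker R) = T"
   unfolding T_def using that int by (intro Henstock_Kurzweil_Integration.integral_combine) auto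
  ultimately show "integral {al..xi} (ker R) < T" by simp
 qed
 have alt: "alternates th al up L a"
  unfolding alternates_def
 proof (intro exI[of _ k] allI conjI ballI)
  fix n
  have a1: "a (n + 1) = a n + L n + T" using a(2) by simp
  show "th t = al + 2 * pi * of_int (k n)" if "t \<in> {a n..a n + L n}" for t
   using th[of n t] fk[of t n] that a1 T by simp
  show "a n + L n < a (n + 1)" using a1 T by simp
  have up_mono: "strict_mono_on {a n + L n..a (n + 1)} th" if "up n"
  proof (rule strict_mono_onI)
   fix s t assume st: "s \<in> {a n + L n..a (n + 1)}" "t \<in> {a n + L n..a (n + 1)}" "s < t"
   then have "Ph (s + (- a n - L n)) < Ph (t + (- a n - L n))" using a1 by (intro strict_mono_onD[OF mono]) auto
   then show "th s < th t" using st L[of n] th[of n s] th[of n t] that by (simp add: f_def)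
  qed
  have down_mono: "strict_antimono_on {a n + L n..a (n + 1)} th" if "~ up n"
  proof (rule monotone_onI)
   fix s t assume st: "s \<in> {a n + L n..a (n + 1)}" "t \<in> {a n + L n..a (n + 1)}" "s < t"
   then have "Ph (- t + (T + a n + L n)) < Ph (- s + (T + a n + L n))" using a1 by (intro strict_mono_onD[OF mono]) auto
   then show "th t < th s" using st L[of n] th[of n s] th[of n t] that by (simp add: f_def)
  qed
  show "if up n then k (n + 1) = k n + 1 & strict_mono_on {a n + L n..a (n + 1)} th
    else k (n + 1) = k n - 1 & strict_antimono_on {a n + L n..a (n + 1)} th"
   using up_mono down_mono k(2) by simp
 qed
 have a01: "a 1 = a0 + L 0 + T" using a(2)[of 0] a(1) by simp
 show ?thesis
 proof (rule that[OF Sth alt a(1) _ T])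
  show "a (n + 1) = a n + L n + T" for n using a(2) by simp
  show "th t = al + 2 * pi * of_int k0" if "a0 <= t" "t <= a0 + L 0" for t
   using th[of 0 t] fk[of t 0] that a01 a(1) k(1) T by simp
 next
  fix xi assume u: "up 0" and xi: "al < xi" "xi < al + 2 * pi"
  let ?t = "a0 + L 0 + integral {al..xi} (ker R)"
  have t: "a 0 < ?t" "?t < a (0 + 1)" using Iin[OF xi] L[of 0] a01 a(1) by auto
  show "th ?t = xi + 2 * pi * of_int k0"
   using th[of 0 ?t] t u Ph(4)[OF xi] a(1) k(1) by (simp add: f_def)
  show "deriv th ?t > 0" using dth[OF t] df[of 0 ?t] u Ph(5)[OF xi] a(1) by simp
 next
  fix xi assume u: "~ up 0" and xi: "al < xi" "xi < al + 2 * pi"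
  let ?t = "a0 + L 0 + T - integral {al..xi} (ker R)"
  have t: "a 0 < ?t" "?t < a (0 + 1)" using Iin[OF xi] L[of 0] a01 a(1) by auto
  have e: "- ?t + (T + a 0 + L 0) = integral {al..xi} (ker R)" using a(1) by simp
  show "th ?t = xi + 2 * pi * of_int (k0 - 1)"
   using th[of 0 ?t] t u Ph(4)[OF xi] e k(1) by (simp add: f_def)
  show "deriv th ?t < 0" using dth[OF t] df[of 0 ?t] u Ph(5)[OF xi] e by simp
 next
  fix n :: int assume u: "\<forall>m. up m"
  have "k n = k0 + n"
  proof (induction n rule: int_induct[where k = 0])
   case (step2 i) then show ?case using k(2)[of "i - 1"] u by simp
  qed (use k u in auto)
  then show "th (a n) = al + 2 * pi * of_int (k0 + n)"
   using th[of n "a n"] fk[of "a n" n] astep[of n] T L[of n] by simp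
 next
  fix n :: int assume u: "\<forall>m. ~ up m"
  have "k n = k0 - n"
  proof (induction n rule: int_induct[where k = 0])
   case (step2 i) then show ?case using k(2)[of "i - 1"] u by simp
  qed (use k u in auto)
  then show "th (a n) = al + 2 * pi * of_int (k0 - n)"
   using th[of n "a n"] fk[of "a n" n] astep[of n] T L[of n] by simp
 qed
qed

text \<open>The adjacent flights are strictly monotone, so the value at the rest is taken neither
  just before nor just after it.\<close>

lemma alternates_maximal:
 assumes "alternates th c up L a" and L: "0 < L n"
 shows "maximal_constancy th (th (a n)) (a n) (a n + L n)"
proof -
 obtain k where k0: "\<forall>n. (\<forall>t\<in>{a n..a n + L n}. th t = c + 2 * pi * of_int (k n)) & a n + L n < a (n + 1) &
    (if up n then k (n + 1) = k n + 1 & strict_mono_on {a n + L n..a (n + 1)} th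
    else k (n + 1) = k n - 1 & strict_antimono_on {a n + L n..a (n + 1)} th)"
  using assms(1) unfolding alternates_def by (elim exE)
 have k: "!!t. t \<in> {a n..a n + L n} ==> th t = c + 2 * pi * of_int (k n)" "a n + L n < a (n + 1)"
  "strict_mono_on {a n + L n..a (n + 1)} th \<or> strict_antimono_on {a n + L n..a (n + 1)} th" for n
  using k0[rule_format, of n] by (auto split: if_splits)
 have ne: "th s ~= th t" if "s \<in> {a n + L n..a (n + 1)}" "t \<in> {a n + L n..a (n + 1)}" "s < t" for s t n
  using k(3)[of n]
 proof
  assume "strict_mono_on {a n + L n..a (n + 1)} th"
  from strict_mono_onD[OF this that] show ?thesis by simp
 next
  assume "strict_antimono_on {a n + L n..a (n + 1)} th"
  from monotone_onD[OF this that] show ?thesis by simp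
 qed
 show ?thesis
  unfolding maximal_constancy_def
 proof (intro conjI ballI allI impI)
  show "th t = th (a n)" if "t \<in> {a n..a n + L n}" for t using k(1)[of t n] k(1)[of "a n" n] that L by simp
  fix a' b' assume *: "a' <= a n & a n + L n <= b' & (\<forall>t\<in>{a'..b'}. th t = th (a n))"
  then have a': "a' <= a n" and b': "a n + L n <= b'" by blast+
  have th: "th t = th (a n)" if "a' <= t" "t <= b'" for t
   using *[THEN conjunct2, THEN conjunct2] that by (meson atLeastAtMost_iff)
  show "a' = a n"
  proof (rule ccontr)
   assume "a' ~= a n"
   define m where "m = n - 1"
   have mn: "n = m + 1" by (simp add: m_def)
   define s where "s = max a' (a m + L m)"
   have s: "s < a n" "a' <= s" "a m + L m <= s" using a' \<open>a' ~= a n\<close> k(2)[of m] by (auto simp: s_def mn)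
   have "th s = th (a n)" by (rule th) (use s b' L in auto)
   moreover have "th s ~= th (a n)" by (rule ne[of _ m]) (use s in \<open>auto simp: mn\<close>)
   ultimately show False by blast
  qed
  show "b' = a n + L n"
  proof (rule ccontr)
   assume "b' ~= a n + L n"
   define s where "s = min b' (a (n + 1))"
   have s: "a n + L n < s" "s <= b'" "s <= a (n + 1)" using b' \<open>b' ~= a n + L n\<close> k(2)[of n] by (auto simp: s_def)
   have "th s = th (a n)" "th (a n + L n) = th (a n)" by (rule th; use s a' b' L in linarith)+
   moreover have "th (a n + L n) ~= th s" by (rule ne[of _ n]) (use s in auto)
   ultimately show False by simp
  qed
 qed
qed

subsection \<open>Existence of extremals with a given angle\<close>

lemma loc_lipschitz_inverse_sqrt:
 assumes q: "loc_lipschitz q" and e: "e > 0"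
 shows "loc_lipschitz (%t. 1 / sqrt (\<bar>q t\<bar> + e))"
proof (rule loc_lipschitz_compose[where f = "%x. 1 / sqrt (\<bar>x\<bar> + e)" and M = "1 / (e * sqrt e)", OF _ q])
 fix x y :: real
 define A B where "A = sqrt (\<bar>x\<bar> + e)" and "B = sqrt (\<bar>y\<bar> + e)"
 have AB: "sqrt e <= A" "sqrt e <= B" "0 < sqrt e" "A\<^sup>2 = \<bar>x\<bar> + e" "B\<^sup>2 = \<bar>y\<bar> + e" using e by (auto simp: A_def B_def)
 then have p: "0 < A" "0 < B" by linarith+
 have "\<bar>B - A\<bar> * (A + B) = \<bar>B\<^sup>2 - A\<^sup>2\<bar>"
  using p by (simp add: power2_eq_square square_diff_square_factored abs_mult)
 also have "\<dots> <= \<bar>x - y\<bar>" unfolding AB by linarith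
 finally have 1: "\<bar>B - A\<bar> * (A + B) <= \<bar>x - y\<bar>" .
 have "\<bar>B - A\<bar> * sqrt e <= \<bar>B - A\<bar> * (A + B)" using AB p by (intro mult_left_mono) auto
 then have 2: "\<bar>B - A\<bar> <= \<bar>x - y\<bar> / sqrt e" using 1 AB(3) by (simp add: pos_le_divide_eq)
 have "e = sqrt e * sqrt e" using e by simp
 also have "\<dots> <= A * B" using AB p by (intro mult_mono) auto
 finally have 3: "e <= A * B" .
 have "\<bar>1 / A - 1 / B\<bar> = \<bar>B - A\<bar> / (A * B)" using p by (simp add: divide_simps abs_mult)
 also have "\<dots> <= (\<bar>x - y\<bar> / sqrt e) / e" using 2 3 e p by (intro frac_le) auto
 finally show "\<bar>1 / A - 1 / B\<bar> <= 1 / (e * sqrt e) * \<bar>x - y\<bar>" by (simp add: mult.commute)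
qed

text \<open>If \<open>h\<close> has the same sign at both times, the increment is that of
  \<open>h^2\<close> up to sign. Otherwise \<open>h\<close> vanishes in between, and the two squares
  are bounded by the distances to that zero.\<close>

lemma loc_lipschitz_signed_square:
 assumes h: "continuous_on UNIV h" and q: "loc_lipschitz (%t. (h t)\<^sup>2)"
 shows "loc_lipschitz (%t. h t * \<bar>h t\<bar>)"
 unfolding loc_lipschitz_def
proof (intro allI)
 fix a b
 obtain C where C: "C > 0" "!!s t. [|s \<in> {a..b}; t \<in> {a..b}|] ==> \<bar>(h t)\<^sup>2 - (h s)\<^sup>2\<bar> <= C * \<bar>t - s\<bar>"
  using loc_lipschitzE[OF q, of a b] by blast
 have le: "\<bar>h t * \<bar>h t\<bar> - h s * \<bar>h s\<bar>\<bar> <= C * (t - s)" if st: "s \<in> {a..b}" "t \<in> {a..b}" "s <= t" for s t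
 proof (cases "h s * h t \<ge> 0")
  case True
  then have "\<bar>h t * \<bar>h t\<bar> - h s * \<bar>h s\<bar>\<bar> = \<bar>(h t)\<^sup>2 - (h s)\<^sup>2\<bar>"
   by (auto simp: zero_le_mult_iff power2_eq_square abs_if mult_neg_neg)
  then show ?thesis using C(2)[OF st(1,2)] st by simp
 next
  case False
  have c: "continuous_on {s..t} h" by (rule continuous_on_subset[OF h]) simp
  have "\<exists>m\<ge>s. m <= t & h m = 0"
  proof (cases "h s <= 0")
   case True
   then show ?thesis using False IVT'[of h s 0 t, OF _ _ st(3) c] by (auto simp: not_le mult_less_0_iff)
  next
   case notle: False
   then show ?thesis using False IVT2'[of h t 0 s, OF _ _ st(3) c] by (auto simp: not_le mult_less_0_iff)
  qed
  then obtain m where m: "s <= m" "m <= t" "h m = 0" by blast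
  have "(h s)\<^sup>2 <= C * (m - s)" "(h t)\<^sup>2 <= C * (t - m)"
   using C(2)[of s m] C(2)[of m t] st m by auto
  moreover have "\<bar>h t * \<bar>h t\<bar> - h s * \<bar>h s\<bar>\<bar> <= (h s)\<^sup>2 + (h t)\<^sup>2"
   using abs_triangle_ineq4[of "h t * \<bar>h t\<bar>" "h s * \<bar>h s\<bar>"] by (simp add: abs_mult power2_eq_square)
  ultimately show ?thesis by (simp add: algebra_simps)
 qed
 have "\<bar>h t * \<bar>h t\<bar> - h s * \<bar>h s\<bar>\<bar> <= C * \<bar>t - s\<bar>" if "s \<in> {a..b}" "t \<in> {a..b}" for s t
  using le[of s t] le[of t s] that by (cases "s <= t") (auto simp: abs_minus_commute)
 then show "\<exists>C. \<forall>s\<in>{a..b}. \<forall>t\<in>{a..b}. \<bar>h t * \<bar>h t\<bar> - h s * \<bar>h s\<bar>\<bar> <= C * \<bar>t - s\<bar>" by blast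
qed

text \<open>The functions \<open>h \<bar>h\<bar> / sqrt (h\<^sup>2 + ep)\<close> are locally Lipschitz and tend to \<open>h\<close>; their derivatives are
 dominated by a multiple of \<open>k\<close>.\<close>

lemma integral_of_root:
 fixes h k :: "real \<Rightarrow> real"
 assumes h: "continuous_on UNIV h" and q: "loc_lipschitz (%t. (h t)\<^sup>2)"
  and dq: "AE t in lebesgue. ((%t. (h t)\<^sup>2) has_real_derivative 2 * h t * k t) (at t)"
  and k: "k \<in> borel_measurable lebesgue" "!!t. \<bar>k t\<bar> <= B" and k0: "!!t. h t = 0 ==> k t = 0"
  and st: "s <= t"
 shows "(k has_integral h t - h s) {s..t}"
proof -
 define e :: "nat \<Rightarrow> real" where "e n = inverse (real (Suc n))" for n
 have e: "e n > 0" for n by (simp add: e_def)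
 have e0: "e \<longlonglongrightarrow> 0" unfolding e_def[abs_def] by (rule LIMSEQ_inverse_real_of_nat)
 define S where "S n t = sqrt ((h t)\<^sup>2 + e n)" for n t
 have S: "S n t > 0" "\<bar>h t\<bar> <= S n t" "(S n t)\<^sup>2 = (h t)\<^sup>2 + e n" for n t
  using e[of n] by (auto simp: S_def add_nonneg_pos intro: real_le_rsqrt)
 define p where "p n t = h t * \<bar>h t\<bar> / S n t" for n t
 \<comment> \<open>The derivative of \<open>p n\<close> is \<open>k * m n\<close>: with
   \<open>c = \<bar>h\<bar> / S n\<close> the quotient rule applied to \<open>h^2 / S n\<close>
   yields \<open>2 * c - c ^ 3\<close>. This tends to 1 where \<open>h\<close> is nonzero and is 0
   where \<open>h = 0\<close>.\<close>
 define m where "m n t = 2 * (\<bar>h t\<bar> / S n t) - (\<bar>h t\<bar> / S n t) ^ 3" for n t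
 have m: "\<bar>m n t\<bar> <= 2" for n t
 proof -
  define c where "c = \<bar>h t\<bar> / S n t"
  have c: "0 <= c" "c <= 1" using S[where n=n and t=t] by (auto simp: c_def)
  then have "0 <= c ^ 3" "c ^ 3 <= c" using power_decreasing[of 1 3 c] by auto
  then have "\<bar>2 * c - c ^ 3\<bar> <= 2" using c by linarith
  then show ?thesis by (simp add: m_def c_def)
 qed
 have lp: "loc_lipschitz (p n)" for n
 proof -
  have "loc_lipschitz (%t. (h t * \<bar>h t\<bar>) * (1 / sqrt (\<bar>(h t)\<^sup>2\<bar> + e n)))"
   by (intro loc_lipschitz_mult loc_lipschitz_signed_square[OF h q] loc_lipschitz_inverse_sqrt[OF q e])
  then show ?thesis by (simp add: p_def[abs_def] S_def)
 qed
 have dp: "(p n has_real_derivative k u * m n u) (at u)"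
  if d: "((%t. (h t)\<^sup>2) has_real_derivative 2 * h u * k u) (at u)" for n u
 proof (cases "h u = 0")
  case True
  have "((%y. ((h y)\<^sup>2 - (h u)\<^sup>2) / (y - u)) \<longlongrightarrow> 0) (at u)"
   using d True by (simp add: has_field_derivative_iff)
  then have "((%y. ((h y)\<^sup>2 - (h u)\<^sup>2) / (y - u) * (1 / sqrt (e n))) \<longlongrightarrow> 0 * (1 / sqrt (e n))) (at u)"
   by (intro tendsto_intros)
  then have l0: "((%y. \<bar>(h y)\<^sup>2 / (y - u) * (1 / sqrt (e n))\<bar>) \<longlongrightarrow> 0) (at u)"
   using True by (intro tendsto_rabs_zero) simp
  \<comment> \<open>At a zero of \<open>h\<close> the function \<open>p n\<close> is bounded by a
    multiple of \<open>h^2\<close>, whose derivative vanishes there, so no differentiability of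
    \<open>h\<close> is needed.\<close>
  have "((%y. (p n y - p n u) / (y - u)) \<longlongrightarrow> 0) (at u)"
  proof (rule Lim_null_comparison[OF _ l0], rule always_eventually, rule allI)
   fix y
   have "sqrt (e n) <= S n y" by (simp add: S_def)
   then have "\<bar>p n y\<bar> <= (h y)\<^sup>2 / sqrt (e n)"
    using S(1)[of n y] e[of n] by (auto simp: p_def abs_mult power2_eq_square[symmetric] intro!: divide_left_mono)
   then have "\<bar>p n y\<bar> / \<bar>y - u\<bar> <= (h y)\<^sup>2 / sqrt (e n) / \<bar>y - u\<bar>" by (rule divide_right_mono) simp
   then show "norm ((p n y - p n u) / (y - u)) <= \<bar>(h y)\<^sup>2 / (y - u) * (1 / sqrt (e n))\<bar>"
    using True e[of n] by (simp add: p_def abs_mult mult.commute)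
  qed
  then show ?thesis using True by (simp add: has_field_derivative_iff m_def)
 next
  case False
  define si where "si = sgn (h u)"
  have ev: "\<forall>\<^sub>F y in nhds u. h y * si > 0"
  proof -
   have "continuous_on UNIV (%y. h y * si)" by (intro continuous_intros h)
   then have "open {y. 0 < h y * si}" by (intro open_Collect_less) (auto intro!: continuous_intros)
   moreover have "u \<in> {y. 0 < h y * si}" using False by (simp add: si_def mult.commute sgn_mult_self_eq abs_sgn[symmetric])
   ultimately show ?thesis using eventually_nhds_in_open by fastforce
  qed
  have "\<forall>\<^sub>F y in nhds u. p n y = si * ((h y)\<^sup>2 / sqrt ((h y)\<^sup>2 + e n))"
   using ev by eventually_elim (use False in \<open>auto simp: p_def S_def si_def sgn_if power2_eq_square abs_if split: if_splits\<close>)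
  moreover have "((%y. si * ((h y)\<^sup>2 / sqrt ((h y)\<^sup>2 + e n))) has_real_derivative
    si * ((2 * h u * k u * sqrt ((h u)\<^sup>2 + e n) - (h u)\<^sup>2 * (2 * h u * k u / 2 / sqrt ((h u)\<^sup>2 + e n))) / (sqrt ((h u)\<^sup>2 + e n) * sqrt ((h u)\<^sup>2 + e n)))) (at u)"
  proof -
   have pos: "0 < (h u)\<^sup>2 + e n" using e[of n] by (simp add: add_nonneg_pos)
   have "((%y. sqrt ((h y)\<^sup>2 + e n)) has_real_derivative 2 * h u * k u / 2 / sqrt ((h u)\<^sup>2 + e n)) (at u)"
    using DERIV_chain2[OF DERIV_real_sqrt[OF pos] DERIV_add[OF d DERIV_const[of "e n"]]] by (simp add: field_simps)
   moreover have "sqrt ((h u)\<^sup>2 + e n) ~= 0" using S(1)[of n u] by (simp add: S_def)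
   ultimately show ?thesis by (intro DERIV_cmult DERIV_divide d)
  qed
  moreover have "si * ((2 * h u * k u * sqrt ((h u)\<^sup>2 + e n) - (h u)\<^sup>2 * (2 * h u * k u / 2 / sqrt ((h u)\<^sup>2 + e n))) / (sqrt ((h u)\<^sup>2 + e n) * sqrt ((h u)\<^sup>2 + e n))) = k u * m n u"
  proof -
   have "\<bar>h u\<bar> = si * h u" "\<bar>h u\<bar> ^ 3 = si * h u * (h u)\<^sup>2" by (auto simp: si_def sgn_if power3_eq_cube power2_eq_square)
   moreover have "si * si = 1" using False by (simp add: si_def sgn_if)
   ultimately show ?thesis unfolding S_def[symmetric] m_def
    using S(1)[of n u] by (simp add: field_simps power3_eq_cube power2_eq_square)
  qed
  ultimately show ?thesis using DERIV_cong_ev[OF refl] by metis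
 qed
 have int: "((%u. k u * m n u) has_integral p n t - p n s) {s..t}" for n
 proof (rule loc_lipschitz_has_integral[OF lp _ st])
  show "AE u in lebesgue. (p n has_real_derivative k u * m n u) (at u)"
   using dq by eventually_elim (rule dp)
 qed
 have lim: "(%n. h u * \<bar>h u\<bar> / S n u) \<longlonglongrightarrow> h u" and limm: "(%n. k u * m n u) \<longlonglongrightarrow> k u" for u
 proof -
  have SL: "(%n. S n u) \<longlonglongrightarrow> \<bar>h u\<bar>"
   unfolding S_def using tendsto_real_sqrt[OF tendsto_add[OF tendsto_const e0], of "(h u)\<^sup>2"] by simp
  show "(%n. h u * \<bar>h u\<bar> / S n u) \<longlonglongrightarrow> h u"
  proof (cases "h u = 0")
   case False
   then show ?thesis using tendsto_divide[OF tendsto_const SL, of "h u * \<bar>h u\<bar>"] by simp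
  qed simp
  show "(%n. k u * m n u) \<longlonglongrightarrow> k u"
  proof (cases "h u = 0")
   case False
   have c1: "(%n. \<bar>h u\<bar> / S n u) \<longlonglongrightarrow> 1"
    using tendsto_divide[OF tendsto_const SL, of "\<bar>h u\<bar>"] False by simp
   have "(%n. m n u) \<longlonglongrightarrow> 2 * 1 - 1 ^ 3" unfolding m_def by (intro tendsto_intros c1)
   then show ?thesis using tendsto_mult[OF tendsto_const, of "%n. m n u" 1 sequentially "k u"] by simp
  qed (simp add: k0)
 qed
 have B: "0 <= B" using k(2)[of 0] by simp
 have dom: "norm (k u * m n u) <= B * 2" for n u
  using mult_mono[OF k(2)[of u] m[of n u]] B by (simp add: abs_mult)
 have "k integrable_on {s..t}" "(%n. integral {s..t} (%u. k u * m n u)) \<longlonglongrightarrow> integral {s..t} k"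
  by (rule dominated_convergence[where h = "%u. B * 2" and f = "%n u. k u * m n u"];
    use int dom limm in \<open>auto simp: integrable_const_ivl has_integral_integrable\<close>)+
 moreover have "(%n. integral {s..t} (%u. k u * m n u)) \<longlonglongrightarrow> h t - h s"
  unfolding integral_unique[OF int] p_def by (intro tendsto_diff lim)
 ultimately have "integral {s..t} k = h t - h s" by (meson LIMSEQ_unique)
 then show ?thesis using \<open>k integrable_on {s..t}\<close> by (simp add: has_integral_integrable_integral)
qed

context plane_quasinorm
begin

text \<open>A measurable choice of \<open>r'\<close>: the right derivative is the pointwise limit of
  a sequence of continuous difference quotients.\<close>

lemma right_derivative_r:
 obtains rd where "rd \<in> borel_measurable borel" "!!xi. between_one_sided_derivs r xi (rd xi)"
proof -
 have "\<exists>d. (r has_real_derivative d) (at_right xi)" for xi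
  using l_right_derivative[of xi] r_derivative_of_l by blast
 then obtain rd where rd: "!!xi. (r has_real_derivative rd xi) (at_right xi)" by metis
 have lim: "(%n. (r (xi + inverse (real (Suc n))) - r xi) * real (Suc n)) \<longlonglongrightarrow> rd xi" for xi
 proof -
  have "(%n. xi + inverse (real (Suc n))) \<longlonglongrightarrow> xi"
   using tendsto_add[OF tendsto_const LIMSEQ_inverse_real_of_nat, of xi] by simp
  then have "filterlim (%n. xi + inverse (real (Suc n))) (at_right xi) sequentially"
   by (rule tendsto_imp_filterlim_at_right) (auto intro: always_eventually)
  from filterlim_compose[OF rd[of xi, unfolded has_field_derivative_iff] this]
  show ?thesis by (simp add: divide_inverse)
 qed
 have cr: "r \<in> borel_measurable borel" by (intro borel_measurable_continuous_onI continuous_r)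
 have "rd \<in> borel_measurable borel"
 proof (rule borel_measurable_LIMSEQ_real[OF lim])
  fix n
  have "continuous_on UNIV (%x. (r (x + inverse (real (Suc n))) - r x) * real (Suc n))"
   by (intro continuous_intros continuous_on_compose2[OF continuous_r[of UNIV]]) auto
  then show "(%x. (r (x + inverse (real (Suc n))) - r x) * real (Suc n)) \<in> borel_measurable borel"
   by (rule borel_measurable_continuous_onI)
 qed
 moreover have "between_one_sided_derivs r xi (rd xi)" for xi
 proof -
  obtain dl where "(r has_real_derivative dl) (at_left xi)"
   using l_left_derivative[of xi] r_derivative_of_l by blast
  then show ?thesis unfolding between_one_sided_derivs_def using rd[of xi] by blast
 qed
 ultimately show ?thesis by (rule that)
qed

lemma angle_rhs_energy:
 "angle_rhs F (ph1, ph2, ph3, ph4, ph5) xi =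
  2 * (energy (ph1, ph2, ph3, ph4, ph5) - (ph5 * (r xi * cos xi) - ph4 * (r xi * sin xi))) / r xi ^ 4"
 by (simp add: algebra_simps)

text \<open>The function \<open>h = r^2 * th'\<close> has to equal
  \<open>ph3 + ph4 * x + ph5 * y\<close>, where \<open>x\<close> and \<open>y\<close> are the
  integrals of the control. Only its square is known to be differentiable almost everywhere, and the
  square root is taken by \<open>integral_of_root\<close>.\<close>

theorem ex_extremal_with:
 fixes ph1 ph2 ph3 ph4 ph5
 defines "E \<equiv> energy (ph1, ph2, ph3, ph4, ph5)"
 assumes nz: "ph4\<^sup>2 + ph5\<^sup>2 ~= 0" and S: "sol (angle_rhs F (ph1, ph2, ph3, ph4, ph5)) th"
  and E: "E > 0" "!!xi. ph5 * (r xi * cos xi) - ph4 * (r xi * sin xi) <= E"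
  and init: "r (th 0) * cos (th 0) = ph1" "r (th 0) * sin (th 0) = ph2" "(r (th 0))\<^sup>2 * deriv th 0 = ph3"
 shows "\<exists>g. extremal_with F (ph1, ph2, ph3, ph4, ph5) g th"
proof -
 define L where "L xi = ph5 * (r xi * cos xi) - ph4 * (r xi * sin xi)" for xi
 define h where "h t = (r (th t))\<^sup>2 * deriv th t" for t
 have rn: "r xi ~= 0" for xi using r_pos[of xi] by simp
 have hq: "(h t)\<^sup>2 = 2 * (E - L (th t))" for t
 proof -
  have "(h t)\<^sup>2 = r (th t) ^ 4 * (deriv th t)\<^sup>2" by (simp add: h_def power_mult_distrib)
  also have "\<dots> = 2 * (E - L (th t))" unfolding sol_eq[OF S] angle_rhs_energy using rn[of "th t"] by (simp add: E_def L_def)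
  finally show ?thesis .
 qed
 have cth: "continuous_on A th" for A by (rule sol_continuous[OF S])
 have crth: "continuous_on A (%t. r (th t))" for A by (rule continuous_on_compose2[OF continuous_r cth]) auto
 have ch: "continuous_on UNIV h" unfolding h_def[abs_def] by (intro continuous_intros crth sol_continuous_deriv[OF S])
 have lipth: "loc_lipschitz th" by (rule C1_imp_loc_lipschitz[OF sol_deriv[OF S] sol_continuous_deriv[OF S]])
 obtain M where M: "!!a b. \<bar>r a - r b\<bar> <= M * \<bar>a - b\<bar>" using r_Lipschitz by blast
 have lipr: "loc_lipschitz (%t. r (th t))" by (rule loc_lipschitz_compose[OF M lipth])
 have lips: "loc_lipschitz (%t. sin (th t))" "loc_lipschitz (%t. cos (th t))"
  by (rule loc_lipschitz_compose[OF abs_sin_diff_le lipth], rule loc_lipschitz_compose[OF abs_cos_diff_le lipth])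
 have lipq: "loc_lipschitz (%t. (h t)\<^sup>2)" unfolding hq L_def by (intro loc_lipschitz_mult loc_lipschitz_diff loc_lipschitz_const lipr lips)
 obtain rd where rd: "rd \<in> borel_measurable borel" "!!xi. between_one_sided_derivs r xi (rd xi)"
  using right_derivative_r by blast
 \<comment> \<open>Where \<open>h = 0\<close>, the value is the line parameter from
   \<open>supp_eq\<close> of the control \<open>(ph5, - ph4) / E\<close>; elsewhere the right
   derivative of \<open>r\<close> is used.\<close>
 define rh where "rh t = (if h t = 0 then (r (th t))\<^sup>2 * (ph5 / E * sin (th t) - (- ph4 / E) * cos (th t)) else rd (th t))" for t
 have thb: "th \<in> borel_measurable borel" by (rule borel_measurable_continuous_onI[OF cth])
 have "continuous_on UNIV (%t. (r (th t))\<^sup>2 * (ph5 / E * sin (th t) - (- ph4 / E) * cos (th t)))"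
  by (intro continuous_intros cth crth)
 note [measurable] = borel_measurable_continuous_onI[OF this] borel_measurable_continuous_onI[OF ch] measurable_compose[OF thb rd(1)]
 have "rh \<in> borel_measurable borel" unfolding rh_def by measurable
 then have rhm: "rh \<in> borel_measurable lebesgue" by (simp add: measurable_completion)
 have sp: "supp1 (th t) (rh t) = ph5 / E" "supp2 (th t) (rh t) = - ph4 / E" if "h t = 0" for t
 proof -
  have "L (th t) = E" using hq[of t] that by simp
  then have "r (th t) * cos (th t) * (ph5 / E) + r (th t) * sin (th t) * (- ph4 / E) = 1"
   using E(1) by (simp add: L_def field_simps)
  from supp_eq[OF this] show "supp1 (th t) (rh t) = ph5 / E" "supp2 (th t) (rh t) = - ph4 / E"
   using that by (simp_all add: rh_def)
 qed
 \<comment> \<open>This is where the bound \<open>L <= E\<close> enters: multiplied by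
   \<open>l xi / E\<close>, it is the inequality that puts the resting control into
   \<open>U\<close>.\<close>
 have uU: "(ph5 / E, - ph4 / E) \<in> U"
  unfolding in_U_iff_l
 proof
  fix xi
  have "r xi * (ph5 * cos xi - ph4 * sin xi) <= E" using E(2)[of xi] by (simp add: algebra_simps)
  then show "ph5 / E * cos xi + - ph4 / E * sin xi <= l xi"
   using E(1) l_pos[of xi] by (simp add: r_eq field_simps)
 qed
 have btw: "between_one_sided_derivs r (th t) (rh t)" for t
 proof (cases "h t = 0")
  case True then show ?thesis using uU sp[OF True] by (simp add: between_iff_supp_in_U)
 next
  case False then show ?thesis using rd(2) by (simp add: rh_def)
 qed
 define a where "a t = supp1 (th t) (rh t)" for t
 define b where "b t = supp2 (th t) (rh t)" for t
 have cl: "continuous_on UNIV (%t. sin (th t))" "continuous_on UNIV (%t. cos (th t))" by (intro continuous_intros cth)+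
 have cm: "f \<in> borel_measurable lebesgue" if "continuous_on UNIV f" for f :: "real \<Rightarrow> real"
  using borel_measurable_continuous_onI[OF that] by (simp add: measurable_completion)
 note [measurable] = rhm cm[OF cl(1)] cm[OF cl(2)] cm[OF crth]
 have am: "a \<in> borel_measurable lebesgue" "b \<in> borel_measurable lebesgue"
  unfolding a_def[abs_def] b_def[abs_def] supp1_def supp2_def by measurable
 obtain B where B: "!!a b. (a, b) \<in> U ==> \<bar>a\<bar> <= B & \<bar>b\<bar> <= B" using U_component_bound by blast
 have ab: "\<bar>a t\<bar> <= B" "\<bar>b t\<bar> <= B" for t
  using B btw[of t] unfolding between_iff_supp_in_U a_def b_def by blast+
 define x where "x t = (LINT ta=ereal 0..ereal t|lebesgue. a ta)" for t
 define y where "y t = (LINT ta=ereal 0..ereal t|lebesgue. b ta)" for t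
 have bd: "\<exists>B. \<forall>t\<in>{p..q}. \<bar>a t\<bar> <= B" "\<exists>B. \<forall>t\<in>{p..q}. \<bar>b t\<bar> <= B" for p q using ab by blast+
 note X = indefinite_integral_loc_bounded[OF am(1) bd(1), folded x_def]
 note Y = indefinite_integral_loc_bounded[OF am(2) bd(2), folded y_def]
 have dq: "AE t in lebesgue. ((%t. (h t)\<^sup>2) has_real_derivative 2 * h t * (ph4 * a t + ph5 * b t)) (at t)"
  using derivative_r_comp_AE[OF sol_deriv[OF S] btw]
 proof eventually_elim
  case (elim t)
  have d: "(th has_real_derivative deriv th t) (at t)" by (rule sol_deriv[OF S])
  have "((%t. 2 * (E - (ph5 * (r (th t) * cos (th t)) - ph4 * (r (th t) * sin (th t))))) has_real_derivative
    2 * (0 - (ph5 * (rh t * deriv th t * cos (th t) + - sin (th t) * deriv th t * r (th t))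
     - ph4 * (rh t * deriv th t * sin (th t) + cos (th t) * deriv th t * r (th t))))) (at t)"
   by (intro DERIV_cmult DERIV_diff DERIV_mult DERIV_const elim DERIV_chain2[OF DERIV_sin d] DERIV_chain2[OF DERIV_cos d])
  moreover have "2 * (0 - (ph5 * (rh t * deriv th t * cos (th t) + - sin (th t) * deriv th t * r (th t))
     - ph4 * (rh t * deriv th t * sin (th t) + cos (th t) * deriv th t * r (th t)))) = 2 * h t * (ph4 * a t + ph5 * b t)"
   using rn[of "th t"] by (simp add: a_def b_def supp1_def supp2_def h_def field_simps)
  ultimately show ?case unfolding hq L_def by simp
 qed
 have k0: "ph4 * a t + ph5 * b t = 0" if "h t = 0" for t using sp[OF that] by (simp add: a_def b_def)
 have km: "(%t. ph4 * a t + ph5 * b t) \<in> borel_measurable lebesgue" using am by measurable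
 have kB: "\<bar>ph4 * a t + ph5 * b t\<bar> <= \<bar>ph4\<bar> * B + \<bar>ph5\<bar> * B" for t
 proof -
  have "\<bar>ph4 * a t\<bar> <= \<bar>ph4\<bar> * B" "\<bar>ph5 * b t\<bar> <= \<bar>ph5\<bar> * B" using ab[of t] by (auto simp: abs_mult intro: mult_left_mono)
  then show ?thesis by linarith
 qed
 \<comment> \<open>The condition that \<open>ph4 * a + ph5 * b\<close> vanishes with
   \<open>h\<close> is the orthogonality built into the resting control.\<close>
 have root: "((%t. ph4 * a t + ph5 * b t) has_integral h t - h s) {s..t}" if "s <= t" for s t
  by (rule integral_of_root[OF ch lipq dq km kB _ that]) (rule k0)
 have inc: "h t - h s = (ph4 * x t + ph5 * y t) - (ph4 * x s + ph5 * y s)" if st: "s <= t" for s t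
 proof -
  have "((%t. ph4 * a t + ph5 * b t) has_integral ph4 * (x t - x s) + ph5 * (y t - y s)) {s..t}"
   by (intro has_integral_add has_integral_mult_right X(4) Y(4) st)
  from has_integral_unique[OF root[OF st] this] show ?thesis by (simp add: algebra_simps)
 qed
 have hx: "h t = ph3 + ph4 * x t + ph5 * y t" for t
  using inc[of 0 t] inc[of t 0] X(2) Y(2) init(3) by (cases "0 <= t") (auto simp: h_def)
 have dth: "(th has_real_derivative (ph3 + ph4 * x t + ph5 * y t) / (r (th t))\<^sup>2) (at t)" for t
  using sol_deriv[OF S, of t] rn[of "th t"] unfolding hx[symmetric] h_def by simp
 obtain z v w where "extremal_data F ph1 ph2 ph3 ph4 ph5 (%t. (x t, y t, z t, v t, w t)) th x y z v w rh"
  using ex_extremal_data[OF rhm btw x_def[unfolded a_def] y_def[unfolded b_def] dth init(1,2)] by blast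
 then show ?thesis using extremal_with_iff_data[OF nz] by blast
qed

end

subsection \<open>Intervals of constancy of the angle\<close>

lemma deriv_zero_on_constancy_interval:
 fixes f :: "real \<Rightarrow> real"
 assumes pq: "p < q" and f: "!!t. t \<in> {p..q} ==> f t = c" and t: "t \<in> {p..q}"
  and d: "(f has_real_derivative d) (at t)"
 shows "d = 0"
proof -
 have "(f has_vector_derivative d) (at t within cbox p q)"
  using has_field_derivative_at_within[OF d] by (simp add: has_real_derivative_iff_has_vector_derivative)
 moreover have "(f has_vector_derivative 0) (at t within cbox p q)"
  by (rule has_vector_derivative_transform[where f = "%t. c"]) (use t f in auto)
 ultimately show ?thesis
  using vector_derivative_unique_within_closed_interval[of p q t f d 0] pq t by simp
qed

lemma increment_eq_antiderivative:
 assumes f: "loc_lipschitz f" and ae: "AE t in lebesgue. t \<in> {p..q} --> (f has_real_derivative k t) (at t)"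
  and K: "!!t. (K has_real_derivative k t) (at t)" and s: "s \<in> {p..q}" "t \<in> {p..q}"
 shows "f t - f s = K t - K s"
proof -
 have "f t - f s = K t - K s" if st: "s <= t" "s \<in> {p..q}" "t \<in> {p..q}" for s t
 proof -
  have "(k has_integral f t - f s) {s..t}"
  proof (rule absolutely_continuous_has_integral[OF loc_lipschitz_absolutely_continuous[OF f] order_refl st(1)])
   show "AE u in lebesgue. u \<in> {s..t} --> (f has_real_derivative k u) (at u within {s..t})"
    using ae by eventually_elim (use st in \<open>auto intro: has_field_derivative_at_within\<close>)
  qed
  moreover have "(k has_integral K t - K s) {s..t}"
   by (rule fundamental_theorem_of_calculus[OF st(1)])
    (metis K has_field_derivative_at_within has_real_derivative_iff_has_vector_derivative)
  ultimately show ?thesis by (rule has_integral_unique)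
 qed
 from this[of s t] this[of t s] s show ?thesis by (cases "s <= t") auto
qed

context extremal_data
begin

abbreviation "E \<equiv> energy (ph1, ph2, ph3, ph4, ph5)"

lemma energy_eq: "ph5 * H1 t - ph4 * H2 t = E - (h3 t)\<^sup>2 / 2"
 unfolding h3_squared by (simp add: field_simps)

context
 fixes p q c
 assumes pq: "p < q" and const: "!!t. t \<in> {p..q} ==> th t = c" and nz: "ph4\<^sup>2 + ph5\<^sup>2 ~= 0"
begin

lemma h3_rest: "t \<in> {p..q} ==> h3 t = 0"
 using deriv_zero_on_constancy_interval[OF pq const _ th_deriv] deriv_th[of t] r_nonzero[of "th t"] by simp

lemma energy_rest: "ph5 * (r c * cos c) - ph4 * (r c * sin c) = E"
 using energy_eq[of p] h3_rest[of p] const[of p] pq by (simp add: H1_def H2_def)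

text \<open>On a rest \<open>h3\<close> vanishes identically, so its derivative
  \<open>ph4 * a + ph5 * b\<close> is 0. Together with \<open>H1 * a + H2 * b = 1\<close> this is a
  linear system with determinant \<open>E\<close>.\<close>

lemma control_rest:
 "AE t in lebesgue. t \<in> {p..q} --> E * a t = ph5 & E * b t = - ph4"
 using dx dy
proof eventually_elim
 case (elim t)
 show ?case
 proof
  assume t: "t \<in> {p..q}"
  have "(h3 has_real_derivative 0 + ph4 * a t + ph5 * b t) (at t)"
   unfolding h3_def[abs_def] by (intro DERIV_add DERIV_cmult DERIV_const elim)
  then have k: "ph4 * a t + ph5 * b t = 0"
   using deriv_zero_on_constancy_interval[OF pq h3_rest t] by simp
  have e: "E = ph5 * H1 t - ph4 * H2 t" using energy_eq[of t] h3_rest[OF t] by simp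
  have "E * a t = ph5 * (H1 t * a t + H2 t * b t) - H2 t * (ph4 * a t + ph5 * b t)"
   unfolding e by (simp add: algebra_simps)
  moreover have "E * b t = - ph4 * (H1 t * a t + H2 t * b t) + H1 t * (ph4 * a t + ph5 * b t)"
   unfolding e by (simp add: algebra_simps)
  ultimately show "E * a t = ph5 & E * b t = - ph4" unfolding k H_dot by simp
 qed
qed

text \<open>A statement that holds almost everywhere on a nondegenerate interval holds at some time.
  With \<open>E = 0\<close> it would force \<open>ph4 = ph5 = 0\<close>.\<close>

lemma energy_rest_nonzero: "E ~= 0" and control_rest_in_U: "(ph5 / E, - ph4 / E) \<in> U"
proof -
 have "\<exists>t\<in>{p..q}. E * a t = ph5 & E * b t = - ph4"
 proof (rule ccontr)
  assume neg: "~ ?thesis"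
  obtain N where N: "negligible N" "{t. ~ (t \<in> {p..q} --> E * a t = ph5 & E * b t = - ph4)} \<subseteq> N"
   using control_rest unfolding eventually_ae_filter_negligible by blast
  have "{p..q} \<subseteq> N" using N(2) neg by blast
  then have "negligible {p..q}" using N(1) negligible_subset by blast
  then show False using negligible_interval(1)[of p q] pq by (simp add: box_real)
 qed
 then obtain t where t: "E * a t = ph5" "E * b t = - ph4" by blast
 show E: "E ~= 0"
 proof
  assume "E = 0"
  then have "ph5 = 0" "ph4 = 0" using t unfolding \<open>E = 0\<close> by simp_all
  then show False using nz by simp
 qed
 have "a t = ph5 / E" "b t = - ph4 / E" using t E by (auto simp: field_simps)
 then show "(ph5 / E, - ph4 / E) \<in> U" using ab_in_U[of t] by simp
qed

lemma ab_rest: "AE t in lebesgue. t \<in> {p..q} --> a t = ph5 / E & b t = - ph4 / E"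
 using control_rest by eventually_elim (use energy_rest_nonzero in \<open>simp add: field_simps\<close>)

lemma h3_rest': "t \<in> {p..q} ==> ph5 * y t = - ph3 - ph4 * x t"
 using h3_rest[of t] by (simp add: h3_def)

lemma position_rest:
 assumes t0: "t0 \<in> {p..q}" and t: "t \<in> {p..q}"
 shows "x t = x t0 + ph5 / E * (t - t0)" "y t = y t0 - ph4 / E * (t - t0)" "z t = z t0 + ph3 / (2 * E) * (t - t0)"
  "v t = v t0 - ph3 * ph5 / (12 * E\<^sup>2) * (t - t0)\<^sup>2 + 1 / (12 * E) * (ph3 * x t0 - 6 * ph5 * z t0) * (t - t0)"
  "w t = w t0 + ph3 * ph4 / (12 * E\<^sup>2) * (t - t0)\<^sup>2 + 1 / (12 * E) * (ph3 * y t0 + 6 * ph4 * z t0) * (t - t0)"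
proof -
 define ep where "ep = E"
 have e: "ep ~= 0" unfolding ep_def by (rule energy_rest_nonzero)
 note ab = ab_rest[folded ep_def]
 have X: "x t = x t0 + ph5 / ep * (t - t0)" if t: "t \<in> {p..q}" for t
 proof -
  have "AE t in lebesgue. t \<in> {p..q} --> (x has_real_derivative ph5 / ep) (at t)"
   using ab dx by eventually_elim auto
  from increment_eq_antiderivative[OF lip(1) this DERIV_cmult_Id t0 t]
  show ?thesis unfolding right_diff_distrib by linarith
 qed
 have Y: "y t = y t0 - ph4 / ep * (t - t0)" if t: "t \<in> {p..q}" for t
 proof -
  have "AE t in lebesgue. t \<in> {p..q} --> (y has_real_derivative - ph4 / ep) (at t)"
   using ab dy by eventually_elim auto
  from increment_eq_antiderivative[OF lip(2) this DERIV_cmult_Id t0 t]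
  show ?thesis unfolding right_diff_distrib minus_divide_left[symmetric] mult_minus_left by linarith
 qed
 have Z: "z t = z t0 + ph3 / (2 * ep) * (t - t0)" if t: "t \<in> {p..q}" for t
 proof -
  have "AE t in lebesgue. t \<in> {p..q} --> (z has_real_derivative ph3 / (2 * ep)) (at t)"
   using ab dz
  proof eventually_elim
   case (elim t)
   show ?case
   proof
    assume t: "t \<in> {p..q}"
    have at: "a t = ph5 / ep" "b t = - ph4 / ep" using elim(1) t by blast+
    have "(x t * b t - y t * a t) / 2 = (- ph4 * x t - ph5 * y t) / (2 * ep)"
     unfolding at using e by (simp add: field_simps)
    also have "\<dots> = ph3 / (2 * ep)" using h3_rest'[OF t] by simp
    finally show "(z has_real_derivative ph3 / (2 * ep)) (at t)" using elim(2) by (simp only:)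
   qed
  qed
  from increment_eq_antiderivative[OF lip(3) this DERIV_cmult_Id t0 t]
  show ?thesis unfolding right_diff_distrib by linarith
 qed
 have V: "AE t in lebesgue. t \<in> {p..q} --> (v has_real_derivative
   - ph3 * ph5 / (12 * ep\<^sup>2) * (2 * (t - t0)) + 1 / (12 * ep) * (ph3 * x t0 - 6 * ph5 * z t0)) (at t)"
  using ab dv
 proof eventually_elim
  case (elim t)
  show ?case
  proof
   assume t: "t \<in> {p..q}"
   have at: "a t = ph5 / ep" "b t = - ph4 / ep" using elim(1) t by blast+
   have "- (z t + x t * y t / 6) / 2 * a t + (x t)\<^sup>2 / 12 * b t
     = - z t * ph5 / (2 * ep) - x t * (ph5 * y t) / (12 * ep) - (x t)\<^sup>2 * ph4 / (12 * ep)"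
    unfolding at using e by (simp add: field_simps)
   also have "\<dots> = - z t * ph5 / (2 * ep) + ph3 * x t / (12 * ep)"
    unfolding h3_rest'[OF t] using e by (simp add: field_simps power2_eq_square)
   also have "\<dots> = - ph3 * ph5 / (12 * ep\<^sup>2) * (2 * (t - t0)) + 1 / (12 * ep) * (ph3 * x t0 - 6 * ph5 * z t0)"
    unfolding X[OF t] Z[OF t] using e by (simp add: field_simps power2_eq_square)
   finally show "(v has_real_derivative - ph3 * ph5 / (12 * ep\<^sup>2) * (2 * (t - t0)) + 1 / (12 * ep) * (ph3 * x t0 - 6 * ph5 * z t0)) (at t)"
    using elim(2) by (simp only:)
  qed
 qed
 have W: "AE t in lebesgue. t \<in> {p..q} --> (w has_real_derivative
   ph3 * ph4 / (12 * ep\<^sup>2) * (2 * (t - t0)) + 1 / (12 * ep) * (ph3 * y t0 + 6 * ph4 * z t0)) (at t)"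
  using ab dw
 proof eventually_elim
  case (elim t)
  show ?case
  proof
   assume t: "t \<in> {p..q}"
   have at: "a t = ph5 / ep" "b t = - ph4 / ep" using elim(1) t by blast+
   have "- (y t)\<^sup>2 / 12 * a t - (z t - x t * y t / 6) / 2 * b t
     = - y t * (ph5 * y t) / (12 * ep) + z t * ph4 / (2 * ep) - x t * y t * ph4 / (12 * ep)"
    unfolding at using e by (simp add: field_simps power2_eq_square)
   also have "\<dots> = z t * ph4 / (2 * ep) + ph3 * y t / (12 * ep)"
    unfolding h3_rest'[OF t] using e by (simp add: field_simps power2_eq_square)
   also have "\<dots> = ph3 * ph4 / (12 * ep\<^sup>2) * (2 * (t - t0)) + 1 / (12 * ep) * (ph3 * y t0 + 6 * ph4 * z t0)"
    unfolding Y[OF t] Z[OF t] using e by (simp add: field_simps power2_eq_square)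
   finally show "(w has_real_derivative ph3 * ph4 / (12 * ep\<^sup>2) * (2 * (t - t0)) + 1 / (12 * ep) * (ph3 * y t0 + 6 * ph4 * z t0)) (at t)"
    using elim(2) by (simp only:)
  qed
 qed
 have dK: "((%t. A * (t - t0)\<^sup>2 + B * t) has_real_derivative A * (2 * (t - t0)) + B) (at t)" for A B t
  by (auto intro!: derivative_eq_intros)
 have quad: "A * (t - t0)\<^sup>2 + B * t - (A * (t0 - t0)\<^sup>2 + B * t0) = A * (t - t0)\<^sup>2 + B * (t - t0)" for A B
  by (simp add: algebra_simps)
 show "x t = x t0 + ph5 / E * (t - t0)" "y t = y t0 - ph4 / E * (t - t0)" "z t = z t0 + ph3 / (2 * E) * (t - t0)"
  using X[OF t] Y[OF t] Z[OF t] by (simp_all only: ep_def)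
 show "v t = v t0 - ph3 * ph5 / (12 * E\<^sup>2) * (t - t0)\<^sup>2 + 1 / (12 * E) * (ph3 * x t0 - 6 * ph5 * z t0) * (t - t0)"
  using increment_eq_antiderivative[OF lip(4) V dK t0 t] unfolding ep_def[symmetric] quad by linarith
 show "w t = w t0 + ph3 * ph4 / (12 * E\<^sup>2) * (t - t0)\<^sup>2 + 1 / (12 * E) * (ph3 * y t0 + 6 * ph4 * z t0) * (t - t0)"
  using increment_eq_antiderivative[OF lip(5) W dK t0 t] unfolding ep_def[symmetric] quad by linarith
qed

text \<open>The two forms differ only in how the relation \<open>h3 = 0\<close> is used: it
  eliminates \<open>y\<close> if \<open>ph5\<close> is nonzero and fixes \<open>x\<close>
  otherwise.\<close>

lemma formulas_B: "formulas_B_on (ph1, ph2, ph3, ph4, ph5) g p q"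
proof -
 define t0 where "t0 = closest_point {p..q} (0::real)"
 have t0: "t0 \<in> {p..q}" unfolding t0_def using pq by (intro closest_point_in_set) auto
 have B: "(ph5 ~= 0 --> g t = point_B1 (ph1, ph2, ph3, ph4, ph5) (g t0) (t - t0)) &
   (ph5 = 0 --> g t = point_B2 (ph1, ph2, ph3, ph4, ph5) (g t0) (t - t0))" if t: "t \<in> {p..q}" for t
 proof -
  note P = position_rest[OF t0 t] and k = h3_rest'[OF t0] h3_rest'[OF t] and e = energy_rest_nonzero
  have 1: "g t = point_B1 (ph1, ph2, ph3, ph4, ph5) (g t0) (t - t0)" if ph5: "ph5 ~= 0"
  proof -
   have y0: "y t0 = - (1 / ph5 * (ph3 + ph4 * x t0))" using k(1) ph5 by (simp add: field_simps)
   have yt: "y t = - ph4 / E * (t - t0) - 1 / ph5 * (ph3 + ph4 * x t0)" unfolding P(2) y0 by simp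
   have wt: "w t = w t0 + ph3 * ph4 / (12 * E\<^sup>2) * (t - t0)\<^sup>2
     + 1 / (12 * ph5 * E) * (6 * ph4 * ph5 * z t0 - ph3 * ph4 * x t0 - ph3\<^sup>2) * (t - t0)"
   proof -
    have "1 / (12 * E) * (ph3 * y t0 + 6 * ph4 * z t0) = 1 / (12 * ph5 * E) * (6 * ph4 * ph5 * z t0 - ph3 * ph4 * x t0 - ph3\<^sup>2)"
     unfolding y0 using ph5 e by (simp del: energy.simps add: field_simps power2_eq_square)
    then show ?thesis unfolding P(5) by (simp only:)
   qed
   show ?thesis unfolding g point_B1.simps Let_def using P(1,3,4) yt wt by (simp only: prod.inject simp_thms)
  qed
  have 2: "g t = point_B2 (ph1, ph2, ph3, ph4, ph5) (g t0) (t - t0)" if ph5: "ph5 = 0"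
  proof -
   have ph4: "ph4 ~= 0" using nz ph5 by auto
   have xt: "x t = - ph3 / ph4" "x t0 = - ph3 / ph4" using k ph5 ph4 by (simp_all add: field_simps)
   have vt: "v t = v t0 - ph3\<^sup>2 / (12 * ph4 * E) * (t - t0)"
   proof -
    have "- ph3 * ph5 / (12 * E\<^sup>2) * (t - t0)\<^sup>2 + 1 / (12 * E) * (ph3 * x t0 - 6 * ph5 * z t0) * (t - t0)
      = - ph3\<^sup>2 / (12 * ph4 * E) * (t - t0)"
     unfolding xt ph5 using ph4 by (simp del: energy.simps add: power2_eq_square)
    then show ?thesis unfolding P(4) by (simp del: energy.simps)
   qed
   show ?thesis unfolding g point_B2.simps Let_def using P(2,3,5) xt(1) vt by (simp only: prod.inject simp_thms)
  qed
  show ?thesis using 1 2 by blast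
 qed
 then show ?thesis unfolding formulas_B_on.simps Let_def t0_def by blast
qed

end

end

section \<open>Straight lines and their minimality\<close>

context plane_quasinorm
begin

text \<open>A calibration: a linear function of \<open>(x, y)\<close> with coefficients in the polar
  figure grows along admissible trajectories at rate at most 1.\<close>

lemma N_trajectory_le:
 assumes T: "0 <= T" and tr: "trajectory F {0..T} g u" and h: "N (h1, h2) <= 1"
 shows "h1 * (fst (g T) - fst (g 0)) + h2 * (fst (snd (g T)) - fst (snd (g 0))) <= T"
proof -
 have D: "fst (X_field q) = 1" "fst (Y_field q) = 0" "fst (snd (X_field q)) = 0" "fst (snd (Y_field q)) = 1" for q
  by (cases q rule: X_field.cases; simp)+
 have ac: "absolutely_continuous_on {0..T} g" and uU: "!!t. t \<in> {0..T} ==> u t \<in> U"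
  and ae: "AE t in lebesgue. t \<in> {0..T} --> (g has_vector_derivative
     (fst (u t) *\<^sub>R X_field (g t) + snd (u t) *\<^sub>R Y_field (g t))) (at t within {0..T})"
  using tr by (auto simp: trajectory_def)
 have nf: "norm (fst q) <= norm q" and ns: "norm (snd q') <= norm q'" for q :: "real \<times> 'a::real_normed_vector" and q' :: "'b::real_normed_vector \<times> 'c::real_normed_vector"
  using norm_fst_le[of "fst q" "snd q"] norm_snd_le[of "snd q'" "fst q'"] by simp_all
 have ac1: "absolutely_continuous_on {0..T} (%t. fst (g t))"
  by (rule absolutely_continuous_on_norm_le[OF ac]) (simp only: fst_diff[symmetric] nf)
 have ac2: "absolutely_continuous_on {0..T} (%t. fst (snd (g t)))"
  by (rule absolutely_continuous_on_norm_le[OF ac])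
   (simp only: fst_diff[symmetric] snd_diff[symmetric] order_trans[OF nf ns])
 have "((%t. fst (u t)) has_integral fst (g T) - fst (g 0)) {0..T}"
 proof (rule absolutely_continuous_has_integral[OF ac1 order_refl T])
  show "AE t in lebesgue. t \<in> {0..T} --> ((%t. fst (g t)) has_real_derivative fst (u t)) (at t within {0..T})"
   using ae
  proof eventually_elim
   case (elim t)
   show ?case
   proof
    assume "t \<in> {0..T}"
    from bounded_linear.has_vector_derivative[OF bounded_linear_fst elim[rule_format, OF this]]
    show "((%t. fst (g t)) has_real_derivative fst (u t)) (at t within {0..T})"
     by (simp add: D has_real_derivative_iff_has_vector_derivative)
   qed
  qed
 qed
 moreover have "((%t. snd (u t)) has_integral fst (snd (g T)) - fst (snd (g 0))) {0..T}"
 proof (rule absolutely_continuous_has_integral[OF ac2 order_refl T])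
  show "AE t in lebesgue. t \<in> {0..T} --> ((%t. fst (snd (g t))) has_real_derivative snd (u t)) (at t within {0..T})"
   using ae
  proof eventually_elim
   case (elim t)
   show ?case
   proof
    assume "t \<in> {0..T}"
    from bounded_linear.has_vector_derivative[OF bounded_linear_compose[OF bounded_linear_fst bounded_linear_snd] elim[rule_format, OF this]]
    show "((%t. fst (snd (g t))) has_real_derivative snd (u t)) (at t within {0..T})"
     by (simp add: D has_real_derivative_iff_has_vector_derivative)
   qed
  qed
 qed
 ultimately have "((%t. h1 * fst (u t) + h2 * snd (u t)) has_integral
   h1 * (fst (g T) - fst (g 0)) + h2 * (fst (snd (g T)) - fst (snd (g 0)))) {0..T}"
  by (intro has_integral_add has_integral_mult_right)
 moreover have "((%t. 1) has_integral T) {0..T}" using has_integral_const_real[of "1::real" 0 T] T by simp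
 moreover have "h1 * fst (u t) + h2 * snd (u t) <= 1" if "t \<in> {0..T}" for t
  using N_ge[OF uU[OF that], of "(h1, h2)"] h by (cases "u t") simp
 ultimately show ?thesis by (rule has_integral_le)
qed

lemma F_eq_1:
 assumes u: "(a, b) \<in> U" and h: "N (h1, h2) <= 1" "h1 * a + h2 * b = 1"
 shows "F (a, b) = 1"
proof (rule antisym)
 show "F (a, b) <= 1" using u by (simp add: U_iff)
 have "(a, b) ~= 0" using h(2) by (auto simp: zero_prod_def)
 then have p: "F (a, b) > 0" using F_eq_0[of "(a, b)"] F_nonneg[of "(a, b)"] by linarith
 then have "F ((1 / F (a, b)) *\<^sub>R (a, b)) = 1" using F_scale[of "1 / F (a, b)" "(a, b)"] by simp
 then have "(1 / F (a, b)) *\<^sub>R (a, b) \<in> U" by (simp only: U_iff order_refl)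
 from N_ge[OF this, of "(h1, h2)"] have "(h1 * a + h2 * b) / F (a, b) <= 1" using h(1) by (simp add: add_divide_distrib)
 then show "1 <= F (a, b)" using h(2) p by (simp add: field_simps)
qed

text \<open>The line itself is an admissible trajectory of the required duration. A momentum that
  pairs to 1 with its velocity calibrates it, so no trajectory between two of its points is
  faster.\<close>

lemma metric_straight_lineI:
 assumes u: "(a, b) \<in> U" and h: "N (h1, h2) <= 1" "h1 * a + h2 * b = 1"
 shows "metric_straight_line F (%t. (a * t, b * t, 0, 0, 0))" (is "metric_straight_line F ?g")
 unfolding metric_straight_line_def sub_Finsler_dist_def
proof (intro allI impI)
 fix t1 t2 :: real assume t: "t1 <= t2"
 let ?S = "{T. 0 <= T & (\<exists>g u. trajectory F {0..T} g u & g 0 = ?g t1 & g T = ?g t2)}"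
 have "trajectory F {0..t2 - t1} (%t. ?g (t1 + t)) (%t. (a, b))"
  unfolding trajectory_def
 proof (intro conjI ballI always_eventually allI impI)
  show "absolutely_continuous_on {0..t2 - t1} (%t. ?g (t1 + t))" by (intro loc_lipschitz_pt loc_lipschitz_mult loc_lipschitz_add loc_lipschitz_const loc_lipschitz_id)
  fix t
  have "((%t. ?g (t1 + t)) has_vector_derivative (a, b, 0, 0, 0)) (at t within {0..t2 - t1})"
   unfolding has_vector_derivative_pt_iff by (auto intro!: derivative_eq_intros)
  moreover have "fst (a, b) *\<^sub>R X_field (?g (t1 + t)) + snd (a, b) *\<^sub>R Y_field (?g (t1 + t)) = (a, b, 0, 0, 0)"
   by (simp add: power2_eq_square field_simps)
  ultimately show "((%t. ?g (t1 + t)) has_vector_derivative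
    fst (a, b) *\<^sub>R X_field (?g (t1 + t)) + snd (a, b) *\<^sub>R Y_field (?g (t1 + t))) (at t within {0..t2 - t1})" by (simp only:)
 qed (use u in auto)
 then have mem: "t2 - t1 \<in> ?S" using t by (intro CollectI conjI exI[of _ "%t. ?g (t1 + t)"] exI[of _ "%t. (a, b)"]) auto
 have low: "t2 - t1 <= T" if "T \<in> ?S" for T
 proof -
  from that obtain g u where T: "0 <= T" and tr: "trajectory F {0..T} g u" and g: "g 0 = ?g t1" "g T = ?g t2" by blast
  have "h1 * (a * t2 - a * t1) + h2 * (b * t2 - b * t1) <= T" using N_trajectory_le[OF T tr h(1)] unfolding g by simp
  moreover have "h1 * (a * t2 - a * t1) + h2 * (b * t2 - b * t1) = (h1 * a + h2 * b) * (t2 - t1)" by (simp add: algebra_simps)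
  ultimately show ?thesis using h(2) by simp
 qed
 show "Inf ?S = t2 - t1" by (rule cInf_eq_minimum[OF mem low])
qed

end

context extremal_data
begin

lemma rest_line:
 assumes const: "!!t. th t = c" and nz: "ph4\<^sup>2 + ph5\<^sup>2 ~= 0"
 shows "metric_line_A F (ph1, ph2, ph3, ph4, ph5) g"
proof -
 define ep where "ep = E"
 have I: "-(\<bar>t\<bar> + 1) < \<bar>t\<bar> + 1" "0 \<in> {-(\<bar>t\<bar> + 1)..\<bar>t\<bar> + 1}" "t \<in> {-(\<bar>t\<bar> + 1)..\<bar>t\<bar> + 1}" for t :: real by auto
 note I0 = I[of 0]
 have e: "ep ~= 0" unfolding ep_def by (rule energy_rest_nonzero[OF I0(1) const nz])
 have u: "(ph5 / ep, - ph4 / ep) \<in> U" unfolding ep_def by (rule control_rest_in_U[OF I0(1) const nz])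
 have ph3: "ph3 = 0" using h3_rest[OF I0(1) const nz I0(2)] at_0 by (simp add: h3_def)
 have gt: "g t = (ph5 / ep * t, - ph4 / ep * t, 0, 0, 0)" for t
  unfolding g using position_rest[OF I(1)[of t] const nz I(2)[of t] I(3)[of t], folded ep_def] at_0 ph3 by simp
 have h: "N (r c * cos c, r c * sin c) <= 1" using N_r[of c] by simp
 have dot: "r c * cos c * (ph5 / ep) + r c * sin c * (- ph4 / ep) = 1"
  using energy_rest[OF I0(1) const nz, folded ep_def] e by (simp add: field_simps)
 have "g = (%t. (ph5 / ep * t, - ph4 / ep * t, 0, 0, 0))" by (rule ext) (rule gt)
 then have line: "metric_straight_line F g" using metric_straight_lineI[OF u h dot] by simp
 have F1: "F (ph5 / ep, - ph4 / ep) = 1" by (rule F_eq_1[OF u h dot])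
 \<comment> \<open>The energy may be negative, and \<open>F\<close> is homogeneous only for
   nonnegative factors. The sign \<open>s\<close> of the energy is the sign in the line formulas, up
   to the signs of \<open>ph4\<close> and \<open>ph5\<close> on the coordinate axes.\<close>
 define s where "s = sgn ep"
 have s: "s * s = 1" "s \<in> {1, -1}" "\<bar>ep\<bar> = s * ep" "s / \<bar>ep\<bar> = 1 / ep" using e by (auto simp: s_def sgn_if)
 have sd: "s * k * t / \<bar>ep\<bar> = k / ep * t" for k t
 proof -
  have "s * k * t / \<bar>ep\<bar> = (s / \<bar>ep\<bar>) * (k * t)" by simp
  then show ?thesis unfolding s(4) by simp
 qed
 have Fs: "F (s * ph5, - s * ph4) = \<bar>ep\<bar>"
  using F_scale[of "\<bar>ep\<bar>" "(ph5 / ep, - ph4 / ep)"] F1 s(3) e by simp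
 have scale: "F (k * a, k * b) = k * F (a, b)" if "0 <= k" for k a b using F_scale[OF that, of "(a, b)"] by simp
 have "\<exists>s\<in>{1, -1}. line_A1 F s g \<or> line_A2 F s g \<or> line_A3 F (ph1, ph2, ph3, ph4, ph5) s g"
 proof -
  consider "ph5 = 0" "ph4 ~= 0" | "ph4 = 0" "ph5 ~= 0" | "ph4 * ph5 ~= 0" using nz by auto
  then show ?thesis
  proof cases
   case 1
   define s' where "s' = - s * sgn ph4"
   have s': "s' \<in> {1, -1}" "\<bar>ph4\<bar> * s' = - s * ph4" using s(2) 1 by (auto simp: s'_def sgn_if)
   have "\<bar>ph4\<bar> * F (0, s') = \<bar>ep\<bar>" using scale[of "\<bar>ph4\<bar>" 0 s'] Fs 1 s'(2) by simp
   then have "F (0, s') = \<bar>ep\<bar> / \<bar>ph4\<bar>" using 1 by (simp add: field_simps)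
   then have "s' * t / F (0, s') = (\<bar>ph4\<bar> * s') * t / \<bar>ep\<bar>" for t by simp
   then have "s' * t / F (0, s') = - ph4 / ep * t" for t unfolding s'(2) using sd[of "- ph4" t] by simp
   then have "line_A1 F s' g" unfolding line_A1_def gt using 1 by simp
   then show ?thesis using s'(1) by blast
  next
   case 2
   define s' where "s' = s * sgn ph5"
   have s': "s' \<in> {1, -1}" "\<bar>ph5\<bar> * s' = s * ph5" using s(2) 2 by (auto simp: s'_def sgn_if)
   have "\<bar>ph5\<bar> * F (s', 0) = \<bar>ep\<bar>" using scale[of "\<bar>ph5\<bar>" s' 0] Fs 2 s'(2) by simp
   then have "F (s', 0) = \<bar>ep\<bar> / \<bar>ph5\<bar>" using 2 by (simp add: field_simps)
   then have "s' * t / F (s', 0) = (\<bar>ph5\<bar> * s') * t / \<bar>ep\<bar>" for t by simp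
   then have "s' * t / F (s', 0) = ph5 / ep * t" for t unfolding s'(2) using sd[of ph5 t] by simp
   then have "line_A2 F s' g" unfolding line_A2_def gt using 2 by simp
   then show ?thesis using s'(1) by blast
  next
   case 3
   have "s * ph5 * t / F (s * ph5, - s * ph4) = ph5 / ep * t" for t
    unfolding Fs by (rule sd)
   then have "line_A3 F (ph1, ph2, ph3, ph4, ph5) s g" unfolding line_A3.simps gt Let_def using 3 by simp
   then show ?thesis using s(2) by blast
  qed
 qed
 then show ?thesis unfolding metric_line_A_def using line by blast
qed

end

subsection \<open>Solutions between and across the zeros\<close>

text \<open>The counterpart of \<open>constant_values\<close> for the scalar equation. The number
  \<open>si\<close> stands for \<open>ph3\<close>: the equation fixes the initial derivative up to
  sign, and \<open>si\<close> selects the sign, with no condition for \<open>si = 0\<close>.\<close>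

definition cv :: "(real \<Rightarrow> real) \<Rightarrow> real \<Rightarrow> real \<Rightarrow> real set \<Rightarrow> bool" where
 "cv R th0 si C \<longleftrightarrow>
  (\<forall>th a b c. sol R th & th 0 = th0 & (si = 0 \<or> 0 < si * deriv th 0) & a < b & (\<forall>t\<in>{a..b}. th t = c) --> c \<in> C) &
  (\<forall>c\<in>C. \<forall>L>0. \<exists>th a. sol R th & th 0 = th0 & (si = 0 \<or> 0 < si * deriv th 0) & maximal_constancy th c a (a + L))"

text \<open>A value held on a nondegenerate interval is a zero of \<open>R\<close>, so for the first
  half it is enough to find all zeros that a solution can reach.\<close>

lemma cvI:
 assumes "!!th c s. [|sol R th; th 0 = th0; si = 0 \<or> 0 < si * deriv th 0; th s = c; R c = 0|] ==> c \<in> C"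
  and "!!c L. [|c \<in> C; 0 < L|] ==>
   \<exists>th a. sol R th & th 0 = th0 & (si = 0 \<or> 0 < si * deriv th 0) & maximal_constancy th c a (a + L)"
 shows "cv R th0 si C"
 unfolding cv_def
proof (intro conjI allI impI ballI)
 fix th a b c assume *: "sol R th & th 0 = th0 & (si = 0 \<or> 0 < si * deriv th 0) & a < b & (\<forall>t\<in>{a..b}. th t = c)"
 then have "deriv th a = 0" using sol_deriv[of R th a] by (intro deriv_zero_on_constancy_interval[of a b th c a]) auto
 then have "R c = 0" using sol_eq[of R th a] * by simp
 then show "c \<in> C" using assms(1)[of th a c] * by auto
qed (use assms(2) in auto)

lemma cv_mirror:
 assumes "cv (%xi. R (- xi)) (- th0) (- si) C"
 shows "cv R th0 si (uminus ` C)"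
 unfolding cv_def
proof (intro conjI allI impI ballI)
 fix th a b c assume *: "sol R th & th 0 = th0 & (si = 0 \<or> 0 < si * deriv th 0) & a < b & (\<forall>t\<in>{a..b}. th t = c)"
 then have "sol (%xi. R (- xi)) (%t. - th t)" "deriv (%t. - th t) 0 = - deriv th 0" using sol_mirror by blast+
 then have "- c \<in> C" using * assms[unfolded cv_def, THEN conjunct1, rule_format, of "%t. - th t" a b "- c"] by simp
 then show "c \<in> uminus ` C" by force
next
 fix c and L :: real assume "c \<in> uminus ` C" and L: "0 < L"
 then obtain d where d: "c = - d" "d \<in> C" by blast
 obtain th a where "sol (%xi. R (- xi)) th & th 0 = - th0 & (- si = 0 \<or> 0 < - si * deriv th 0) & maximal_constancy th d a (a + L)"
  using assms[unfolded cv_def, THEN conjunct2, rule_format, OF d(2) L] by blast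
 then have *: "sol (%xi. R (- xi)) th" "th 0 = - th0" "- si = 0 \<or> 0 < - si * deriv th 0" "maximal_constancy th (- c) a (a + L)"
  using d(1) by auto
 have "sol R (%t. - th t)" "deriv (%t. - th t) 0 = - deriv th 0" using sol_mirror[OF *(1)] by simp_all
 then show "\<exists>th a. sol R th & th 0 = th0 & (si = 0 \<or> 0 < si * deriv th 0) & maximal_constancy th c a (a + L)"
  using *(2,3) maximal_constancy_minus[OF *(4)] by (intro exI[of _ "%t. - th t"] exI[of _ a]) auto
qed

lemma maximal_constancy_translate:
 "maximal_constancy (%t. th t + k) (c + k) a b \<longleftrightarrow> maximal_constancy th c a b"
 by (simp add: maximal_constancy_def)

lemma cv_translate:
 assumes cv: "cv R th0 si C" and per: "!!xi. R (xi + k) = R xi"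
 shows "cv R (th0 + k) si ((%xi. xi + k) ` C)"
 unfolding cv_def
proof (intro conjI allI impI ballI)
 have per': "R (xi + - k) = R xi" for xi using per[of "xi - k"] by simp
 fix th a b c assume *: "sol R th & th 0 = th0 + k & (si = 0 \<or> 0 < si * deriv th 0) & a < b & (\<forall>t\<in>{a..b}. th t = c)"
 then have S: "sol R th" by blast
 have "c - k \<in> C" using * sol_translate[OF S per'] cv[unfolded cv_def, THEN conjunct1, rule_format, of "%t. th t + - k" a b "c - k"] by simp
 then show "c \<in> (%xi. xi + k) ` C" by force
next
 fix c and L :: real assume "c \<in> (%xi. xi + k) ` C" and L: "0 < L"
 then obtain d where d: "c = d + k" "d \<in> C" by blast
 obtain th a where "sol R th & th 0 = th0 & (si = 0 \<or> 0 < si * deriv th 0) & maximal_constancy th d a (a + L)"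
  using cv[unfolded cv_def, THEN conjunct2, rule_format, OF d(2) L] by blast
 then have *: "sol R th" "th 0 = th0" "si = 0 \<or> 0 < si * deriv th 0" "maximal_constancy th d a (a + L)" "c = d + k"
  using d(1) by auto
 then show "\<exists>th a. sol R th & th 0 = th0 + k & (si = 0 \<or> 0 < si * deriv th 0) & maximal_constancy th c a (a + L)"
  using sol_translate[OF *(1) per] by (intro exI[of _ "%t. th t + k"] exI[of _ a]) (auto simp: maximal_constancy_translate)
qed

lemma attain:
 fixes f :: "real \<Rightarrow> real"
 assumes c: "continuous_on UNIV f" and "f s <= y" "y <= f t"
 shows "\<exists>u. f u = y"
proof (cases "s <= t")
 case True
 then show ?thesis using IVT'[of f s y t, OF assms(2,3) True continuous_on_subset[OF c]] by auto
next
 case False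
 then have "t <= s" by simp
 then show ?thesis using IVT2'[of f s y t, OF assms(2,3) _ continuous_on_subset[OF c]] by auto
qed

definition oriented_integral :: "(real \<Rightarrow> real) \<Rightarrow> real \<Rightarrow> real \<Rightarrow> real" where
 "oriented_integral f a b = (if a <= b then integral {a..b} f else - integral {b..a} f)"

text \<open>Targets below and negative initial derivatives are reduced to the rising case by
  reflecting the angle and reversing time; each of these changes one of the two signs in the
  argument.\<close>

lemma reach:
 assumes S: "sol R th" and d: "deriv th 0 ~= 0"
  and R: "!!et. [|et \<in> closed_segment (th 0) xi; et ~= xi|] ==> R et > 0"
  and i: "ker R integrable_on {min (th 0) xi..max (th 0) xi}"
 shows "th (sgn (deriv th 0) * oriented_integral (ker R) (th 0) xi) = xi"
proof -
 have up: "th (oriented_integral (ker R) (th 0) xi) = xi"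
  if S: "sol R th" and d: "deriv th 0 > 0" and x: "th 0 < xi"
   and R: "!!et. [|th 0 <= et; et < xi|] ==> R et > 0" and i: "ker R integrable_on {th 0..xi}" for R th xi
  using flight_reach(1)[OF S d x R i] x by (simp add: oriented_integral_def)
 consider "xi = th 0" | "th 0 < xi" | "xi < th 0" by linarith
 then show ?thesis
 proof cases
  case 1 then show ?thesis by (simp add: oriented_integral_def)
 next
  case 2
  have Rp: "R et > 0" if "th 0 <= et" "et < xi" for et using R[of et] that 2 by (simp add: closed_segment_eq_real_ivl)
  have ii: "ker R integrable_on {th 0..xi}" using i 2 by simp
  show ?thesis
  proof (cases "deriv th 0 > 0")
   case True then show ?thesis using up[OF S True 2 Rp ii] by simp
  next
   case False
   note r = sol_reverse[OF S, of 0]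
   have d': "deriv (%t. th (0 - t)) 0 > 0" unfolding r(2) using False d by simp
   have "th (0 - oriented_integral (ker R) (th (0 - 0)) xi) = xi"
    by (rule up[OF r(1) d']) (use 2 Rp ii in simp_all)
   then show ?thesis using False d by simp
  qed
 next
  case 3
  have Rp: "R (- et) > 0" if "- th 0 <= et" "et < - xi" for et using R[of "- et"] that 3 by (simp add: closed_segment_eq_real_ivl)
  have "ker R integrable_on {xi..th 0}" using i 3 by (simp add: min_def max_def)
  then have ii: "ker (%xi. R (- xi)) integrable_on {- th 0..- xi}" unfolding ker_mirror integral_mirror(2) .
  have o: "oriented_integral (ker (%xi. R (- xi))) (- th 0) (- xi) = - oriented_integral (ker R) (th 0) xi"
   using 3 unfolding oriented_integral_def ker_mirror by (simp add: integral_mirror(3))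
  note m = sol_mirror[OF S]
  show ?thesis
  proof (cases "deriv th 0 > 0")
   case False
   have d': "deriv (%t. - th t) 0 > 0" unfolding m(2) using False d by simp
   have "- th (oriented_integral (ker (%xi. R (- xi))) (- th 0) (- xi)) = - xi"
    by (rule up[OF m(1) d']) (use 3 Rp ii in simp_all)
   then show ?thesis using False d unfolding o by simp
  next
   case True
   note r = sol_reverse[OF m(1), of 0]
   have d': "deriv (%t. - th (0 - t)) 0 > 0" unfolding r(2) m(2) using True by simp
   have "- th (0 - oriented_integral (ker (%xi. R (- xi))) (- th (0 - 0)) (- xi)) = - xi"
    by (rule up[OF r(1) d']) (use 3 Rp ii in simp_all)
   then show ?thesis using True o by simp
  qed
 qed
qed

lemma inj_if_positive:
 assumes S: "sol R th" and R: "!!t. R (th t) > 0"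
 shows "inj th"
proof -
 have "th s ~= th t" if st: "s < t" for s t
 proof
  assume "th s = th t"
  moreover have "th differentiable (at x)" for x using sol_deriv[OF S] real_differentiable_def by blast
  ultimately obtain z where "(th has_real_derivative 0) (at z)"
   using Rolle[OF st _ sol_continuous[OF S]] by auto
  then have "deriv th z = 0" using sol_deriv[OF S, of z] DERIV_unique by blast
  then show False using sol_eq[OF S, of z] R[of z] by simp
 qed
 then show ?thesis by (intro linorder_injI)
qed

text \<open>One period of \<open>R\<close> at the maximal energy: an arc of positivity followed by
  an arc of zeros. The case \<open>be = al + 2 * pi\<close>, in which the zeros of a period shrink
  to one point, is included and behaves differently.\<close>

locale gap_ode =
 fixes R :: "real \<Rightarrow> real" and al be :: real
 assumes continuous_R: "continuous_on UNIV R" and periodic_R: "!!xi k. R (xi + 2 * pi * of_int k) = R xi"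
  and less: "al < be" and le: "be <= al + 2 * pi"
  and pos: "!!xi. [|al < xi; xi < be|] ==> R xi > 0"
  and zero: "!!xi. [|be <= xi; xi <= al + 2 * pi|] ==> R xi = 0"
begin

lemma periodic_1: "R (xi + 2 * pi) = R xi" "R (xi + - 2 * pi) = R xi"
 using periodic_R[of xi 1] periodic_R[of xi "-1"] by simp_all

lemma zero_low: "R xi = 0" if "be - 2 * pi <= xi" "xi <= al"
 using zero[of "xi + 2 * pi"] that by (simp add: periodic_1)

lemma R_ends: "R al = 0" "R be = 0" using zero[of be] zero_low[of al] le by auto

lemma mirrored: "gap_ode (%xi. R (- xi)) (- be) (- al)"
proof
 show "continuous_on UNIV (%xi. R (- xi))" by (intro continuous_on_compose2[OF continuous_R] continuous_intros) auto
 show "R (- (xi + 2 * pi * of_int k)) = R (- xi)" for xi k using periodic_R[of "- xi" "- k"] by (simp add: algebra_simps)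
qed (use less le pos zero_low in auto)

lemma ker_sub: "ker R integrable_on {p'..q'}" if "ker R integrable_on {p..q}" "p <= p'" "q' <= q"
 by (rule integrable_subinterval_real[OF that(1)]) (use that in auto)

lemma ker_inside: "ker R integrable_on {p..q}" if "al < p" "q < be"
 by (intro integrable_continuous_real ker_continuous[OF continuous_R] pos) (use that in auto)

lemma ker_from_left: "ker R integrable_on {al..y}" if "ker R integrable_on {al..x}" "al < x" "y < be"
proof (cases "y <= x")
 case True then show ?thesis using ker_sub[OF that(1)] by simp
next
 case False then show ?thesis using Henstock_Kurzweil_Integration.integrable_combine[OF _ _ that(1) ker_inside[of x y]] that by simp
qed

lemma ker_whole: "ker R integrable_on {al..be}"
 if "ker R integrable_on {al..x}" "ker R integrable_on {x..be}" "al <= x" "x <= be"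
 using Henstock_Kurzweil_Integration.integrable_combine[OF that(3,4,1,2)] .

text \<open>A nondegenerate arc of zeros cannot be crossed, so crossing \<open>be\<close> means that
  the zero is isolated. Departure upwards from it then shows convergence at \<open>al\<close>, which
  is the same zero up to a full turn.\<close>

lemma cross_up:
 assumes S: "sol R th" and s: "th s <= be" and t: "be < th t"
 shows "be = al + 2 * pi" "\<exists>x. al < x & x < be & ker R integrable_on {al..x}"
proof -
 note ca = sol_continuous[OF S, of UNIV]
 obtain u where u: "th u = be" using attain[OF ca s, of t] t by auto
 show eq: "be = al + 2 * pi"
 proof (rule ccontr)
  assume "be ~= al + 2 * pi"
  then have lt: "be < al + 2 * pi" using le by simp
  obtain u' where "th u' = min (th t) (al + 2 * pi)" using attain[OF ca, of s "min (th t) (al + 2 * pi)" t] s t lt by auto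
  from no_flat_crossing[OF S _ u this] show False using t lt zero by auto
 qed
 define x where "x = min (th t - 2 * pi) ((al + be) / 2)"
 have x: "al < x" "x < be" "x + 2 * pi <= th t" using t eq less by (auto simp: x_def min_less_iff_disj)
 obtain u' where u': "th u' = x + 2 * pi" using attain[OF ca, of s "x + 2 * pi" t] s x eq by auto
 have "ker R integrable_on {al..x}"
  by (rule connect_integrable[OF sol_translate(1)[OF S periodic_1(2)], of al x u u']) (use x u u' eq pos in auto)
 then show "\<exists>x. al < x & x < be & ker R integrable_on {al..x}" using x by blast
qed

lemma cross_down:
 assumes S: "sol R th" and s: "al <= th s" and t: "th t < al"
 shows "be = al + 2 * pi" "\<exists>x. al < x & x < be & ker R integrable_on {x..be}"
proof -
 interpret M: gap_ode "%xi. R (- xi)" "- be" "- al" by (rule mirrored)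
 note C = M.cross_up[OF sol_mirror(1)[OF S], of s t]
 show "be = al + 2 * pi" using C(1) s t by simp
 obtain x where x: "- be < x" "x < - al" "ker (%xi. R (- xi)) integrable_on {- be..x}" using C(2) s t by auto
 have "ker R integrable_on {- x..be}" using x(3) integral_mirror(2)[of "ker R" "be" "- x"] by (simp add: ker_mirror)
 then show "\<exists>x. al < x & x < be & ker R integrable_on {x..be}" using x by (intro exI[of _ "- x"]) auto
qed

text \<open>The arc of zeros preceding \<open>al\<close> can be left upwards only from
  \<open>al\<close> itself, since movement inside it is impossible; the departure takes finite
  time.\<close>

lemma leave_flat_up:
 assumes S: "sol R th" and s: "be - 2 * pi <= th s" "th s <= al" and t: "th s < th t"
 shows "th s = al" "\<exists>x. al < x & x < be & ker R integrable_on {al..x}"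
proof -
 note ca = sol_continuous[OF S, of UNIV]
 show eq: "th s = al"
 proof (rule ccontr)
  assume "th s ~= al"
  then have lt: "th s < al" using s by simp
  obtain u' where u': "th u' = min (th t) al" using attain[OF ca, of s "min (th t) al" t] t lt by auto
  show False
  proof (rule no_flat_crossing[OF S _ refl u'])
   show "R xi = 0" if "th s < xi" "xi < min (th t) al" for xi using that s by (intro zero_low) auto
  qed (use t lt in auto)
 qed
 define x where "x = min (th t) ((al + be) / 2)"
 have x: "al < x" "x < be" "x <= th t" using t eq less by (auto simp: x_def min_less_iff_disj)
 obtain u' where u': "th u' = x" using attain[OF ca, of s x t] x eq by auto
 have "ker R integrable_on {al..x}"
  by (rule connect_integrable[OF S, of al x s u']) (use x eq u' pos in auto)
 then show "\<exists>x. al < x & x < be & ker R integrable_on {al..x}" using x by blast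
qed

lemma leave_flat_down:
 assumes S: "sol R th" and s: "be - 2 * pi <= th s" "th s <= al" and t: "th t < th s"
 shows "th s = be - 2 * pi" "\<exists>x. al < x & x < be & ker R integrable_on {x..be}"
proof -
 interpret M: gap_ode "%xi. R (- xi)" "- be" "- al" by (rule mirrored)
 note C = M.leave_flat_up[OF sol_translate(1)[OF sol_mirror(1)[OF S] M.periodic_1(2)], of s t]
 show "th s = be - 2 * pi" using C(1) s t by simp
 obtain x where x: "- be < x" "x < - al" "ker (%xi. R (- xi)) integrable_on {- be..x}" using C(2) s t by auto
 have "ker R integrable_on {- x..be}" using x(3) integral_mirror(2)[of "ker R" "be" "- x"] by (simp add: ker_mirror)
 then show "\<exists>x. al < x & x < be & ker R integrable_on {x..be}" using x by (intro exI[of _ "- x"]) auto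
qed

lemma hit_left:
 assumes S: "sol R th" and s: "al < th s" "th s < be" and t: "th t <= al"
 shows "ker R integrable_on {al..th s}"
proof -
 obtain u where "th u = al" using attain[OF sol_continuous[OF S], of t al s] t s by auto
 then show ?thesis using connect_integrable[OF S s(1) _ refl] pos s by auto
qed

lemma hit_right:
 assumes S: "sol R th" and s: "al <= th s" "th s < be" and t: "be <= th t"
 shows "ker R integrable_on {th s..be}"
proof -
 obtain u where "th u = be" using attain[OF sol_continuous[OF S], of s be t] t s by auto
 then show ?thesis using connect_integrable[OF S s(2) refl] pos s by auto
qed

lemma pause_left:
 assumes i: "ker R integrable_on {al..x}" "al < x" and L: "0 < L"
 obtains B where "sol R B" "maximal_constancy B al 0 L" "B 0 = al"
  "!!xi. [|al < xi; xi < be|] ==> B (- integral {al..xi} (ker R)) = xi & deriv B (- integral {al..xi} (ker R)) < 0"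
  "!!xi. [|al < xi; xi < be|] ==> B (L + integral {al..xi} (ker R)) = xi & deriv B (L + integral {al..xi} (ker R)) > 0"
  "ker R integrable_on {al..be} ==> B (- integral {al..be} (ker R)) = be"
proof -
 have ii: "ker R integrable_on {al..xi}" if "al < xi" "xi < be" for xi using ker_from_left[OF i that(2)] .
 obtain Ph where dep: "is_departure R al be Ph" using departure[OF continuous_R less pos R_ends ii] by blast
 note D = is_departureD[OF dep]
 have ne: "Ph t ~= al" if "0 < t" for t using D(3)[OF that] by simp
 define B where "B t = (if t <= L / 2 then Ph (- t) else Ph (t - L))" for t
 note P = pause[OF D(1) D(2) ne R_ends(1) L, folded B_def[abs_def] B_def]
 have Ip: "0 < integral {al..xi} (ker R)" if "al < xi" "xi < be" for xi
  by (rule ker_integral_pos[OF continuous_R ii[OF that] that(1)]) (use that pos in auto)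
 show ?thesis
 proof (rule that[OF P(1,2)])
  show "B 0 = al" using P(5)[of 0] L D(2)[of 0] by simp
 next
  fix xi assume x: "al < xi" "xi < be"
  let ?I = "integral {al..xi} (ker R)"
  note I = Ip[OF x]
  show "B (- ?I) = xi & deriv B (- ?I) < 0"
   using P(3)[of "- ?I"] P(5)[of "- ?I"] D(5,6)[OF x] I L by simp
  show "B (L + ?I) = xi & deriv B (L + ?I) > 0"
   using P(4)[of "L + ?I"] P(6)[of "L + ?I"] D(5,6)[OF x] I L by simp
 next
  assume j: "ker R integrable_on {al..be}"
  let ?I = "integral {al..be} (ker R)"
  have "0 < ?I" by (rule ker_integral_pos[OF continuous_R j less pos])
  then show "B (- ?I) = be" using P(5)[of "- ?I"] D(7)[OF j order_refl] L by simp
 qed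
qed

text \<open>A solution that comes down to \<open>al\<close>, rests and rises again passes every
  value of the arc twice, with both signs of the derivative. A time shift puts the suitable passage
  at time 0.\<close>

lemma ex_pause_left:
 assumes i: "ker R integrable_on {al..x}" "al < x" and L: "0 < L"
  and th0: "th0 = al & si = 0 \<or> al < th0 & th0 < be & si ~= 0 \<or> th0 = be & si = 0 & ker R integrable_on {al..be}"
 shows "\<exists>th a. sol R th & th 0 = th0 & (si = 0 \<or> 0 < si * deriv th 0) & maximal_constancy th al a (a + L)"
proof -
 obtain B where B: "sol R B" "maximal_constancy B al 0 L" "B 0 = al"
  "!!xi. [|al < xi; xi < be|] ==> B (- integral {al..xi} (ker R)) = xi & deriv B (- integral {al..xi} (ker R)) < 0"
  "!!xi. [|al < xi; xi < be|] ==> B (L + integral {al..xi} (ker R)) = xi & deriv B (L + integral {al..xi} (ker R)) > 0"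
  "ker R integrable_on {al..be} ==> B (- integral {al..be} (ker R)) = be"
  using pause_left[OF i L] by blast
 have sh: ?thesis if "B s = th0" "si = 0 \<or> 0 < si * deriv B s" for s
  using sol_shift[OF B(1), of s] that maximal_constancy_shift[OF B(2), of s]
  by (intro exI[of _ "%t. B (t + s)"] exI[of _ "- s"]) (simp add: add.commute)
 \<comment> \<open>Time 0 is placed inside the rest, before it if \<open>si < 0\<close>, after it if
   \<open>si > 0\<close>, and at the top of the incoming flight if \<open>th0 = be\<close>.\<close>
 consider "th0 = al" "si = 0" | "al < th0" "th0 < be" "si < 0" | "al < th0" "th0 < be" "si > 0"
  | "th0 = be" "si = 0" "ker R integrable_on {al..be}" using th0 by linarith
 then show ?thesis
 proof cases
  case 1 then show ?thesis using B(3) by (intro sh[of 0]) auto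
 next
  case 2 then show ?thesis using B(4)[OF 2(1,2)] by (intro sh) (auto simp: mult_neg_neg)
 next
  case 3 then show ?thesis using B(5)[OF 3(1,2)] by (intro sh) auto
 next
  case 4 then show ?thesis using B(6) by (intro sh) auto
 qed
qed

lemma ex_pause_right:
 assumes i: "ker R integrable_on {x..be}" "x < be" and L: "0 < L"
  and th0: "th0 = be & si = 0 \<or> al < th0 & th0 < be & si ~= 0 \<or> th0 = al & si = 0 & ker R integrable_on {al..be}"
 shows "\<exists>th a. sol R th & th 0 = th0 & (si = 0 \<or> 0 < si * deriv th 0) & maximal_constancy th be a (a + L)"
proof -
 interpret M: gap_ode "%xi. R (- xi)" "- be" "- al" by (rule mirrored)
 have "\<exists>th a. sol (%xi. R (- xi)) th & th 0 = - th0 & (- si = 0 \<or> 0 < - si * deriv th 0) & maximal_constancy th (- be) a (a + L)"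
 proof (rule M.ex_pause_left[OF _ _ L])
  show "ker (%xi. R (- xi)) integrable_on {- be..- x}" using i(1) by (simp add: ker_mirror integral_mirror(2))
  show "- th0 = - be & - si = 0 \<or> - be < - th0 & - th0 < - al & - si ~= 0 \<or>
   - th0 = - al & - si = 0 & ker (%xi. R (- xi)) integrable_on {- be..- al}"
   using th0 by (auto simp: ker_mirror integral_mirror(2))
 qed (use i in simp)
 then obtain th a where *: "sol (%xi. R (- xi)) th" "th 0 = - th0" "- si = 0 \<or> 0 < - si * deriv th 0" "maximal_constancy th (- be) a (a + L)"
  by blast
 have "sol R (%t. - th t)" "deriv (%t. - th t) 0 = - deriv th 0" using sol_mirror[OF *(1)] by simp_all
 then show ?thesis
  using *(2,3) maximal_constancy_minus[OF *(4)] by (intro exI[of _ "%t. - th t"] exI[of _ a]) auto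
qed

lemma stays_inside:
 assumes S: "sol R th" and s: "al < th s" "th s < be"
  and i: "~ ker R integrable_on {al..th s}" "~ ker R integrable_on {th s..be}"
 shows "al < th t" "th t < be"
 using hit_left[OF S s, of t] hit_right[OF S _ s(2), of t] i s by force+

text \<open>Going beyond \<open>al\<close> or \<open>be\<close> is possible only if the zero is
  isolated and the integral converges on both sides, which \<open>nb\<close> excludes. So the only
  candidates are the two ends, each reached exactly when its integral converges.\<close>

lemma cv_interior:
 assumes th0: "al < th0" "th0 < be" and si: "si ~= 0"
  and nb: "~ (be = al + 2 * pi & ker R integrable_on {al..th0} & ker R integrable_on {th0..be})"
 shows "cv R th0 si {c. c = al & ker R integrable_on {al..th0} \<or> c = be & ker R integrable_on {th0..be}}"
proof (rule cvI)
 fix th c s assume S: "sol R th" and i: "th 0 = th0" and c: "th s = c" "R c = 0"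
 have l: "al < th 0" "th 0 < be" using th0 i by auto
 have hl: "ker R integrable_on {al..th0}" if "th t <= al" for t using hit_left[OF S l that] i by simp
 have hr: "ker R integrable_on {th0..be}" if "be <= th t" for t using hit_right[OF S _ l(2) that] l i by simp
 have "th s <= be"
 proof (rule ccontr)
  assume "~ ?thesis"
  then have b: "be < th s" by simp
  note C = cross_up[OF S less_imp_le[OF l(2)] b]
  have "ker R integrable_on {al..th0}" using C(2) ker_from_left th0(2) by blast
  then show False using nb C(1) hr[of s] b by simp
 qed
 moreover have "al <= th s"
 proof (rule ccontr)
  assume "~ ?thesis"
  then have b: "th s < al" by simp
  note C = cross_down[OF S less_imp_le[OF l(1)] b]
  obtain x where x: "al < x" "x < be" "ker R integrable_on {x..be}" using C(2) by blast
  have "ker R integrable_on {th0..be}"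
  proof (cases "x <= th0")
   case True then show ?thesis using ker_sub[OF x(3)] by simp
  next
   case False then show ?thesis using Henstock_Kurzweil_Integration.integrable_combine[OF _ _ ker_inside[of th0 x] x(3)] x th0 by simp
  qed
  then show False using nb C(1) hl[of s] b by simp
 qed
 ultimately have "c = al \<or> c = be" using pos[of c] c by force
 then show "c \<in> {c. c = al & ker R integrable_on {al..th0} \<or> c = be & ker R integrable_on {th0..be}}"
  using hl[of s] hr[of s] c(1) by auto
next
 fix c and L :: real
 assume "c \<in> {c. c = al & ker R integrable_on {al..th0} \<or> c = be & ker R integrable_on {th0..be}}" and L: "0 < L"
 then consider "c = al" "ker R integrable_on {al..th0}" | "c = be" "ker R integrable_on {th0..be}" by blast
 then show "\<exists>th a. sol R th & th 0 = th0 & (si = 0 \<or> 0 < si * deriv th 0) & maximal_constancy th c a (a + L)"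
 proof cases
  case 1 show ?thesis unfolding 1(1) by (rule ex_pause_left[OF 1(2) th0(1) L]) (use th0 si in auto)
 next
  case 2 show ?thesis unfolding 2(1) by (rule ex_pause_right[OF 2(2) th0(2) L]) (use th0 si in auto)
 qed
qed

text \<open>From \<open>al\<close> the solution can rise to \<open>be\<close> only if the whole arc
  has finite travel time. Falling below \<open>al\<close> would need an isolated zero with
  convergence at \<open>be\<close>; combined with \<open>i\<close> this is the case excluded by
  \<open>nb\<close>.\<close>

lemma cv_left_end:
 assumes i: "ker R integrable_on {al..x}" "al < x"
  and nb: "~ (be = al + 2 * pi & ker R integrable_on {al..be})"
 shows "cv R al 0 {c. c = al \<or> c = be & ker R integrable_on {al..be}}"
proof (rule cvI)
 fix th c s assume S: "sol R th" and i0: "th 0 = al" and c: "th s = c" "R c = 0"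
 have l: "al <= th 0" "th 0 < be" using less i0 by auto
 have hr: "ker R integrable_on {al..be}" if "be <= th t" for t using hit_right[OF S l that] i0 by simp
 have "th s <= be"
 proof (rule ccontr)
  assume "~ ?thesis"
  then have b: "be < th s" by simp
  show False using nb cross_up(1)[OF S less_imp_le[OF l(2)] b] hr[of s] b by simp
 qed
 moreover have "al <= th s"
 proof (rule ccontr)
  assume "~ ?thesis"
  then have b: "th s < al" by simp
  note C = cross_down[OF S l(1) b]
  obtain z where z: "al < z" "z < be" "ker R integrable_on {z..be}" using C(2) by blast
  have "ker R integrable_on {al..be}" using ker_whole[OF ker_from_left[OF i z(2)] z(3)] z by simp
  then show False using nb C(1) by simp
 qed
 ultimately have "c = al \<or> c = be" using pos[of c] c by force
 then show "c \<in> {c. c = al \<or> c = be & ker R integrable_on {al..be}}" using hr[of s] c(1) by auto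
next
 fix c and L :: real
 assume "c \<in> {c. c = al \<or> c = be & ker R integrable_on {al..be}}" and L: "0 < L"
 then consider "c = al" | "c = be" "ker R integrable_on {al..be}" by blast
 then show "\<exists>th a. sol R th & th 0 = al & ((0::real) = 0 \<or> 0 < 0 * deriv th 0) & maximal_constancy th c a (a + L)"
 proof cases
  case 1 show ?thesis unfolding 1(1) by (rule ex_pause_left[OF i L]) simp
 next
  case 2 show ?thesis unfolding 2(1) by (rule ex_pause_right[OF 2(2) less L]) (use 2 in simp)
 qed
qed

lemma cv_right_end:
 assumes i: "ker R integrable_on {x..be}" "x < be"
  and nb: "~ (be = al + 2 * pi & ker R integrable_on {al..be})"
 shows "cv R be 0 {c. c = be \<or> c = al & ker R integrable_on {al..be}}"
proof -
 interpret M: gap_ode "%xi. R (- xi)" "- be" "- al" by (rule mirrored)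
 have "cv (%xi. R (- xi)) (- be) 0 {c. c = - be \<or> c = - al & ker (%xi. R (- xi)) integrable_on {- be..- al}}"
 proof (rule M.cv_left_end)
  show "ker (%xi. R (- xi)) integrable_on {- be..- x}" using i(1) by (simp add: ker_mirror integral_mirror(2))
  show "~ (- al = - be + 2 * pi & ker (%xi. R (- xi)) integrable_on {- be..- al})"
  proof
   assume *: "- al = - be + 2 * pi & ker (%xi. R (- xi)) integrable_on {- be..- al}"
   have "be = al + 2 * pi" using *[THEN conjunct1] by linarith
   then show False using nb *[THEN conjunct2, unfolded ker_mirror integral_mirror(2)] by blast
  qed
 qed (use i in simp)
 then have "cv R be 0 (uminus ` {c. c = - be \<or> c = - al & ker (%xi. R (- xi)) integrable_on {- be..- al}})"
  by (intro cv_mirror) simp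
 moreover have "uminus ` {c. c = - be \<or> c = - al & ker (%xi. R (- xi)) integrable_on {- be..- al}} =
   {c. c = be \<or> c = al & ker R integrable_on {al..be}}"
  unfolding ker_mirror integral_mirror(2) by force
 ultimately show ?thesis by simp
qed

end

locale isolated_zero_ode = gap_ode +
 assumes full: "be = al + 2 * pi" and int: "ker R integrable_on {al..be}"
begin

lemma zeros: "\<exists>k::int. c = al + 2 * pi * of_int k" if "R c = 0"
proof -
 define k where "k = \<lfloor>(c - al) / (2 * pi)\<rfloor>"
 have "of_int k <= (c - al) / (2 * pi)" "(c - al) / (2 * pi) < of_int k + 1" by (simp_all add: k_def)
 then have k: "al + 2 * pi * of_int k <= c" "c < al + 2 * pi * of_int k + 2 * pi" by (simp_all add: field_simps)
 have "R (c + 2 * pi * of_int (- k)) = 0" using that periodic_R[of c "- k"] by (simp only:)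
 then have "~ al < c + 2 * pi * of_int (- k)" using pos[of "c + 2 * pi * of_int (- k)"] k full by force
 then show ?thesis using k by (intro exI[of _ k]) simp
qed

lemma ex_alternating_interior:
 assumes th0: "al < th0" "th0 < be" and si: "si ~= 0" and up: "up 0 \<longleftrightarrow> si > 0" and L: "!!n. 0 <= L n"
 obtains th a where "sol R th" "th 0 = th0" "0 < si * deriv th 0" "alternates th al up L a" "a 0 + L 0 < 0" "0 < a 1"
  "!!n. (\<forall>m. up m) ==> th (a n) = al + 2 * pi * of_int n"
  "!!n. (\<forall>m. ~ up m) ==> th (a n) = al + 2 * pi * of_int (1 - n)"
proof -
 have p: "R xi > 0" if "al < xi" "xi < al + 2 * pi" for xi using pos[of xi] that full by simp
 have i: "ker R integrable_on {al..al + 2 * pi}" using int full by simp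
 have th0': "th0 < al + 2 * pi" using th0 full by simp
 define I where "I = integral {al..th0} (ker R)"
 define T where "T = integral {al..al + 2 * pi} (ker R)"
 have i1: "ker R integrable_on {al..th0}" "ker R integrable_on {th0..al + 2 * pi}" by (rule ker_sub[OF i]; use th0 th0' in simp)+
 have "0 < I" unfolding I_def by (rule ker_integral_pos[OF continuous_R i1(1) th0(1)]) (use th0' p in auto)
 moreover have "0 < integral {th0..al + 2 * pi} (ker R)" by (rule ker_integral_pos[OF continuous_R i1(2) th0']) (use th0 p in auto)
 moreover have "I + integral {th0..al + 2 * pi} (ker R) = T"
  unfolding I_def T_def using th0 th0' i by (intro Henstock_Kurzweil_Integration.integral_combine) auto
 ultimately have I: "0 < I" "I < T" by linarith+
 show ?thesis
 proof (cases "si > 0")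
  case True
  show ?thesis
  \<comment> \<open>Rising start: the flight leaves \<open>al\<close> at time \<open>- I\<close> and
    so passes \<open>th0\<close> at time 0; the rest of length \<open>L 0\<close> precedes
    it.\<close>
  proof (rule alternating_solution[where ?k0.0 = 0 and up = up and ?a0.0 = "- L 0 - I", OF continuous_R periodic_R p R_ends(1) i L], fold T_def)
   fix th a
   assume A: "sol R th" "alternates th al up L a" "a 0 = - L 0 - I" "!!n. a (n + 1) = a n + L n + T"
    and B: "!!xi. [|up 0; al < xi; xi < al + 2 * pi|] ==> th (- L 0 - I + L 0 + integral {al..xi} (ker R)) = xi + 2 * pi * of_int 0"
     "!!xi. [|up 0; al < xi; xi < al + 2 * pi|] ==> deriv th (- L 0 - I + L 0 + integral {al..xi} (ker R)) > 0"
     "!!n. (\<forall>m. up m) ==> th (a n) = al + 2 * pi * of_int (0 + n)"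
   have u: "up 0" using up True by simp
   have t: "- L 0 - I + L 0 + integral {al..th0} (ker R) = 0" by (simp add: I_def)
   show ?thesis
   proof (rule that[OF A(1) _ _ A(2)])
    show "th 0 = th0" using B(1)[OF u th0(1) th0'] unfolding t by simp
    show "0 < si * deriv th 0" using B(2)[OF u th0(1) th0'] True unfolding t by simp
    show "a 0 + L 0 < 0" "0 < a 1" using A(3) A(4)[of 0] I by simp_all
    show "th (a n) = al + 2 * pi * of_int n" if "\<forall>m. up m" for n using B(3)[OF that] by simp
    show "th (a n) = al + 2 * pi * of_int (1 - n)" if "\<forall>m. ~ up m" for n using that u by blast
   qed
  qed
 next
  case False
  show ?thesis
  \<comment> \<open>Falling start: the flight comes down from \<open>al + 2 * pi\<close>, hence the
    initial level 1. It reaches \<open>al\<close> at time \<open>I\<close> and passes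
    \<open>th0\<close> at time 0.\<close>
  proof (rule alternating_solution[where ?k0.0 = 1 and up = up and ?a0.0 = "- L 0 - T + I", OF continuous_R periodic_R p R_ends(1) i L], fold T_def)
   fix th a
   assume A: "sol R th" "alternates th al up L a" "a 0 = - L 0 - T + I" "!!n. a (n + 1) = a n + L n + T"
    and B: "!!xi. [|~ up 0; al < xi; xi < al + 2 * pi|] ==> th (- L 0 - T + I + L 0 + T - integral {al..xi} (ker R)) = xi + 2 * pi * of_int (1 - 1)"
     "!!xi. [|~ up 0; al < xi; xi < al + 2 * pi|] ==> deriv th (- L 0 - T + I + L 0 + T - integral {al..xi} (ker R)) < 0"
     "!!n. (\<forall>m. ~ up m) ==> th (a n) = al + 2 * pi * of_int (1 - n)"
   have u: "~ up 0" using up False by simp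
   have t: "- L 0 - T + I + L 0 + T - integral {al..th0} (ker R) = 0" by (simp add: I_def)
   show ?thesis
   proof (rule that[OF A(1) _ _ A(2)])
    show "th 0 = th0" using B(1)[OF u th0(1) th0'] unfolding t by simp
    show "0 < si * deriv th 0" using B(2)[OF u th0(1) th0'] False si unfolding t by (simp add: mult_neg_neg)
    show "a 0 + L 0 < 0" "0 < a 1" using A(3) A(4)[of 0] I by simp_all
    show "th (a n) = al + 2 * pi * of_int (1 - n)" if "\<forall>m. ~ up m" for n using B(3)[OF that] by simp
    show "th (a n) = al + 2 * pi * of_int n" if "\<forall>m. up m" for n using that u by blast
   qed
  qed
 qed
qed

lemma ex_alternating_rest:
 assumes L: "!!n. 0 <= L n" and s: "0 <= s" "s <= L 0"
 obtains th a where "sol R th" "th 0 = al" "alternates th al up L a" "a 0 = - s"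
  "!!n. (\<forall>m. up m) ==> th (a n) = al + 2 * pi * of_int n"
proof -
 have p: "R xi > 0" if "al < xi" "xi < al + 2 * pi" for xi using pos[of xi] that full by simp
 have i: "ker R integrable_on {al..al + 2 * pi}" using int full by simp
 show ?thesis
 proof (rule alternating_solution[where ?k0.0 = 0 and up = up and ?a0.0 = "- s", OF continuous_R periodic_R p R_ends(1) i L])
  fix th a
  assume A: "sol R th" "alternates th al up L a" "a 0 = - s" "!!t. [|- s <= t; t <= - s + L 0|] ==> th t = al + 2 * pi * of_int 0"
   "!!n. (\<forall>m. up m) ==> th (a n) = al + 2 * pi * of_int (0 + n)"
  show ?thesis by (rule that[OF A(1) _ A(2,3)]) (use A(4)[of 0] A(5) s in auto)
 qed
qed

text \<open>Every zero is reached by moving in one direction with rests of length \<open>L\<close>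
  between the flights: the index is \<open>k\<close> for a rising start and \<open>1 - k\<close> for
  a falling one, because a falling chain starts one level higher.\<close>

lemma cv_all:
 assumes "al < th0 & th0 < be & si ~= 0 \<or> th0 = al & si = 0"
 shows "cv R th0 si {al + 2 * pi * of_int k |k::int. True}"
proof (rule cvI)
 fix c and L :: real assume "c \<in> {al + 2 * pi * of_int k |k::int. True}" and L: "0 < L"
 then obtain k :: int where c: "c = al + 2 * pi * of_int k" by blast
 let ?goal = "\<exists>th a. sol R th & th 0 = th0 & (si = 0 \<or> 0 < si * deriv th 0) & maximal_constancy th c a (a + L)"
 have fin: ?goal if "sol R th" "th 0 = th0" "si = 0 \<or> 0 < si * deriv th 0" "alternates th al up (%n. L) a" "th (a n) = c" for th up a n
  using that(1-3) alternates_maximal[OF that(4) L, of n] unfolding that(5) by blast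
 have L': "0 <= L" using L by simp
 consider "al < th0" "th0 < be" "si > 0" | "al < th0" "th0 < be" "si < 0" | "th0 = al" "si = 0" using assms by linarith
 then show ?goal
 proof cases
  case 1
  show ?thesis
  proof (rule ex_alternating_interior[OF 1(1,2), of si "%n. True" "%n. L"])
   fix th a assume A: "sol R th" "th 0 = th0" "0 < si * deriv th 0" "alternates th al (%n. True) (%n. L) a"
    "!!n. \<forall>m::int. True ==> th (a n) = al + 2 * pi * of_int n"
   show ?thesis by (rule fin[OF A(1,2) disjI2[OF A(3)] A(4), of k]) (use A(5)[of k] c in simp)
  qed (use 1 L' in simp_all)
 next
  case 2
  show ?thesis
  proof (rule ex_alternating_interior[OF 2(1,2), of si "%n. False" "%n. L"])
   fix th a assume A: "sol R th" "th 0 = th0" "0 < si * deriv th 0" "alternates th al (%n. False) (%n. L) a"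
    "!!n. \<forall>m::int. ~ False ==> th (a n) = al + 2 * pi * of_int (1 - n)"
   show ?thesis by (rule fin[OF A(1,2) disjI2[OF A(3)] A(4), of "1 - k"]) (use A(5)[of "1 - k"] c in simp)
  qed (use 2 L' in simp_all)
 next
  case 3
  show ?thesis
  proof (rule ex_alternating_rest[of "%n. L" 0 "%n. True"])
   fix th a assume A: "sol R th" "th 0 = al" "alternates th al (%n. True) (%n. L) a"
    "!!n. \<forall>m::int. True ==> th (a n) = al + 2 * pi * of_int n"
   show ?thesis by (rule fin[OF A(1) _ _ A(3), of k]) (use A(2) A(4)[of k] c 3 in simp_all)
  qed (use L' in simp_all)
 qed
qed (use zeros in auto)

end

subsection \<open>The time integrals\<close>

lemma ker_measurable: "continuous_on UNIV R ==> ker R \<in> borel_measurable borel"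
 unfolding ker_def[abs_def] using borel_measurable_continuous_onI[of R] by measurable

lemma set_integrable_open_interval_iff:
 fixes f :: "real \<Rightarrow> real"
 assumes f: "f \<in> borel_measurable borel" and nn: "!!xi. [|a < xi; xi < b|] ==> 0 <= f xi"
 shows "set_integrable lborel {a<..<b} f \<longleftrightarrow> f integrable_on {a..b}"
  and "set_integrable lborel {a<..<b} f ==> (LINT xi:{a<..<b}|lborel. f xi) = integral {a..b} f"
proof -
 show "set_integrable lborel {a<..<b} f \<longleftrightarrow> f integrable_on {a..b}"
 proof
  assume "set_integrable lborel {a<..<b} f"
  then show "f integrable_on {a..b}"
   using set_borel_integral_eq_integral(1) by (simp add: integrable_on_Icc_iff_Ioo)
 next
  assume "f integrable_on {a..b}"
  then have "f integrable_on {a<..<b}" by (simp add: integrable_on_Icc_iff_Ioo)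
  then have "f absolutely_integrable_on {a<..<b}" using nn by (intro nonnegative_absolutely_integrable_1) auto
  then show "set_integrable lborel {a<..<b} f"
   unfolding set_integrable_def using f by (subst (asm) integrable_completion) auto
 qed
 show "(LINT xi:{a<..<b}|lborel. f xi) = integral {a..b} f" if "set_integrable lborel {a<..<b} f"
  using set_borel_integral_eq_integral(2)[OF that] by (simp add: integral_open_interval_real)
qed

lemma integral_finite_ker:
 assumes c: "continuous_on UNIV R" and nn: "!!xi. [|min a b < xi; xi < max a b|] ==> 0 <= R xi"
 shows "integral_finite (ker R) a b \<longleftrightarrow> ker R integrable_on {min a b..max a b}"
  and "ker R integrable_on {min a b..max a b} ==> integral_from_to (ker R) a b = oriented_integral (ker R) a b"
proof -
 have kn: "0 <= ker R xi" if "min a b < xi" "xi < max a b" for xi using nn[OF that] by (simp add: ker_def)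
 note S = set_integrable_open_interval_iff[OF ker_measurable[OF c] kn]
 show iff: "integral_finite (ker R) a b \<longleftrightarrow> ker R integrable_on {min a b..max a b}"
  using S(1) by (cases "a <= b") (auto simp: interval_lebesgue_integrable_def min_def max_def)
 show "integral_from_to (ker R) a b = oriented_integral (ker R) a b" if i: "ker R integrable_on {min a b..max a b}"
 proof (cases "a <= b")
  case True
  then show ?thesis using S(2) i S(1) by (simp add: interval_lebesgue_integral_def oriented_integral_def min_def max_def)
 next
  case False
  then show ?thesis using S(2) i S(1) by (simp add: interval_lebesgue_integral_def oriented_integral_def min_def max_def)
 qed
qed

lemma integral_finite_scale:
 assumes "k ~= 0"
 shows "integral_finite (%xi. k * f xi) a b \<longleftrightarrow> integral_finite f a b"
proof
 assume "integral_finite (%xi. k * f xi) a b"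
 then have *: "integral_finite (%xi. inverse k * (k * f xi)) a b"
  by (rule interval_lebesgue_integrable_mult_right)
 have "(%xi. inverse k * (k * f xi)) = f" using assms by (simp add: fun_eq_iff)
 then show "integral_finite f a b" using * by (simp only:)
qed (intro interval_lebesgue_integrable_mult_right)

text \<open>Comparison with the inverse square root, whose antiderivative is explicit. Zeros with at
  least linear growth are therefore reached in finite time.\<close>

lemma ker_integrable_left_end:
 assumes cR: "continuous_on UNIV R" and c: "0 < c" and px: "p <= x" and Rp: "R p = 0"
  and R: "!!xi. [|p <= xi; xi <= x|] ==> c * (xi - p) <= R xi"
 shows "ker R integrable_on {p..x}"
proof -
 let ?g = "%xi. 1 / sqrt (c * (xi - p))"
 have "(?g has_integral 2 / sqrt c * sqrt (x - p) - 2 / sqrt c * sqrt (p - p)) {p..x}"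
 proof (rule fundamental_theorem_of_calculus_interior[OF px])
  show "continuous_on {p..x} (%xi. 2 / sqrt c * sqrt (xi - p))" by (intro continuous_intros)
  fix xi assume "xi \<in> {p<..<x}"
  then have "0 < xi - p" by simp
  then have d: "((%xi. sqrt (xi - p)) has_real_derivative inverse (sqrt (xi - p)) / 2) (at xi)"
   by (auto intro!: derivative_eq_intros)
  have "2 / sqrt c * (inverse (sqrt (xi - p)) / 2) = ?g xi"
   unfolding real_sqrt_mult inverse_eq_divide by simp
  then have "((%xi. 2 / sqrt c * sqrt (xi - p)) has_real_derivative ?g xi) (at xi)"
   using DERIV_cmult[OF d, of "2 / sqrt c"] by (simp only:)
  then show "((%xi. 2 / sqrt c * sqrt (xi - p)) has_vector_derivative ?g xi) (at xi)"
   by (simp add: has_real_derivative_iff_has_vector_derivative)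
 qed
 then have gi: "?g integrable_on {p..x}" by blast
 show ?thesis
 proof (rule measurable_bounded_by_integrable_imp_integrable[OF _ gi])
  show "ker R \<in> borel_measurable (lebesgue_on {p..x})"
   using ker_measurable[OF cR] by (intro measurable_restrict_space1 measurable_completion) simp
  fix xi assume x: "xi \<in> {p..x}"
  show "norm (ker R xi) <= ?g xi"
  proof (cases "xi = p")
   case False
   then have "0 < c * (xi - p)" "c * (xi - p) <= R xi" using x c R by auto
   then show ?thesis by (auto simp: ker_def intro!: divide_left_mono mult_pos_pos)
  qed (simp add: ker_def Rp)
 qed simp
qed

lemma ker_integrable_right_end:
 assumes cR: "continuous_on UNIV R" and c: "0 < c" and xq: "x <= q" and Rq: "R q = 0"
  and R: "!!xi. [|x <= xi; xi <= q|] ==> c * (q - xi) <= R xi"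
 shows "ker R integrable_on {x..q}"
proof -
 have "ker (%xi. R (- xi)) integrable_on {- q..- x}"
 proof (rule ker_integrable_left_end[OF _ c])
  show "continuous_on UNIV (%xi. R (- xi))" by (intro continuous_on_compose2[OF cR] continuous_intros) auto
  show "c * (xi - - q) <= R (- xi)" if "- q <= xi" "xi <= - x" for xi using R[of "- xi"] that by (simp add: add.commute)
 qed (use xq Rq in simp_all)
 then show ?thesis by (simp add: ker_mirror integral_mirror(2))
qed

lemma ker_integrable_linear_ends:
 assumes cR: "continuous_on UNIV R" and c: "0 < c" and d: "0 < d" and pq: "p < q" and R0: "R p = 0" "R q = 0"
  and R: "!!xi. [|p < xi; xi < q|] ==> 0 < R xi"
  and l: "!!xi. [|p <= xi; xi <= p + d|] ==> c * (xi - p) <= R xi" and u: "!!xi. [|q - d <= xi; xi <= q|] ==> c * (q - xi) <= R xi"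
 shows "ker R integrable_on {p..q}"
proof -
 define e where "e = min d ((q - p) / 3)"
 have "0 < e" "e <= d" "e <= (q - p) / 3" using d pq unfolding e_def by (simp_all only: min.cobounded1 min.cobounded2) simp
 moreover from this have "p + e < q - e" using pq by simp
 ultimately have e: "0 < e" "e <= d" "p + e < q - e" by blast+
 have 1: "ker R integrable_on {p..p + e}" by (rule ker_integrable_left_end[OF cR c]) (use e R0 l in auto)
 have 2: "ker R integrable_on {q - e..q}" by (rule ker_integrable_right_end[OF cR c]) (use e R0 u in auto)
 have 3: "ker R integrable_on {p + e..q - e}"
  by (intro integrable_continuous_real ker_continuous[OF cR] R) (use e in auto)
 have "ker R integrable_on {p..q - e}" by (rule Henstock_Kurzweil_Integration.integrable_combine[OF _ _ 1 3]) (use e in auto)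
 from Henstock_Kurzweil_Integration.integrable_combine[OF _ _ this 2] show ?thesis using e by simp
qed

subsection \<open>Trigonometrically convex functions\<close>

text \<open>The analogue of convexity with sinusoids in place of affine functions: on intervals
  shorter than \<open>pi\<close> the graph lies below the sinusoid through its end points.\<close>

definition trig_convex :: "(real \<Rightarrow> real) \<Rightarrow> bool" where
 "trig_convex H \<longleftrightarrow> (\<forall>p xi q. p <= xi & xi <= q & q <= p + pi -->
  sin (q - p) * H xi <= sin (q - xi) * H p + sin (xi - p) * H q)"

lemma trig_convex_mirror: "trig_convex H ==> trig_convex (%xi. H (- xi))"
 unfolding trig_convex_def
proof (intro allI impI)
 fix p xi q :: real
 assume H: "\<forall>p xi q. p <= xi & xi <= q & q <= p + pi --> sin (q - p) * H xi <= sin (q - xi) * H p + sin (xi - p) * H q"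
  and "p <= xi & xi <= q & q <= p + pi"
 then have "sin (- p - - q) * H (- xi) <= sin (- p - - xi) * H (- q) + sin (- xi - - q) * H (- p)"
  by (intro H[rule_format]) auto
 then show "sin (q - p) * H (- xi) <= sin (q - xi) * H (- p) + sin (xi - p) * H (- q)" by (simp add: add.commute)
qed

text \<open>Let \<open>a\<close> be a zero between \<open>m - pi\<close> and \<open>m\<close>. The
  sinusoid through the points of the graph at \<open>a\<close> and \<open>m\<close> lies above the
  graph between them and below it to the left of \<open>a\<close>, so the sign changes at
  \<open>a\<close> with at least linear speed.\<close>

lemma trig_convex_left_zero:
 assumes tc: "trig_convex H" and cH: "continuous_on UNIV H" and m: "H m < 0" "0 < H (m - pi)"
 obtains a c where "m - pi < a" "a < m" "0 < c" "H a = 0"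
  "!!xi. [|a <= xi; xi <= m|] ==> H xi <= - c * sin (xi - a)" "!!xi. [|m - pi < xi; xi <= a|] ==> c * sin (a - xi) <= H xi"
proof -
 obtain a where a: "m - pi <= a" "a <= m" "H a = 0"
  using IVT2'[of H m 0 "m - pi"] m continuous_on_subset[OF cH] pi_gt_zero by (auto simp: less_imp_le)
 have "a ~= m" "a ~= m - pi" using a m by auto
 then have a': "m - pi < a" "a < m" using a by auto
 have s: "0 < sin (m - a)" using a' by (intro sin_gt_zero) auto
 \<comment> \<open>The amplitude for which \<open>- c * sin (xi - a)\<close> agrees with
   \<open>H\<close> at \<open>m\<close>.\<close>
 define c where "c = - H m / sin (m - a)"
 have c: "0 < c" "H m = - c * sin (m - a)" using s m by (auto simp: c_def field_simps)
 show ?thesis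
 proof (rule that[OF a' c(1) a(3)])
  fix xi assume x: "a <= xi" "xi <= m"
  have "sin (m - a) * H xi <= sin (m - xi) * H a + sin (xi - a) * H m"
   by (rule tc[unfolded trig_convex_def, rule_format]) (use x a' in auto)
  then have "sin (m - a) * H xi <= sin (m - a) * (- c * sin (xi - a))" unfolding a(3) c(2) by (simp add: mult_ac)
  then show "H xi <= - c * sin (xi - a)" using s mult_le_cancel_left_pos by blast
 next
  fix xi assume x: "m - pi < xi" "xi <= a"
  have "sin (m - xi) * H a <= sin (m - a) * H xi + sin (a - xi) * H m"
   by (rule tc[unfolded trig_convex_def, rule_format]) (use x a' in auto)
  then have "sin (m - a) * (c * sin (a - xi)) <= sin (m - a) * H xi" unfolding a(3) c(2) by (simp add: mult_ac)
  then show "c * sin (a - xi) <= H xi" using s mult_le_cancel_left_pos by blast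
 qed
qed

lemma half_le_sin:
 fixes a :: real
 assumes "0 <= a" "a <= 2 / 3"
 shows "a / 2 <= sin a"
 using abs_le_twice_abs_sin[of a] assms sin_ge_zero[of a] pi_gt3 by simp

text \<open>The right zero comes from the mirrored function, for which the value at the antipode is
  the same by periodicity. The sinusoidal bounds from both zeros determine all signs in the period
  and become linear bounds near the zeros.\<close>

lemma trig_convex_zeros:
 assumes tc: "trig_convex H" and cH: "continuous_on UNIV H" and per: "!!xi. H (xi + 2 * pi) = H xi"
  and m: "H m < 0" "0 < H (m - pi)"
 obtains a b c d where "a < b" "b < a + 2 * pi" "0 < c" "0 < d" "H a = 0" "H b = 0"
  "!!xi. [|a < xi; xi < b|] ==> H xi < 0" "!!xi. [|b < xi; xi < a + 2 * pi|] ==> 0 < H xi"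
  "!!xi. [|a <= xi; xi <= a + d|] ==> c * (xi - a) <= - H xi" "!!xi. [|b - d <= xi; xi <= b|] ==> c * (b - xi) <= - H xi"
  "!!xi. [|b <= xi; xi <= b + d|] ==> c * (xi - b) <= H xi" "!!xi. [|a - d <= xi; xi <= a|] ==> c * (a - xi) <= H xi"
proof -
 obtain a c1 where A: "m - pi < a" "a < m" "0 < c1" "H a = 0"
  "!!xi. [|a <= xi; xi <= m|] ==> H xi <= - c1 * sin (xi - a)" "!!xi. [|m - pi < xi; xi <= a|] ==> c1 * sin (a - xi) <= H xi"
  using trig_convex_left_zero[OF tc cH m] by blast
 have cH': "continuous_on UNIV (%xi. H (- xi))" by (intro continuous_on_compose2[OF cH] continuous_intros) auto
 have mp: "H (m + pi) = H (m - pi)" using per[of "m - pi"] by (simp add: add.commute)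
 have pre: "H (- (- m)) < 0" "0 < H (- (- m - pi))" using m mp by (simp_all add: add.commute)
 obtain b' c2 where B': "- m - pi < b'" "b' < - m" "0 < c2" "H (- b') = 0"
  "!!xi. [|b' <= xi; xi <= - m|] ==> H (- xi) <= - c2 * sin (xi - b')" "!!xi. [|- m - pi < xi; xi <= b'|] ==> c2 * sin (b' - xi) <= H (- xi)"
  using trig_convex_left_zero[OF trig_convex_mirror[OF tc] cH' pre] by blast
 define b where "b = - b'"
 have B: "m < b" "b < m + pi" "H b = 0" using B' by (auto simp: b_def)
 have B5: "H xi <= - c2 * sin (b - xi)" if "m <= xi" "xi <= b" for xi using B'(5)[of "- xi"] that by (simp add: b_def minus_diff_commute)
 have B6: "c2 * sin (xi - b) <= H xi" if "b <= xi" "xi < m + pi" for xi using B'(6)[of "- xi"] that by (simp add: b_def add.commute)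
 \<comment> \<open>The entry \<open>2 / 3\<close> allows the bound \<open>half_le_sin\<close>; the
   others keep the linear bounds inside the ranges of the sinusoidal ones. Halving the smaller
   amplitude in \<open>c\<close> pays for replacing the sine by half its argument.\<close>
 define d where "d = Min {2 / 3, m - a, b - m, (m + pi - b) / 2, (a - (m - pi)) / 2}"
 have d: "0 < d" using A(1,2) B(1,2) by (auto simp: d_def Min_gr_iff)
 have dl: "d <= 2 / 3" "d <= m - a" "d <= b - m" "d <= (m + pi - b) / 2" "d <= (a - (m - pi)) / 2"
  unfolding d_def by (rule Min_le; simp)+
 then have dl': "b + d < m + pi" "m - pi < a - d" using d by (auto simp: field_simps)
 define c where "c = min c1 c2 / 2"
 have c: "0 < c" "2 * c <= c1" "2 * c <= c2" using A(3) B'(3) by (auto simp: c_def)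
 have lin: "c * t <= k * sin t" if "0 <= t" "t <= d" "2 * c <= k" for t k
 proof -
  have "c * t = (2 * c) * (t / 2)" by simp
  also have "\<dots> <= k * sin t" using half_le_sin[of t] that dl(1) c(1) by (intro mult_mono) auto
  finally show ?thesis .
 qed
 show ?thesis
 proof (rule that[of a b c d])
  show "a < b" "b < a + 2 * pi" using A(1,2) B by auto
  show "0 < c" "0 < d" "H a = 0" "H b = 0" using c d A B by auto
  show "H xi < 0" if x: "a < xi" "xi < b" for xi
  proof (cases "xi <= m")
   case True
   have "0 < c1 * sin (xi - a)" using x True A(1,3) by (intro mult_pos_pos sin_gt_zero) auto
   then show ?thesis using A(5)[of xi] x True by simp
  next
   case False
   have "0 < c2 * sin (b - xi)" using x False B(2) B'(3) by (intro mult_pos_pos sin_gt_zero) auto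
   then show ?thesis using B5[of xi] x False by simp
  qed
  show "0 < H xi" if x: "b < xi" "xi < a + 2 * pi" for xi
  proof -
   consider "xi < m + pi" | "xi = m + pi" | "m + pi < xi" by linarith
   then show ?thesis
   proof cases
    case 1
    have "0 < c2 * sin (xi - b)" using x 1 B B'(3) by (intro mult_pos_pos sin_gt_zero) auto
    then show ?thesis using B6[of xi] x 1 by simp
   next
    case 2 then show ?thesis using mp m by simp
   next
    case 3
    have "0 < c1 * sin (a - (xi - 2 * pi))" using x 3 A by (intro mult_pos_pos sin_gt_zero) auto
    then show ?thesis using A(6)[of "xi - 2 * pi"] x 3 per[of "xi - 2 * pi"] by simp
   qed
  qed
  show "c * (xi - a) <= - H xi" if "a <= xi" "xi <= a + d" for xi using lin[of "xi - a" c1] A(5)[of xi] that c dl by simp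
  show "c * (b - xi) <= - H xi" if "b - d <= xi" "xi <= b" for xi using lin[of "b - xi" c2] B5[of xi] that c dl by simp
  show "c * (xi - b) <= H xi" if "b <= xi" "xi <= b + d" for xi using lin[of "xi - b" c2] B6[of xi] that c dl' by simp
  show "c * (a - xi) <= H xi" if "a - d <= xi" "xi <= a" for xi using lin[of "a - xi" c1] A(6)[of xi] that c dl' by simp
 qed
qed

text \<open>The sinusoid through two zeros less than \<open>pi\<close> apart is identically 0, so
  nonnegativity leaves no room.\<close>

lemma trig_convex_zero_between:
 assumes tc: "trig_convex H" and nn: "!!xi. 0 <= H xi" and pq: "p <= xi" "xi <= q" "q < p + pi" "H p = 0" "H q = 0"
 shows "H xi = 0"
proof (cases "p = q")
 case False
 have "sin (q - p) * H xi <= sin (q - xi) * H p + sin (xi - p) * H q"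
  by (rule tc[unfolded trig_convex_def, rule_format]) (use pq in auto)
 moreover have "0 < sin (q - p)" using pq False by (intro sin_gt_zero) auto
 ultimately have "H xi <= 0" using pq(4,5) by (simp add: mult_le_0_iff)
 then show ?thesis using nn[of xi] by simp
qed (use pq in auto)

subsection \<open>Oscillation\<close>

text \<open>The composition of the reflections at \<open>t1\<close> and \<open>t2\<close> is the
  translation by \<open>2 * (t2 - t1)\<close>.\<close>

lemma periodic_if_reflections:
 fixes th :: "real \<Rightarrow> real"
 assumes r: "!!t. th (t1 + t) = th (t1 - t)" "!!t. th (t2 + t) = th (t2 - t)"
 shows "th (t + 2 * of_int k * (t2 - t1)) = th t"
proof -
 have step: "th (t + 2 * (t2 - t1)) = th t" for t
  using r(2)[of "t + t2 - 2 * t1"] r(1)[of "t1 - t"] by (simp add: algebra_simps)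
 show ?thesis
 proof (induction k rule: int_induct[where k = 0])
  case base then show ?case by simp
 next
  case (step1 i)
  then show ?case using step[of "t + 2 * of_int i * (t2 - t1)"] by (simp add: algebra_simps)
 next
  case (step2 i)
  then show ?case using step[of "t + 2 * of_int (i - 1) * (t2 - t1)"] by (simp add: algebra_simps)
 qed
qed

lemma trapped:
 assumes S: "sol R th" and s: "th s \<in> {p..q}" and e: "0 < e"
  and out: "!!xi. [|q < xi; xi < q + e|] ==> R xi < 0" "!!xi. [|p - e < xi; xi < p|] ==> R xi < 0"
 shows "th t \<in> {p..q}"
proof (rule ccontr)
 assume "th t \<notin> {p..q}"
 then consider "q < th t" | "th t < p" by force
 then show False
 proof cases
  case 1
  define y where "y = min (th t) (q + e / 2)"
  have y: "q < y" "y < q + e" "y <= th t" using 1 e by (auto simp: y_def min_def)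
  then obtain u where "th u = y" using attain[OF sol_continuous[OF S], of s y t] s by auto
  then show False using sol_nonneg[OF S, of u] out(1)[OF y(1,2)] by simp
 next
  case 2
  define y where "y = max (th t) (p - e / 2)"
  have y: "y < p" "p - e < y" "th t <= y" using 2 e by (auto simp: y_def max_def)
  then obtain u where "th u = y" using attain[OF sol_continuous[OF S], of t y s] s by auto
  then show False using sol_nonneg[OF S, of u] out(2)[OF y(2,1)] by simp
 qed
qed

subsection \<open>The zeros of the right-hand side\<close>

context plane_quasinorm
begin

definition lin :: "real \<Rightarrow> real \<Rightarrow> real \<Rightarrow> real" where
 "lin ph4 ph5 xi = ph5 * (r xi * cos xi) - ph4 * (r xi * sin xi)"

text \<open>This is \<open>l * (e - L)\<close> written without division. It has the sign of
  \<open>e - L\<close>, and it is a multiple of \<open>l\<close> minus a sinusoid, so for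
  \<open>e >= 0\<close> it inherits trigonometric convexity, and for \<open>e <= 0\<close> its
  negative does.\<close>

definition gap :: "real \<Rightarrow> real \<Rightarrow> real \<Rightarrow> real \<Rightarrow> real" where
 "gap ph4 ph5 e xi = e * l xi - (ph5 * cos xi - ph4 * sin xi)"

lemma gap_lin: "gap ph4 ph5 e xi = l xi * (e - lin ph4 ph5 xi)"
 using l_pos[of xi] by (simp add: gap_def lin_def r_eq field_simps)

lemma angle_rhs_gap:
 "angle_rhs F (ph1, ph2, ph3, ph4, ph5) xi = 2 * l xi ^ 3 * gap ph4 ph5 (energy (ph1, ph2, ph3, ph4, ph5)) xi"
 unfolding angle_rhs_energy gap_lin lin_def[symmetric] using l_pos[of xi]
 by (simp del: energy.simps add: r_eq power_divide field_simps power3_eq_cube power4_eq_xxxx)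

lemma lin_minus: "lin (- ph4) (- ph5) xi = - lin ph4 ph5 xi"
 by (simp add: lin_def)

lemma lin_periodic: "lin ph4 ph5 (xi + 2 * pi * of_int k) = lin ph4 ph5 xi"
proof -
 have "cos (xi + 2 * pi * of_int k) = cos xi" "sin (xi + 2 * pi * of_int k) = sin xi"
  by (simp_all add: cos_add sin_add cos_int_2pin sin_int_2pin)
 then show ?thesis by (simp add: lin_def r_periodic)
qed

lemma continuous_lin: "continuous_on S (lin ph4 ph5)"
 unfolding lin_def[abs_def] by (intro continuous_intros continuous_r)

lemma continuous_gap: "continuous_on S (gap ph4 ph5 e)"
 unfolding gap_def[abs_def] by (intro continuous_intros continuous_l)

lemma gap_periodic: "gap ph4 ph5 e (xi + 2 * pi * of_int k) = gap ph4 ph5 e xi"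
 by (simp add: gap_lin lin_periodic l_periodic)

lemma gap_periodic_1: "gap ph4 ph5 e (xi + 2 * pi) = gap ph4 ph5 e xi"
 using gap_periodic[of ph4 ph5 e xi 1] by simp

text \<open>The sinusoidal part changes sign at the antipode. This provides the opposite signs at
  distance \<open>pi\<close> from which the zeros are located.\<close>

lemma gap_antipode: "gap ph4 ph5 e (xi + pi) = e * l (xi + pi) + l xi * lin ph4 ph5 xi"
 "gap ph4 ph5 e (xi - pi) = e * l (xi - pi) + l xi * lin ph4 ph5 xi"
 using l_pos[of xi] by (simp_all add: gap_def lin_def r_eq field_simps cos_diff sin_diff)

lemma gap_trig_convex:
 shows "0 <= e ==> trig_convex (gap ph4 ph5 e)" and "e <= 0 ==> trig_convex (%xi. - gap ph4 ph5 e xi)"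
proof -
 have cs: "sin (q - p) * cos xi = sin (q - xi) * cos p + sin (xi - p) * cos q"
  "sin (q - p) * sin xi = sin (q - xi) * sin p + sin (xi - p) * sin q" for p q xi :: real
  unfolding sin_diff by (simp_all add: algebra_simps)
 have P: "sin (q - p) * (ph5 * cos xi - ph4 * sin xi) =
   sin (q - xi) * (ph5 * cos p - ph4 * sin p) + sin (xi - p) * (ph5 * cos q - ph4 * sin q)" for p q xi
 proof -
  have "sin (q - p) * (ph5 * cos xi - ph4 * sin xi) = ph5 * (sin (q - p) * cos xi) - ph4 * (sin (q - p) * sin xi)"
   by (simp add: algebra_simps)
  then show ?thesis unfolding cs(1)[of q p xi] cs(2)[of q p xi] by (simp add: algebra_simps)
 qed
 show "trig_convex (gap ph4 ph5 e)" if e: "0 <= e"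
  unfolding trig_convex_def
 proof (intro allI impI)
  fix p xi q :: real assume "p <= xi & xi <= q & q <= p + pi"
  then have "e * (sin (q - p) * l xi) <= e * (sin (q - xi) * l p + sin (xi - p) * l q)"
   using e by (intro mult_left_mono l_le) auto
  then show "sin (q - p) * gap ph4 ph5 e xi <= sin (q - xi) * gap ph4 ph5 e p + sin (xi - p) * gap ph4 ph5 e q"
   using P[of q p xi] by (simp add: gap_def right_diff_distrib distrib_left mult.left_commute)
 qed
 show "trig_convex (%xi. - gap ph4 ph5 e xi)" if e: "e <= 0"
  unfolding trig_convex_def
 proof (intro allI impI)
  fix p xi q :: real assume "p <= xi & xi <= q & q <= p + pi"
  then have "- e * (sin (q - p) * l xi) <= - e * (sin (q - xi) * l p + sin (xi - p) * l q)"
   using e by (intro mult_left_mono l_le) auto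
  then show "sin (q - p) * - gap ph4 ph5 e xi <= sin (q - xi) * - gap ph4 ph5 e p + sin (xi - p) * - gap ph4 ph5 e q"
   using P[of q p xi] by (simp add: gap_def right_diff_distrib distrib_left mult.left_commute)
 qed
qed

lemma curve_in_polar_figure: "(r xi * cos xi, r xi * sin xi) \<in> polar_figure U"
 using N_r[of xi] by (simp add: polar_figure_def N_def)

text \<open>A point of the polar figure is a multiple of a boundary point by a factor between 0 and
  1. As the maximum over the boundary curve is positive, such a factor cannot increase the value
  beyond it.\<close>

lemma lin_max:
 assumes nz: "ph4\<^sup>2 + ph5\<^sup>2 ~= 0"
 obtains m where "0 < lin ph4 ph5 m" "!!xi. lin ph4 ph5 xi <= lin ph4 ph5 m"
  "!!h. h \<in> polar_figure U ==> ph5 * fst h - ph4 * snd h <= lin ph4 ph5 m"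
proof -
 have "\<exists>m\<in>{0..2 * pi}. \<forall>xi\<in>{0..2 * pi}. lin ph4 ph5 xi <= lin ph4 ph5 m"
  by (rule continuous_attains_sup) (auto intro!: continuous_lin)
 then obtain m where m: "!!xi. xi \<in> {0..2 * pi} ==> lin ph4 ph5 xi <= lin ph4 ph5 m" by blast
 have max: "lin ph4 ph5 xi <= lin ph4 ph5 m" for xi
 proof -
  obtain k :: int where k: "0 <= xi + 2 * pi * of_int k" "xi + 2 * pi * of_int k < 0 + 2 * pi" using shift_2pi by blast
  show ?thesis using m[of "xi + 2 * pi * of_int k"] k lin_periodic[of ph4 ph5 xi k] by simp
 qed
 obtain rh xi :: real where p: "rh \<ge> 0" "(ph5, - ph4) = (rh * cos xi, rh * sin xi)" using polar_coordinates by blast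
 have "rh ~= 0" using p nz by auto
 have q: "ph5 = rh * cos xi" "ph4 = - (rh * sin xi)" using p(2) by simp_all
 have "lin ph4 ph5 xi = r xi * rh * ((cos xi)\<^sup>2 + (sin xi)\<^sup>2)" 
  unfolding lin_def q power2_eq_square by algebra
 then have "0 < lin ph4 ph5 xi" using r_pos[of xi] p(1) \<open>rh ~= 0\<close> by simp
 then have pos: "0 < lin ph4 ph5 m" using max[of xi] by simp
 show ?thesis
 proof (rule that[OF pos max])
  fix h assume h: "h \<in> polar_figure U"
  obtain rh et :: real where p: "rh \<ge> 0" "h = (rh * cos et, rh * sin et)" using polar_coordinates by blast
  have "rh * l et <= 1" using h N_polar[OF p(1), of et] p(2) by (simp add: polar_figure_def N_def)
  then have c: "0 <= rh * l et" "rh * l et <= 1" using p(1) l_pos[of et] by auto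
  have "ph5 * fst h - ph4 * snd h = (rh * l et) * lin ph4 ph5 et"
   using l_pos[of et] by (simp add: p(2) lin_def r_eq field_simps)
  also have "\<dots> <= (rh * l et) * lin ph4 ph5 m" using c max by (intro mult_left_mono) auto
  also have "\<dots> <= 1 * lin ph4 ph5 m" using c pos by (intro mult_right_mono) auto
  finally show "ph5 * fst h - ph4 * snd h <= lin ph4 ph5 m" by simp
 qed
qed

lemma Sup_lin:
 assumes nz: "ph4\<^sup>2 + ph5\<^sup>2 ~= 0"
 defines "E0 \<equiv> (SUP h\<in>polar_figure U. ph5 * fst h - ph4 * snd h)"
 shows "0 < E0" "lin ph4 ph5 xi <= E0" "\<exists>m. lin ph4 ph5 m = E0"
proof -
 obtain m where m: "0 < lin ph4 ph5 m" "!!xi. lin ph4 ph5 xi <= lin ph4 ph5 m"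
  "!!h. h \<in> polar_figure U ==> ph5 * fst h - ph4 * snd h <= lin ph4 ph5 m" using lin_max[OF nz] by blast
 have "E0 = lin ph4 ph5 m" unfolding E0_def
 proof (rule cSup_eq_maximum)
  show "lin ph4 ph5 m \<in> (%h. ph5 * fst h - ph4 * snd h) ` polar_figure U"
   by (rule image_eqI[OF _ curve_in_polar_figure[of m]]) (simp add: lin_def)
 qed (use m(3) in auto)
 then show "0 < E0" "lin ph4 ph5 xi <= E0" "\<exists>m. lin ph4 ph5 m = E0" using m by auto
qed

lemma Inf_lin:
 assumes nz: "ph4\<^sup>2 + ph5\<^sup>2 ~= 0"
 defines "E1 \<equiv> (INF h\<in>polar_figure U. ph5 * fst h - ph4 * snd h)"
 shows "E1 < 0" "E1 <= lin ph4 ph5 xi" "\<exists>m. lin ph4 ph5 m = E1"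
proof -
 have nz': "(- ph4)\<^sup>2 + (- ph5)\<^sup>2 ~= 0" using nz by simp
 obtain m where m: "0 < lin (- ph4) (- ph5) m" "!!xi. lin (- ph4) (- ph5) xi <= lin (- ph4) (- ph5) m"
  "!!h. h \<in> polar_figure U ==> - ph5 * fst h - - ph4 * snd h <= lin (- ph4) (- ph5) m" using lin_max[OF nz'] by blast
 have "E1 = lin ph4 ph5 m" unfolding E1_def
 proof (rule cInf_eq_minimum)
  show "lin ph4 ph5 m \<in> (%h. ph5 * fst h - ph4 * snd h) ` polar_figure U"
   by (rule image_eqI[OF _ curve_in_polar_figure[of m]]) (simp add: lin_def)
  fix x assume "x \<in> (%h. ph5 * fst h - ph4 * snd h) ` polar_figure U"
  then show "lin ph4 ph5 m <= x" using m(3) by (force simp: lin_minus)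
 qed
 then show "E1 < 0" "E1 <= lin ph4 ph5 xi" "\<exists>m. lin ph4 ph5 m = E1" using m by (auto simp: lin_minus)
qed

lemma continuous_angle_rhs: "continuous_on S (angle_rhs F (ph1, ph2, ph3, ph4, ph5))"
 unfolding angle_rhs_gap by (intro continuous_intros continuous_l continuous_gap)

lemma angle_rhs_periodic: "angle_rhs F (ph1, ph2, ph3, ph4, ph5) (xi + 2 * pi * of_int k) = angle_rhs F (ph1, ph2, ph3, ph4, ph5) xi"
 unfolding angle_rhs_gap gap_periodic l_periodic ..

lemma angle_rhs_sign:
 fixes ph1 ph2 ph3 ph4 ph5
 defines "R \<equiv> angle_rhs F (ph1, ph2, ph3, ph4, ph5)" and "E \<equiv> energy (ph1, ph2, ph3, ph4, ph5)"
 shows "0 < R xi \<longleftrightarrow> lin ph4 ph5 xi < E" "R xi = 0 \<longleftrightarrow> lin ph4 ph5 xi = E" "R xi < 0 \<longleftrightarrow> E < lin ph4 ph5 xi"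
proof -
 have "R xi = 2 * l xi ^ 4 * (E - lin ph4 ph5 xi)"
  unfolding R_def E_def angle_rhs_gap gap_lin by (simp del: energy.simps add: power3_eq_cube power4_eq_xxxx)
 moreover have "0 < 2 * l xi ^ 4" using l_pos[of xi] by simp
 ultimately show "0 < R xi \<longleftrightarrow> lin ph4 ph5 xi < E" "R xi = 0 \<longleftrightarrow> lin ph4 ph5 xi = E" "R xi < 0 \<longleftrightarrow> E < lin ph4 ph5 xi"
  by (auto simp: zero_less_mult_iff mult_less_0_iff)
qed

text \<open>The sign of \<open>E\<close> decides which function is trigonometrically convex. For
  \<open>E >= 0\<close> it is the gap, and its arc of negativity is the forbidden one; for
  \<open>E < 0\<close> it is the negated gap, whose arc of negativity is the allowed one. Linear
  growth at the zeros makes the travel time finite, so an intermediate energy level has no divergent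
  case.\<close>

lemma oscillation_interval:
 fixes ph1 ph2 ph3 ph4 ph5
 defines "R \<equiv> angle_rhs F (ph1, ph2, ph3, ph4, ph5)" and "E \<equiv> energy (ph1, ph2, ph3, ph4, ph5)"
 assumes hi: "E < lin ph4 ph5 m1" "0 < lin ph4 ph5 m1" and lo: "lin ph4 ph5 m2 < E" "lin ph4 ph5 m2 < 0"
 obtains p q where "p < q" "q < p + 2 * pi" "R p = 0" "R q = 0" "!!xi. [|p < xi; xi < q|] ==> 0 < R xi"
  "!!xi. [|q < xi; xi < p + 2 * pi|] ==> R xi < 0" "ker R integrable_on {p..q}"
proof -
 let ?G = "gap ph4 ph5 E"
 obtain \<mu> where \<mu>: "\<mu> > 0" "!!xi. \<mu> <= l xi" using l_lower_bound by blast
 have R: "R xi = 2 * l xi ^ 3 * ?G xi" for xi unfolding R_def E_def by (rule angle_rhs_gap)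
 have l3: "0 < 2 * l xi ^ 3" for xi using l_pos[of xi] by simp
 have Rs: "0 < R xi \<longleftrightarrow> 0 < ?G xi" "R xi = 0 \<longleftrightarrow> ?G xi = 0" "R xi < 0 \<longleftrightarrow> ?G xi < 0" for xi
  using l3[of xi] by (auto simp: R zero_less_mult_iff mult_less_0_iff)
 have Rl: "2 * \<mu> ^ 3 * c * t <= R xi" if "c * t <= ?G xi" "0 <= c * t" for c t xi
 proof -
  have "2 * \<mu> ^ 3 <= 2 * l xi ^ 3" using \<mu> by (simp add: power_mono)
  then have "(2 * \<mu> ^ 3) * (c * t) <= (2 * l xi ^ 3) * ?G xi" using that \<mu>(1) l_pos[of xi] by (intro mult_mono) auto
  then show ?thesis by (simp add: R mult.assoc)
 qed
 have cR: "continuous_on UNIV R" unfolding R_def by (rule continuous_angle_rhs)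
 show ?thesis
 proof (cases "0 <= E")
  case True
  \<comment> \<open>At the antipode of \<open>m1\<close> both summands of the gap are nonnegative
    and the linear one is positive.\<close>
  have m: "?G m1 < 0" "0 < ?G (m1 - pi)"
  proof -
   show "?G m1 < 0" using hi l_pos[of m1] by (simp add: gap_lin mult_less_0_iff)
   have "0 <= E * l (m1 - pi)" using True l_pos[of "m1 - pi"] by simp
   moreover have "0 < l m1 * lin ph4 ph5 m1" using hi l_pos[of m1] by simp
   ultimately show "0 < ?G (m1 - pi)" unfolding gap_antipode by simp
  qed
  show ?thesis
  proof (rule trig_convex_zeros[OF gap_trig_convex(1)[OF True] continuous_gap gap_periodic_1 m])
  fix a b c d assume Z: "a < b" "b < a + 2 * pi" "0 < c" "0 < d" "?G a = 0" "?G b = 0"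
   "!!xi. [|a < xi; xi < b|] ==> ?G xi < 0" "!!xi. [|b < xi; xi < a + 2 * pi|] ==> 0 < ?G xi"
   "!!xi. [|b <= xi; xi <= b + d|] ==> c * (xi - b) <= ?G xi" "!!xi. [|a - d <= xi; xi <= a|] ==> c * (a - xi) <= ?G xi"
  have z: "?G (a + 2 * pi) = 0" using Z(5) by (simp add: gap_periodic_1)
  show ?thesis
  proof (rule that[of b "a + 2 * pi"])
   show "b < a + 2 * pi" "a + 2 * pi < b + 2 * pi" using Z by auto
   show R0: "R b = 0" "R (a + 2 * pi) = 0" using Rs Z z by auto
   show Rp: "0 < R xi" if "b < xi" "xi < a + 2 * pi" for xi using Rs Z(8) that by blast
   show "R xi < 0" if "a + 2 * pi < xi" "xi < b + 2 * pi" for xi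
    using Z(7)[of "xi - 2 * pi"] that gap_periodic_1[of ph4 ph5 E "xi - 2 * pi"] Rs by simp
   show "ker R integrable_on {b..a + 2 * pi}"
   proof (rule ker_integrable_linear_ends[OF cR _ Z(4,2) R0 Rp])
    show "0 < 2 * \<mu> ^ 3 * c" using \<mu> Z(3) by simp
    show "2 * \<mu> ^ 3 * c * (xi - b) <= R xi" if "b <= xi" "xi <= b + d" for xi
     using Rl[OF Z(9)[OF that]] that Z(3) by simp
    fix xi assume x: "a + 2 * pi - d <= xi" "xi <= a + 2 * pi"
    then have "c * (a + 2 * pi - xi) <= ?G xi"
     using Z(10)[of "xi - 2 * pi"] gap_periodic_1[of ph4 ph5 E "xi - 2 * pi"] by (simp add: algebra_simps)
    then show "2 * \<mu> ^ 3 * c * (a + 2 * pi - xi) <= R xi" by (rule Rl) (use x Z(3) in simp)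
   qed
  qed
  qed
 next
  case False
  then have E: "E <= 0" by simp
  let ?H = "%xi. - ?G xi"
  have m: "?H m2 < 0" "0 < ?H (m2 - pi)"
  proof -
   show "?H m2 < 0" using lo l_pos[of m2] by (simp add: gap_lin)
   have "E * l (m2 - pi) <= 0" using E l_pos[of "m2 - pi"] by (simp add: mult_le_0_iff)
   moreover have "l m2 * lin ph4 ph5 m2 < 0" using lo l_pos[of m2] by (simp add: mult_less_0_iff)
   ultimately show "0 < ?H (m2 - pi)" unfolding gap_antipode by simp
  qed
  have cH: "continuous_on UNIV ?H" by (intro continuous_intros continuous_gap)
  have pH: "?H (xi + 2 * pi) = ?H xi" for xi by (simp add: gap_periodic_1)
  show ?thesis
  proof (rule trig_convex_zeros[OF gap_trig_convex(2)[OF E] cH pH m])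
  fix a b c d assume Z: "a < b" "b < a + 2 * pi" "0 < c" "0 < d" "?H a = 0" "?H b = 0"
   "!!xi. [|a < xi; xi < b|] ==> ?H xi < 0" "!!xi. [|b < xi; xi < a + 2 * pi|] ==> 0 < ?H xi"
   "!!xi. [|a <= xi; xi <= a + d|] ==> c * (xi - a) <= - ?H xi" "!!xi. [|b - d <= xi; xi <= b|] ==> c * (b - xi) <= - ?H xi"
  show ?thesis
  proof (rule that[OF Z(1,2)])
   show R0: "R a = 0" "R b = 0" using Rs Z by auto
   show Rp: "0 < R xi" if "a < xi" "xi < b" for xi using Rs(1)[of xi] Z(7)[OF that] by simp
   show "R xi < 0" if "b < xi" "xi < a + 2 * pi" for xi using Rs(3)[of xi] Z(8)[OF that] by simp
   show "ker R integrable_on {a..b}"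
   proof (rule ker_integrable_linear_ends[OF cR _ Z(4,1) R0 Rp])
    show "0 < 2 * \<mu> ^ 3 * c" using \<mu> Z(3) by simp
    show "2 * \<mu> ^ 3 * c * (xi - a) <= R xi" if "a <= xi" "xi <= a + d" for xi
     using Z(9)[OF that] that Z(3) by (intro Rl) simp_all
    show "2 * \<mu> ^ 3 * c * (b - xi) <= R xi" if "b - d <= xi" "xi <= b" for xi
     using Z(10)[OF that] that Z(3) by (intro Rl) simp_all
   qed
  qed
  qed
 qed
qed

text \<open>The gap is nonnegative, and the antipode of each of its zeros is not a zero. The last
  zero before and the first zero after such an antipode bound the arc of positivity. The remaining
  part of the period is shorter than \<open>pi\<close>, so it consists of zeros by
  convexity.\<close>

lemma gap_ode_at:
 fixes ph1 ph2 ph3 ph4 ph5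
 defines "R \<equiv> angle_rhs F (ph1, ph2, ph3, ph4, ph5)" and "E \<equiv> energy (ph1, ph2, ph3, ph4, ph5)"
 assumes E: "0 < E" and le: "!!xi. lin ph4 ph5 xi <= E" and m: "lin ph4 ph5 m = E"
 obtains al be where "gap_ode R al be" "be - 2 * pi <= th0" "th0 < be"
proof -
 let ?G = "gap ph4 ph5 E"
 have cR: "continuous_on UNIV R" unfolding R_def by (rule continuous_angle_rhs)
 have per: "R (xi + 2 * pi * of_int k) = R xi" for xi k unfolding R_def by (rule angle_rhs_periodic)
 have nn: "0 <= ?G xi" for xi using le[of xi] l_pos[of xi] by (simp add: gap_lin)
 have R: "R xi = 2 * l xi ^ 3 * ?G xi" for xi unfolding R_def E_def by (rule angle_rhs_gap)
 have R0: "R xi = 0 \<longleftrightarrow> ?G xi = 0" for xi using l_pos[of xi] by (simp add: R)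
 have Rnn: "0 <= R xi" for xi using nn[of xi] l_pos[of xi] by (simp add: R)
 have G0: "?G xi = 0 \<longleftrightarrow> lin ph4 ph5 xi = E" for xi using l_pos[of xi] by (auto simp: gap_lin)
 have anti: "0 < ?G (xi + pi)" if "?G xi = 0" for xi
  using that E l_pos[of xi] l_pos[of "xi + pi"] unfolding gap_antipode G0 by (simp add: add_pos_pos)
 define n where "n = m + pi"
 have n: "0 < ?G n" using anti[of m] m G0 by (simp add: n_def)
 have closed: "closed {xi. R xi = 0}" by (intro closed_Collect_eq cR continuous_on_const)
 have zm: "R m = 0" "R (m + 2 * pi) = 0" using m G0 R0 per[of m 1] by auto
 have "\<exists>al\<in>{xi. R xi = 0} \<inter> {m..n}. \<forall>xi\<in>{xi. R xi = 0} \<inter> {m..n}. xi <= al"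
  by (rule compact_attains_sup) (use closed zm in \<open>auto intro: closed_Int_compact simp: n_def\<close>)
 then obtain al where a: "R al = 0" "m <= al" "al <= n" "!!xi. [|R xi = 0; m <= xi; xi <= n|] ==> xi <= al" by auto
 have "\<exists>be\<in>{xi. R xi = 0} \<inter> {n..m + 2 * pi}. \<forall>xi\<in>{xi. R xi = 0} \<inter> {n..m + 2 * pi}. be <= xi"
  by (rule compact_attains_inf) (use closed zm in \<open>auto intro: closed_Int_compact simp: n_def\<close>)
 then obtain be where b: "R be = 0" "n <= be" "be <= m + 2 * pi" "!!xi. [|R xi = 0; n <= xi; xi <= m + 2 * pi|] ==> be <= xi" by auto
 have ne: "al ~= n" "be ~= n" using a b n R0 by auto
 then have lt: "al < n" "n < be" using a b by auto
 note tc = gap_trig_convex(1)[OF less_imp_le[OF E]]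
 \<comment> \<open>At distance exactly \<open>pi\<close> the two zeros would be antipodal; at a
   smaller distance the gap would vanish at \<open>n\<close> between them.\<close>
 have far: "al + pi < be"
 proof (rule ccontr)
  assume "~ ?thesis"
  then consider "be = al + pi" | "be < al + pi" by linarith
  then show False
  proof cases
   case 1 then show False using anti[of al] a(1) b(1) R0 by simp
  next
   case 2
   have "?G n = 0" by (rule trig_convex_zero_between[OF tc nn, of al n be]) (use 2 lt a b R0 in auto)
   then show False using n by simp
  qed
 qed
 \<comment> \<open>The arcs are moved by full turns until \<open>th0\<close> lies in the chosen
   period.\<close>
 obtain k :: int where k: "be - 2 * pi <= th0 + 2 * pi * of_int k" "th0 + 2 * pi * of_int k < be - 2 * pi + 2 * pi"
  using shift_2pi by blast
 define s where "s = 2 * pi * of_int k"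
 have per_s: "R (xi + s) = R xi" for xi unfolding s_def by (rule per)
 show ?thesis
 proof (rule that[of "al - s" "be - s"])
  show "gap_ode R (al - s) (be - s)"
  proof
   show "al - s < be - s" "be - s <= al - s + 2 * pi" using lt a b by auto
   fix xi
   show "0 < R xi" if "al - s < xi" "xi < be - s"
   proof -
    have "R (xi + s) ~= 0" using a(4)[of "xi + s"] b(4)[of "xi + s"] that a b by force
    then show ?thesis using Rnn[of xi] per_s[of xi] by simp
   qed
   show "R xi = 0" if "be - s <= xi" "xi <= al - s + 2 * pi"
   proof -
    have "?G (al + 2 * pi) = 0" using a(1) R0 by (simp add: gap_periodic_1)
    then have "?G (xi + s) = 0"
     by (intro trig_convex_zero_between[OF tc nn, of be "xi + s" "al + 2 * pi"]) (use that far b R0 in auto)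
    then show ?thesis using R0[of "xi + s"] per_s[of xi] by simp
   qed
  qed (rule cR, rule per)
 qed (use k in \<open>auto simp: s_def\<close>)
qed

end

subsection \<open>The classification of extremals\<close>

declare energy.simps [simp del] angle_rhs.simps [simp del]

lemma integrable_translate:
 fixes f :: "real \<Rightarrow> real"
 assumes "f integrable_on {p..q}"
 shows "(%x. f (x + s)) integrable_on {p - s..q - s}"
proof -
 have "(%x. (1 / 1) *\<^sub>R x + - ((1 / 1) *\<^sub>R s)) = (%x. x + - s)" by simp
 from integrable_affinity[of f p q 1 s, unfolded this] assms show ?thesis
  unfolding box_real image_add_atLeastAtMost' by simp
qed

locale initial_data = plane_quasinorm F for F +
 fixes ph1 ph2 ph3 ph4 ph5 th0 :: real
 assumes nz: "ph4\<^sup>2 + ph5\<^sup>2 ~= 0"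
  and init: "r th0 * cos th0 = ph1" "r th0 * sin th0 = ph2"
begin

abbreviation "ph \<equiv> (ph1, ph2, ph3, ph4, ph5)"
abbreviation "R \<equiv> angle_rhs F ph"
abbreviation "E \<equiv> energy ph"
abbreviation "L \<equiv> lin ph4 ph5"
abbreviation "E0 \<equiv> (SUP h\<in>polar_figure U. ph5 * fst h - ph4 * snd h)"
abbreviation "E1 \<equiv> (INF h\<in>polar_figure U. ph5 * fst h - ph4 * snd h)"
abbreviation "T \<equiv> time_integrand F ph"
abbreviation "T0 \<equiv> time_integrand0 F ph"

lemmas cR = continuous_angle_rhs[of UNIV ph1 ph2 ph3 ph4 ph5]
lemmas perR = angle_rhs_periodic[of ph1 ph2 ph3 ph4 ph5]
lemmas R_sign = angle_rhs_sign[of ph1 ph2 ph3 ph4 ph5]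
lemmas Emax = Sup_lin[OF nz]
lemmas Emin = Inf_lin[OF nz]

lemma energy_init: "E = ph3\<^sup>2 / 2 + L th0"
 by (simp add: energy.simps lin_def init)

lemma R_init: "r th0 ^ 4 * R th0 = ph3\<^sup>2"
proof -
 have "R th0 = 2 * (E - L th0) / r th0 ^ 4" unfolding angle_rhs_energy lin_def ..
 then show ?thesis using energy_init r_pos[of th0] by simp
qed

lemma R_init_sign: "0 <= R th0" "ph3 = 0 \<longleftrightarrow> R th0 = 0" "ph3 ~= 0 \<longleftrightarrow> 0 < R th0"
proof -
 have p: "0 < r th0 ^ 4" using r_pos[of th0] by simp
 show "0 <= R th0" using R_init p by (metis zero_le_mult_iff zero_le_power2 not_le)
 have "r th0 ^ 4 * R th0 = 0 \<longleftrightarrow> R th0 = 0" using p by simp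
 then show "ph3 = 0 \<longleftrightarrow> R th0 = 0" unfolding R_init by simp
 then show "ph3 ~= 0 \<longleftrightarrow> 0 < R th0" using \<open>0 <= R th0\<close> unfolding less_le by auto
qed

lemma energy_range:
 "ph3 ~= 0 & E > E0 \<or> ph3 = 0 & E = E1 \<or> E1 < E & E < E0 \<or> ph3 ~= 0 & E = E0 \<or> ph3 = 0 & E = E0"
proof -
 have le: "E1 <= L th0" "L th0 <= E0" by (rule Emin(2), rule Emax(2))
 show ?thesis
 proof (cases "ph3 = 0")
  case True
  then have "E = L th0" using energy_init by simp
  then have "E = E1 \<or> E1 < E & E < E0 \<or> E = E0" using le by linarith
  then show ?thesis using True by blast
 next
  case False
  then have "0 < ph3\<^sup>2" by simp
  then have "E1 < E" using le energy_init by linarith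
  then have "E > E0 \<or> E1 < E & E < E0 \<or> E = E0" by linarith
  then show ?thesis using False by blast
 qed
qed

text \<open>What the initial covector prescribes for the scalar equation: the value at 0 and, since
  the square of the derivative is already determined, only the sign of the derivative.\<close>

definition adm :: "(real \<Rightarrow> real) \<Rightarrow> bool" where
 "adm th \<longleftrightarrow> sol R th & th 0 = th0 & (ph3 = 0 \<or> 0 < ph3 * deriv th 0)"

lemma ext_adm:
 assumes e: "extremal_with F ph g th" and i: "th 0 = th0"
 shows "adm th"
proof -
 obtain x y z v w rh where "extremal_data F ph1 ph2 ph3 ph4 ph5 g th x y z v w rh"
  using e unfolding extremal_with_iff_data[OF nz] by blast
 then interpret D: extremal_data F ph1 ph2 ph3 ph4 ph5 g th x y z v w rh .
 have "sol R th" unfolding sol_def using D.th_deriv D.continuous_deriv_th D.deriv_th_squared by blast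
 moreover have "deriv th 0 = ph3 / (r (th 0))\<^sup>2" using D.deriv_th[of 0] D.at_0 by (simp add: D.h3_def)
 then have "ph3 = 0 \<or> 0 < ph3 * deriv th 0"
  using r_pos[of "th 0"] by (simp add: power2_eq_square[symmetric] zero_less_divide_iff)
 ultimately show ?thesis using i by (simp add: adm_def)
qed

lemma adm_ext:
 assumes EE: "E = E0" and a: "adm th"
 shows "\<exists>g. extremal_with F ph g th"
proof (rule ex_extremal_with[OF nz])
 show S: "sol R th" using a by (simp add: adm_def)
 have i: "th 0 = th0" using a by (simp add: adm_def)
 show "0 < E" "ph5 * (r xi * cos xi) - ph4 * (r xi * sin xi) <= E" for xi
  using Emax(1) Emax(2)[of xi] unfolding EE lin_def by auto
 show "r (th 0) * cos (th 0) = ph1" "r (th 0) * sin (th 0) = ph2" using init i by auto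
 \<comment> \<open>The equation gives \<open>d^2 = ph3^2\<close>, and the sign condition excludes
   the root \<open>- ph3\<close> unless both are 0.\<close>
 define d where "d = (r th0)\<^sup>2 * deriv th 0"
 have "d\<^sup>2 = r th0 ^ 4 * (deriv th 0)\<^sup>2" by (simp add: d_def power_mult_distrib)
 then have "d\<^sup>2 = ph3\<^sup>2" unfolding sol_eq[OF S] i R_init .
 then have "d = ph3 \<or> d = - ph3" by (simp add: power2_eq_iff)
 moreover have "ph3 = 0 \<or> 0 < ph3 * d"
 proof -
  have "ph3 * d = (r th0)\<^sup>2 * (ph3 * deriv th 0)" by (simp add: d_def)
  moreover have rp: "0 < (r th0)\<^sup>2" using r_pos[of th0] by simp
  have "0 < (r th0)\<^sup>2 * (ph3 * deriv th 0)" if "ph3 ~= 0"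
   by (rule mult_pos_pos[OF rp]) (use a that in \<open>simp add: adm_def\<close>)
  ultimately show ?thesis by (simp only:) blast
 qed
 moreover have "ph3 * - ph3 <= 0" by simp
 ultimately have "d = ph3" by auto
 then show "(r (th 0))\<^sup>2 * deriv th 0 = ph3" by (simp add: d_def i)
qed

text \<open>On a rest \<open>L = E\<close> and the control \<open>(ph5, - ph4) / E\<close> lies in
  \<open>U\<close>, which means \<open>L / E <= 1\<close> everywhere. So \<open>E\<close> is an
  extreme value of \<open>L\<close>, and rests are impossible at intermediate energies.\<close>

lemma ext_constancy:
 assumes e: "extremal_with F ph g th" and ab: "a < b" and c: "!!t. t \<in> {a..b} ==> th t = c"
 shows "formulas_B_on ph g a b" "E = E0 \<or> E = E1"
proof -
 obtain x y z v w rh where "extremal_data F ph1 ph2 ph3 ph4 ph5 g th x y z v w rh"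
  using e unfolding extremal_with_iff_data[OF nz] by blast
 then interpret D: extremal_data F ph1 ph2 ph3 ph4 ph5 g th x y z v w rh .
 show "formulas_B_on ph g a b" by (rule D.formulas_B[OF ab c nz])
 have E: "E ~= 0" by (rule D.energy_rest_nonzero[OF ab c nz])
 have Lc: "L c = E" using D.energy_rest[OF ab c nz] by (simp add: lin_def)
 have "ph5 / E * cos xi + - ph4 / E * sin xi <= l xi" for xi
  using D.control_rest_in_U[OF ab c nz] unfolding in_U_iff_l by blast
 moreover have "ph5 / E * cos xi + - ph4 / E * sin xi = (l xi * L xi) / E" for xi
  using l_pos[of xi] E by (simp add: lin_def r_eq field_simps)
 ultimately have "l xi * (L xi / E) <= l xi * 1" for xi by simp
 then have le: "L xi / E <= 1" for xi using l_pos[of xi] mult_le_cancel_left_pos by blast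
 obtain m0 m1 where m: "L m0 = E0" "L m1 = E1" using Emax(3) Emin(3) by blast
 show "E = E0 \<or> E = E1"
 proof (cases "0 < E")
  case True
  then have "E0 <= E" using le[of m0] m by (simp add: field_simps)
  then show ?thesis using Emax(2)[of c] Lc by simp
 next
  case False
  then have "E <= E1" using le[of m1] m E by (simp add: field_simps)
  then show ?thesis using Emin(2)[of c] Lc by simp
 qed
qed

lemma ext_line:
 assumes "extremal_with F ph g th" "!!t. th t = c"
 shows "metric_line_A F ph g"
proof -
 obtain x y z v w rh where "extremal_data F ph1 ph2 ph3 ph4 ph5 g th x y z v w rh"
  using assms(1) unfolding extremal_with_iff_data[OF nz] by blast
 then interpret D: extremal_data F ph1 ph2 ph3 ph4 ph5 g th x y z v w rh .
 show ?thesis by (rule D.rest_line[OF assms(2) nz])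
qed

lemma cv_constant_values:
 assumes EE: "E = E0" and cv: "cv R th0 ph3 C"
 shows "constant_values F ph th0 C"
 unfolding constant_values_def
proof (intro conjI allI impI ballI)
 fix g th a b c assume *: "extremal_with F ph g th & th 0 = th0 & a < b & (\<forall>t\<in>{a..b}. th t = c)"
 then have "adm th" using ext_adm by blast
 then show "c \<in> C" using * cv[unfolded cv_def, THEN conjunct1, rule_format, of th a b c] by (auto simp: adm_def)
 show "formulas_B_on ph g a b" by (rule ext_constancy(1)[of g th a b c]) (use * in auto)
next
 fix c and d :: real assume "c \<in> C" "0 < d"
 from cv[unfolded cv_def, THEN conjunct2, rule_format, OF this]
 obtain th a where t: "sol R th & th 0 = th0 & (ph3 = 0 \<or> 0 < ph3 * deriv th 0) & maximal_constancy th c a (a + d)" by blast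
 then have "adm th" by (simp add: adm_def)
 then obtain g where "extremal_with F ph g th" using adm_ext[OF EE] by blast
 then show "\<exists>g th a. extremal_with F ph g th & th 0 = th0 & maximal_constancy th c a (a + d)" using t by blast
qed

text \<open>A solution with a maximal rest of length 1 is altered by \<open>rest_forever\<close>;
  both versions lift to extremals.\<close>

lemma cv_not_unique:
 assumes EE: "E = E0" and cv: "cv R th0 ph3 C" and c: "c \<in> C"
 shows "angle_not_unique F ph th0"
proof -
 from cv[unfolded cv_def, THEN conjunct2, rule_format, OF c zero_less_one]
 obtain th a where t: "sol R th & th 0 = th0 & (ph3 = 0 \<or> 0 < ph3 * deriv th 0) & maximal_constancy th c a (a + 1)" by blast
 then have S: "sol R th" and mc: "maximal_constancy th c a (a + 1)" by blast+
 have ct: "th t = c" if "t \<in> {a..a + 1}" for t using mc that unfolding maximal_constancy_def by blast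
 have "deriv th a = 0" by (rule deriv_zero_on_constancy_interval[OF _ ct _ sol_deriv[OF S], of a]) auto
 then have "R c = 0" using sol_eq[OF S, of a] ct[of a] by simp
 then obtain th' where t': "sol R th'" "th' ~= th" "th' 0 = th 0" "deriv th' 0 = deriv th 0"
  using rest_forever[OF S _ mc] by auto
 have ad: "adm th" "adm th'" using t t' by (auto simp: adm_def)
 obtain g where g: "extremal_with F ph g th" using adm_ext[OF EE ad(1)] by blast
 obtain g' where g': "extremal_with F ph g' th'" using adm_ext[OF EE ad(2)] by blast
 have "extremal_with F ph g th & extremal_with F ph g' th' & th 0 = th0 & th' 0 = th0 & th ~= th'" using g g' t t' by auto
 then show ?thesis unfolding angle_not_unique_def by blast
qed

section \<open>The time integrals of the theorem in terms of \<open>ker R\<close>, and the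
  noncritical energies\<close>

lemma T_eq:
 assumes ph3: "ph3 ~= 0"
 shows "T = (%xi. sgn ph3 * ker R xi)"
proof
 fix xi
 have rp: "0 < r xi" by (rule r_pos)
 have "1 + (2 * ph4 / ph3\<^sup>2) * (r xi * sin xi - ph2) - (2 * ph5 / ph3\<^sup>2) * (r xi * cos xi - ph1)
   = ((r xi)\<^sup>2)\<^sup>2 * R xi / ph3\<^sup>2"
  using ph3 rp by (simp add: angle_rhs.simps field_simps)
 then have "sqrt (1 + (2 * ph4 / ph3\<^sup>2) * (r xi * sin xi - ph2) - (2 * ph5 / ph3\<^sup>2) * (r xi * cos xi - ph1))
   = (r xi)\<^sup>2 * sqrt (R xi) / \<bar>ph3\<bar>"
  by (simp only: real_sqrt_divide real_sqrt_mult real_sqrt_abs abs_power2)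
 then show "T xi = sgn ph3 * ker R xi"
  using ph3 rp by (simp add: ker_def sgn_if)
qed

lemma T0_eq:
 assumes ph3: "ph3 = 0"
 shows "T0 = ker R"
proof
 fix xi
 have rp: "0 < r xi" by (rule r_pos)
 have "2 * ph4 * (r xi * sin xi - ph2) - 2 * ph5 * (r xi * cos xi - ph1) = ((r xi)\<^sup>2)\<^sup>2 * R xi"
  using ph3 rp by (simp add: angle_rhs.simps field_simps)
 then have "sqrt (2 * ph4 * (r xi * sin xi - ph2) - 2 * ph5 * (r xi * cos xi - ph1)) = (r xi)\<^sup>2 * sqrt (R xi)"
  by (simp only: real_sqrt_mult real_sqrt_abs abs_power2)
 then show "T0 xi = ker R xi" using rp by (simp add: ker_def)
qed

lemma T_integral:
 assumes ph3: "ph3 ~= 0" and nn: "!!xi. [|min a b < xi; xi < max a b|] ==> 0 <= R xi"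
 shows "integral_finite T a b \<longleftrightarrow> ker R integrable_on {min a b..max a b}"
  and "ker R integrable_on {min a b..max a b} ==> integral_from_to T a b = sgn ph3 * oriented_integral (ker R) a b"
proof -
 have "sgn ph3 ~= 0" using ph3 by (simp add: sgn_if)
 then show "integral_finite T a b \<longleftrightarrow> ker R integrable_on {min a b..max a b}"
  unfolding T_eq[OF ph3] using integral_finite_scale integral_finite_ker(1)[OF cR nn] by blast
 assume "ker R integrable_on {min a b..max a b}"
 from integral_finite_ker(2)[OF cR nn this]
 show "integral_from_to T a b = sgn ph3 * oriented_integral (ker R) a b"
  unfolding T_eq[OF ph3] by (simp only: interval_lebesgue_integral_mult_right)
qed

lemma time_reach:
 assumes ph3: "ph3 ~= 0" and a: "adm th"
  and R: "!!et. [|et \<in> closed_segment th0 xi; et ~= xi|] ==> R et > 0"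
  and i: "ker R integrable_on {min th0 xi..max th0 xi}"
 shows "integral_finite T th0 xi" "th (integral_from_to T th0 xi) = xi"
  "integral_from_to T th0 xi = sgn ph3 * oriented_integral (ker R) th0 xi"
proof -
 have nn: "0 <= R et" if "min th0 xi < et" "et < max th0 xi" for et
  using R[of et] that by (auto simp: closed_segment_eq_real_ivl min_def max_def split: if_splits)
 note TI = T_integral[OF ph3 nn]
 show "integral_finite T th0 xi" using TI(1) i by blast
 show eq: "integral_from_to T th0 xi = sgn ph3 * oriented_integral (ker R) th0 xi" by (rule TI(2)[OF _ _ i])
 have S: "sol R th" and t0: "th 0 = th0" and d: "0 < ph3 * deriv th 0" using a ph3 by (auto simp: adm_def)
 have sg: "sgn (deriv th 0) = sgn ph3" using d by (auto simp: zero_less_mult_iff)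
 have "deriv th 0 ~= 0" using d by auto
 from reach[OF S this, of xi] R i show "th (integral_from_to T th0 xi) = xi" unfolding eq t0 sg by blast
qed

text \<open>Here \<open>R\<close> is positive everywhere, so every angle is reached in finite time
  and \<open>th\<close> is injective; injectivity makes the right inverse two-sided.\<close>

lemma case1:
 assumes "ph3 ~= 0 & E > E0" and e: "extremal_with F ph g th & th 0 = th0"
 shows "(\<forall>t. integral_from_to T th0 (th t) = t) &
  (\<forall>xi. integral_finite T th0 xi & th (integral_from_to T th0 xi) = xi)"
proof -
 have ph3: "ph3 ~= 0" and EE: "E > E0" using assms by auto
 have a: "adm th" using ext_adm e by blast
 have Rp: "R xi > 0" for xi using R_sign(1)[of xi] Emax(2)[of xi] EE by simp
 have i: "ker R integrable_on {p..q}" for p q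
  by (intro integrable_continuous_real ker_continuous[OF cR]) (rule Rp)
 note tr = time_reach[OF ph3 a Rp i]
 have "inj th" using inj_if_positive Rp a unfolding adm_def by blast
 then have "integral_from_to T th0 (th t) = t" for t using tr(2)[of "th t"] by (rule injD)
 then show ?thesis using tr by blast
qed

lemma constant_if_at_rest:
 assumes S: "sol R th" and z: "!!t. R (th t) = 0"
 shows "th t = th 0"
proof -
 have "(th has_real_derivative 0) (at t)" for t
  using sol_deriv[OF S, of t] sol_deriv_at_zero[OF S z, of t] by simp
 then show ?thesis using DERIV_isconst_all[of th t 0] by blast
qed

text \<open>At the minimal energy \<open>R\<close> is nowhere positive, so it vanishes along the
  solution and the angle cannot move.\<close>

lemma case2:
 assumes "ph3 = 0 & E = E1" and e: "extremal_with F ph g th & th 0 = th0"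
 shows "(\<forall>t. th t = th0) & metric_line_A F ph g"
proof -
 have S: "sol R th" using ext_adm e by (auto simp: adm_def)
 have "R (th t) = 0" for t
 proof -
  have "~ 0 < R (th t)" unfolding R_sign(1) using Emin(2)[of "th t"] assms(1)[THEN conjunct2] by linarith
  then show ?thesis using sol_nonneg[OF S, of t] by linarith
 qed
 then have c: "th t = th0" for t using constant_if_at_rest[OF S, of t] e by simp
 then show ?thesis using ext_line[of g th th0] e by blast
qed

lemma case3_interval:
 assumes EE: "E1 < E" "E < E0"
 obtains p q where "p <= th0" "th0 <= q" "p < q" "q < p + 2 * pi" "R p = 0" "R q = 0" "!!xi. [|p < xi; xi < q|] ==> 0 < R xi"
  "!!xi. [|q < xi; xi < p + 2 * pi|] ==> R xi < 0" "ker R integrable_on {p..q}"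
proof -
 obtain m0 m1 where m: "L m0 = E0" "L m1 = E1" using Emax(3) Emin(3) by blast
 have hi: "E < L m0" "0 < L m0" and lo: "L m1 < E" "L m1 < 0" using m EE Emax(1) Emin(1) by auto
 show ?thesis
 proof (rule oscillation_interval[OF hi lo])
  fix p q
  assume I: "p < q" "q < p + 2 * pi" "R p = 0" "R q = 0" "!!xi. [|p < xi; xi < q|] ==> 0 < R xi"
   "!!xi. [|q < xi; xi < p + 2 * pi|] ==> R xi < 0" "ker R integrable_on {p..q}"
  obtain k :: int where k: "p <= th0 + 2 * pi * of_int k" "th0 + 2 * pi * of_int k < p + 2 * pi" using shift_2pi by blast
  define s where "s = 2 * pi * of_int k"
  have ps: "R (xi + s) = R xi" for xi unfolding s_def by (rule perR)
  have "th0 + s <= q" using I(6)[of "th0 + s"] k R_init_sign(1) ps[of th0] by (force simp: s_def)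
  show ?thesis
  proof (rule that[of "p - s" "q - s"])
   show "p - s <= th0" "th0 <= q - s" using k \<open>th0 + s <= q\<close> by (auto simp: s_def)
   show "R (p - s) = 0" "R (q - s) = 0" using ps[of "p - s"] ps[of "q - s"] I by auto
   show "0 < R xi" if "p - s < xi" "xi < q - s" for xi using I(5)[of "xi + s"] that ps[of xi] by auto
   show "R xi < 0" if "q - s < xi" "xi < p - s + 2 * pi" for xi using I(6)[of "xi + s"] that ps[of xi] by auto
   have "ker R (xi + s) = ker R xi" for xi by (simp add: ker_def ps)
   moreover have "(%xi. ker R (xi + s)) integrable_on {p - s..q - s}"
    by (rule integrable_translate[OF I(7)])
   ultimately show "ker R integrable_on {p - s..q - s}" by simp
  qed (use I in auto)
 qed
qed

text \<open>Negative values of \<open>R\<close> outside the allowed arc trap the angle, and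
  \<open>ext_constancy\<close> excludes rests, so the solution oscillates. The times
  \<open>t1\<close>, \<open>t2\<close> are arrivals at the two ends, about which it is symmetric;
  the sign of \<open>ph3\<close> decides which end comes first.\<close>

lemma case3:
 assumes EE: "E1 < E & E < E0" and e: "extremal_with F ph g th & th 0 = th0"
 shows "\<exists>t1 t2. t1 < t2 &
  (\<forall>t. \<forall>k::int. th (t + 2 * of_int k * (t2 - t1)) = th t) &
  (\<forall>t. \<forall>ti\<in>{t1, t2}. deriv th (ti + t) = - deriv th (ti - t) & th (ti + t) = th (ti - t)) &
  (ph3 ~= 0 -->
   (\<exists>th1 th2. nearest_zeros R th0 (min th1 th2) (max th1 th2) &
    ph3 * (th2 - th1) > 0 &
    integral_finite T th0 th1 & t1 = integral_from_to T th0 th1 &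
    integral_finite T th0 th2 & t2 = integral_from_to T th0 th2)) &
  (ph3 = 0 -->
   t1 = 0 &
   (\<exists>th2. th2 ~= th0 &
    (\<forall>xi\<in>closed_segment th0 th2.
      ph4 * (r xi * sin xi - r th0 * sin th0) \<ge> ph5 * (r xi * cos xi - r th0 * cos th0) &
      (ph4 * (r xi * sin xi - r th0 * sin th0) = ph5 * (r xi * cos xi - r th0 * cos th0) \<longleftrightarrow> xi = th0 \<or> xi = th2)) &
    integral_finite T0 th0 th2 &
    t2 = (if th2 > th0 then 1 else -1) * integral_from_to T0 th0 th2))" (is "\<exists>t1 t2. ?main t1 t2")
proof (rule case3_interval[OF EE[THEN conjunct1] EE[THEN conjunct2]])
 fix p q
 assume pq: "p <= th0" "th0 <= q" "p < q" "q < p + 2 * pi" and R0: "R p = 0" "R q = 0"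
  and Rp: "!!xi. [|p < xi; xi < q|] ==> 0 < R xi" and Rn: "!!xi. [|q < xi; xi < p + 2 * pi|] ==> R xi < 0"
  and int: "ker R integrable_on {p..q}"
 have a: "adm th" using ext_adm e by blast
 then have S: "sol R th" and t0: "th 0 = th0" by (auto simp: adm_def)
 have low: "R xi < 0" if "p - (p + 2 * pi - q) < xi" "xi < p" for xi
  using Rn[of "xi + 2 * pi"] perR[of xi 1] that by simp
 have stay: "th t \<in> {p..q}" for t
  by (rule trapped[OF S, of 0 p q "p + 2 * pi - q"]) (use t0 pq Rn low in auto)
 \<comment> \<open>Rests are excluded for extremals, not for arbitrary solutions of the scalar
   equation, which could stay at an end of the arc.\<close>
 have move: "\<exists>ta\<in>{s..t}. th ta ~= th s" if "s < t" for s t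
 proof (rule ccontr)
  assume "~ ?thesis"
  then have "th ta = th s" if "ta \<in> {s..t}" for ta using that by blast
  from ext_constancy(2)[OF e[THEN conjunct1] that this] show False using EE by auto
 qed
 have O: "oscillates R p q th" unfolding oscillates_def using S stay move by blast
 have sym: "th (s + ta) = th (s - ta)" "deriv th (s + ta) = - deriv th (s - ta)" if "th s \<in> {p, q}" for s ta
  by (rule oscillation_symmetric[OF O cR pq(3) int _ that]; rule Rp; assumption)+
 have main: "(\<forall>t. \<forall>k::int. th (t + 2 * of_int k * (t2 - t1)) = th t) &
  (\<forall>t. \<forall>ti\<in>{t1, t2}. deriv th (ti + t) = - deriv th (ti - t) & th (ti + t) = th (ti - t))"
  if "th t1 \<in> {p, q}" "th t2 \<in> {p, q}" for t1 t2
 proof -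
  have "th (t + 2 * of_int k * (t2 - t1)) = th t" for t and k :: int
   using periodic_if_reflections[of th t1 t2 t k] sym(1)[OF that(1)] sym(1)[OF that(2)] by blast
  then show ?thesis using sym[OF that(1)] sym[OF that(2)] by blast
 qed
 have sub: "ker R integrable_on {p'..q'}" if "p <= p'" "q' <= q" for p' q'
  by (rule integrable_subinterval_real[OF int]) (use that in auto)
 show "\<exists>t1 t2. ?main t1 t2"
 proof (cases "ph3 = 0")
  case False
  then have "0 < R th0" using R_init_sign(3) by blast
  then have th0: "p < th0" "th0 < q" using R0 pq by (auto simp: less_le)
  have "integral_finite T th0 p & th (integral_from_to T th0 p) = p &
    integral_from_to T th0 p = sgn ph3 * oriented_integral (ker R) th0 p"
   by (intro conjI time_reach[OF False a]) (use th0 Rp sub in \<open>auto simp: closed_segment_eq_real_ivl\<close>)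
  then have P: "integral_finite T th0 p" "th (integral_from_to T th0 p) = p"
   "integral_from_to T th0 p = - (sgn ph3 * integral {p..th0} (ker R))" using th0 by (auto simp: oriented_integral_def)
  have "integral_finite T th0 q & th (integral_from_to T th0 q) = q &
    integral_from_to T th0 q = sgn ph3 * oriented_integral (ker R) th0 q"
   by (intro conjI time_reach[OF False a]) (use th0 Rp sub in \<open>auto simp: closed_segment_eq_real_ivl\<close>)
  then have Q: "integral_finite T th0 q" "th (integral_from_to T th0 q) = q"
   "integral_from_to T th0 q = sgn ph3 * integral {th0..q} (ker R)" using th0 by (auto simp: oriented_integral_def)
  have "0 < integral {p..th0} (ker R)" by (rule ker_integral_pos[OF cR sub]) (use th0 Rp in auto)
  moreover have "0 < integral {th0..q} (ker R)" by (rule ker_integral_pos[OF cR sub]) (use th0 Rp in auto)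
  ultimately have sgn: "ph3 > 0 ==> integral_from_to T th0 p < integral_from_to T th0 q"
   "ph3 < 0 ==> integral_from_to T th0 q < integral_from_to T th0 p" using P(3) Q(3) by auto
  have nz: "nearest_zeros R th0 p q" unfolding nearest_zeros_def using th0 R0 Rp by force
  show ?thesis
  proof (cases "ph3 > 0")
   case True
   have "min p q = p" "max p q = q" using pq(3) by auto
   then have "nearest_zeros R th0 (min p q) (max p q)" using nz by simp
   moreover have "ph3 * (q - p) > 0" using True pq(3) by simp
   ultimately have ex: "\<exists>th1 th2. nearest_zeros R th0 (min th1 th2) (max th1 th2) &
    ph3 * (th2 - th1) > 0 &
    integral_finite T th0 th1 & integral_from_to T th0 p = integral_from_to T th0 th1 &
    integral_finite T th0 th2 & integral_from_to T th0 q = integral_from_to T th0 th2"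
    using P(1) Q(1) by (intro exI[of _ p] exI[of _ q] conjI refl)
   have "th (integral_from_to T th0 p) \<in> {p, q}" "th (integral_from_to T th0 q) \<in> {p, q}" using P(2) Q(2) by simp_all
   from main[OF this] sgn(1)[OF True] ex False show ?thesis
    by (intro exI[of _ "integral_from_to T th0 p"] exI[of _ "integral_from_to T th0 q"]) blast
  next
   case neg: False
   then have neg: "ph3 < 0" using False by simp
   have "min q p = p" "max q p = q" using pq(3) by auto
   then have "nearest_zeros R th0 (min q p) (max q p)" using nz by simp
   moreover have "ph3 * (p - q) > 0" using neg pq(3) by (simp add: mult_neg_neg)
   ultimately have ex: "\<exists>th1 th2. nearest_zeros R th0 (min th1 th2) (max th1 th2) &
    ph3 * (th2 - th1) > 0 &
    integral_finite T th0 th1 & integral_from_to T th0 q = integral_from_to T th0 th1 &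
    integral_finite T th0 th2 & integral_from_to T th0 p = integral_from_to T th0 th2"
    using Q(1) P(1) by (intro exI[of _ q] exI[of _ p] conjI refl)
   have "th (integral_from_to T th0 q) \<in> {p, q}" "th (integral_from_to T th0 p) \<in> {p, q}" using P(2) Q(2) by simp_all
   from main[OF this] sgn(2)[OF neg] ex False show ?thesis
    by (intro exI[of _ "integral_from_to T th0 q"] exI[of _ "integral_from_to T th0 p"]) blast
  qed
 next
  case True
  then have "R th0 = 0" using R_init_sign(2) by blast
  then have "th0 = p \<or> th0 = q" using Rp[of th0] pq by force
  define M where "M = integral {p..q} (ker R)"
  have M: "0 < M" unfolding M_def by (rule ker_integral_pos[OF cR int pq(3) Rp])
  have lev: "ph4 * (r xi * sin xi - r th0 * sin th0) \<ge> ph5 * (r xi * cos xi - r th0 * cos th0) &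
    (ph4 * (r xi * sin xi - r th0 * sin th0) = ph5 * (r xi * cos xi - r th0 * cos th0) \<longleftrightarrow> xi = p \<or> xi = q)"
   if "xi \<in> {p..q}" for xi
  proof -
   have eq: "ph4 * (r xi * sin xi - r th0 * sin th0) - ph5 * (r xi * cos xi - r th0 * cos th0) = E - L xi"
    using energy_init True by (simp add: lin_def algebra_simps)
   have "xi = p \<or> xi = q \<or> 0 < R xi" using Rp[of xi] that by force
   then have "L xi <= E & (L xi = E \<longleftrightarrow> xi = p \<or> xi = q)"
    using R0 R_sign[of xi] R_sign(2)[of p] R_sign(2)[of q] by auto
   then show ?thesis using eq by auto
  qed
  have nn: "0 <= R xi" if "p < xi" "xi < q" for xi using Rp[OF that] by simp
  have K: "integral_finite T0 p q" "integral_finite T0 q p" "integral_from_to T0 p q = M" "integral_from_to T0 q p = - M"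
   unfolding T0_eq[OF True] using integral_finite_ker[OF cR, of p q] integral_finite_ker[OF cR, of q p] nn int pq(3)
   by (auto simp: oriented_integral_def M_def)
  from \<open>th0 = p \<or> th0 = q\<close> show ?thesis
  proof
   assume p: "th0 = p"
   have "th (0 + integral {p..q} (ker R)) = q" by (rule turn_low(1)[OF O cR pq(3) int Rp]) (use t0 p in simp_all)
   then have "th M = q" by (simp add: M_def)
   then have "(\<forall>t. \<forall>k::int. th (t + 2 * of_int k * (M - 0)) = th t) &
    (\<forall>t. \<forall>ti\<in>{0, M}. deriv th (ti + t) = - deriv th (ti - t) & th (ti + t) = th (ti - t))"
    using t0 p by (intro main) auto
   moreover have "q ~= th0 & (\<forall>xi\<in>closed_segment th0 q.
      ph4 * (r xi * sin xi - r th0 * sin th0) \<ge> ph5 * (r xi * cos xi - r th0 * cos th0) &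
      (ph4 * (r xi * sin xi - r th0 * sin th0) = ph5 * (r xi * cos xi - r th0 * cos th0) \<longleftrightarrow> xi = th0 \<or> xi = q)) &
    integral_finite T0 th0 q & M = (if q > th0 then 1 else -1) * integral_from_to T0 th0 q"
    using lev K pq(3) p by (simp add: closed_segment_eq_real_ivl del: time_integrand0.simps)
   ultimately show ?thesis using True M by (intro exI[of _ 0] exI[of _ M]) blast
  next
   assume q: "th0 = q"
   have "th (0 + integral {p..q} (ker R)) = p" by (rule turn(2)[OF O cR pq(3) int Rp]) (use t0 q in simp_all)
   then have "th M = p" by (simp add: M_def)
   then have "(\<forall>t. \<forall>k::int. th (t + 2 * of_int k * (M - 0)) = th t) &
    (\<forall>t. \<forall>ti\<in>{0, M}. deriv th (ti + t) = - deriv th (ti - t) & th (ti + t) = th (ti - t))"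
    using t0 q by (intro main) auto
   moreover have "p ~= th0 & (\<forall>xi\<in>closed_segment th0 p.
      ph4 * (r xi * sin xi - r th0 * sin th0) \<ge> ph5 * (r xi * cos xi - r th0 * cos th0) &
      (ph4 * (r xi * sin xi - r th0 * sin th0) = ph5 * (r xi * cos xi - r th0 * cos th0) \<longleftrightarrow> xi = th0 \<or> xi = p)) &
    integral_finite T0 th0 p & M = (if p > th0 then 1 else -1) * integral_from_to T0 th0 p"
    using lev K pq(3) q by (auto simp: closed_segment_eq_real_ivl simp del: time_integrand0.simps)
   ultimately show ?thesis using True M by (intro exI[of _ 0] exI[of _ M]) blast
  qed
 qed
qed

end

section \<open>The maximal energy level \<open>E = E0\<close>\<close>

context initial_data
begin

lemma gap_at_init:
 assumes EE: "E = E0"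
 obtains al be where "gap_ode R al be" "be - 2 * pi <= th0" "th0 < be"
proof -
 obtain m where m: "L m = E0" using Emax(3) by blast
 have 1: "0 < E" "L m = E" and 2: "L xi <= E" for xi using Emax(1) Emax(2)[of xi] m EE by simp_all
 show ?thesis by (rule gap_ode_at[OF 1(1) 2 1(2)]) (rule that)
qed

lemma R_nonneg: "E = E0 ==> 0 <= R xi"
 using R_sign(3)[of xi] Emax(2)[of xi] by (metis not_less)

text \<open>As \<open>ph3\<close> is nonzero, \<open>th0\<close> lies inside the arc of positivity,
  whose ends are the nearest zeros. Divergence at both ends keeps the angle inside with an
  invertible time function; convergence at an end makes it a resting place.\<close>

lemma case4:
 assumes A: "ph3 ~= 0 & E = E0"
 shows "\<exists>th1 th2. nearest_zeros R th0 th1 th2 &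
  (~ integral_finite T th0 th1 & ~ integral_finite T th0 th2 -->
   (\<forall>g th. extremal_with F ph g th & th 0 = th0 -->
    (\<forall>t. th t \<in> {th1<..<th2} & integral_from_to T th0 (th t) = t) &
    (\<forall>xi\<in>{th1<..<th2}. integral_finite T th0 xi & th (integral_from_to T th0 xi) = xi))) &
  (integral_finite T th0 th1 \<or> integral_finite T th0 th2 -->
   angle_not_unique F ph th0 &
   (if integral_finite T th0 th1 & integral_finite T th0 th2 & th2 = th1 + 2 * pi
   then constant_values F ph th0 {th1 + 2 * pi * of_int k |k::int. True} &
    (\<forall>up L. (up 0 \<longleftrightarrow> ph3 > 0) & (\<forall>n. 0 <= L n) -->
     (\<exists>g th a. extremal_with F ph g th & th 0 = th0 &
      alternates th th1 up L a & a 0 + L 0 < 0 & 0 < a 1))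
   else constant_values F ph th0 {xi\<in>{th1, th2}. integral_finite T th0 xi}))"
proof -
 have ph3: "ph3 ~= 0" and EE: "E = E0" using A by blast+
 obtain al be where g: "gap_ode R al be" and thbe: "be - 2 * pi <= th0" "th0 < be" using gap_at_init[OF EE] by blast
 interpret gap_ode R al be by (rule g)
 have "0 < R th0" using R_init_sign(3) ph3 by blast
 then have th0: "al < th0" "th0 < be" using zero_low[of th0] thbe by force+
 have nn: "0 <= R xi" for xi by (rule R_nonneg[OF EE])
 have f1: "integral_finite T th0 al \<longleftrightarrow> ker R integrable_on {al..th0}"
  and f2: "integral_finite T th0 be \<longleftrightarrow> ker R integrable_on {th0..be}"
  using T_integral(1)[OF ph3 nn, of th0 al] T_integral(1)[OF ph3 nn, of th0 be] th0 by (simp_all add: min_def max_def)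
 have nz: "nearest_zeros R th0 al be" unfolding nearest_zeros_def using th0 R_ends pos by force
 have div: "(\<forall>t. th t \<in> {al<..<be} & integral_from_to T th0 (th t) = t) &
    (\<forall>xi\<in>{al<..<be}. integral_finite T th0 xi & th (integral_from_to T th0 xi) = xi)"
  if nf: "~ integral_finite T th0 al" "~ integral_finite T th0 be" and e: "extremal_with F ph g th & th 0 = th0" for g th
 proof -
  have a: "adm th" using ext_adm e by blast
  then have S: "sol R th" and t0: "th 0 = th0" by (auto simp: adm_def)
  have st: "al < th t" "th t < be" for t using stays_inside[OF S, of 0 t] th0 nf unfolding f1 f2 t0 by blast+
  have tr: "integral_finite T th0 xi & th (integral_from_to T th0 xi) = xi" if "al < xi" "xi < be" for xi
  proof -
   have p: "R et > 0" if "et \<in> closed_segment th0 xi" "et ~= xi" for et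
    using that th0 \<open>al < xi\<close> \<open>xi < be\<close> by (intro pos) (auto simp: closed_segment_eq_real_ivl split: if_splits)
   have i: "ker R integrable_on {min th0 xi..max th0 xi}" by (rule ker_inside) (use th0 that in auto)
   show ?thesis using time_reach(1,2)[OF ph3 a p i] by blast
  qed
  have "inj th" using inj_if_positive[OF S] pos st by blast
  then have "integral_from_to T th0 (th t) = t" for t using tr[OF st, of t] by (auto dest: injD)
  then show ?thesis using st tr by auto
 qed
 have fin: "angle_not_unique F ph th0 &
   (if integral_finite T th0 al & integral_finite T th0 be & be = al + 2 * pi
   then constant_values F ph th0 {al + 2 * pi * of_int k |k::int. True} &
    (\<forall>up L. (up 0 \<longleftrightarrow> ph3 > 0) & (\<forall>n. 0 <= L n) -->
     (\<exists>g th a. extremal_with F ph g th & th 0 = th0 &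
      alternates th al up L a & a 0 + L 0 < 0 & 0 < a 1))
   else constant_values F ph th0 {xi\<in>{al, be}. integral_finite T th0 xi})"
  if f: "integral_finite T th0 al \<or> integral_finite T th0 be"
 proof (cases "integral_finite T th0 al & integral_finite T th0 be & be = al + 2 * pi")
  case True
  have i1: "ker R integrable_on {al..th0}" "ker R integrable_on {th0..be}" using True f1 f2 by blast+
  have i: "ker R integrable_on {al..be}" by (rule ker_whole[OF i1]) (use th0 in auto)
  \<comment> \<open>Convergence from \<open>th0\<close> to both ends gives a finite travel time for
    the whole arc, and zeros occur once per turn, so the angle may go round any number of times in
    either direction.\<close>
  interpret isolated_zero_ode R al be by unfold_locales (use True i in auto)
  have cv: "cv R th0 ph3 {al + 2 * pi * of_int k |k::int. True}" by (rule cv_all) (use th0 ph3 in blast)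
  have alt: "\<exists>g th a. extremal_with F ph g th & th 0 = th0 & alternates th al up M a & a 0 + M 0 < 0 & 0 < a 1"
   if u: "(up 0 \<longleftrightarrow> ph3 > 0) & (\<forall>n. 0 <= M n)" for up M
  proof (rule ex_alternating_interior[OF th0 ph3, of up M])
   fix th a assume B: "sol R th" "th 0 = th0" "0 < ph3 * deriv th 0" "alternates th al up M a" "a 0 + M 0 < 0" "0 < a 1"
   then have "adm th" by (simp add: adm_def)
   then obtain g where "extremal_with F ph g th" using adm_ext[OF EE] by blast
   then show ?thesis using B by blast
  qed (use u in blast)+
  have "al + 2 * pi * of_int 0 \<in> {al + 2 * pi * of_int k |k::int. True}" by blast
  from cv_not_unique[OF EE cv this] cv_constant_values[OF EE cv] alt show ?thesis unfolding if_P[OF True] by blast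
 next
  case False
  then have nb: "~ (be = al + 2 * pi & ker R integrable_on {al..th0} & ker R integrable_on {th0..be})" unfolding f1 f2 by blast
  note cv = cv_interior[OF th0 ph3 nb, folded f1 f2]
  have C: "{c. c = al & integral_finite T th0 al \<or> c = be & integral_finite T th0 be} = {xi\<in>{al, be}. integral_finite T th0 xi}" by blast
  have "\<exists>c. c \<in> {c. c = al & integral_finite T th0 al \<or> c = be & integral_finite T th0 be}" using f by blast
  then have "angle_not_unique F ph th0" using cv_not_unique[OF EE cv] by blast
  moreover have "constant_values F ph th0 {xi\<in>{al, be}. integral_finite T th0 xi}" using cv_constant_values[OF EE cv] unfolding C .
  ultimately show ?thesis unfolding if_not_P[OF False] by blast
 qed
 show ?thesis by (intro exI[of _ al] exI[of _ be] conjI nz impI allI) (use div fin in blast)+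
qed

text \<open>As \<open>ph3 = 0\<close>, the angle starts at a zero. It can leave the segment of zeros
  only from an end at which the time integral converges on the outer side; without such a departure
  the extremal is a line.\<close>

lemma case5:
 assumes A: "ph3 = 0 & E = E0"
 shows "\<exists>th1 th2. largest_segment (%xi. ph5 * (r xi * cos xi - ph1) = ph4 * (r xi * sin xi - ph2)) th0 th1 th2 &
  (if th1 = th0 & th0 = th2 & ~ finite_from_left T0 th0 & ~ finite_from_right T0 th0 \<or>
    th1 < th0 & th0 < th2 \<or>
    th0 = th1 & th1 < th2 & ~ finite_from_left T0 th0 \<or>
    th0 = th2 & th2 > th1 & ~ finite_from_right T0 th0
  then
   (\<forall>g th. extremal_with F ph g th & th 0 = th0 -->
    (\<forall>t. th t = th0) & metric_line_A F ph g)
  else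
   angle_not_unique F ph th0 &
   (if th1 < th0 & th0 = th2 & finite_from_right T0 th0 &
     integral_finite T0 th0 (th1 + 2 * pi)
    then constant_values F ph th0 {th0, th1 + 2 * pi}
    else if th0 = th1 & th1 < th2 & finite_from_left T0 th0 &
     integral_finite T0 th0 (th2 - 2 * pi)
    then constant_values F ph th0 {th0, th2 - 2 * pi}
    else if th0 = th1 & th1 = th2 & finite_from_left T0 th0 & finite_from_right T0 th0
    then constant_values F ph th0 {th0 + 2 * pi * of_int k |k::int. True} &
     (\<forall>up L s. (\<forall>n. 0 <= L n) & 0 <= s & s <= L 0 -->
      (\<exists>g th a. extremal_with F ph g th & th 0 = th0 &
       alternates th th0 up L a & a 0 = - s))
    else constant_values F ph th0 {th0}))"
proof -
 have ph3: "ph3 = 0" and EE: "E = E0" using A by blast+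
 obtain al be where g: "gap_ode R al be" and thbe: "be - 2 * pi <= th0" "th0 < be" using gap_at_init[OF EE] by blast
 interpret gap_ode R al be by (rule g)
 \<comment> \<open>The segment of zeros containing \<open>th0\<close> is \<open>{ga..al}\<close>,
   where \<open>ga\<close> is the end \<open>be\<close> of the arc of positivity moved back by a
   full turn.\<close>
 define ga where "ga = be - 2 * pi"
 have "R th0 = 0" using R_init_sign(2) ph3 by blast
 then have th0: "ga <= th0" "th0 <= al" using pos[of th0] thbe unfolding ga_def by force+
 have ga: "ga <= al" "be = ga + 2 * pi" using le by (simp_all add: ga_def)
 have nn: "0 <= R xi" for xi by (rule R_nonneg[OF EE])
 have R0: "ph5 * (r xi * cos xi - ph1) = ph4 * (r xi * sin xi - ph2) \<longleftrightarrow> R xi = 0" for xi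
  unfolding R_sign(2) using ph3 by (auto simp: energy.simps lin_def algebra_simps)
 have seg: "largest_segment (%xi. ph5 * (r xi * cos xi - ph1) = ph4 * (r xi * sin xi - ph2)) th0 ga al"
  unfolding largest_segment_def R0
 proof (intro conjI ballI allI impI)
  show "R xi = 0" if "xi \<in> {ga..al}" for xi using zero_low[of xi] that by (simp add: ga_def)
  fix a' b' assume ab: "th0 \<in> {a'..b'} & (\<forall>xi\<in>{a'..b'}. R xi = 0)"
  then have z: "R xi = 0" if "a' <= xi" "xi <= b'" for xi using that by auto
  have "b' <= al"
  proof (rule ccontr)
   assume "~ b' <= al"
   define y where "y = min b' ((al + be) / 2)"
   have y: "al < y" "y < be" "y <= b'" using \<open>~ b' <= al\<close> less by (auto simp: y_def min_less_iff_disj)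
   then have "R y = 0" using ab th0 by (intro z) auto
   then show False using pos[OF y(1,2)] by simp
  qed
  moreover have "ga <= a'"
  proof (rule ccontr)
   assume "~ ga <= a'"
   define y where "y = max (a' + 2 * pi) ((al + be) / 2)"
   have y: "al < y" "y < be" "a' + 2 * pi <= y" using \<open>~ ga <= a'\<close> less by (auto simp: y_def less_max_iff_disj ga_def)
   then have "R (y - 2 * pi) = 0" using ab th0 by (intro z) (auto simp: ga_def)
   then show False using pos[OF y(1,2)] periodic_1(2)[of y] by simp
  qed
  ultimately show "{a'..b'} \<subseteq> {ga..al}" by auto
 qed (use ga th0 in auto)
 \<comment> \<open>Convergence at the two ends of the arc of positivity. By periodicity
   \<open>finL\<close>, stated at \<open>be\<close>, is convergence to the left of
   \<open>ga\<close>.\<close>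
 define finR where "finR \<longleftrightarrow> (\<exists>x. al < x & x < be & ker R integrable_on {al..x})"
 define finL where "finL \<longleftrightarrow> (\<exists>x. al < x & x < be & ker R integrable_on {x..be})"
 define A where "A \<longleftrightarrow> ker R integrable_on {al..be}"
 have fi: "integral_finite T0 a b \<longleftrightarrow> ker R integrable_on {min a b..max a b}" for a b
  unfolding T0_eq[OF ph3] by (rule integral_finite_ker(1)[OF cR nn])
 have kper: "ker R (x + 2 * pi) = ker R x" "ker R (x + - 2 * pi) = ker R x" for x by (simp_all only: ker_def periodic_1)
 have down: "ker R integrable_on {p - 2 * pi..q - 2 * pi} \<longleftrightarrow> ker R integrable_on {p..q}" for p q
 proof
  assume "ker R integrable_on {p - 2 * pi..q - 2 * pi}"
  from integrable_translate[OF this, of "- 2 * pi"] show "ker R integrable_on {p..q}" unfolding kper by simp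
 next
  assume "ker R integrable_on {p..q}"
  from integrable_translate[OF this, of "2 * pi"] show "ker R integrable_on {p - 2 * pi..q - 2 * pi}" unfolding kper .
 qed
 have R: "finite_from_right T0 th0 \<longleftrightarrow> finR" if t: "th0 = al"
 proof
  assume "finite_from_right T0 th0"
  then obtain b where b: "b > al" "ker R integrable_on {al..b}" unfolding finite_from_right_def fi t by auto
  define x where "x = min b ((al + be) / 2)"
  have x: "al < x" "x < be" "x <= b" using b(1) less by (auto simp: x_def min_less_iff_disj)
  then show finR unfolding finR_def using ker_sub[OF b(2), of al x] by auto
 next
  assume finR
  then obtain x where "al < x" "ker R integrable_on {al..x}" unfolding finR_def by blast
  then show "finite_from_right T0 th0" unfolding finite_from_right_def fi t by (intro exI[of _ x]) simp
 qed
 have Lf: "finite_from_left T0 th0 \<longleftrightarrow> finL" if t: "th0 = ga"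
 proof
  assume "finite_from_left T0 th0"
  then obtain a where a: "a < ga" "ker R integrable_on {a..ga}" unfolding finite_from_left_def fi t by auto
  then have a2: "ker R integrable_on {a + 2 * pi..be}" using down[of "a + 2 * pi" be] by (simp add: ga_def)
  define x where "x = max (a + 2 * pi) ((al + be) / 2)"
  have x: "al < x" "x < be" "a + 2 * pi <= x" using a(1) less by (auto simp: x_def less_max_iff_disj ga_def)
  then show finL unfolding finL_def using ker_sub[OF a2, of x be] by auto
 next
  assume finL
  then obtain x where x: "x < be" "ker R integrable_on {x..be}" unfolding finL_def by blast
  then have "ker R integrable_on {x - 2 * pi..ga}" unfolding ga_def down by blast
  then show "finite_from_left T0 th0" unfolding finite_from_left_def fi t using x(1) by (intro exI[of _ "x - 2 * pi"]) (simp add: ga_def)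
 qed
 have AR: "integral_finite T0 th0 (ga + 2 * pi) \<longleftrightarrow> A" if "th0 = al" unfolding fi A_def using that less ga by simp
 have AL: "integral_finite T0 th0 (al - 2 * pi) \<longleftrightarrow> A" if "th0 = ga"
 proof -
  have "min th0 (al - 2 * pi) = al - 2 * pi" "max th0 (al - 2 * pi) = be - 2 * pi" using that less by (auto simp: ga_def)
  then show ?thesis unfolding fi A_def by (simp only: down)
 qed
 have A_fin: "finR" "finL" if A
 proof -
  have m: "al < (al + be) / 2" "(al + be) / 2 < be" using less by auto
  then show finR finL unfolding finR_def finL_def using ker_sub[OF that[unfolded A_def]] by (intro exI[of _ "(al + be) / 2"]; simp)+
 qed
 \<comment> \<open>The integrand is continuous inside the arc, so convergence at both ends amounts
   to a finite travel time for the whole arc.\<close>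
 have fin_A: A if fr: finR and fl: finL
 proof -
  obtain x where x: "al < x" "ker R integrable_on {al..x}" using fr unfolding finR_def by blast
  obtain z where z: "al < z" "z < be" "ker R integrable_on {z..be}" using fl unfolding finL_def by blast
  show A unfolding A_def using ker_whole[OF ker_from_left[OF x(2,1) z(2)] z(3)] z by simp
 qed
 have const: "(\<forall>t. th t = th0) & metric_line_A F ph g"
  if n: "~ (th0 = al & finR)" "~ (th0 = ga & finL)" and e: "extremal_with F ph g th & th 0 = th0" for g th
 proof -
  have S: "sol R th" using ext_adm e by (auto simp: adm_def)
  have b: "be - 2 * pi <= th 0" "th 0 <= al" using th0 e by (auto simp: ga_def)
  have "~ th 0 < th t" for t using leave_flat_up[OF S b, of t] n(1) e unfolding finR_def by auto
  moreover have "~ th t < th 0" for t using leave_flat_down[OF S b, of t] n(2) e unfolding finL_def ga_def by auto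
  ultimately have "th t = th0" for t using e by (metis linorder_neqE)
  then show ?thesis using ext_line[of g th th0] e by blast
 qed
 have out: "angle_not_unique F ph th0" "constant_values F ph th0 C" if "cv R th0 0 C" "c \<in> C" for C c
  using cv_not_unique[OF EE, of C c] cv_constant_values[OF EE, of C] that ph3 by simp_all
 have right: "cv R th0 0 {c. c = th0 \<or> c = ga + 2 * pi & A}" if t: "th0 = al" and f: finR and nb: "~ (ga = al & A)"
 proof -
  obtain x where x: "al < x" "ker R integrable_on {al..x}" using f unfolding finR_def by blast
  have "~ (be = al + 2 * pi & ker R integrable_on {al..be})" using nb ga unfolding A_def by auto
  from cv_left_end[OF x(2,1) this] show ?thesis unfolding t A_def ga(2)[symmetric] .
 qed
 have left: "cv R th0 0 {c. c = th0 \<or> c = al - 2 * pi & A}" if t: "th0 = ga" and f: finL and nb: "~ (ga = al & A)"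
 proof -
  obtain x where x: "x < be" "ker R integrable_on {x..be}" using f unfolding finL_def by blast
  have "~ (be = al + 2 * pi & ker R integrable_on {al..be})" using nb ga unfolding A_def by auto
  from cv_translate[OF cv_right_end[OF x(2,1) this] periodic_1(2)]
  have "cv R (be + - 2 * pi) 0 ((%xi. xi + - 2 * pi) ` {c. c = be \<or> c = al & A})" unfolding A_def .
  moreover have "(%xi. xi + - 2 * pi) ` {c. c = be \<or> c = al & A} = {c. c = th0 \<or> c = al - 2 * pi & A}"
   unfolding t ga_def by force
  moreover have "be + - 2 * pi = th0" unfolding t ga_def by simp
  ultimately show ?thesis by simp
 qed
 have isolated: "constant_values F ph th0 {th0 + 2 * pi * of_int k |k::int. True} & angle_not_unique F ph th0 &
   (\<forall>up L s. (\<forall>n. 0 <= L n) & 0 <= s & s <= L 0 -->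
    (\<exists>g th a. extremal_with F ph g th & th 0 = th0 & alternates th th0 up L a & a 0 = - s))"
  if t: "th0 = al" and eq: "ga = al" and a: A
 proof -
  interpret isolated_zero_ode R al be by unfold_locales (use a eq ga in \<open>auto simp: A_def\<close>)
  have cv: "cv R th0 0 {th0 + 2 * pi * of_int k |k::int. True}" using cv_all[of th0 0] t by simp
  have "\<exists>g th a. extremal_with F ph g th & th 0 = th0 & alternates th th0 up M a & a 0 = - s"
   if u: "(\<forall>n. 0 <= M n) & 0 <= s & s <= M 0" for up M s
  proof (rule ex_alternating_rest[of M s up])
   fix th a assume B: "sol R th" "th 0 = al" "alternates th al up M a" "a 0 = - s"
   have "th 0 = th0" using B(2) t by simp
   then have "adm th" using B(1) ph3 unfolding adm_def by blast
   then obtain g where "extremal_with F ph g th" using adm_ext[OF EE] by blast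
   then show ?thesis using B t by blast
  qed (use u in blast)+
  moreover have "th0 + 2 * pi * of_int 0 \<in> {th0 + 2 * pi * of_int k |k::int. True}" by blast
  ultimately show ?thesis using out[OF cv] by blast
 qed
 \<comment> \<open>\<open>P\<close> says that a departure is possible: \<open>th0\<close> is an end
   of the segment with convergence on its outer side. The four cases without departure in the
   statement are together its negation.\<close>
 define P where "P \<longleftrightarrow> th0 = al & finR \<or> th0 = ga & finL"
 have cond: "(ga = th0 & th0 = al & ~ finite_from_left T0 th0 & ~ finite_from_right T0 th0 \<or>
    ga < th0 & th0 < al \<or> th0 = ga & ga < al & ~ finite_from_left T0 th0 \<or>
    th0 = al & al > ga & ~ finite_from_right T0 th0) \<longleftrightarrow> ~ P"
  using R Lf th0 unfolding P_def by (cases "th0 = al"; cases "th0 = ga") auto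
 have c1: "ga < th0 & th0 = al & finite_from_right T0 th0 & integral_finite T0 th0 (ga + 2 * pi) \<longleftrightarrow> ga < th0 & th0 = al & A"
  using R AR A_fin(1) by blast
 have c2: "th0 = ga & ga < al & finite_from_left T0 th0 & integral_finite T0 th0 (al - 2 * pi) \<longleftrightarrow> th0 = ga & ga < al & A"
  using Lf AL A_fin(2) by blast
 have c3: "th0 = ga & ga = al & finite_from_left T0 th0 & finite_from_right T0 th0 \<longleftrightarrow> th0 = ga & ga = al & A"
  using R Lf A_fin fin_A by blast
 have val: "angle_not_unique F ph th0 &
   (if ga < th0 & th0 = al & A then constant_values F ph th0 {th0, ga + 2 * pi}
    else if th0 = ga & ga < al & A then constant_values F ph th0 {th0, al - 2 * pi}
    else if th0 = ga & ga = al & A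
    then constant_values F ph th0 {th0 + 2 * pi * of_int k |k::int. True} &
     (\<forall>up L s. (\<forall>n. 0 <= L n) & 0 <= s & s <= L 0 -->
      (\<exists>g th a. extremal_with F ph g th & th 0 = th0 & alternates th th0 up L a & a 0 = - s))
    else constant_values F ph th0 {th0})" if p: P
 proof (cases "ga = al & A")
  case True
  then have "th0 = al" using th0 by simp
  then have n: "~ (ga < th0 & th0 = al & A)" "~ (th0 = ga & ga < al & A)" "th0 = ga & ga = al & A" using True by auto
  show ?thesis unfolding if_not_P[OF n(1)] if_not_P[OF n(2)] if_P[OF n(3)]
   using isolated[OF \<open>th0 = al\<close> True[THEN conjunct1] True[THEN conjunct2]] by blast
 next
  case nb: False
  have n3: "~ (th0 = ga & ga = al & A)" using nb by blast
  show ?thesis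
  proof (cases "th0 = al & finR")
   case True
   note cv = right[OF True[THEN conjunct1] True[THEN conjunct2] nb]
   have o: "angle_not_unique F ph th0" "constant_values F ph th0 {c. c = th0 \<or> c = ga + 2 * pi & A}" using out[OF cv, of th0] by blast+
   show ?thesis
   proof (cases A)
    case a: True
    have eq: "{c. c = th0 \<or> c = ga + 2 * pi & A} = {th0, ga + 2 * pi}" using a by blast
    have n: "ga < th0 & th0 = al & A" using a nb True th0 by auto
    show ?thesis unfolding if_P[OF n] using o[unfolded eq] by blast
   next
    case a: False
    have eq: "{c. c = th0 \<or> c = ga + 2 * pi & A} = {th0}" using a by blast
    have n: "~ (ga < th0 & th0 = al & A)" "~ (th0 = ga & ga < al & A)" using a by blast+
    show ?thesis unfolding if_not_P[OF n(1)] if_not_P[OF n(2)] if_not_P[OF n3] using o[unfolded eq] by blast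
   qed
  next
   case False
   then have l: "th0 = ga" finL using p unfolding P_def by blast+
   note cv = left[OF l nb]
   have o: "angle_not_unique F ph th0" "constant_values F ph th0 {c. c = th0 \<or> c = al - 2 * pi & A}" using out[OF cv, of th0] by blast+
   show ?thesis
   proof (cases A)
    case a: True
    have eq: "{c. c = th0 \<or> c = al - 2 * pi & A} = {th0, al - 2 * pi}" using a by blast
    have n: "~ (ga < th0 & th0 = al & A)" "th0 = ga & ga < al & A" using a nb l ga by auto
    show ?thesis unfolding if_not_P[OF n(1)] if_P[OF n(2)] using o[unfolded eq] by blast
   next
    case a: False
    have eq: "{c. c = th0 \<or> c = al - 2 * pi & A} = {th0}" using a by blast
    have n: "~ (ga < th0 & th0 = al & A)" "~ (th0 = ga & ga < al & A)" using a by blast+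
    show ?thesis unfolding if_not_P[OF n(1)] if_not_P[OF n(2)] if_not_P[OF n3] using o[unfolded eq] by blast
   qed
  qed
 qed
 show ?thesis
 proof (rule exI[of _ ga], rule exI[of _ al], rule conjI[OF seg], unfold cond c1 c2 c3)
  show "if ~ P then \<forall>g th. extremal_with F ph g th & th 0 = th0 --> (\<forall>t. th t = th0) & metric_line_A F ph g
  else angle_not_unique F ph th0 &
   (if ga < th0 & th0 = al & A then constant_values F ph th0 {th0, ga + 2 * pi}
    else if th0 = ga & ga < al & A then constant_values F ph th0 {th0, al - 2 * pi}
    else if th0 = ga & ga = al & A
    then constant_values F ph th0 {th0 + 2 * pi * of_int k |k::int. True} &
     (\<forall>up L s. (\<forall>n. 0 <= L n) & 0 <= s & s <= L 0 -->
      (\<exists>g th a. extremal_with F ph g th & th 0 = th0 & alternates th th0 up L a & a 0 = - s))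
    else constant_values F ph th0 {th0})"
  proof (cases P)
   case True
   then have n: "~ ~ P" by blast
   show ?thesis unfolding if_not_P[OF n] by (rule val[OF True])
  next
   case False
   then have "~ (th0 = al & finR)" "~ (th0 = ga & finL)" unfolding P_def by blast+
   from const[OF this] show ?thesis unfolding if_P[OF False] by blast
  qed
 qed
qed

end

theorem theorem2:
  fixes F :: "real \<times> real \<Rightarrow> real"
    and \<phi>1 \<phi>2 \<phi>3 \<phi>4 \<phi>5 E E0 E1 :: real
    and \<phi> :: pt
    and r h1 h2 T T0 :: "real \<Rightarrow> real"
  assumes "quasinorm F"
    and "\<phi>4\<^sup>2 + \<phi>5\<^sup>2 \<noteq> 0"
    and "\<phi> = (\<phi>1, \<phi>2, \<phi>3, \<phi>4, \<phi>5)"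
    and "r = polar_radius F"
    and "h1 = (\<lambda>\<xi>. r \<xi> * cos \<xi>)"
    and "h2 = (\<lambda>\<xi>. r \<xi> * sin \<xi>)"
    and "E = energy \<phi>"
    and "E0 = (SUP h\<in>polar_figure (unit_ball F). \<phi>5 * fst h - \<phi>4 * snd h)"
    and "E1 = (INF h\<in>polar_figure (unit_ball F). \<phi>5 * fst h - \<phi>4 * snd h)"
    and "T = time_integrand F \<phi>"
    and "T0 = time_integrand0 F \<phi>"
  shows
    "(\<forall>g u \<psi>. extremal F g u \<psi> \<and> \<psi> 0 = \<phi> \<longrightarrow> (\<exists>\<theta>. angle_function F g \<psi> \<theta>)) \<and>
     (\<forall>g \<theta>. extremal_with F \<phi> g \<theta> \<longleftrightarrow> extremal_formulas F \<phi> g \<theta>) \<and>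
     (\<forall>\<theta>0. h1 \<theta>0 = \<phi>1 \<and> h2 \<theta>0 = \<phi>2 \<longrightarrow>

       (\<phi>3 \<noteq> 0 \<and> E > E0 \<or> \<phi>3 = 0 \<and> E = E1 \<or> E1 < E \<and> E < E0 \<or>
        \<phi>3 \<noteq> 0 \<and> E = E0 \<or> \<phi>3 = 0 \<and> E = E0) \<and>

       (\<comment> \<open>1\<close> \<phi>3 \<noteq> 0 \<and> E > E0 \<longrightarrow>
         (\<forall>g \<theta>. extremal_with F \<phi> g \<theta> \<and> \<theta> 0 = \<theta>0 \<longrightarrow>
           (\<forall>t. integral_from_to T \<theta>0 (\<theta> t) = t) \<and>
           (\<forall>\<xi>. integral_finite T \<theta>0 \<xi> \<and> \<theta> (integral_from_to T \<theta>0 \<xi>) = \<xi>))) \<and>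

       (\<comment> \<open>2\<close> \<phi>3 = 0 \<and> E = E1 \<longrightarrow>
         (\<forall>g \<theta>. extremal_with F \<phi> g \<theta> \<and> \<theta> 0 = \<theta>0 \<longrightarrow>
           (\<forall>t. \<theta> t = \<theta>0) \<and> metric_line_A F \<phi> g)) \<and>

       (\<comment> \<open>3\<close> E1 < E \<and> E < E0 \<longrightarrow>
         (\<forall>g \<theta>. extremal_with F \<phi> g \<theta> \<and> \<theta> 0 = \<theta>0 \<longrightarrow>
           (\<exists>t1 t2. t1 < t2 \<and>
             (\<forall>t. \<forall>k::int. \<theta> (t + 2 * of_int k * (t2 - t1)) = \<theta> t) \<and>
             (\<forall>t. \<forall>ti\<in>{t1, t2}. deriv \<theta> (ti + t) = - deriv \<theta> (ti - t) \<and> \<theta> (ti + t) = \<theta> (ti - t)) \<and>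
             (\<comment> \<open>3.1\<close> \<phi>3 \<noteq> 0 \<longrightarrow>
               (\<exists>\<theta>1 \<theta>2. nearest_zeros (angle_rhs F \<phi>) \<theta>0 (min \<theta>1 \<theta>2) (max \<theta>1 \<theta>2) \<and>
                 \<phi>3 * (\<theta>2 - \<theta>1) > 0 \<and>
                 integral_finite T \<theta>0 \<theta>1 \<and> t1 = integral_from_to T \<theta>0 \<theta>1 \<and>
                 integral_finite T \<theta>0 \<theta>2 \<and> t2 = integral_from_to T \<theta>0 \<theta>2)) \<and>
             (\<comment> \<open>3.2\<close> \<phi>3 = 0 \<longrightarrow>
               t1 = 0 \<and>
               (\<exists>\<theta>2. \<theta>2 \<noteq> \<theta>0 \<and>
                 (\<forall>\<xi>\<in>closed_segment \<theta>0 \<theta>2.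
                    \<phi>4 * (h2 \<xi> - h2 \<theta>0) \<ge> \<phi>5 * (h1 \<xi> - h1 \<theta>0) \<and>
                    (\<phi>4 * (h2 \<xi> - h2 \<theta>0) = \<phi>5 * (h1 \<xi> - h1 \<theta>0) \<longleftrightarrow> \<xi> = \<theta>0 \<or> \<xi> = \<theta>2)) \<and>
                 integral_finite T0 \<theta>0 \<theta>2 \<and>
                 t2 = (if \<theta>2 > \<theta>0 then 1 else -1) * integral_from_to T0 \<theta>0 \<theta>2))))) \<and>

       (\<comment> \<open>4\<close> \<phi>3 \<noteq> 0 \<and> E = E0 \<longrightarrow>
         (\<exists>\<theta>1 \<theta>2. nearest_zeros (angle_rhs F \<phi>) \<theta>0 \<theta>1 \<theta>2 \<and>
           (\<not> integral_finite T \<theta>0 \<theta>1 \<and> \<not> integral_finite T \<theta>0 \<theta>2 \<longrightarrow>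
             (\<forall>g \<theta>. extremal_with F \<phi> g \<theta> \<and> \<theta> 0 = \<theta>0 \<longrightarrow>
               (\<forall>t. \<theta> t \<in> {\<theta>1<..<\<theta>2} \<and> integral_from_to T \<theta>0 (\<theta> t) = t) \<and>
               (\<forall>\<xi>\<in>{\<theta>1<..<\<theta>2}. integral_finite T \<theta>0 \<xi> \<and> \<theta> (integral_from_to T \<theta>0 \<xi>) = \<xi>))) \<and>
           (integral_finite T \<theta>0 \<theta>1 \<or> integral_finite T \<theta>0 \<theta>2 \<longrightarrow>
             angle_not_unique F \<phi> \<theta>0 \<and>
             (if integral_finite T \<theta>0 \<theta>1 \<and> integral_finite T \<theta>0 \<theta>2 \<and> \<theta>2 = \<theta>1 + 2 * pi
              then constant_values F \<phi> \<theta>0 {\<theta>1 + 2 * pi * of_int k |k::int. True} \<and>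
                (\<forall>up L. (up 0 \<longleftrightarrow> \<phi>3 > 0) \<and> (\<forall>n. 0 \<le> L n) \<longrightarrow>
                  (\<exists>g \<theta> a. extremal_with F \<phi> g \<theta> \<and> \<theta> 0 = \<theta>0 \<and>
                    alternates \<theta> \<theta>1 up L a \<and> a 0 + L 0 < 0 \<and> 0 < a 1))
              else constant_values F \<phi> \<theta>0 {\<xi>\<in>{\<theta>1, \<theta>2}. integral_finite T \<theta>0 \<xi>})))) \<and>

       (\<comment> \<open>5\<close> \<phi>3 = 0 \<and> E = E0 \<longrightarrow>
         (\<exists>\<theta>1 \<theta>2. largest_segment (\<lambda>\<xi>. \<phi>5 * (h1 \<xi> - \<phi>1) = \<phi>4 * (h2 \<xi> - \<phi>2)) \<theta>0 \<theta>1 \<theta>2 \<and>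
           (if \<comment> \<open>5.1\<close> \<theta>1 = \<theta>0 \<and> \<theta>0 = \<theta>2 \<and> \<not> finite_from_left T0 \<theta>0 \<and> \<not> finite_from_right T0 \<theta>0 \<or>
               \<comment> \<open>5.2\<close> \<theta>1 < \<theta>0 \<and> \<theta>0 < \<theta>2 \<or>
               \<comment> \<open>5.3\<close> \<theta>0 = \<theta>1 \<and> \<theta>1 < \<theta>2 \<and> \<not> finite_from_left T0 \<theta>0 \<or>
               \<comment> \<open>5.4\<close> \<theta>0 = \<theta>2 \<and> \<theta>2 > \<theta>1 \<and> \<not> finite_from_right T0 \<theta>0
            then
              (\<forall>g \<theta>. extremal_with F \<phi> g \<theta> \<and> \<theta> 0 = \<theta>0 \<longrightarrow>
                (\<forall>t. \<theta> t = \<theta>0) \<and> metric_line_A F \<phi> g)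
            else
              angle_not_unique F \<phi> \<theta>0 \<and>
              (if \<theta>1 < \<theta>0 \<and> \<theta>0 = \<theta>2 \<and> finite_from_right T0 \<theta>0 \<and>
                  integral_finite T0 \<theta>0 (\<theta>1 + 2 * pi)
               then constant_values F \<phi> \<theta>0 {\<theta>0, \<theta>1 + 2 * pi}
               else if \<theta>0 = \<theta>1 \<and> \<theta>1 < \<theta>2 \<and> finite_from_left T0 \<theta>0 \<and>
                  integral_finite T0 \<theta>0 (\<theta>2 - 2 * pi)
               then constant_values F \<phi> \<theta>0 {\<theta>0, \<theta>2 - 2 * pi}
               else if \<theta>0 = \<theta>1 \<and> \<theta>1 = \<theta>2 \<and> finite_from_left T0 \<theta>0 \<and> finite_from_right T0 \<theta>0
               then constant_values F \<phi> \<theta>0 {\<theta>0 + 2 * pi * of_int k |k::int. True} \<and>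
                 (\<forall>up L s. (\<forall>n. 0 \<le> L n) \<and> 0 \<le> s \<and> s \<le> L 0 \<longrightarrow>
                   (\<exists>g \<theta> a. extremal_with F \<phi> g \<theta> \<and> \<theta> 0 = \<theta>0 \<and>
                     alternates \<theta> \<theta>0 up L a \<and> a 0 = - s))
               else constant_values F \<phi> \<theta>0 {\<theta>0})))))"
proof -
  interpret plane_quasinorm F by unfold_locales (rule assms(1))
  have 1: "\<forall>g u \<psi>. extremal F g u \<psi> \<and> \<psi> 0 = (\<phi>1, \<phi>2, \<phi>3, \<phi>4, \<phi>5) \<longrightarrow> (\<exists>\<theta>. angle_function F g \<psi> \<theta>)"
    using extremal_imp_data(1) by blast
  have 2: "\<forall>g \<theta>. extremal_with F (\<phi>1, \<phi>2, \<phi>3, \<phi>4, \<phi>5) g \<theta> \<longleftrightarrow> extremal_formulas F (\<phi>1, \<phi>2, \<phi>3, \<phi>4, \<phi>5) g \<theta>"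
    using extremal_with_iff_formulas[OF assms(2)] by blast
  show ?thesis
    unfolding assms(7-11) unfolding assms(5,6) unfolding assms(3,4)
  proof (rule conjI[OF 1], rule conjI[OF 2], rule allI, rule impI, goal_cases)
    case (1 \<theta>0)
    then interpret I: initial_data F \<phi>1 \<phi>2 \<phi>3 \<phi>4 \<phi>5 \<theta>0 by unfold_locales (use assms(2) in auto)
    show ?case
      by (rule conjI[OF I.energy_range],
          rule conjI, rule impI, intro allI impI, rule I.case1, assumption+,
          rule conjI, rule impI, intro allI impI, rule I.case2, assumption+,
          rule conjI, rule impI, intro allI impI, rule I.case3, assumption+,
          rule conjI, rule impI, rule I.case4, assumption,
          rule impI, rule I.case5, assumption)
  qed
qed

end
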